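(* Let $k\ge2$, $V\in\mathcal V$ and $\mathbf w_h\in\mathbf V_h$ (Taylor--Hood velocity space of order $k$). The local patch problem defined in the context has a unique solution $(\boldsymbol\sigma^V_h,\phi_h,\boldsymbol\lambda_h)\in\Sigma_{h,0}(\mathcal T_{\omega_V})\times\widetilde Q_h^0(\mathcal T_{\omega_V})\times W_h(\omega_V)$, and it satisfies: (i) $\|\boldsymbol\sigma^V_h\|_{L^2(\omega_V)}\le C\,h_V\|\operatorname{div}\mathbf w_h\|_{L^2(\omega_V)}$ with a constant $C$ independent of $\mathbf w_h$ and $h_V$; (ii) with $\boldsymbol\sigma^V_h$ extended by zero to $\Omega$, $(\operatorname{div}\boldsymbol\sigma^V_h,\tilde q_h)=(\operatorname{div}\mathbf w_h,\mathcal P^{\mathcal B}_V(\tilde q_h-\mathcal S\tilde q_h))_{\omega_V}$ for all $\tilde q_h\in\Pi^{k-1}(\mathcal T)$; (iii) $(\boldsymbol\sigma^V_h,\boldsymbol\xi)_{\omega_V}=0$ for all $\boldsymbol\xi\in[\Pi^{k-2}(\omega_V)]^d$.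
   Context: Let $\Omega\subset\mathbb R^d$, $d\in\{2,3\}$, be a bounded open polyhedral domain with Lipschitz boundary and $\mathcal T$ a shape-regular conforming simplicial triangulation with vertex set $\mathcal V$. For $V\in\mathcal V$: $\mathcal T_{\omega_V}=\{T\in\mathcal T:V\in T\}$, $\omega_V=\bigcup_{T\in\mathcal T_{\omega_V}}T$, $h_V=\max_{T\in\mathcal T_{\omega_V}}\operatorname{diam}T$. $\Pi^m(D)$: polynomials of degree $\le m$ on $D$ (a single polynomial on $D$; $\{0\}$ if $m<0$); $\Pi^m(\mathcal T)$, $\Pi^m(\mathcal T_{\omega_V})$: broken piecewise polynomials. $(\cdot,\cdot)$, $(\cdot,\cdot)_{\omega_V}$: $L^2(\Omega)$, $L^2(\omega_V)$ inner products. $\mathbf V_h=[\Pi^k(\mathcal T)]^d\cap[C^0(\overline\Omega)]^d\cap[H^1_0(\Omega)]^d$. Oswald interpolator $\mathcal S$ (on $\mathcal T$ or on $\mathcal T_{\omega_V}$): maps broken $\Pi^{k-1}$ functions to continuous piecewise $\Pi^{k-1}$ functions by assigning to each degree-$(k-1)$ Lagrange node the average of the values at that node of the restrictions to the simplices (of the respective mesh) containing it. Bubble projector: for $T\ni V$, with degree-$(k-1)$ Lagrange nodes $x_j$ and Lagrange basis $\phi_j$ on $T$, and $\lambda_V$ the barycentric coordinate of $V$ in $T$, $\mathcal P^{\mathcal B}_{T,V}(\sum_j q_j\phi_j)=\sum_j q_j\lambda_V(x_j)\phi_j$; for a broken function $\tilde q$, $\mathcal P^{\mathcal B}_V\tilde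 q$ equals $\mathcal P^{\mathcal B}_{T,V}(\tilde q|_T)$ on each $T\in\mathcal T_{\omega_V}$ and $0$ on $\Omega\setminus\omega_V$. Koszul: $d=2$: $\kappa_{\vec x-V}(a)=(-(y-V_2),x-V_1)^Ta$ for scalar $a$; $d=3$: $\kappa_{\vec x-V}(\mathbf a)=(\vec x-V)\times\mathbf a$. $W_h(\omega_V)=\kappa_{\vec x-V}(\Pi^{k-3}(\omega_V))$ ($d=2$), $\kappa_{\vec x-V}([\Pi^{k-3}(\omega_V)]^3)$ ($d=3$); it is $\{0\}$ for $k=2$. $\Sigma_{h,0}(\mathcal T_{\omega_V})$: Raviart--Thomas space of index $k-1$ on $\mathcal T_{\omega_V}$ (normal-continuous fields with restrictions in $[\Pi^{k-1}(T)]^d+\vec x\,\Pi^{k-1}(T)$) with zero normal trace on $\partial\omega_V$; $\widetilde Q^0_h(\mathcal T_{\omega_V})=\Pi^{k-1}(\mathcal T_{\omega_V})\cap L^2_0(\omega_V)$. Local patch problem: find $(\boldsymbol\sigma^V_h,\phi_h,\boldsymbol\lambda_h)\in\Sigma_{h,0}(\mathcal T_{\omega_V})\times\widetilde Q_h^0(\mathcal T_{\omega_V})\times W_h(\omega_V)$ such that $(\boldsymbol\sigma^V_h,\boldsymbol\tau_h)_{\omega_V}+(\operatorname{div}\boldsymbol\tau_h,\phi_h)_{\omega_V}+(\boldsymbol\tau_h,\boldsymbol\lambda_h)_{\omega_V}+(\operatorname{div}\boldsymbol\sigma^V_h,\psi_h)_{\omega_V}+(\boldsymbol\sigma^V_h,\boldsymbol\mu_h)_{\omega_V}=(\operatorname{div}\mathbf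 w_h,\mathcal P^{\mathcal B}_V(\psi_h-\mathcal S\psi_h))_{\omega_V}$ for all $(\boldsymbol\tau_h,\psi_h,\boldsymbol\mu_h)$ in the same product space, with $\mathcal S$ the Oswald interpolator on $\mathcal T_{\omega_V}$. *)

theory Defs
  imports "HOL-Analysis.Analysis"
begin

text \<open>Points of R^d are vectors (real,'n) vec, d = CARD('n). The index type carries a linear
order only so that "the first, second, third coordinate" make sense (needed for the
Koszul operator).\<close>

definition coord :: "nat \<Rightarrow> 'n::{finite,linorder}" where
  "coord i = sorted_list_of_set (UNIV :: 'n set) ! i"

definition lipschitz_boundary :: "((real,'n::finite) vec) set \<Rightarrow> bool" where
  "lipschitz_boundary \<Omega> \<longleftrightarrow>
     (\<forall>x\<in>frontier \<Omega>. \<exists>r>0. \<exists>e L. \<exists>g :: (real,'n) vec \<Rightarrow> real.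
        norm e = 1 \<and> L-lipschitz_on UNIV g \<and>
        (\<forall>y\<in>ball x r. y \<in> \<Omega> \<longleftrightarrow> y \<bullet> e < g (y - (y \<bullet> e) *\<^sub>R e)))"

definition polyhedral_domain :: "((real,'n::finite) vec) set \<Rightarrow> bool" where
  "polyhedral_domain \<Omega> \<longleftrightarrow> open \<Omega> \<and> bounded \<Omega> \<and> connected \<Omega> \<and> \<Omega> \<noteq> {} \<and>
     (\<exists>P. finite P \<and> (\<forall>S\<in>P. finite S) \<and> closure \<Omega> = \<Union>((\<lambda>S. convex hull S) ` P))"

definition is_simplex :: "((real,'n::finite) vec) set \<Rightarrow> bool" where
  "is_simplex S \<longleftrightarrow> finite S \<and> card S = CARD('n) + 1 \<and> \<not> affine_dependent S"

definition conforming_triangulation :: "((real,'n::finite) vec) set set \<Rightarrow> ((real,'n) vec) set \<Rightarrow> bool" where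
  "conforming_triangulation T \<Omega> \<longleftrightarrow> finite T \<and> (\<forall>S\<in>T. is_simplex S) \<and>
     \<Union>((\<lambda>S. convex hull S) ` T) = closure \<Omega> \<and>
     (\<forall>S\<in>T. \<forall>S'\<in>T. convex hull S \<inter> convex hull S' = convex hull (S \<inter> S'))"

definition mesh_vertices :: "((real,'n::finite) vec) set set \<Rightarrow> ((real,'n) vec) set" where
  "mesh_vertices T = \<Union>T"

definition inradius :: "((real,'n::finite) vec) set \<Rightarrow> real" where
  "inradius S = Sup {r. \<exists>c. ball c r \<subseteq> convex hull S}"

definition shape_param :: "((real,'n::finite) vec) set \<Rightarrow> real" where
  "shape_param S = diameter (convex hull S) / inradius S"

definition patch :: "((real,'n::finite) vec) set set \<Rightarrow> (real,'n) vec \<Rightarrow> ((real,'n) vec) set set" where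
  "patch T V = {S\<in>T. V \<in> S}"

definition omega :: "((real,'n::finite) vec) set set \<Rightarrow> (real,'n) vec \<Rightarrow> ((real,'n) vec) set" where
  "omega T V = \<Union>((\<lambda>S. convex hull S) ` patch T V)"

definition hV :: "((real,'n::finite) vec) set set \<Rightarrow> (real,'n) vec \<Rightarrow> real" where
  "hV T V = Max ((\<lambda>S. diameter (convex hull S)) ` patch T V)"

definition polys :: "int \<Rightarrow> ((real,'n::finite) vec \<Rightarrow> real) set" where
  "polys m = (if m < 0 then {\<lambda>_. 0} else
     {p. \<exists>c :: ('n \<Rightarrow> nat) \<Rightarrow> real.
        p = (\<lambda>x. \<Sum>\<alpha>\<in>{\<alpha>. sum \<alpha> UNIV \<le> nat m}. c \<alpha> * (\<Prod>i\<in>UNIV. (x $ i) ^ (\<alpha> i)))})"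

definition vpolys :: "int \<Rightarrow> ((real,'n::finite) vec \<Rightarrow> (real,'n) vec) set" where
  "vpolys m = {f. \<forall>i. (\<lambda>x. f x $ i) \<in> polys m}"

text \<open>Broken (element-wise) functions on a mesh M are families indexed by the simplices
of M, vanishing for simplices outside M.\<close>
definition broken_polys :: "((real,'n::finite) vec) set set \<Rightarrow> int \<Rightarrow> (((real,'n) vec) set \<Rightarrow> (real,'n) vec \<Rightarrow> real) set" where
  "broken_polys M m = {q. (\<forall>S\<in>M. q S \<in> polys m) \<and> (\<forall>S. S \<notin> M \<longrightarrow> q S = (\<lambda>_. 0))}"

definition divg :: "((real,'n::finite) vec \<Rightarrow> (real,'n) vec) \<Rightarrow> (real,'n) vec \<Rightarrow> real" where
  "divg f x = (\<Sum>i\<in>UNIV. frechet_derivative f (at x) (axis i 1) $ i)"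

definition bip :: "((real,'n::finite) vec) set set \<Rightarrow> (((real,'n) vec) set \<Rightarrow> (real,'n) vec \<Rightarrow> real) \<Rightarrow>
    (((real,'n) vec) set \<Rightarrow> (real,'n) vec \<Rightarrow> real) \<Rightarrow> real" where
  "bip M f g = (\<Sum>S\<in>M. LINT x:(convex hull S)|lborel. f S x * g S x)"

definition bvip :: "((real,'n::finite) vec) set set \<Rightarrow> (((real,'n) vec) set \<Rightarrow> (real,'n) vec \<Rightarrow> (real,'n) vec) \<Rightarrow>
    (((real,'n) vec) set \<Rightarrow> (real,'n) vec \<Rightarrow> (real,'n) vec) \<Rightarrow> real" where
  "bvip M f g = (\<Sum>S\<in>M. LINT x:(convex hull S)|lborel. f S x \<bullet> g S x)"

definition bdiv :: "(((real,'n::finite) vec) set \<Rightarrow> (real,'n) vec \<Rightarrow> (real,'n) vec) \<Rightarrow> ((real,'n) vec) set \<Rightarrow> (real,'n) vec \<Rightarrow> real" where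
  "bdiv \<tau> = (\<lambda>S. divg (\<tau> S))"

definition lnodes :: "((real,'n::finite) vec) set \<Rightarrow> nat \<Rightarrow> ((real,'n) vec) set" where
  "lnodes S m = {(\<Sum>v\<in>S. (real (\<beta> v) / real m) *\<^sub>R v) | \<beta>. (\<Sum>v\<in>S. \<beta> v) = m}"

definition bary :: "((real,'n::finite) vec) set \<Rightarrow> (real,'n) vec \<Rightarrow> (real,'n) vec \<Rightarrow> real" where
  "bary S V x = (THE u. (\<forall>v. v \<notin> S \<longrightarrow> u v = 0) \<and> sum u S = 1 \<and> (\<Sum>v\<in>S. u v *\<^sub>R v) = x) V"

definition linterp :: "((real,'n::finite) vec) set \<Rightarrow> nat \<Rightarrow> ((real,'n) vec \<Rightarrow> real) \<Rightarrow> (real,'n) vec \<Rightarrow> real" where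
  "linterp S m g = (THE p. p \<in> polys (int m) \<and> (\<forall>y\<in>lnodes S m. p y = g y))"

definition bubble_T :: "((real,'n::finite) vec) set \<Rightarrow> (real,'n) vec \<Rightarrow> nat \<Rightarrow> ((real,'n) vec \<Rightarrow> real) \<Rightarrow> (real,'n) vec \<Rightarrow> real" where
  "bubble_T S V m q = linterp S m (\<lambda>y. q y * bary S V y)"

definition bubbleP :: "((real,'n::finite) vec) set set \<Rightarrow> (real,'n) vec \<Rightarrow> nat \<Rightarrow>
    (((real,'n) vec) set \<Rightarrow> (real,'n) vec \<Rightarrow> real) \<Rightarrow> ((real,'n) vec) set \<Rightarrow> (real,'n) vec \<Rightarrow> real" where
  "bubbleP T V m q = (\<lambda>S. if S \<in> T \<and> V \<in> S then bubble_T S V m (q S) else (\<lambda>_. 0))"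

definition oswald :: "((real,'n::finite) vec) set set \<Rightarrow> nat \<Rightarrow>
    (((real,'n) vec) set \<Rightarrow> (real,'n) vec \<Rightarrow> real) \<Rightarrow> ((real,'n) vec) set \<Rightarrow> (real,'n) vec \<Rightarrow> real" where
  "oswald M m q = (\<lambda>S. if S \<in> M then
      linterp S m (\<lambda>y. (\<Sum>S'\<in>{S'\<in>M. y \<in> convex hull S'}. q S' y) /
                        real (card {S'\<in>M. y \<in> convex hull S'}))
    else (\<lambda>_. 0))"

definition bminus :: "(((real,'n::finite) vec) set \<Rightarrow> (real,'n) vec \<Rightarrow> real) \<Rightarrow>
    (((real,'n) vec) set \<Rightarrow> (real,'n) vec \<Rightarrow> real) \<Rightarrow> ((real,'n) vec) set \<Rightarrow> (real,'n) vec \<Rightarrow> real" where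
  "bminus f g = (\<lambda>S x. f S x - g S x)"

definition Vh :: "((real,'n::finite) vec) set set \<Rightarrow> ((real,'n) vec) set \<Rightarrow> nat \<Rightarrow> ((real,'n) vec \<Rightarrow> (real,'n) vec) set" where
  "Vh T \<Omega> k = {w. continuous_on (closure \<Omega>) w \<and>
      (\<forall>S\<in>T. \<exists>p\<in>vpolys (int k). \<forall>x\<in>convex hull S. w x = p x) \<and>
      (\<forall>x\<in>frontier \<Omega>. w x = 0)}"

definition rt_local :: "int \<Rightarrow> ((real,'n::finite) vec \<Rightarrow> (real,'n) vec) set" where
  "rt_local m = {\<tau>. \<exists>a b. a \<in> vpolys m \<and> b \<in> polys m \<and> \<tau> = (\<lambda>x. a x + b x *\<^sub>R x)}"

definition normal_to :: "((real,'n::finite) vec) set \<Rightarrow> (real,'n) vec \<Rightarrow> bool" where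
  "normal_to F n \<longleftrightarrow> (\<forall>u\<in>F. \<forall>w\<in>F. n \<bullet> (u - w) = 0)"

definition RT0 :: "((real,'n::finite) vec) set set \<Rightarrow> int \<Rightarrow> (((real,'n) vec) set \<Rightarrow> (real,'n) vec \<Rightarrow> (real,'n) vec) set" where
  "RT0 M m = {\<tau>. (\<forall>S\<in>M. \<tau> S \<in> rt_local m) \<and> (\<forall>S. S \<notin> M \<longrightarrow> \<tau> S = (\<lambda>_. 0)) \<and>
     (\<forall>S\<in>M. \<forall>S'\<in>M. \<forall>F. F \<subseteq> S \<and> F \<subseteq> S' \<and> card F = CARD('n) \<longrightarrow>
        (\<forall>n. normal_to F n \<longrightarrow> (\<forall>x\<in>convex hull F. (\<tau> S x - \<tau> S' x) \<bullet> n = 0))) \<and>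
     (\<forall>S\<in>M. \<forall>F. F \<subseteq> S \<and> card F = CARD('n) \<and>
        convex hull F \<subseteq> frontier (\<Union>((\<lambda>S. convex hull S) ` M)) \<longrightarrow>
        (\<forall>n. normal_to F n \<longrightarrow> (\<forall>x\<in>convex hull F. \<tau> S x \<bullet> n = 0)))}"

definition Q0 :: "((real,'n::finite) vec) set set \<Rightarrow> int \<Rightarrow> (((real,'n) vec) set \<Rightarrow> (real,'n) vec \<Rightarrow> real) set" where
  "Q0 M m = {\<psi> \<in> broken_polys M m. (\<Sum>S\<in>M. LINT x:(convex hull S)|lborel. \<psi> S x) = 0}"

definition koszul2 :: "(real,'n::{finite,linorder}) vec \<Rightarrow> real \<Rightarrow> (real,'n) vec \<Rightarrow> (real,'n) vec" where
  "koszul2 V a x = (\<chi> j. if j = coord 0 then - ((x $ coord 1 - V $ coord 1) * a)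
                          else if j = coord 1 then (x $ coord 0 - V $ coord 0) * a else 0)"

definition koszul3 :: "(real,'n::{finite,linorder}) vec \<Rightarrow> (real,'n) vec \<Rightarrow> (real,'n) vec \<Rightarrow> (real,'n) vec" where
  "koszul3 V a x = (let y = x - V; c = (\<lambda>i. y $ coord i); b = (\<lambda>i. a $ coord i) in
     (\<chi> j. if j = coord 0 then c 1 * b 2 - c 2 * b 1
           else if j = coord 1 then c 2 * b 0 - c 0 * b 2
           else if j = coord 2 then c 0 * b 1 - c 1 * b 0 else 0))"

definition Wh :: "nat \<Rightarrow> (real,'n::{finite,linorder}) vec \<Rightarrow> ((real,'n) vec \<Rightarrow> (real,'n) vec) set" where
  "Wh k V = (if CARD('n::{finite,linorder}) = 2
      then {(\<lambda>x. koszul2 V (a x) x) | a. a \<in> polys (int k - 3)}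
      else {(\<lambda>x. koszul3 V (a x) x) | a. a \<in> vpolys (int k - 3)})"

definition patch_problem :: "((real,'n::{finite,linorder}) vec) set set \<Rightarrow> (real,'n) vec \<Rightarrow> nat \<Rightarrow>
    ((real,'n) vec \<Rightarrow> (real,'n) vec) \<Rightarrow>
    (((real,'n) vec) set \<Rightarrow> (real,'n) vec \<Rightarrow> (real,'n) vec) \<Rightarrow> (((real,'n) vec) set \<Rightarrow> (real,'n) vec \<Rightarrow> real) \<Rightarrow>
    ((real,'n) vec \<Rightarrow> (real,'n) vec) \<Rightarrow> bool" where
  "patch_problem T V k w \<sigma> \<phi> lam \<longleftrightarrow>
     (let M = patch T V in
      \<sigma> \<in> RT0 M (int k - 1) \<and> \<phi> \<in> Q0 M (int k - 1) \<and> lam \<in> Wh k V \<and>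
      (\<forall>\<tau>\<in>RT0 M (int k - 1). \<forall>\<psi>\<in>Q0 M (int k - 1). \<forall>\<mu>\<in>Wh k V.
         bvip M \<sigma> \<tau> + bip M (bdiv \<tau>) \<phi> + bvip M \<tau> (\<lambda>_. lam)
         + bip M (bdiv \<sigma>) \<psi> + bvip M \<sigma> (\<lambda>_. \<mu>)
         = bip M (\<lambda>_. divg w) (bubbleP T V (k - 1) (bminus \<psi> (oswald M (k - 1) \<psi>)))))"

end

theory Submission
  imports Defs "HOL-Library.Function_Algebras"
begin

text \<open>The load vanishes on globally polynomial pressures, because the Oswald interpolator reproduces them, so
  by the discrete divergence theorem the constraint on mean-free pressures extends to all pressures, which is (ii).
  Splitting \<open>\<xi> = \<nabla>q + \<mu>\<close> with \<open>\<mu>\<close> in the Koszul space and integrating by parts then gives (iii).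

  Unique solvability and (i) both come from one estimate for triples \<open>(\<sigma>, \<phi>, \<mu>)\<close> that satisfy the first equation.
  Testing with \<open>\<Sum>\<^sub>v \<lambda>\<^sub>v ((v - x) \<cdot> \<xi>)(v - x)\<close> on one simplex, where \<open>\<xi> = \<nabla>\<phi> - \<mu>\<close>, bounds \<open>\<integral> \<lambda>\<^sub>v ((v - x) \<cdot> \<xi>)\<^sup>2\<close>
  by \<open>h\<^sup>2 \<parallel>\<sigma>\<parallel>\<^sup>2\<close>. Since \<open>\<mu> \<cdot> (x - V) = 0\<close>, the case v = V contains only the radial derivative of \<open>\<phi>\<close> about V
  and so controls the oscillation of \<open>\<phi>\<close> on the simplex; the other vertices then control \<open>\<mu>\<close>. Testing with the lowest
  order Raviart--Thomas field of an interior facet bounds the jump of \<open>\<phi>\<close> between two neighbours at V, and in a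
  Lipschitz domain the simplices of a patch are connected through facets. Hence \<open>\<phi>\<close> is constant up to
  \<open>h \<parallel>\<sigma>\<parallel>\<close>, and (i) follows from \<open>\<parallel>\<sigma>\<parallel>\<^sup>2 = - (div w, P(\<phi> - S\<phi>))\<close>. No inf-sup constant enters: all constants
  are those of polynomial inequalities on a reference simplex.\<close>

section \<open>Linear functionals and semi-inner products on function spaces\<close>

text \<open>Existence comes from uniqueness: the problem is a symmetric form on a finite-dimensional
  space, so one estimate with the norm of \<sigma> on the right settles solvability and (i). The
  constant has to be fixed before mesh, vertex and velocity; hence everything mesh dependent is
  reduced to shape regularity, the number of simplices by a volume count and the ratios of volumes
  along chains of shared facets. No surface measure enters. A facet integral is represented by the
  volume integral of the divergence of g (x - v), which depends on g only through the facet opposite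
  v; integration by parts then becomes algebra with barycentric coordinates. The polynomial
  inequalities are scale free because they are stated for averages over a simplex and for radial
  derivatives, both of which commute with affine maps. The factor h in (i) enters only through the
  length of x - v in the two kinds of test field.\<close>

instantiation "fun" :: (type, real_vector) real_vector
begin
definition "scaleR c f = (\<lambda>x. c *\<^sub>R f x)"
instance
  by standard (simp_all add: fun_eq_iff scaleR_fun_def scaleR_add_right scaleR_add_left)
end

lemma scaleR_fun_apply [simp]: "(c *\<^sub>R f) x = c *\<^sub>R f x"
  by (simp add: scaleR_fun_def)

lemma sum_fun_apply: "(\<Sum>i\<in>I. f i) x = (\<Sum>i\<in>I. f i x)"
  by (induction I rule: infinite_finite_induct) auto

text \<open>Linearity is asked for on X only: functionals built from derivatives or integrals are
  additive on polynomials, but not on arbitrary functions, where the derivative or the integral may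
  be a default value.\<close>

definition linear_functional_on :: "'a::real_vector set \<Rightarrow> ('a \<Rightarrow> real) \<Rightarrow> bool" where
  "linear_functional_on X f \<longleftrightarrow>
     (\<forall>x\<in>X. \<forall>y\<in>X. f (x + y) = f x + f y) \<and> (\<forall>c. \<forall>x\<in>X. f (c *\<^sub>R x) = c * f x)"

definition seminorm_on :: "'a::real_vector set \<Rightarrow> ('a \<Rightarrow> real) \<Rightarrow> bool" where
  "seminorm_on X N \<longleftrightarrow>
     (\<forall>x\<in>X. \<forall>y\<in>X. N (x + y) \<le> N x + N y) \<and> (\<forall>c. \<forall>x\<in>X. N (c *\<^sub>R x) = \<bar>c\<bar> * N x)"

definition semi_inner_on :: "'a::real_vector set \<Rightarrow> ('a \<Rightarrow> 'a \<Rightarrow> real) \<Rightarrow> bool" where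
  "semi_inner_on X b \<longleftrightarrow> (\<forall>x\<in>X. linear_functional_on X (b x)) \<and>
     (\<forall>x\<in>X. \<forall>y\<in>X. b x y = b y x) \<and> (\<forall>x\<in>X. 0 \<le> b x x)"

lemma linear_functional_on_zero:
  assumes "linear_functional_on X f" "0 \<in> X" shows "f 0 = 0"
  using assms unfolding linear_functional_on_def by (metis mult_zero_left scaleR_zero_left)

lemma linear_functional_on_sum:
  assumes f: "linear_functional_on X f" and X: "subspace X" and "\<And>i. i \<in> I \<Longrightarrow> x i \<in> X"
  shows "f (\<Sum>i\<in>I. c i *\<^sub>R x i) = (\<Sum>i\<in>I. c i * f (x i))"
  using assms(3)
proof (induction I rule: infinite_finite_induct)
  case (insert i I)
  then have "(\<Sum>i\<in>I. c i *\<^sub>R x i) \<in> X" "c i *\<^sub>R x i \<in> X"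
    using X by (auto intro!: subspace_sum subspace_scale)
  with insert f show ?case by (auto simp: linear_functional_on_def)
qed (use linear_functional_on_zero[OF f] X in \<open>auto simp: subspace_0\<close>)

lemma linear_functional_on_subset:
  "linear_functional_on X f \<Longrightarrow> Y \<subseteq> X \<Longrightarrow> linear_functional_on Y f"
  unfolding linear_functional_on_def by blast

lemma semi_inner_on_subset: "semi_inner_on X b \<Longrightarrow> Y \<subseteq> X \<Longrightarrow> semi_inner_on Y b"
  unfolding semi_inner_on_def using linear_functional_on_subset by blast

lemma seminorm_on_subset: "seminorm_on X b \<Longrightarrow> Y \<subseteq> X \<Longrightarrow> seminorm_on Y b"
  unfolding seminorm_on_def by blast

text \<open>Induction on the index set. Either \<open>g j\<close> already vanishes on the common
  kernel of the others and gets the coefficient 0, or some \<open>x0\<close> in that kernel has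
  \<open>g j x0\<close> nonzero, and subtracting a multiple of \<open>g j\<close> from f leads back
  to the smaller set.\<close>

lemma functional_combination:
  assumes "finite I" and X: "subspace X"
    and "\<And>i. i \<in> I \<Longrightarrow> linear_functional_on X (g i)" and "linear_functional_on X f"
    and "\<And>x. x \<in> X \<Longrightarrow> (\<And>i. i \<in> I \<Longrightarrow> g i x = 0) \<Longrightarrow> f x = 0"
  shows "\<exists>c. \<forall>x\<in>X. f x = (\<Sum>i\<in>I. c i * g i x)"
  using assms(1,3-)
proof (induction I arbitrary: f rule: finite_induct)
  case empty
  then show ?case by auto
next
  case (insert j I)
  have gl: "linear_functional_on X (g i)" if "i \<in> insert j I" for i using insert.prems(1) that .
  show ?case
  proof (cases "\<exists>x0\<in>X. (\<forall>i\<in>I. g i x0 = 0) \<and> g j x0 \<noteq> 0")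
    case True
    then obtain x0 where x0: "x0 \<in> X" "\<And>i. i \<in> I \<Longrightarrow> g i x0 = 0" "g j x0 \<noteq> 0" by blast
    define r where "r = f x0 / g j x0"
    define f' where "f' x = f x - r * g j x" for x
    have lin: "linear_functional_on X f'"
      using insert.prems(2) gl[of j] unfolding linear_functional_on_def f'_def by (auto simp: algebra_simps)
    have "f' x = 0" if x: "x \<in> X" "\<And>i. i \<in> I \<Longrightarrow> g i x = 0" for x
    proof -
      \<comment> \<open>This t puts \<open>x + t *\<^sub>R x0\<close> into the kernel of
        \<open>g j\<close> as well, so the assumption on f applies to it.\<close>
      define t where "t = - (g j x / g j x0)"
      have inX: "t *\<^sub>R x0 \<in> X" "x + t *\<^sub>R x0 \<in> X"
        using x x0 X by (auto intro: subspace_add subspace_scale)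
      have val: "h (x + t *\<^sub>R x0) = h x + t * h x0" if "linear_functional_on X h" for h
        using that x x0 inX unfolding linear_functional_on_def by metis
      have "g i (x + t *\<^sub>R x0) = 0" if i: "i \<in> insert j I" for i
        unfolding val[OF gl[OF i]] using i x x0 by (auto simp: t_def)
      then have "f (x + t *\<^sub>R x0) = 0" using insert.prems(3) inX by blast
      then have "f x + t * f x0 = 0" using val[OF insert.prems(2)] by simp
      then show ?thesis by (simp add: f'_def r_def t_def)
    qed
    then obtain c where c: "\<And>x. x \<in> X \<Longrightarrow> f' x = (\<Sum>i\<in>I. c i * g i x)"
      using insert.IH[OF gl lin] by blast
    have "f x = (\<Sum>i\<in>insert j I. (c(j := r)) i * g i x)" if "x \<in> X" for x
    proof -
      have "(\<Sum>i\<in>I. (c(j := r)) i * g i x) = (\<Sum>i\<in>I. c i * g i x)"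
        using insert.hyps by (intro sum.cong) auto
      then show ?thesis using c[OF that] insert.hyps by (simp add: f'_def)
    qed
    then show ?thesis by blast
  next
    case False
    then have "f x = 0" if "x \<in> X" "\<And>i. i \<in> I \<Longrightarrow> g i x = 0" for x
      using insert.prems(3) that by auto
    then obtain c where c: "\<And>x. x \<in> X \<Longrightarrow> f x = (\<Sum>i\<in>I. c i * g i x)"
      using insert.IH[OF gl insert.prems(2)] by blast
    have "f x = (\<Sum>i\<in>insert j I. (c(j := 0)) i * g i x)" if "x \<in> X" for x
    proof -
      have "(\<Sum>i\<in>I. (c(j := 0)) i * g i x) = (\<Sum>i\<in>I. c i * g i x)"
        using insert.hyps by (intro sum.cong) auto
      then show ?thesis using c[OF that] insert.hyps by simp
    qed
    then show ?thesis by blast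
  qed
qed

lemma semi_inner_on_sym: "semi_inner_on X b \<Longrightarrow> x \<in> X \<Longrightarrow> y \<in> X \<Longrightarrow> b x y = b y x"
  unfolding semi_inner_on_def by blast

lemma semi_inner_on_nonneg: "semi_inner_on X b \<Longrightarrow> x \<in> X \<Longrightarrow> 0 \<le> b x x"
  unfolding semi_inner_on_def by blast

lemma semi_inner_on_linear: "semi_inner_on X b \<Longrightarrow> x \<in> X \<Longrightarrow> linear_functional_on X (b x)"
  unfolding semi_inner_on_def by blast

lemma linear_functional_on_add:
  "linear_functional_on X f \<Longrightarrow> x \<in> X \<Longrightarrow> y \<in> X \<Longrightarrow> f (x + y) = f x + f y"
  unfolding linear_functional_on_def by blast

lemma linear_functional_on_scale:
  "linear_functional_on X f \<Longrightarrow> x \<in> X \<Longrightarrow> f (c *\<^sub>R x) = c * f x"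
  unfolding linear_functional_on_def by blast

lemma semi_inner_on_add:
  assumes "semi_inner_on X b" "subspace X" "x \<in> X" "y \<in> X" "u \<in> X" "v \<in> X"
  shows "b (x + y) (u + v) = b x u + b x v + b y u + b y v"
proof -
  have xy: "x + y \<in> X" "u + v \<in> X" using assms subspace_add[OF assms(2)] by auto
  have r: "b z (u + v) = b z u + b z v" if "z \<in> X" for z
    using assms that unfolding semi_inner_on_def linear_functional_on_def by blast
  have l: "b (x + y) z = b x z + b y z" if "z \<in> X" for z
  proof -
    have "b (x + y) z = b z (x + y)" "b x z = b z x" "b y z = b z y"
      using assms that xy unfolding semi_inner_on_def by blast+
    moreover have "b z (x + y) = b z x + b z y"
      using assms that unfolding semi_inner_on_def linear_functional_on_def by blast
    ultimately show ?thesis by simp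
  qed
  show ?thesis using r[OF xy(1)] l assms by simp
qed

lemma semi_inner_on_scale:
  assumes "semi_inner_on X b" "subspace X" "x \<in> X" "y \<in> X"
  shows "b (s *\<^sub>R x) (t *\<^sub>R y) = s * t * b x y"
proof -
  have sx: "s *\<^sub>R x \<in> X" using assms subspace_scale by blast
  have "b (s *\<^sub>R x) (t *\<^sub>R y) = t * b (s *\<^sub>R x) y"
    using assms sx unfolding semi_inner_on_def linear_functional_on_def by blast
  also have "b (s *\<^sub>R x) y = b y (s *\<^sub>R x)" using assms sx unfolding semi_inner_on_def by blast
  also have "\<dots> = s * b y x" using assms unfolding semi_inner_on_def linear_functional_on_def by blast
  also have "b y x = b x y" using assms unfolding semi_inner_on_def by blast
  finally show ?thesis by simp
qed

text \<open>Otherwise the form value of t x + y would be 2 t b(x,y) + b(y,y), which is affine in t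
  and takes the value -1.\<close>

lemma semi_inner_on_null:
  assumes b: "semi_inner_on X b" "subspace X" "x \<in> X" "y \<in> X" and "b x x = 0"
  shows "b x y = 0"
proof (rule ccontr)
  assume n: "b x y \<noteq> 0"
  define t where "t = - (b y y + 1) / (2 * b x y)"
  have tx: "t *\<^sub>R x \<in> X" "t *\<^sub>R x + y \<in> X" using b subspace_scale subspace_add by blast+
  have "b (t *\<^sub>R x + y) (t *\<^sub>R x + y) =
      b (t *\<^sub>R x) (t *\<^sub>R x) + b (t *\<^sub>R x) y + b y (t *\<^sub>R x) + b y y"
    by (rule semi_inner_on_add) (use b tx in auto)
  also have "b y (t *\<^sub>R x) = b (t *\<^sub>R x) y" using b tx unfolding semi_inner_on_def by blast
  also have "b (t *\<^sub>R x) y = t * b x y" using semi_inner_on_scale[OF b(1-4), of t 1] by simp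
  also have "b (t *\<^sub>R x) (t *\<^sub>R x) = 0"
    using semi_inner_on_scale[OF b(1-3,3), of t t] assms(5) by simp
  also have "0 + t * b x y + t * b x y + b y y = 2 * t * b x y + b y y" by simp
  also have "\<dots> = -1" using n by (simp add: t_def field_simps)
  finally have "b (t *\<^sub>R x + y) (t *\<^sub>R x + y) < 0" by simp
  then show False using b(1) tx(2) unfolding semi_inner_on_def by (meson not_le)
qed

text \<open>A version of the equivalence of norms in finite dimension, obtained by Gram-Schmidt over
  the generators instead of compactness, so that no topology on the function space is
  involved.\<close>

lemma seminorm_le_semi_inner:
  assumes "finite B" and "semi_inner_on (span B) b" and "seminorm_on (span B) N"
    and "\<And>x. x \<in> span B \<Longrightarrow> b x x = 0 \<Longrightarrow> N x = 0"
  shows "\<exists>C\<ge>0. \<forall>x\<in>span B. N x \<le> C * sqrt (b x x)"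
  using assms
proof (induction B rule: finite_induct)
  case empty
  then have "linear_functional_on {0} (b 0)" by (simp add: semi_inner_on_def)
  then have "b 0 0 = 0" by (rule linear_functional_on_zero) simp
  with empty show ?case by (intro exI[of _ 1]) auto
next
  case (insert a B)
  let ?Y = "span (insert a B)"
  have sub: "span B \<subseteq> ?Y" by (simp add: span_mono subset_insertI)
  note b = insert.prems(1) and N = insert.prems(2)
  have aY: "a \<in> ?Y" and BY: "B \<subseteq> ?Y" by (auto intro: span_base)
  note bB = semi_inner_on_subset[OF b sub]
  obtain C where C: "C \<ge> 0" "\<And>x. x \<in> span B \<Longrightarrow> N x \<le> C * sqrt (b x x)"
    using insert.IH[OF bB seminorm_on_subset[OF N sub]] insert.prems(3) sub by blast
  \<comment> \<open>Orthogonal projection of a onto \<open>span B\<close>. It exists even for a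
    degenerate form: an x in \<open>span B\<close> that is orthogonal to B has
    \<open>b x x = 0\<close> and is therefore orthogonal to a too.\<close>
  have "\<exists>c. \<forall>x\<in>span B. b a x = (\<Sum>e\<in>B. c e * b e x)"
  proof (rule functional_combination)
    show "finite B" by fact
    show "linear_functional_on (span B) (b e)" if "e \<in> B" for e
      using bB span_base[OF that] by (auto simp: semi_inner_on_def)
    show "linear_functional_on (span B) (b a)"
      using b aY sub linear_functional_on_subset unfolding semi_inner_on_def by blast
    fix x assume x: "x \<in> span B" "\<And>e. e \<in> B \<Longrightarrow> b e x = 0"
    obtain c where xc: "x = (\<Sum>e\<in>B. c e *\<^sub>R e)"
      using x(1) span_finite[OF insert.hyps(1)] by auto
    have "b x x = b x (\<Sum>e\<in>B. c e *\<^sub>R e)" using xc by simp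
    also have "\<dots> = (\<Sum>e\<in>B. c e * b x e)"
      by (rule linear_functional_on_sum[OF semi_inner_on_linear[OF bB] subspace_span])
         (use x in \<open>auto intro: span_base\<close>)
    also have "\<dots> = (\<Sum>e\<in>B. c e * b e x)"
      using semi_inner_on_sym[OF bB x(1)] by (intro sum.cong) (auto intro: span_base)
    also have "\<dots> = 0" using x(2) by simp
    finally have "b x a = 0"
      using semi_inner_on_null[OF b subspace_span _ aY] x sub by blast
    then show "b a x = 0" using semi_inner_on_sym[OF b aY] x(1) sub by auto
  qed auto
  then obtain c where c: "\<And>x. x \<in> span B \<Longrightarrow> b a x = (\<Sum>e\<in>B. c e * b e x)" by blast
  define p where "p = (\<Sum>e\<in>B. c e *\<^sub>R e)"
  have p: "p \<in> span B" unfolding p_def by (intro span_sum span_scale span_base)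
  have bp: "b p x = b a x" if x: "x \<in> span B" for x
  proof -
    have "b p x = b x p" by (rule semi_inner_on_sym[OF bB p x])
    also have "\<dots> = (\<Sum>e\<in>B. c e * b x e)" unfolding p_def
      by (rule linear_functional_on_sum[OF semi_inner_on_linear[OF bB] subspace_span])
         (use x in \<open>auto intro: span_base\<close>)
    also have "\<dots> = (\<Sum>e\<in>B. c e * b e x)"
      using semi_inner_on_sym[OF bB x] by (intro sum.cong) (auto intro: span_base)
    finally show ?thesis using c[OF x] by simp
  qed
  define a' where "a' = a + (-1) *\<^sub>R p"
  have a'Y: "a' \<in> ?Y" unfolding a'_def using aY p sub by (intro span_add span_scale) auto
  have orth: "b a' x = 0" if x: "x \<in> span B" for x
  proof -
    have xY: "x \<in> ?Y" "p \<in> ?Y" using x p sub by auto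
    note L = semi_inner_on_linear[OF b xY(1)]
    have "b x a' = b x a + b x ((-1) *\<^sub>R p)"
      unfolding a'_def by (rule linear_functional_on_add[OF L aY]) (use xY in \<open>auto intro: span_neg\<close>)
    also have "b x ((-1) *\<^sub>R p) = (-1) * b x p" by (rule linear_functional_on_scale[OF L xY(2)])
    also have "b x p = b p x" by (rule semi_inner_on_sym[OF b xY])
    also have "b p x = b a x" by (rule bp[OF x])
    also have "b x a = b a x" by (rule semi_inner_on_sym[OF b xY(1) aY])
    finally have "b x a' = 0" by simp
    then show ?thesis using semi_inner_on_sym[OF b a'Y xY(1)] by simp
  qed
  have bnn: "b a' a' \<ge> 0" by (rule semi_inner_on_nonneg[OF b a'Y])
  obtain C' where C': "C' \<ge> 0" "N a' \<le> C' * sqrt (b a' a')"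
  \<comment> \<open>If a' is null, the hypothesis gives \<open>N a' = 0\<close> and the constant 0
    will do.\<close>
  proof (cases "b a' a' = 0")
    case True
    then show ?thesis using insert.prems(3)[OF a'Y] that[of 0] by auto
  next
    case False
    show ?thesis
    proof (rule that[of "\<bar>N a'\<bar> / sqrt (b a' a')"])
      show "N a' \<le> \<bar>N a'\<bar> / sqrt (b a' a') * sqrt (b a' a')" using False by simp
    qed (use bnn in auto)
  qed
  have "N y \<le> (C + C') * sqrt (b y y)" if y: "y \<in> ?Y" for y
  proof -
    obtain k where k: "y - k *\<^sub>R a \<in> span B" using y by (auto simp: span_insert)
    define x where "x = y - k *\<^sub>R a + k *\<^sub>R p"
    have x: "x \<in> span B" unfolding x_def using k p by (intro span_add span_scale)
    have yx: "y = k *\<^sub>R a' + x" by (simp add: x_def a'_def algebra_simps)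
    have kY: "k *\<^sub>R a' \<in> ?Y" "x \<in> ?Y" using a'Y x sub by (auto intro: span_scale)
    have "b y y = b (k *\<^sub>R a') (k *\<^sub>R a') + b (k *\<^sub>R a') x + b x (k *\<^sub>R a') + b x x"
      unfolding yx by (rule semi_inner_on_add[OF b subspace_span kY kY])
    also have "b (k *\<^sub>R a') x = 0"
      using semi_inner_on_scale[OF b subspace_span a'Y kY(2), of k 1] orth[OF x] by simp
    also have "b x (k *\<^sub>R a') = b (k *\<^sub>R a') x" by (rule semi_inner_on_sym[OF b kY(2,1)])
    also have "b (k *\<^sub>R a') x = 0"
      using semi_inner_on_scale[OF b subspace_span a'Y kY(2), of k 1] orth[OF x] by simp
    also have "b (k *\<^sub>R a') (k *\<^sub>R a') = k * k * b a' a'"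
      by (rule semi_inner_on_scale[OF b subspace_span a'Y a'Y])
    finally have byy: "b y y = k\<^sup>2 * b a' a' + b x x" by (simp add: power2_eq_square)
    have bx: "b x x \<ge> 0" by (rule semi_inner_on_nonneg[OF b kY(2)])
    have "N y \<le> N (k *\<^sub>R a') + N x" using N kY unfolding yx seminorm_on_def by blast
    also have "N (k *\<^sub>R a') = \<bar>k\<bar> * N a'" using N a'Y unfolding seminorm_on_def by blast
    also have "\<bar>k\<bar> * N a' \<le> \<bar>k\<bar> * (C' * sqrt (b a' a'))" using C' by (intro mult_left_mono) auto
    also have "\<dots> = C' * sqrt (k\<^sup>2 * b a' a')" by (simp add: real_sqrt_mult)
    also have "\<dots> \<le> C' * sqrt (b y y)" using C' bx byy by (intro mult_left_mono) auto
    also have "N x \<le> C * sqrt (b x x)" by (rule C(2)[OF x])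
    also have "\<dots> \<le> C * sqrt (b y y)" using C bnn byy by (intro mult_left_mono) auto
    finally show ?thesis by (simp add: algebra_simps)
  qed
  then show ?case using C C' by (intro exI[of _ "C + C'"]) auto
qed

section \<open>Finite-dimensional function spaces\<close>

definition finite_dimensional :: "'a::real_vector set \<Rightarrow> bool" where
  "finite_dimensional X \<longleftrightarrow> (\<exists>B. finite B \<and> X \<subseteq> span B)"

lemma finite_dimensional_subset: "finite_dimensional Y \<Longrightarrow> X \<subseteq> Y \<Longrightarrow> finite_dimensional X"
  unfolding finite_dimensional_def by blast

lemma finite_dimensional_linear_image:
  assumes "finite_dimensional X" "linear f" shows "finite_dimensional (f ` X)"
  using assms unfolding finite_dimensional_def
  by (metis finite_imageI image_mono linear_span_image)

lemma finite_dimensional_sums: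
  assumes "finite_dimensional X" "finite_dimensional Y"
  shows "finite_dimensional {x + y | x y. x \<in> X \<and> y \<in> Y}"
proof -
  obtain A B where "finite A" "X \<subseteq> span A" "finite B" "Y \<subseteq> span B"
    using assms unfolding finite_dimensional_def by blast
  moreover have "x + y \<in> span (A \<union> B)" if "x \<in> span A" "y \<in> span B" for x y
    using that span_mono[of A "A \<union> B"] span_mono[of B "A \<union> B"] by (intro span_add) auto
  ultimately show ?thesis unfolding finite_dimensional_def
    by (intro exI[of _ "A \<union> B"]) auto
qed

lemma finite_dimensional_family_sum:
  assumes "finite I" "\<And>i. i \<in> I \<Longrightarrow> finite_dimensional (X i)"
  shows "finite_dimensional {\<Sum>i\<in>I. x i | x. \<forall>i\<in>I. x i \<in> X i}"
  using assms
proof (induction I rule: finite_induct)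
  case empty
  then show ?case by (auto simp: finite_dimensional_def intro!: exI[of _ "{}"])
next
  case (insert j I)
  have "{\<Sum>i\<in>insert j I. x i | x. \<forall>i\<in>insert j I. x i \<in> X i} \<subseteq>
        {a + b | a b. a \<in> X j \<and> b \<in> {\<Sum>i\<in>I. x i | x. \<forall>i\<in>I. x i \<in> X i}}"
    using insert.hyps by auto
  then show ?case
    using finite_dimensional_subset[OF finite_dimensional_sums] insert by blast
qed

lemma finite_dimensional_subspace_span:
  assumes "finite_dimensional X" "subspace X"
  obtains B where "finite B" "X = span B" "B \<subseteq> X"
proof -
  obtain A where A: "finite A" "X \<subseteq> span A" using assms(1) by (auto simp: finite_dimensional_def)
  obtain B where B: "B \<subseteq> X" "independent B" "X \<subseteq> span B"
    using maximal_independent_subset by blast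
  have "finite B" using independent_span_bound[OF A(1) B(2)] B A by blast
  moreover have "span B \<subseteq> X" using B(1) assms(2) by (rule span_minimal)
  ultimately show ?thesis using that B by blast
qed

lemma finite_dimensional_Times:
  assumes "finite_dimensional X" "finite_dimensional Y" shows "finite_dimensional (X \<times> Y)"
proof -
  have l: "linear (\<lambda>x::'a. (x, 0::'b))" "linear (\<lambda>y::'b. (0::'a, y))"
    by (auto simp: linear_iff)
  have "X \<times> Y \<subseteq> {a + b | a b. a \<in> (\<lambda>x. (x, 0)) ` X \<and> b \<in> (\<lambda>y. (0, y)) ` Y}"
    by (force simp: image_iff)
  then show ?thesis
    by (rule finite_dimensional_subset[OF finite_dimensional_sums
        [OF finite_dimensional_linear_image[OF assms(1) l(1)] finite_dimensional_linear_image[OF assms(2) l(2)]]])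
qed

text \<open>Nondegeneracy says that the functionals \<open>b e\<close>, with e from a finite
  spanning set, have no common zero but 0. Every functional is then a combination of them, and
  symmetry turns the coefficients into the representing vector. This is the passage from uniqueness
  to existence.\<close>

lemma symmetric_form_represents:
  assumes X: "subspace X" "finite_dimensional X"
    and lin: "\<And>x. x \<in> X \<Longrightarrow> linear_functional_on X (b x)"
    and sym: "\<And>x y. x \<in> X \<Longrightarrow> y \<in> X \<Longrightarrow> b x y = b y x"
    and nondeg: "\<And>x. x \<in> X \<Longrightarrow> (\<And>y. y \<in> X \<Longrightarrow> b x y = 0) \<Longrightarrow> x = 0"
    and f: "linear_functional_on X f"
  obtains u where "u \<in> X" "\<And>x. x \<in> X \<Longrightarrow> b u x = f x"
proof -
  obtain B where B: "finite B" "X = span B" "B \<subseteq> X"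
    using finite_dimensional_subspace_span[OF X(2,1)] by blast
  have expand: "b x y = (\<Sum>e\<in>B. c e * b x e)" if "x \<in> X" "y = (\<Sum>e\<in>B. c e *\<^sub>R e)" for x y c
    unfolding that(2) by (rule linear_functional_on_sum[OF lin[OF that(1)] X(1)]) (use B in auto)
  have "\<exists>c. \<forall>x\<in>X. f x = (\<Sum>e\<in>B. c e * b e x)"
  proof (rule functional_combination[OF B(1) X(1)])
    fix x assume x: "x \<in> X" "\<And>e. e \<in> B \<Longrightarrow> b e x = 0"
    have "b x y = 0" if y: "y \<in> X" for y
    proof -
      obtain c where c: "y = (\<Sum>e\<in>B. c e *\<^sub>R e)" using y span_finite[OF B(1)] B(2) by auto
      show ?thesis using x sym B(3) unfolding expand[OF x(1) c] by (auto intro!: sum.neutral)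
    qed
    then have "x = 0" using nondeg x by blast
    then show "f x = 0" using linear_functional_on_zero[OF f subspace_0[OF X(1)]] by simp
  qed (use lin f B in auto)
  then obtain c where c: "\<And>x. x \<in> X \<Longrightarrow> f x = (\<Sum>e\<in>B. c e * b e x)" by blast
  define u where "u = (\<Sum>e\<in>B. c e *\<^sub>R e)"
  have u: "u \<in> X" unfolding u_def B(2) by (intro span_sum span_scale span_base)
  have "b u x = f x" if x: "x \<in> X" for x
  proof -
    have "b u x = b x u" using sym u x by blast
    also have "\<dots> = (\<Sum>e\<in>B. c e * b x e)" by (rule expand[OF x u_def])
    also have "\<dots> = f x" unfolding c[OF x] using sym x B(3) by (auto intro!: sum.cong)
    finally show ?thesis .
  qed
  then show ?thesis using that u by blast
qed

section \<open>Polynomials\<close>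

definition monomial :: "('n::finite \<Rightarrow> nat) \<Rightarrow> (real,'n) vec \<Rightarrow> real" where
  "monomial \<alpha> x = (\<Prod>i\<in>UNIV. (x $ i) ^ (\<alpha> i))"

lemma finite_multi_indices: "finite {\<alpha> :: 'n::finite \<Rightarrow> nat. sum \<alpha> UNIV \<le> m}"
proof (rule finite_subset)
  show "{\<alpha> :: 'n \<Rightarrow> nat. sum \<alpha> UNIV \<le> m} \<subseteq> PiE UNIV (\<lambda>_. {..m})"
  proof
    fix \<alpha> :: "'n \<Rightarrow> nat" assume "\<alpha> \<in> {\<alpha>. sum \<alpha> UNIV \<le> m}"
    moreover have "\<alpha> i \<le> sum \<alpha> UNIV" for i by (rule member_le_sum) auto
    ultimately show "\<alpha> \<in> PiE UNIV (\<lambda>_. {..m})" by (force intro: order_trans)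
  qed
qed (rule finite_PiE, auto)

lemma polys_neg: "m < 0 \<Longrightarrow> polys m = {0}"
  by (auto simp: polys_def zero_fun_def)

lemma polys_subspace: "subspace (polys m)"
proof (cases "m < 0")
  case False
  have "\<exists>c'. (\<lambda>x. (\<Sum>\<alpha>\<in>A. c \<alpha> * g \<alpha> x)) + (\<lambda>x. (\<Sum>\<alpha>\<in>A. d \<alpha> * g \<alpha> x)) = (\<lambda>x. \<Sum>\<alpha>\<in>A. c' \<alpha> * g \<alpha> x)"
    for A c d and g :: "('a \<Rightarrow> nat) \<Rightarrow> (real, 'a) vec \<Rightarrow> real"
    by (rule exI[of _ "\<lambda>\<alpha>. c \<alpha> + d \<alpha>"]) (auto simp: fun_eq_iff algebra_simps sum.distrib)
  moreover have "\<exists>c'. r *\<^sub>R (\<lambda>x. (\<Sum>\<alpha>\<in>A. c \<alpha> * g \<alpha> x)) = (\<lambda>x. \<Sum>\<alpha>\<in>A. c' \<alpha> * g \<alpha> x)"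
    for A c r and g :: "('a \<Rightarrow> nat) \<Rightarrow> (real, 'a) vec \<Rightarrow> real"
    by (rule exI[of _ "\<lambda>\<alpha>. r * c \<alpha>"]) (auto simp: fun_eq_iff sum_distrib_left mult.assoc)
  moreover have "\<exists>c'. (0 :: (real, 'a) vec \<Rightarrow> real) = (\<lambda>x. \<Sum>\<alpha>\<in>A. c' \<alpha> * g \<alpha> x)"
    for A and g :: "('a \<Rightarrow> nat) \<Rightarrow> (real, 'a) vec \<Rightarrow> real"
    by (rule exI[of _ "\<lambda>\<alpha>. 0"]) (auto simp: fun_eq_iff)
  ultimately show ?thesis using False unfolding polys_def subspace_def by fastforce
qed (auto simp: polys_neg)

lemma polys_zero: "(\<lambda>x. 0) \<in> polys m"
  using subspace_0[OF polys_subspace[of m]] by (simp add: zero_fun_def)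

lemma polys_add: "p \<in> polys m \<Longrightarrow> q \<in> polys m \<Longrightarrow> (\<lambda>x. p x + q x) \<in> polys m"
  using subspace_add[OF polys_subspace[of m]] by (simp add: plus_fun_def)

lemma polys_cmult: "p \<in> polys m \<Longrightarrow> (\<lambda>x. c * p x) \<in> polys m"
  using subspace_scale[OF polys_subspace[of m], of p c] by (simp add: scaleR_fun_def)

lemma polys_multc: "p \<in> polys m \<Longrightarrow> (\<lambda>x. p x * c) \<in> polys m"
  using polys_cmult[of p m c] by (simp add: mult.commute)

lemma polys_diff: "p \<in> polys m \<Longrightarrow> q \<in> polys m \<Longrightarrow> (\<lambda>x. p x - q x) \<in> polys m"
  using polys_add[OF _ polys_cmult[of q m "-1"]] by simp

lemma polys_minus: "p \<in> polys m \<Longrightarrow> (\<lambda>x. - p x) \<in> polys m"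
  using polys_cmult[of p m "-1"] by simp

lemma polys_sum: "(\<And>i. i \<in> I \<Longrightarrow> p i \<in> polys m) \<Longrightarrow> (\<lambda>x. \<Sum>i\<in>I. p i x) \<in> polys m"
  by (induction I rule: infinite_finite_induct) (auto intro: polys_zero polys_add)

lemma mult_if_zero: "a * (if P then b else 0) = (if P then a * b else (0::real))"
  by simp

lemma monomial_in_polys:
  assumes "sum \<alpha> UNIV \<le> nat m" "0 \<le> m" shows "monomial \<alpha> \<in> polys m"
proof -
  have "monomial \<alpha> x = (\<Sum>\<beta>\<in>{\<beta>. sum \<beta> UNIV \<le> nat m}. (if \<beta> = \<alpha> then 1 else 0) * monomial \<beta> x)" for x
  proof -
    have "(\<Sum>\<beta>\<in>{\<beta>. sum \<beta> UNIV \<le> nat m}. (if \<beta> = \<alpha> then 1 else 0) * monomial \<beta> x)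
        = (\<Sum>\<beta>\<in>{\<beta>. sum \<beta> UNIV \<le> nat m}. if \<beta> = \<alpha> then monomial \<beta> x else 0)"
      by (intro sum.cong) auto
    then show ?thesis using assms by (simp add: finite_multi_indices)
  qed
  then show ?thesis using assms(2) unfolding polys_def monomial_def by auto
qed

lemma polys_span:
  assumes "0 \<le> m" shows "polys m = span (monomial ` {\<alpha>. sum \<alpha> UNIV \<le> nat m})"
proof
  show "span (monomial ` {\<alpha>. sum \<alpha> UNIV \<le> nat m}) \<subseteq> polys m"
    by (rule span_minimal) (use assms in \<open>auto intro: monomial_in_polys polys_subspace\<close>)
  show "polys m \<subseteq> span (monomial ` {\<alpha>. sum \<alpha> UNIV \<le> nat m})"
  proof
    fix p assume "p \<in> polys m"
    then obtain c where "p = (\<lambda>x. \<Sum>\<alpha>\<in>{\<alpha>. sum \<alpha> UNIV \<le> nat m}. c \<alpha> * monomial \<alpha> x)"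
      using assms unfolding polys_def monomial_def by auto
    then have "p = (\<Sum>\<alpha>\<in>{\<alpha>. sum \<alpha> UNIV \<le> nat m}. c \<alpha> *\<^sub>R monomial \<alpha>)"
      by (auto simp: fun_eq_iff sum_fun_apply)
    then show "p \<in> span (monomial ` {\<alpha>. sum \<alpha> UNIV \<le> nat m})"
      by (simp only:) (rule span_sum, rule span_scale, rule span_base, auto)
  qed
qed

lemma finite_dimensional_polys: "finite_dimensional (polys m)"
proof (cases "m < 0")
  case False
  then have "polys m = span (monomial ` {\<alpha> :: 'a \<Rightarrow> nat. sum \<alpha> UNIV \<le> nat m})"
    by (intro polys_span) simp
  then show ?thesis unfolding finite_dimensional_def
    by (intro exI[of _ "monomial ` {\<alpha> :: 'a \<Rightarrow> nat. sum \<alpha> UNIV \<le> nat m}"] conjI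
        finite_imageI finite_multi_indices) simp
qed (auto simp: polys_neg finite_dimensional_def intro!: exI[of _ "{}"])

lemma polys_const: "0 \<le> m \<Longrightarrow> (\<lambda>x. c) \<in> polys m"
  using polys_multc[OF monomial_in_polys[of "\<lambda>_. 0" m], of c] by (simp add: monomial_def)

lemma monomial_mult_coord: "x $ i * monomial \<alpha> x = monomial (\<alpha>(i := Suc (\<alpha> i))) x"
  unfolding monomial_def
  by (subst (1 2) prod.remove[of UNIV i]) (auto intro!: prod.cong)

lemma sum_upd_Suc: "sum ((\<alpha> :: 'n::finite \<Rightarrow> nat)(i := Suc (\<alpha> i))) UNIV = Suc (sum \<alpha> UNIV)"
  by (subst (1 2) sum.remove[of UNIV i]) (auto intro!: sum.cong)

lemma polys_coord_mult:
  assumes "p \<in> polys m" shows "(\<lambda>x. x $ i * p x) \<in> polys (m + 1)"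
proof (cases "m < 0")
  case False
  have "p \<in> span (monomial ` {\<alpha>. sum \<alpha> UNIV \<le> nat m})" using assms False by (simp add: polys_span)
  then show ?thesis
  proof (induction rule: span_induct_alt)
    case base
    then show ?case by (simp add: polys_zero)
  next
    case (step c q p)
    then obtain \<alpha> where \<alpha>: "q = monomial \<alpha>" "sum \<alpha> UNIV \<le> nat m" by auto
    have "monomial (\<alpha>(i := Suc (\<alpha> i))) \<in> polys (m + 1)"
      using \<alpha> False by (intro monomial_in_polys) (auto simp: sum_upd_Suc simp del: fun_upd_apply)
    from polys_add[OF polys_cmult[OF this, of c] step(2)] show ?case
      by (simp add: \<alpha> monomial_mult_coord[symmetric] algebra_simps)
  qed
qed (use assms in \<open>auto simp: polys_neg polys_zero\<close>)

lemma polys_mono: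
  assumes "p \<in> polys m" "m \<le> n" shows "p \<in> polys n"
proof (cases "m < 0")
  case False
  then have m: "0 \<le> m" and n: "0 \<le> n" using assms(2) by auto
  have "monomial ` {\<alpha> :: 'a \<Rightarrow> nat. sum \<alpha> UNIV \<le> nat m} \<subseteq> monomial ` {\<alpha>. sum \<alpha> UNIV \<le> nat n}"
  proof (rule image_mono, rule subsetI)
    fix \<alpha> :: "'a \<Rightarrow> nat" assume "\<alpha> \<in> {\<alpha>. sum \<alpha> UNIV \<le> nat m}"
    then show "\<alpha> \<in> {\<alpha>. sum \<alpha> UNIV \<le> nat n}" using assms(2) nat_mono[OF assms(2)] by simp
  qed
  then have "polys m \<subseteq> (polys n :: ((real, 'a) vec \<Rightarrow> real) set)"
    unfolding polys_span[OF m] polys_span[OF n] by (rule span_mono)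
  then show ?thesis using assms by blast
qed (use assms in \<open>auto simp: polys_neg zero_fun_def polys_zero\<close>)

lemma polys_coord: "1 \<le> m \<Longrightarrow> (\<lambda>x. x $ i) \<in> polys m"
  using polys_coord_mult[OF polys_const[of 0 1], of i] by (auto intro: polys_mono)

lemma polys_0_const:
  assumes "p \<in> polys 0" obtains c where "p = (\<lambda>_. c)"
proof -
  have "{\<alpha> :: 'a::finite \<Rightarrow> nat. sum \<alpha> UNIV \<le> 0} = {\<lambda>_. 0}" by (auto simp: fun_eq_iff)
  then show ?thesis using assms that unfolding polys_def by auto
qed

lemma polys_Suc_decompose:
  assumes "p \<in> polys (int (Suc m))"
  obtains c q where "\<And>i. q i \<in> polys (int m)" "p = (\<lambda>x. c + (\<Sum>i\<in>UNIV. x $ i * q i x))"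
proof -
  have "p \<in> span (monomial ` {\<alpha>. sum \<alpha> UNIV \<le> Suc m})" using assms by (simp add: polys_span del: of_nat_Suc)
  then have "\<exists>c q. (\<forall>i. q i \<in> polys (int m)) \<and> p = (\<lambda>x. c + (\<Sum>i\<in>UNIV. x $ i * q i x))"
  proof (induction rule: span_induct_alt)
    case base
    show ?case by (rule exI[of _ 0], rule exI[of _ "\<lambda>_ _. 0"]) (auto simp: polys_zero fun_eq_iff)
  next
    case (step k r p)
    from step(2) obtain c q where q: "\<And>i. q i \<in> polys (int m)" "p = (\<lambda>x. c + (\<Sum>i\<in>UNIV. x $ i * q i x))"
      by blast
    from step(1) obtain \<alpha> where \<alpha>: "r = monomial \<alpha>" "sum \<alpha> UNIV \<le> Suc m" by auto
    show ?case
    proof (cases "sum \<alpha> UNIV = 0")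
      case True
      then have "r = (\<lambda>x. 1)" using \<alpha> by (auto simp: monomial_def fun_eq_iff)
      then show ?thesis using q
        by (intro exI[of _ "k + c"] exI[of _ q]) (auto simp: fun_eq_iff)
    next
      case False
      then obtain i where i: "\<alpha> i > 0" by (metis neq0_conv sum.neutral)
      define \<beta> where "\<beta> = \<alpha>(i := \<alpha> i - 1)"
      have ab: "\<alpha> = \<beta>(i := Suc (\<beta> i))" using i by (auto simp: \<beta>_def)
      then have "sum \<alpha> UNIV = Suc (sum \<beta> UNIV)" using sum_upd_Suc by metis
      then have \<beta>: "monomial \<beta> \<in> polys (int m)" using \<alpha> by (intro monomial_in_polys) auto
      have r: "r x = x $ i * monomial \<beta> x" for x using \<alpha>(1) ab monomial_mult_coord by metis
      show ?thesis
      proof (rule exI[of _ c], rule exI[of _ "\<lambda>j x. (if j = i then k * monomial \<beta> x else 0) + q j x"], intro conjI allI)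
        show "(\<lambda>x. (if j = i then k * monomial \<beta> x else 0) + q j x) \<in> polys (int m)" for j
          using q(1) \<beta> by (cases "j = i") (auto intro!: polys_add polys_cmult)
        show "k *\<^sub>R r + p = (\<lambda>x. c + (\<Sum>j\<in>UNIV. x $ j * ((if j = i then k * monomial \<beta> x else 0) + q j x)))"
          by (auto simp: fun_eq_iff r q(2) distrib_left sum.distrib mult_if_zero)
      qed
    qed
  qed
  then show ?thesis using that by blast
qed

text \<open>Degree induction in the style of Horner: later facts are checked for constants, sums and
  multiplication by a coordinate, without multi-indices.\<close>

lemma polys_induct [consumes 1, case_names const step]:
  assumes "p \<in> polys (int m)"
    and const: "\<And>c. P 0 (\<lambda>_. c)"
    and step: "\<And>m c q. (\<And>i. q i \<in> polys (int m)) \<Longrightarrow> (\<And>i. P m (q i)) \<Longrightarrow>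
       P (Suc m) (\<lambda>x. c + (\<Sum>i\<in>UNIV. x $ i * q i x))"
  shows "P m p"
  using assms(1)
proof (induction m arbitrary: p)
  case 0
  then obtain c where "p = (\<lambda>_. c)" using polys_0_const[of p] by auto
  then show ?case using const by simp
next
  case (Suc m)
  obtain c q where q: "\<And>i. q i \<in> polys (int m)" "p = (\<lambda>x. c + (\<Sum>i\<in>UNIV. x $ i * q i x))"
    using polys_Suc_decompose[OF Suc.prems] by blast
  show ?case unfolding q(2) by (rule step[OF q(1) Suc.IH[OF q(1)]])
qed

lemma polys_mult_nat:
  assumes "p \<in> polys (int a)" "q \<in> polys (int b)"
  shows "(\<lambda>x. p x * q x) \<in> polys (int a + int b)"
  using assms(1)
proof (induction rule: polys_induct)
  case (const c)
  then show ?case using polys_cmult[OF assms(2)] by simp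
next
  case (step m c r)
  have "(\<lambda>x. x $ i * (r i x * q x)) \<in> polys (int (Suc m) + int b)" for i
    using polys_coord_mult[OF step(2)] by (simp add: algebra_simps)
  moreover have "(\<lambda>x. c * q x) \<in> polys (int (Suc m) + int b)"
    by (rule polys_mono[OF polys_cmult[OF assms(2)]]) simp
  ultimately have "(\<lambda>x. c * q x + (\<Sum>i\<in>UNIV. x $ i * (r i x * q x))) \<in> polys (int (Suc m) + int b)"
    by (intro polys_add polys_sum) auto
  then show ?case by (simp add: distrib_right sum_distrib_right mult.assoc)
qed

lemma polys_mult:
  assumes "p \<in> polys a" "q \<in> polys b" shows "(\<lambda>x. p x * q x) \<in> polys (a + b)"
proof (cases "a < 0 \<or> b < 0")
  case True
  then have "(\<lambda>x. p x * q x) = (\<lambda>x. 0)" using assms by (auto simp: polys_neg)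
  then show ?thesis by (simp add: polys_zero)
next
  case False
  then show ?thesis using polys_mult_nat[of p "nat a" q "nat b"] assms by simp
qed

lemma polys_mult_le:
  assumes "p \<in> polys a" "q \<in> polys b" "a + b \<le> c" shows "(\<lambda>x. p x * q x) \<in> polys c"
  using polys_mono[OF polys_mult[OF assms(1,2)] assms(3)] .

lemma polys_prod:
  assumes "finite I" "\<And>i. i \<in> I \<Longrightarrow> p i \<in> polys (int (n i))"
  shows "(\<lambda>x. \<Prod>i\<in>I. p i x) \<in> polys (int (\<Sum>i\<in>I. n i))"
  using assms
proof (induction I rule: finite_induct)
  case (insert i I)
  then show ?case using polys_mult_nat[of "p i" "n i" "\<lambda>x. \<Prod>i\<in>I. p i x" "\<Sum>i\<in>I. n i"] by simp
qed (simp add: polys_const)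

lemma polys_compose:
  assumes "p \<in> polys m" and f: "\<And>i. (\<lambda>x. f x $ i) \<in> polys 1"
  shows "(\<lambda>x. p (f x)) \<in> polys m"
proof (cases "m < 0")
  case False
  then have "p \<in> polys (int (nat m))" using assms by simp
  then have "(\<lambda>x. p (f x)) \<in> polys (int (nat m))"
  proof (induction rule: polys_induct)
    case (step m c q)
    then show ?case using polys_mult[OF f step(2)]
      by (intro polys_add polys_sum polys_const) (auto simp: algebra_simps)
  qed (simp add: polys_const)
  then show ?thesis using False by simp
qed (use assms in \<open>auto simp: polys_neg polys_zero\<close>)

lemma polys_shift: "p \<in> polys m \<Longrightarrow> (\<lambda>x. p (a + x)) \<in> polys m"
  by (erule polys_compose) (auto intro!: polys_add polys_const polys_coord)

section \<open>Polynomials along lines: zeros, divisibility, homogeneous parts, differences\<close>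

lemma polys_univariate:
  assumes "p \<in> polys m" obtains P :: "real poly" where "\<And>s. p (a + s *\<^sub>R d) = poly P s"
proof (cases "m < 0")
  case True
  then show ?thesis using assms that[of 0] by (auto simp: polys_neg)
next
  case False
  then have "p \<in> polys (int (nat m))" using assms by simp
  then have "\<exists>P. \<forall>s. p (a + s *\<^sub>R d) = poly P s"
  proof (induction rule: polys_induct)
    case (const c)
    show ?case by (rule exI[of _ "[:c:]"]) simp
  next
    case (step m c q)
    then obtain Q where Q: "\<And>i s. q i (a + s *\<^sub>R d) = poly (Q i) s" by metis
    show ?case
      by (rule exI[of _ "[:c:] + (\<Sum>i\<in>UNIV. [:a $ i, d $ i:] * Q i)"])
         (auto simp: Q poly_sum algebra_simps)
  qed
  then show ?thesis using that by blast
qed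

lemma polys_zero_on_line:
  assumes "p \<in> polys m" "infinite {s. p (a + s *\<^sub>R d) = 0}"
  shows "p (a + s *\<^sub>R d) = 0"
proof -
  obtain P where P: "\<And>s. p (a + s *\<^sub>R d) = poly P s" using polys_univariate[OF assms(1)] by blast
  then have "P = 0" using assms(2) poly_roots_finite[of P] by auto
  then show ?thesis using P by simp
qed

text \<open>The line through x and a point of U has infinitely many parameters with points in U, and
  a univariate polynomial with infinitely many roots is zero.\<close>

lemma polys_zero_if_zero_on_open:
  assumes "p \<in> polys m" "open U" "U \<noteq> {}" "\<And>x. x \<in> U \<Longrightarrow> p x = 0"
  shows "p = (\<lambda>_. 0)"
proof
  fix x
  obtain a e where a: "a \<in> U" "e > 0" "ball a e \<subseteq> U" using assms(2,3) open_contains_ball by blast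
  \<comment> \<open>For s < r the point stays within e of a; the added 1 covers x = a.\<close>
  define r where "r = e / (norm (x - a) + 1)"
  have r: "r > 0" unfolding r_def using a by (simp add: add_nonneg_pos)
  have "{0<..<r} \<subseteq> {s. p (a + s *\<^sub>R (x - a)) = 0}"
  proof safe
    fix s assume s: "s \<in> {0<..<r}"
    have "s * norm (x - a) \<le> s * (norm (x - a) + 1)" using s by simp
    also have "\<dots> < r * (norm (x - a) + 1)"
      using s by (intro mult_strict_right_mono) (auto simp: add_nonneg_pos)
    also have "\<dots> = e" unfolding r_def by (simp add: add_nonneg_eq_0_iff)
    finally have "a + s *\<^sub>R (x - a) \<in> ball a e" using s by (simp add: dist_norm)
    then show "p (a + s *\<^sub>R (x - a)) = 0" using a assms(4) by blast
  qed
  then have "infinite {s. p (a + s *\<^sub>R (x - a)) = 0}"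
    using r infinite_Ioo finite_subset by blast
  from polys_zero_on_line[OF assms(1) this, of 1] show "p x = 0" by simp
qed

text \<open>The product rule for differences shows that a displacement by
  \<open>l x *\<^sub>R u\<close> changes a polynomial by a multiple of l. If the displaced point
  lies in the zero plane of l, this is divisibility by l.\<close>

lemma polys_divide_affine:
  assumes "p \<in> polys (int m)" "l \<in> polys 1"
  shows "\<exists>n. \<exists>h\<in>polys (int n). \<forall>x. p x - p (x - l x *\<^sub>R u) = l x * h x"
  using assms(1)
proof (induction rule: polys_induct)
  case (const c)
  show ?case by (rule exI[of _ 0], rule bexI[of _ "\<lambda>_. 0"]) (auto simp: polys_zero)
next
  case (step m c q)
  have "\<forall>i. \<exists>n. \<exists>h\<in>polys (int n). \<forall>x. q i x - q i (x - l x *\<^sub>R u) = l x * h x"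
    using step(2) by blast
  then obtain n h where h: "\<And>i. h i \<in> polys (int (n i))"
      "\<And>i x. q i x - q i (x - l x *\<^sub>R u) = l x * h i x"
    by metis
  define N where "N = (\<Sum>i\<in>UNIV. n i) + m + 1"
  let ?H = "\<lambda>x. \<Sum>i\<in>UNIV. x $ i * h i x + u $ i * q i (x - l x *\<^sub>R u)"
  have "n i \<le> (\<Sum>i\<in>UNIV. n i)" for i by (rule member_le_sum) auto
  then have "n i + 1 \<le> N" for i unfolding N_def by (simp add: trans_le_add1)
  then have "int (n i) + 1 \<le> int N" for i by (metis of_nat_1 of_nat_add of_nat_mono)
  then have hN: "(\<lambda>x. x $ i * h i x) \<in> polys (int N)" for i
    by (rule polys_mono[OF polys_coord_mult[OF h(1)]])
  have "(\<lambda>x. (x - l x *\<^sub>R u) $ i) \<in> polys 1" for i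
    using assms(2) by (auto intro!: polys_diff polys_coord polys_multc)
  then have "(\<lambda>x. q i (x - l x *\<^sub>R u)) \<in> polys (int N)" for i
    by (rule polys_mono[OF polys_compose[OF step(1)]]) (simp only: of_nat_le_iff, simp add: N_def)
  then have H: "?H \<in> polys (int N)" using hN by (intro polys_sum polys_add polys_cmult) auto
  have "x $ i * q i x - (x - l x *\<^sub>R u) $ i * q i (x - l x *\<^sub>R u)
      = l x * (x $ i * h i x + u $ i * q i (x - l x *\<^sub>R u))" for i x
    using h(2)[of i x] by (simp add: algebra_simps)
  then have "(\<Sum>i\<in>UNIV. x $ i * q i x) - (\<Sum>i\<in>UNIV. (x - l x *\<^sub>R u) $ i * q i (x - l x *\<^sub>R u)) = l x * ?H x" for x
    by (simp add: sum_subtractf[symmetric] sum_distrib_left)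
  then show ?case using H by (intro exI[of _ N] bexI[of _ ?H]) auto
qed

text \<open>Radial scaling of a polynomial becomes a sum of powers of the scaling factor. This
  serves both the flux functional of a facet and Euler's identity.\<close>

lemma polys_homogeneous_parts:
  assumes "p \<in> polys (int m)"
  obtains G where "\<And>j. j \<le> m \<Longrightarrow> G j \<in> polys (int j)" "\<And>j s y. G j (s *\<^sub>R y) = s ^ j * G j y"
    "\<And>y. p y = (\<Sum>j\<le>m. G j y)"
proof -
  have "\<exists>G. (\<forall>j\<le>m. G j \<in> polys (int j)) \<and> (\<forall>j s y. G j (s *\<^sub>R y) = s ^ j * G j y) \<and>
      (\<forall>y. p y = (\<Sum>j\<le>m. G j y))"
    using assms
  proof (induction rule: polys_induct)
    case (const c)
    show ?case by (rule exI[of _ "\<lambda>j y. if j = 0 then c else 0"]) (auto simp: polys_const)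
  next
    case (step m c q)
    have "\<forall>i. \<exists>G. (\<forall>j\<le>m. G j \<in> polys (int j)) \<and> (\<forall>j s y. G j (s *\<^sub>R y) = s ^ j * G j y) \<and>
      (\<forall>y. q i y = (\<Sum>j\<le>m. G j y))" using step(2) by blast
    then obtain G where G: "\<And>i j. j \<le> m \<Longrightarrow> G i j \<in> polys (int j)"
        "\<And>i j s y. G i j (s *\<^sub>R y) = s ^ j * G i j y" "\<And>i y. q i y = (\<Sum>j\<le>m. G i j y)"
      by metis
    define H where "H j y = (case j of 0 \<Rightarrow> c | Suc l \<Rightarrow> (\<Sum>i\<in>UNIV. y $ i * G i l y))" for j y
    have "H j \<in> polys (int j)" if "j \<le> Suc m" for j
    proof (cases j)
      case (Suc l)
      then have "H j = (\<lambda>y. \<Sum>i\<in>UNIV. y $ i * G i l y)" by (simp add: H_def fun_eq_iff)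
      then show ?thesis using Suc that polys_coord_mult[OF G(1)[of l]]
        by (auto intro!: polys_sum simp: add.commute)
    qed (simp add: H_def[abs_def] polys_const)
    moreover have "H j (s *\<^sub>R y) = s ^ j * H j y" for j s y
      by (cases j) (auto simp: H_def G(2) sum_distrib_left algebra_simps intro!: sum.cong)
    moreover have "c + (\<Sum>i\<in>UNIV. y $ i * q i y) = (\<Sum>j\<le>Suc m. H j y)" for y
    proof -
      have "(\<Sum>j\<le>Suc m. H j y) = c + (\<Sum>j\<le>m. \<Sum>i\<in>UNIV. y $ i * G i j y)"
        by (subst sum.atMost_Suc_shift) (simp add: H_def)
      also have "(\<Sum>j\<le>m. \<Sum>i\<in>UNIV. y $ i * G i j y) = (\<Sum>i\<in>UNIV. y $ i * q i y)"
        by (subst sum.swap) (simp add: G(3) sum_distrib_left)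
      finally show ?thesis by simp
    qed
    ultimately show ?case by blast
  qed
  then show ?thesis using that by blast
qed

lemma polys_difference:
  assumes "p \<in> polys (int (Suc m))" shows "(\<lambda>x. p (x + d) - p x) \<in> polys (int m)"
  using assms
proof (induction m arbitrary: p)
  case 0
  obtain c q where q: "\<And>i. q i \<in> polys (int 0)" "p = (\<lambda>x. c + (\<Sum>i\<in>UNIV. x $ i * q i x))"
    using polys_Suc_decompose[OF 0] by blast
  have "\<exists>e. q i = (\<lambda>_. e)" for i using polys_0_const[of "q i"] q(1)[of i] by auto
  then obtain e where "\<And>i. q i = (\<lambda>_. e i)" by metis
  then have "(\<lambda>x. p (x + d) - p x) = (\<lambda>x. \<Sum>i\<in>UNIV. d $ i * e i)"
    by (auto simp: q(2) fun_eq_iff sum_subtractf[symmetric] algebra_simps)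
  then show ?case by (simp add: polys_const)
next
  case (Suc m)
  obtain c q where q: "\<And>i. q i \<in> polys (int (Suc m))" "p = (\<lambda>x. c + (\<Sum>i\<in>UNIV. x $ i * q i x))"
    using polys_Suc_decompose[OF Suc.prems] by blast
  have "(\<lambda>x. x $ i * (q i (x + d) - q i x)) \<in> polys (int (Suc m))" for i
    using polys_coord_mult[OF Suc.IH[OF q(1)]] by (simp add: add.commute)
  moreover have "(\<lambda>x. d $ i * q i (x + d)) \<in> polys (int (Suc m))" for i
    using polys_cmult[OF polys_shift[OF q(1), of i d]] by (simp add: add.commute)
  ultimately have "(\<lambda>x. \<Sum>i\<in>UNIV. x $ i * (q i (x + d) - q i x) + d $ i * q i (x + d)) \<in> polys (int (Suc m))"
    by (intro polys_sum polys_add) auto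
  moreover have "(\<lambda>x. p (x + d) - p x) = (\<lambda>x. \<Sum>i\<in>UNIV. x $ i * (q i (x + d) - q i x) + d $ i * q i (x + d))"
    by (auto simp: q(2) fun_eq_iff sum_subtractf[symmetric] algebra_simps)
  ultimately show ?case by simp
qed

text \<open>The values at x + n d agree for all natural n, so p - p x has infinitely many zeros on
  the line.\<close>

lemma polys_periodic_const:
  assumes p: "p \<in> polys m" and per: "\<And>x. p (x + d) = p x"
  shows "p (x + s *\<^sub>R d) = p x"
proof -
  have n: "p (x + real n *\<^sub>R d) = p x" for n
  proof (induction n)
    case (Suc n)
    then show ?case using per[of "x + real n *\<^sub>R d"] by (simp add: algebra_simps)
  qed simp
  have q: "(\<lambda>y. p y - p x) \<in> polys (max m 0)"
    using p by (intro polys_diff polys_const) (auto intro: polys_mono)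
  have "range real \<subseteq> {s. p (x + s *\<^sub>R d) - p x = 0}" using n by auto
  then have "infinite {s. p (x + s *\<^sub>R d) - p x = 0}"
    using range_inj_infinite[of real] inj_of_nat finite_subset by blast
  from polys_zero_on_line[OF q this] show ?thesis by simp
qed

text \<open>Differences along \<open>d i\<close> lower the degree and vanish on the smaller lattice,
  so by induction every \<open>d i\<close> is a period of p. A polynomial is constant in the
  direction of a period, and the periods span the space.\<close>

lemma polys_zero_on_lattice:
  fixes d :: "'i \<Rightarrow> (real, 'n::finite) vec"
  assumes p: "p \<in> polys (int m)" and "finite I" and span: "span (d ` I) = UNIV"
    and zero: "\<And>\<beta>. sum \<beta> I \<le> m \<Longrightarrow> p (x0 + (\<Sum>i\<in>I. real (\<beta> i) *\<^sub>R d i)) = 0"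
  shows "p = (\<lambda>_. 0)"
  using p zero
proof (induction m arbitrary: p)
  case 0
  obtain c where "p = (\<lambda>_. c)" using 0(1) polys_0_const[of p] by auto
  then show ?case using 0(2)[of "\<lambda>_. 0"] by simp
next
  case (Suc m)
  have per: "p (x + d i) = p x" if i: "i \<in> I" for i x
  proof -
    have "(\<lambda>x. p (x + d i) - p x) = (\<lambda>_. 0)"
    proof (rule Suc.IH)
      show "(\<lambda>x. p (x + d i) - p x) \<in> polys (int m)" by (rule polys_difference[OF Suc.prems(1)])
      fix \<beta> :: "'i \<Rightarrow> nat" assume b: "sum \<beta> I \<le> m"
      have s: "sum (\<beta>(i := Suc (\<beta> i))) I = Suc (sum \<beta> I)"
        using i assms(2) by (simp add: sum.remove[of I i])
      have v: "(\<Sum>j\<in>I. real ((\<beta>(i := Suc (\<beta> i))) j) *\<^sub>R d j) = (\<Sum>j\<in>I. real (\<beta> j) *\<^sub>R d j) + d i"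
        using i assms(2) by (simp add: sum.remove[of I i] algebra_simps)
      show "p (x0 + (\<Sum>i\<in>I. real (\<beta> i) *\<^sub>R d i) + d i) - p (x0 + (\<Sum>i\<in>I. real (\<beta> i) *\<^sub>R d i)) = 0"
        using Suc.prems(2)[of "\<beta>(i := Suc (\<beta> i))"] Suc.prems(2)[of \<beta>] s v b by (simp add: algebra_simps)
    qed
    then show ?thesis by (metis eq_iff_diff_eq_0)
  qed
  have shift: "p (x + y) = p x" if "y \<in> span (d ` I)" for x y
    using that
  proof (induction arbitrary: x rule: span_induct_alt)
    case (step c b y)
    then obtain i where i: "i \<in> I" "b = d i" by auto
    have "p (x + (c *\<^sub>R b + y)) = p ((x + y) + c *\<^sub>R d i)" by (simp add: i add_ac)
    also have "\<dots> = p (x + y)" by (rule polys_periodic_const[OF Suc.prems(1) per[OF i(1)]])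
    finally show ?case using step.IH by simp
  qed simp
  have "p y = 0" for y
    using shift[of "y - x0" x0] span Suc.prems(2)[of "\<lambda>_. 0"] by simp
  then show ?case by auto
qed

lemma polys_continuous: "p \<in> polys m \<Longrightarrow> continuous_on A p"
  unfolding polys_def by (auto split: if_splits intro!: continuous_intros)

subsection \<open>Gradients and divergence\<close>

definition pgrad :: "((real,'n::finite) vec \<Rightarrow> real) \<Rightarrow> (real,'n) vec \<Rightarrow> (real,'n) vec" where
  "pgrad p x = (\<chi> i. frechet_derivative p (at x) (axis i 1))"

lemma pgrad_eq:
  assumes "(p has_derivative (\<lambda>h. g \<bullet> h)) (at x)" shows "pgrad p x = g"
  using frechet_derivative_at[OF assms]
  by (simp add: pgrad_def vec_eq_iff inner_axis fun_eq_iff) (metis inner_axis inner_real_def mult.right_neutral)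

lemma polys_gradient:
  assumes "p \<in> polys m"
  shows "pgrad p \<in> vpolys (m - 1)" "(p has_derivative (\<lambda>h. pgrad p x \<bullet> h)) (at x)"
proof -
  have "\<exists>g\<in>vpolys (m - 1). \<forall>x. (p has_derivative (\<lambda>h. g x \<bullet> h)) (at x)"
  proof (cases "m < 0")
    case True
    then have "p = (\<lambda>_. 0)" using assms by (auto simp: polys_neg)
    then show ?thesis by (intro bexI[of _ "\<lambda>_. 0"]) (auto simp: vpolys_def polys_zero)
  next
    case False
    then have "p \<in> polys (int (nat m))" using assms by simp
    then have "\<exists>g\<in>vpolys (int (nat m) - 1). \<forall>x. (p has_derivative (\<lambda>h. g x \<bullet> h)) (at x)"
    proof (induction rule: polys_induct)
      case (const c)
      show ?case by (intro bexI[of _ "\<lambda>_. 0"]) (auto simp: vpolys_def polys_zero)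
    next
      case (step m c q)
      have "\<forall>i. \<exists>g. g \<in> vpolys (int m - 1) \<and> (\<forall>x. (q i has_derivative (\<lambda>h. g x \<bullet> h)) (at x))"
        using step(2) by blast
      then obtain g where g: "\<And>i. g i \<in> vpolys (int m - 1)"
        "\<And>i x. (q i has_derivative (\<lambda>h. g i x \<bullet> h)) (at x)" by metis
      let ?g = "\<lambda>x. \<Sum>i\<in>UNIV. q i x *\<^sub>R axis i 1 + (x $ i) *\<^sub>R g i x"
      have "(\<lambda>x. x $ i * g i x $ j) \<in> polys (int m)" for i j
        using polys_coord_mult[of "\<lambda>x. g i x $ j" "int m - 1" i] g(1)[of i] by (simp add: vpolys_def)
      then have "(\<lambda>x. ?g x $ j) \<in> polys (int m)" for j
        using step(1) by (simp add: axis_def) (intro polys_sum polys_add, auto simp: polys_zero)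
      then have 1: "?g \<in> vpolys (int (Suc m) - 1)" by (simp add: vpolys_def)
      have "((\<lambda>x. x $ i * q i x) has_derivative (\<lambda>h. x $ i * (g i x \<bullet> h) + h $ i * q i x)) (at x)" for i x
        by (rule has_derivative_mult[OF bounded_linear_imp_has_derivative[OF bounded_linear_vec_nth] g(2)])
      then have "((\<lambda>x. c + (\<Sum>i\<in>UNIV. x $ i * q i x)) has_derivative
          (\<lambda>h. 0 + (\<Sum>i\<in>UNIV. x $ i * (g i x \<bullet> h) + h $ i * q i x))) (at x)" for x
        by (intro has_derivative_add has_derivative_const has_derivative_sum) auto
      moreover have "(\<lambda>h. 0 + (\<Sum>i\<in>UNIV. x $ i * (g i x \<bullet> h) + h $ i * q i x)) = (\<lambda>h. ?g x \<bullet> h)" for x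
        by (auto simp: fun_eq_iff inner_sum_left inner_add_left inner_axis' algebra_simps)
      ultimately show ?case using 1 by (intro bexI[of _ ?g]) auto
    qed
    then show ?thesis using False by simp
  qed
  then obtain g where g: "g \<in> vpolys (m - 1)" "\<And>x. (p has_derivative (\<lambda>h. g x \<bullet> h)) (at x)" by blast
  then have "pgrad p = g" using pgrad_eq by blast
  then show "pgrad p \<in> vpolys (m - 1)" "(p has_derivative (\<lambda>h. pgrad p x \<bullet> h)) (at x)" using g by auto
qed

lemma vpolys_has_derivative:
  assumes "f \<in> vpolys m"
  shows "(f has_derivative (\<lambda>h. \<chi> i. pgrad (\<lambda>x. f x $ i) x \<bullet> h)) (at x)"
  by (subst has_derivative_componentwise_within)
    (use assms in \<open>auto simp: vpolys_def Basis_vec_def inner_axis intro: polys_gradient(2)\<close>)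

lemma divg_eq:
  assumes "(f has_derivative f') (at x)" shows "divg f x = (\<Sum>i\<in>UNIV. f' (axis i 1) $ i)"
  using frechet_derivative_at[OF assms] by (simp add: divg_def)

lemma divg_vpolys:
  assumes "f \<in> vpolys m" shows "divg f x = (\<Sum>i\<in>UNIV. pgrad (\<lambda>x. f x $ i) x $ i)"
  by (simp add: divg_eq[OF vpolys_has_derivative[OF assms]] inner_axis)

lemma divg_polys:
  assumes "f \<in> vpolys m" shows "divg f \<in> polys (m - 1)"
proof -
  have "divg f = (\<lambda>x. \<Sum>i\<in>UNIV. pgrad (\<lambda>x. f x $ i) x $ i)"
    by (rule ext, rule divg_vpolys[OF assms])
  moreover have "(\<lambda>x. pgrad (\<lambda>x. f x $ i) x $ i) \<in> polys (m - 1)" for i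
    using assms polys_gradient(1)[of "\<lambda>x. f x $ i" m] unfolding vpolys_def by blast
  ultimately show ?thesis by (simp add: polys_sum)
qed

lemma vpolys_add: "f \<in> vpolys m \<Longrightarrow> g \<in> vpolys m \<Longrightarrow> (\<lambda>x. f x + g x) \<in> vpolys m"
  by (auto simp: vpolys_def intro: polys_add)

lemma vpolys_diff: "f \<in> vpolys m \<Longrightarrow> g \<in> vpolys m \<Longrightarrow> (\<lambda>x. f x - g x) \<in> vpolys m"
  by (auto simp: vpolys_def intro: polys_diff)

lemma vpolys_cscale: "f \<in> vpolys m \<Longrightarrow> (\<lambda>x. c *\<^sub>R f x) \<in> vpolys m"
  by (auto simp: vpolys_def intro: polys_cmult)

lemma vpolys_sum: "(\<And>i. i \<in> I \<Longrightarrow> f i \<in> vpolys m) \<Longrightarrow> (\<lambda>x. \<Sum>i\<in>I. f i x) \<in> vpolys m"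
  by (auto simp: vpolys_def intro!: polys_sum)

lemma vpolys_const: "0 \<le> m \<Longrightarrow> (\<lambda>x. c) \<in> vpolys m"
  by (simp add: vpolys_def polys_const)

lemma vpolys_id: "1 \<le> m \<Longrightarrow> (\<lambda>x. x) \<in> vpolys m"
  by (simp add: vpolys_def polys_coord)

lemma vpolys_mono: "f \<in> vpolys m \<Longrightarrow> m \<le> n \<Longrightarrow> f \<in> vpolys n"
  by (auto simp: vpolys_def intro: polys_mono)

lemma vpolys_scale: "p \<in> polys a \<Longrightarrow> f \<in> vpolys b \<Longrightarrow> a + b \<le> c \<Longrightarrow> (\<lambda>x. p x *\<^sub>R f x) \<in> vpolys c"
  by (auto simp: vpolys_def intro: polys_mult_le)

lemma polys_inner: "f \<in> vpolys a \<Longrightarrow> g \<in> vpolys b \<Longrightarrow> a + b \<le> c \<Longrightarrow> (\<lambda>x. f x \<bullet> g x) \<in> polys c"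
  by (auto simp: vpolys_def inner_vec_def intro!: polys_sum polys_mult_le)

lemma vpolys_continuous:
  assumes "f \<in> vpolys m" shows "continuous_on A f"
proof -
  have "continuous_on A (\<lambda>x. f x $ i)" for i
    by (rule polys_continuous[of _ m]) (use assms in \<open>auto simp: vpolys_def\<close>)
  then have "continuous_on A (\<lambda>x. \<chi> i. f x $ i)" by (rule continuous_on_vec_lambda)
  then show ?thesis by simp
qed

lemma vpolys_zero_if_zero_on_open:
  assumes "f \<in> vpolys m" "open U" "U \<noteq> {}" "\<And>x. x \<in> U \<Longrightarrow> f x = 0"
  shows "f = (\<lambda>_. 0)"
proof -
  have "(\<lambda>x. f x $ i) = (\<lambda>_. 0)" for i
    by (rule polys_zero_if_zero_on_open[OF _ assms(2,3)]) (use assms in \<open>auto simp: vpolys_def\<close>)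
  then show ?thesis by (auto simp: fun_eq_iff vec_eq_iff)
qed

lemma finite_dimensional_vpolys: "finite_dimensional (vpolys m :: ((real,'n::finite) vec \<Rightarrow> (real,'n) vec) set)"
proof -
  let ?L = "\<lambda>i::'n. \<lambda>p :: (real,'n) vec \<Rightarrow> real. (\<lambda>x. p x *\<^sub>R (axis i 1 :: (real,'n) vec))"
  have "linear (?L i)" for i by (auto simp: linear_iff fun_eq_iff scaleR_add_left)
  then have fd: "finite_dimensional (?L i ` polys m)" for i
    by (rule finite_dimensional_linear_image[OF finite_dimensional_polys])
  have "vpolys m \<subseteq> {\<Sum>i\<in>UNIV. f i | f. \<forall>i\<in>UNIV. f i \<in> ?L i ` polys m}"
  proof
    fix f :: "(real,'n) vec \<Rightarrow> (real,'n) vec" assume f: "f \<in> vpolys m"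
    have "f = (\<Sum>i\<in>UNIV. ?L i (\<lambda>x. f x $ i))"
      by (auto simp: fun_eq_iff sum_fun_apply vec_eq_iff axis_def mult_if_zero)
    then show "f \<in> {\<Sum>i\<in>UNIV. f i | f. \<forall>i\<in>UNIV. f i \<in> ?L i ` polys m}"
      using f unfolding vpolys_def by (intro CollectI exI[of _ "\<lambda>i. ?L i (\<lambda>x. f x $ i)"]) auto
  qed
  then show ?thesis
    using finite_dimensional_subset[OF finite_dimensional_family_sum[of UNIV "\<lambda>i. ?L i ` polys m"]] fd by auto
qed

lemma divg_scale:
  assumes p: "p \<in> polys a" and f: "f \<in> vpolys b"
  shows "divg (\<lambda>x. p x *\<^sub>R f x) x = pgrad p x \<bullet> f x + p x * divg f x"
proof -
  have "((\<lambda>x. p x *\<^sub>R f x) has_derivative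
      (\<lambda>h. p x *\<^sub>R (\<chi> i. pgrad (\<lambda>x. f x $ i) x \<bullet> h) + (pgrad p x \<bullet> h) *\<^sub>R f x)) (at x)"
    by (rule has_derivative_scaleR[OF polys_gradient(2)[OF p] vpolys_has_derivative[OF f]])
  from divg_eq[OF this] show ?thesis
    by (simp add: divg_vpolys[OF f] inner_axis sum.distrib sum_distrib_left) (simp add: inner_vec_def)
qed

lemma divg_add:
  assumes "f \<in> vpolys a" "g \<in> vpolys b"
  shows "divg (\<lambda>x. f x + g x) x = divg f x + divg g x"
  by (simp add: divg_eq[OF has_derivative_add[OF vpolys_has_derivative[OF assms(1)] vpolys_has_derivative[OF assms(2)]]]
      divg_vpolys[OF assms(1)] divg_vpolys[OF assms(2)] inner_axis sum.distrib)

lemma divg_cscale: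
  assumes "f \<in> vpolys a" shows "divg (\<lambda>x. c *\<^sub>R f x) x = c * divg f x"
  by (simp add: divg_eq[OF has_derivative_scaleR_right[OF vpolys_has_derivative[OF assms]]]
      divg_vpolys[OF assms] inner_axis sum_distrib_left)

lemma divg_position: "divg (\<lambda>x :: (real,'n::finite) vec. x - v) x = real CARD('n)"
proof -
  have "((\<lambda>x :: (real,'n) vec. x - v) has_derivative (\<lambda>h. h)) (at x)"
    by (auto intro!: derivative_eq_intros)
  from divg_eq[OF this] show ?thesis by simp
qed

section \<open>Linear changes of variables\<close>

subsection \<open>A well-ordered index type of the same cardinality\<close>

text \<open>The change of variables theorem of HOL-Analysis is stated for index types of class
  wellorder, and a type variable of class linorder cannot be coerced to it even when it is finite.\<close>

typedef (overloaded) ('n::finite) enum_index = "{..<CARD('n)}"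
  by (rule exI[of _ 0]) simp

instantiation enum_index :: (finite) wellorder
begin
definition "x \<le> y \<longleftrightarrow> Rep_enum_index x \<le> Rep_enum_index y"
definition "x < y \<longleftrightarrow> Rep_enum_index x < Rep_enum_index y"
instance
proof
  fix P :: "'a enum_index \<Rightarrow> bool" and a
  assume step: "\<And>x. (\<And>y. y < x \<Longrightarrow> P y) \<Longrightarrow> P x"
  show "P a"
  proof (induction "Rep_enum_index a" arbitrary: a rule: less_induct)
    case less
    then show ?case using step by (simp add: less_enum_index_def)
  qed
qed (auto simp: less_eq_enum_index_def less_enum_index_def Rep_enum_index_inject)
end

instance enum_index :: (finite) finite
proof
  show "finite (UNIV :: 'a enum_index set)"
    using type_definition.Abs_image[OF type_definition_enum_index] by (metis finite_imageI finite_lessThan)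
qed

lemma CARD_enum_index: "CARD('n::finite enum_index) = CARD('n)"
  by (subst type_definition.card[OF type_definition_enum_index]) simp

subsection \<open>Integrals over images of compact sets\<close>

lemma set_integrable_compact:
  fixes f :: "'a::euclidean_space \<Rightarrow> real"
  assumes "compact K" "continuous_on K f" shows "set_integrable lborel K f"
  using borel_integrable_compact[OF assms] by (simp add: set_integrable_def)

lemma LINT_linear_image_wellorder:
  fixes g :: "(real, 'm::{finite,wellorder}) vec \<Rightarrow> (real, 'm) vec" and f :: "(real,'m) vec \<Rightarrow> real"
  assumes g: "linear g" and K: "compact K" "continuous_on (g ` K) f"
  shows "(LINT x:g ` K|lborel. f x) = \<bar>det (matrix g)\<bar> * (LINT x:K|lborel. f (g x))"
proof -
  \<comment> \<open>The change of variables rule takes vector-valued integrands, so f is read as the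
    only component of a field with values in a one-dimensional space.\<close>
  define F where "F = (\<lambda>x. (vec (f x) :: (real, 1) vec))"
  have "continuous_on K g" using g by (intro linear_continuous_on) (simp add: linear_conv_bounded_linear)
  then have gK: "compact (g ` K)" "continuous_on K g" using K(1) compact_continuous_image by auto
  have cF: "continuous_on (g ` K) F" unfolding F_def vec_def
    by (intro continuous_on_vec_lambda K)
  have "integrable lborel (\<lambda>x. indicator (g ` K) x *\<^sub>R F x)"
    by (rule borel_integrable_compact[OF gK(1) cF])
  then have "F absolutely_integrable_on (g ` K)"
    unfolding set_integrable_def by (subst integrable_completion) (auto dest: borel_measurable_integrable)
  then have *: "integral (g ` K) F = \<bar>det (matrix g)\<bar> *\<^sub>R integral K (F \<circ> g)"
    by (intro integral_change_of_variables_linear[OF g]) auto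
  have i1: "set_integrable lborel (g ` K) f" by (rule set_integrable_compact[OF gK(1) K(2)])
  have i2: "set_integrable lborel K (\<lambda>x. f (g x))"
    by (rule set_integrable_compact[OF K(1) continuous_on_compose2[OF K(2) gK(2)]]) auto
  have i3: "set_integrable lborel (g ` K) F" "set_integrable lborel K (F \<circ> g)"
    unfolding set_integrable_def
    by (intro borel_integrable_compact gK cF K continuous_on_compose)+
  have "integral (g ` K) F $ 1 = integral (g ` K) f"
    using integral_component_eq_cart[OF set_borel_integral_eq_integral(1)[OF i3(1)], of 1] by (simp add: F_def)
  moreover have "integral K (F \<circ> g) $ 1 = integral K (\<lambda>x. f (g x))"
    using integral_component_eq_cart[OF set_borel_integral_eq_integral(1)[OF i3(2)], of 1] by (simp add: F_def)
  ultimately show ?thesis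
    using * set_borel_integral_eq_integral(2)[OF i1] set_borel_integral_eq_integral(2)[OF i2] by simp
qed

definition enum_bij :: "'n::finite enum_index \<Rightarrow> 'n" where
  "enum_bij = (SOME \<pi>. bij \<pi>)"

lemma bij_enum_bij: "bij (enum_bij :: 'n::finite enum_index \<Rightarrow> 'n)"
proof -
  have "\<exists>\<pi> :: 'n enum_index \<Rightarrow> 'n. bij \<pi>"
    using finite_same_card_bij[of "UNIV :: 'n enum_index set" "UNIV :: 'n set"] by (auto simp: CARD_enum_index)
  then show ?thesis unfolding enum_bij_def by (rule someI_ex)
qed

lemma enum_bij_inverse [simp]: "enum_bij (inv enum_bij i) = i" "inv enum_bij (enum_bij j) = j"
  by (rule surj_f_inv_f[OF bij_is_surj[OF bij_enum_bij]], rule inv_f_f[OF bij_is_inj[OF bij_enum_bij]])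

definition reindex :: "(real, 'n::finite) vec \<Rightarrow> (real, 'n enum_index) vec" where
  "reindex x = (\<chi> i. x $ enum_bij i)"

definition unindex :: "(real, 'n::finite enum_index) vec \<Rightarrow> (real, 'n) vec" where
  "unindex y = (\<chi> i. y $ (inv enum_bij i))"

lemma unindex_reindex [simp]: "unindex (reindex x) = x"
  by (simp add: reindex_def unindex_def vec_eq_iff)

lemma reindex_unindex [simp]: "reindex (unindex x) = x"
  by (simp add: reindex_def unindex_def vec_eq_iff)

lemma linear_reindex: "linear reindex" "linear unindex"
  by (auto simp: linear_iff reindex_def unindex_def vec_eq_iff)

lemma inner_reindex: "reindex x \<bullet> reindex y = x \<bullet> y"
  unfolding inner_vec_def reindex_def
  using sum.reindex_bij_betw[OF bij_enum_bij, of "\<lambda>i. x $ i * y $ i"] by simp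

lemma prod_Basis_vec: "(\<Prod>b\<in>Basis. x \<bullet> b) = (\<Prod>i\<in>UNIV. x $ i)" for x :: "(real, 'n::finite) vec"
proof -
  have "(Basis :: (real,'n) vec set) = range (\<lambda>i. axis i 1)" by (auto simp: Basis_vec_def)
  moreover have "inj (\<lambda>i. axis i 1 :: (real,'n) vec)" by (auto simp: inj_on_def axis_eq_axis)
  then have "(\<Prod>b\<in>range (\<lambda>i. axis i 1). x \<bullet> b) = (\<Prod>i\<in>UNIV. x \<bullet> axis i 1)"
    by (subst prod.reindex) auto
  ultimately show ?thesis by (simp add: inner_axis)
qed

text \<open>A permutation of the coordinates maps boxes to boxes of the same volume, and this
  characterises Lebesgue measure.\<close>

lemma lborel_reindex: "distr lborel borel reindex = (lborel :: (real, 'n::finite enum_index) vec measure)"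
proof (rule lborel_eqI[symmetric])
  fix l u :: "(real, 'n enum_index) vec"
  assume le: "\<And>b. b \<in> Basis \<Longrightarrow> l \<bullet> b \<le> u \<bullet> b"
  have [measurable]: "reindex \<in> borel_measurable (borel :: (real, 'n) vec measure)"
    using linear_reindex(1) by (intro borel_measurable_continuous_onI linear_continuous_on)
      (simp add: linear_conv_bounded_linear)
  have lu: "l $ i \<le> u $ i" for i using le[of "axis i 1"] by (simp add: inner_axis axis_in_Basis_iff)
  have "reindex -` box l u = box (unindex l) (unindex u)"
  proof -
    have "(\<forall>i. P (enum_bij i) i) \<longleftrightarrow> (\<forall>j. P j (inv enum_bij j))" for P :: "'n \<Rightarrow> 'n enum_index \<Rightarrow> bool"
      by (metis enum_bij_inverse)
    from this[of "\<lambda>j i. l $ i < _ $ j \<and> _ $ j < u $ i"] show ?thesis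
      by (auto simp: mem_box_cart reindex_def unindex_def set_eq_iff)
  qed
  then have "emeasure (distr lborel borel reindex) (box l u) = emeasure lborel (box (unindex l) (unindex u))"
    by (subst emeasure_distr) auto
  also have "\<dots> = (\<Prod>b\<in>Basis. (unindex u - unindex l) \<bullet> b)"
    by (rule emeasure_lborel_box) (auto simp: Basis_vec_def inner_axis unindex_def lu)
  also have "(\<Prod>b\<in>Basis. (unindex u - unindex l) \<bullet> b) = (\<Prod>i\<in>UNIV. (unindex u - unindex l) $ i)"
    by (rule prod_Basis_vec)
  also have "\<dots> = (\<Prod>i\<in>UNIV. (u - l) $ i)"
    using prod.reindex_bij_betw[OF bij_enum_bij, of "\<lambda>i. (unindex u - unindex l) $ i"]
    by (simp add: unindex_def)
  also have "\<dots> = (\<Prod>b\<in>Basis. (u - l) \<bullet> b)" by (rule prod_Basis_vec[symmetric])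
  finally show "emeasure (distr lborel borel reindex) (box l u) = (\<Prod>b\<in>Basis. (u - l) \<bullet> b)" .
qed simp

lemma LINT_reindex:
  fixes f :: "(real, 'n::finite) vec \<Rightarrow> real"
  assumes "compact K" "continuous_on K f"
  shows "(LINT x:K|lborel. f x) = (LINT y:reindex ` K|lborel. f (unindex y))"
proof -
  have c: "continuous_on A reindex" "continuous_on B unindex" for A :: "(real, 'n) vec set" and B
    using linear_reindex by (auto intro!: linear_continuous_on simp: linear_conv_bounded_linear)
  have [measurable]: "reindex \<in> borel_measurable (borel :: (real, 'n) vec measure)"
    by (intro borel_measurable_continuous_onI c)
  have "integrable lborel (\<lambda>y. indicator (reindex ` K) y *\<^sub>R f (unindex y))"
    by (intro borel_integrable_compact compact_continuous_image c assms
        continuous_on_compose2[OF assms(2) c(2)]) auto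
  then have m: "(\<lambda>y. indicator (reindex ` K) y *\<^sub>R f (unindex y)) \<in> borel_measurable borel"
    using borel_measurable_integrable by force
  have ind: "indicator (reindex ` K) (reindex x) = (indicator K x :: real)" for x
    by (auto simp: indicator_def) (metis unindex_reindex)
  have "(LINT y:reindex ` K|lborel. f (unindex y)) = (LINT y|distr lborel borel reindex. indicator (reindex ` K) y *\<^sub>R f (unindex y))"
    by (simp add: lborel_reindex set_lebesgue_integral_def)
  also have "\<dots> = (LINT x|lborel. indicator (reindex ` K) (reindex x) *\<^sub>R f (unindex (reindex x)))"
    by (rule integral_distr) (use m in auto)
  finally show ?thesis by (simp add: set_lebesgue_integral_def ind)
qed

text \<open>The determinant of the reindexed map, in the form in which the change of variables
  delivers it. It is evaluated only for rank one perturbations of the identity and for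
  scalings.\<close>

definition lin_det :: "((real, 'n::finite) vec \<Rightarrow> (real, 'n) vec) \<Rightarrow> real" where
  "lin_det g = det (matrix (\<lambda>y. reindex (g (unindex y))))"

lemma LINT_linear_image:
  fixes g :: "(real, 'n::finite) vec \<Rightarrow> (real, 'n) vec" and f :: "(real,'n) vec \<Rightarrow> real"
  assumes g: "linear g" and K: "compact K" "continuous_on (g ` K) f"
  shows "(LINT x:g ` K|lborel. f x) = \<bar>lin_det g\<bar> * (LINT x:K|lborel. f (g x))"
proof -
  have c: "continuous_on A unindex" "continuous_on C g" "continuous_on C reindex"
    for A :: "(real, 'n enum_index) vec set" and C
    using linear_reindex g by (auto intro!: linear_continuous_on simp: linear_conv_bounded_linear)
  let ?h = "\<lambda>y. reindex (g (unindex y))"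
  have l: "linear ?h"
    using linear_compose[OF linear_compose[OF linear_reindex(2) g] linear_reindex(1)] by (simp add: o_def)
  have img: "reindex ` g ` K = ?h ` reindex ` K" by (simp add: image_image)
  have gK: "compact (g ` K)" by (intro compact_continuous_image c K)
  have "(LINT x:g ` K|lborel. f x) = (LINT y:?h ` reindex ` K|lborel. f (unindex y))"
    unfolding LINT_reindex[OF gK K(2)] img ..
  also have "\<dots> = \<bar>lin_det g\<bar> * (LINT y:reindex ` K|lborel. f (unindex (?h y)))"
    unfolding lin_det_def
  proof (rule LINT_linear_image_wellorder[OF l])
    show "compact (reindex ` K)" by (intro compact_continuous_image c K)
    show "continuous_on (?h ` reindex ` K) (\<lambda>y. f (unindex y))"
      by (rule continuous_on_compose2[OF K(2) c(1)]) auto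
  qed
  also have "(LINT y:reindex ` K|lborel. f (unindex (?h y))) = (LINT x:K|lborel. f (g x))"
    by (subst (2) LINT_reindex) (auto intro: K continuous_on_compose2[OF K(2) c(2)])
  finally show ?thesis .
qed

lemma LINT_translation:
  fixes f :: "(real,'n::finite) vec \<Rightarrow> real"
  assumes "compact K" "continuous_on ((+) b ` K) f"
  shows "(LINT x:(+) b ` K|lborel. f x) = (LINT x:K|lborel. f (b + x))"
proof -
  have "compact ((+) b ` K)" using assms(1) by (rule compact_translation)
  from borel_integrable_compact[OF this assms(2)]
  have m: "(\<lambda>x. indicator ((+) b ` K) x *\<^sub>R f x) \<in> borel_measurable borel"
    using borel_measurable_integrable by force
  have "(LINT x:(+) b ` K|lborel. f x) = (LINT x|distr lborel borel ((+) b). indicator ((+) b ` K) x *\<^sub>R f x)"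
    by (simp add: lborel_distr_plus set_lebesgue_integral_def)
  also have "\<dots> = (LINT x|lborel. indicator ((+) b ` K) (b + x) *\<^sub>R f (b + x))"
    by (rule integral_distr) (use m in auto)
  also have "(\<lambda>x. indicator ((+) b ` K) (b + x) :: real) = indicator K"
    by (auto simp: indicator_def fun_eq_iff image_iff)
  finally show ?thesis by (simp add: set_lebesgue_integral_def)
qed

lemma LINT_affine_image:
  fixes g :: "(real, 'n::finite) vec \<Rightarrow> (real, 'n) vec" and f :: "(real,'n) vec \<Rightarrow> real"
  assumes g: "linear g" and K: "compact K" "continuous_on ((\<lambda>x. b + g x) ` K) f"
  shows "(LINT x:(\<lambda>x. b + g x) ` K|lborel. f x) = \<bar>lin_det g\<bar> * (LINT x:K|lborel. f (b + g x))"
proof -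
  have gK: "compact (g ` K)"
    using g by (intro compact_continuous_image K linear_continuous_on) (simp add: linear_conv_bounded_linear)
  have img: "(\<lambda>x. b + g x) ` K = (+) b ` g ` K" by (simp add: image_image)
  have "(LINT x:(+) b ` g ` K|lborel. f x) = (LINT x:g ` K|lborel. f (b + x))"
    by (rule LINT_translation[OF gK]) (use K(2) img in simp)
  also have "\<dots> = \<bar>lin_det g\<bar> * (LINT x:K|lborel. f (b + g x))"
    by (rule LINT_linear_image[OF g K(1)])
       (rule continuous_on_compose2[OF K(2)], auto intro!: continuous_intros)
  finally show ?thesis unfolding img .
qed

subsection \<open>Determinants of rank one perturbations\<close>

lemma det_axis_rows:
  fixes a :: "(real, 'm::finite) vec"
  assumes "finite K" "j \<notin> K"
  shows "det (\<chi> i. if i = j then a else if i \<in> K then axis i 1 + u i *s a else axis i 1) = a $ j"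
  using assms
proof (induction K rule: finite_induct)
  case empty
  have r: "row i (mat 1 :: real^'m^'m) = axis i 1" for i
    by (auto simp: row_def mat_def axis_def vec_eq_iff)
  have s: "(\<Sum>i\<in>UNIV. a $ i *s axis i 1) = a"
    by (auto simp: vec_eq_iff axis_def mult_if_zero)
  show ?case using cramer_lemma_transpose[of j a "mat 1"] unfolding r s by (simp cong: if_cong)
next
  case (insert l K)
  let ?A = "(\<chi> i. if i = j then a else if i \<in> K then axis i 1 + u i *s a else axis i 1) :: real^'m^'m"
  have "(\<chi> i. if i = j then a else if i \<in> insert l K then axis i 1 + u i *s a else axis i 1)
      = (\<chi> k. if k = l then row l ?A + u l *s row j ?A else row k ?A)"
    using insert by (auto simp: vec_eq_iff row_def)
  then show ?case using det_row_operation[of l j ?A "u l"] insert by auto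
qed

text \<open>The matrix determinant lemma det (I + u a^T) = 1 + a . u, restricted to the rows in K. A
  new row splits the determinant in two; in the part whose row is a multiple of a, the other
  multiples of a are cleared by row operations.\<close>

lemma det_rank_one_rows:
  fixes a :: "(real, 'm::finite) vec"
  assumes "finite K"
  shows "det (\<chi> i. if i \<in> K then axis i 1 + u i *s a else axis i 1) = 1 + (\<Sum>i\<in>K. u i * a $ i)"
  using assms
proof (induction K rule: finite_induct)
  case empty
  have "(\<chi> i. axis i 1) = (mat 1 :: real^'m^'m)" by (auto simp: vec_eq_iff mat_def axis_def)
  then show ?case by simp
next
  case (insert j K)
  let ?c = "\<lambda>i. if i \<in> K then axis i 1 + u i *s a else axis i 1"
  have "(\<chi> i. if i \<in> insert j K then axis i 1 + u i *s a else axis i 1)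
      = (\<chi> i. if i = j then axis i 1 + u i *s a else ?c i)"
    by (auto simp: vec_eq_iff)
  also have "det \<dots> = det (\<chi> i. if i = j then axis i 1 else ?c i) + det (\<chi> i. if i = j then u i *s a else ?c i)"
    by (rule det_row_add)
  also have "(\<chi> i. if i = j then axis i 1 else ?c i) = (\<chi> i. ?c i)"
    using insert by (auto simp: vec_eq_iff)
  also have "(\<chi> i. if i = j then u i *s a else ?c i) = (\<chi> i. if i = j then u j *s a else ?c i)"
    by (auto simp: vec_eq_iff)
  also have "det \<dots> = u j * det (\<chi> i. if i = j then a else ?c i)"
    by (rule det_row_mul)
  also have "det (\<chi> i. if i = j then a else ?c i) = a $ j" using insert by (intro det_axis_rows) auto
  finally show ?case using insert by simp
qed

lemma lin_det_rank_one: "lin_det (\<lambda>x. x + (a \<bullet> x) *\<^sub>R u) = 1 + a \<bullet> u"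
proof -
  let ?a = "reindex a" and ?u = "reindex u"
  have "reindex (unindex y + (a \<bullet> unindex y) *\<^sub>R u) = y + (?a \<bullet> y) *\<^sub>R ?u" for y
    using inner_reindex[of a "unindex y"] by (simp add: linear_add[OF linear_reindex(1)] linear_scale[OF linear_reindex(1)])
  then have "lin_det (\<lambda>x. x + (a \<bullet> x) *\<^sub>R u) = det (matrix (\<lambda>y. y + (?a \<bullet> y) *\<^sub>R ?u))"
    by (simp add: lin_det_def)
  also have "matrix (\<lambda>y. y + (?a \<bullet> y) *\<^sub>R ?u) = (\<chi> i. if i \<in> UNIV then axis i 1 + (?u $ i) *s ?a else axis i 1)"
    using inner_axis[of ?a _ 1] by (auto simp: matrix_def vec_eq_iff axis_def)
  also have "det \<dots> = 1 + (\<Sum>i\<in>UNIV. ?u $ i * ?a $ i)" by (rule det_rank_one_rows) simp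
  also have "(\<Sum>i\<in>UNIV. ?u $ i * ?a $ i) = ?a \<bullet> ?u" by (simp add: inner_vec_def mult.commute)
  finally show ?thesis by (simp add: inner_reindex)
qed

section \<open>Simplices and barycentric coordinates\<close>

lemma is_simplexD:
  assumes "is_simplex (S :: (real,'n::finite) vec set)"
  shows "finite S" "card S = CARD('n) + 1" "\<not> affine_dependent S" "S \<noteq> {}" "affine hull S = UNIV"
proof -
  show *: "finite S" "card S = CARD('n) + 1" "\<not> affine_dependent S" using assms by (auto simp: is_simplex_def)
  then show "S \<noteq> {}" by auto
  show "affine hull S = UNIV" by (rule affine_independent_span_eq) (use * in auto)
qed

lemma barycentric_unique:
  assumes S: "is_simplex S" and u: "sum u S = 1" "(\<Sum>v\<in>S. u v *\<^sub>R v) = x"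
    and w: "sum w S = 1" "(\<Sum>v\<in>S. w v *\<^sub>R v) = x" and "v \<in> S"
  shows "u v = w v"
proof (rule ccontr)
  assume n: "u v \<noteq> w v"
  have "sum (\<lambda>v. u v - w v) S = 0" "(\<Sum>v\<in>S. (u v - w v) *\<^sub>R v) = 0"
    using u w by (auto simp: sum_subtractf algebra_simps)
  then have "affine_dependent S"
    unfolding affine_dependent_explicit_finite[OF is_simplexD(1)[OF S]]
    using n \<open>v \<in> S\<close> by (intro exI[of _ "\<lambda>v. u v - w v"]) auto
  then show False using is_simplexD(3)[OF S] by simp
qed

lemma bary_exists1:
  assumes S: "is_simplex S"
  shows "\<exists>!u. (\<forall>v. v \<notin> S \<longrightarrow> u v = 0) \<and> sum u S = 1 \<and> (\<Sum>v\<in>S. u v *\<^sub>R v) = x"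
proof -
  have "x \<in> affine hull S" using is_simplexD(5)[OF S] by simp
  then obtain u where u: "sum u S = 1" "(\<Sum>v\<in>S. u v *\<^sub>R v) = x"
    unfolding affine_hull_finite[OF is_simplexD(1)[OF S]] by blast
  define u' where "u' v = (if v \<in> S then u v else 0)" for v
  have "sum u' S = sum u S" "(\<Sum>v\<in>S. u' v *\<^sub>R v) = (\<Sum>v\<in>S. u v *\<^sub>R v)"
    by (auto simp: u'_def intro!: sum.cong)
  then have u': "(\<forall>v. v \<notin> S \<longrightarrow> u' v = 0) \<and> sum u' S = 1 \<and> (\<Sum>v\<in>S. u' v *\<^sub>R v) = x"
    using u by (simp add: u'_def)
  show ?thesis
  proof (rule ex1I[of _ u'])
    fix w assume w: "(\<forall>v. v \<notin> S \<longrightarrow> w v = 0) \<and> sum w S = 1 \<and> (\<Sum>v\<in>S. w v *\<^sub>R v) = x"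
    show "w = u'"
    proof
      fix v show "w v = u' v"
        using barycentric_unique[OF S, of w x u' v] w u' by (cases "v \<in> S") auto
    qed
  qed (rule u')
qed

lemma bary_props:
  assumes "is_simplex S"
  shows "v \<notin> S \<Longrightarrow> bary S v x = 0" "(\<Sum>v\<in>S. bary S v x) = 1" "(\<Sum>v\<in>S. bary S v x *\<^sub>R v) = x"
  using theI'[OF bary_exists1[OF assms, of x]] unfolding bary_def by auto

lemma bary_unique:
  assumes "is_simplex S" "sum u S = 1" "(\<Sum>v\<in>S. u v *\<^sub>R v) = x" "v \<in> S"
  shows "bary S v x = u v"
  by (rule barycentric_unique[OF assms(1) bary_props(2,3)[OF assms(1)] assms(2-4)])

lemma bary_affine:
  assumes S: "is_simplex S" and c: "finite I" "sum c I = 1"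
  shows "bary S v (\<Sum>i\<in>I. c i *\<^sub>R y i) = (\<Sum>i\<in>I. c i * bary S v (y i))"
proof (cases "v \<in> S")
  case True
  have "(\<Sum>v\<in>S. \<Sum>i\<in>I. c i * bary S v (y i)) = (\<Sum>i\<in>I. c i * (\<Sum>v\<in>S. bary S v (y i)))"
    by (subst sum.swap) (simp add: sum_distrib_left)
  then have 1: "(\<Sum>v\<in>S. \<Sum>i\<in>I. c i * bary S v (y i)) = 1" using c by (simp add: bary_props[OF S])
  have "(\<Sum>v\<in>S. (\<Sum>i\<in>I. c i * bary S v (y i)) *\<^sub>R v) = (\<Sum>i\<in>I. c i *\<^sub>R (\<Sum>v\<in>S. bary S v (y i) *\<^sub>R v))"
    by (simp add: scaleR_sum_left scaleR_sum_right) (rule sum.swap)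
  then have "(\<Sum>v\<in>S. (\<Sum>i\<in>I. c i * bary S v (y i)) *\<^sub>R v) = (\<Sum>i\<in>I. c i *\<^sub>R y i)"
    by (simp add: bary_props[OF S])
  from bary_unique[OF S 1 this True] show ?thesis .
qed (simp add: bary_props[OF S])

lemma bary_affine2:
  assumes "is_simplex S"
  shows "bary S v (x + s *\<^sub>R (y - x)) = (1 - s) * bary S v x + s * bary S v y"
proof -
  have "x + s *\<^sub>R (y - x) = (\<Sum>i\<in>UNIV. (if i then 1 - s else s) *\<^sub>R (if i then x else y))"
    by (simp add: UNIV_bool algebra_simps)
  then show ?thesis
    using bary_affine[OF assms, of "UNIV :: bool set" "\<lambda>i. if i then 1 - s else s" v "\<lambda>i. if i then x else y"]
    by (simp add: UNIV_bool)
qed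

lemma bary_vertex:
  assumes "is_simplex S" "w \<in> S" "v \<in> S" shows "bary S v w = (if v = w then 1 else 0)"
proof (rule bary_unique[OF assms(1)])
  show "(\<Sum>v\<in>S. if v = w then 1 else 0 :: real) = 1" using assms is_simplexD(1)[OF assms(1)] by simp
  have "(\<Sum>v\<in>S. (if v = w then 1 else 0) *\<^sub>R v) = (\<Sum>v\<in>S. if v = w then v else 0)"
    by (intro sum.cong) auto
  then show "(\<Sum>v\<in>S. (if v = w then 1 else 0 :: real) *\<^sub>R v) = w" using assms is_simplexD(1)[OF assms(1)] by simp
qed fact

text \<open>The gradient of the barycentric coordinate of v. Unit increments give it because the
  coordinate is affine.\<close>

definition bgrad :: "(real,'n::finite) vec set \<Rightarrow> (real,'n) vec \<Rightarrow> (real,'n) vec" where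
  "bgrad S v = (\<chi> i. bary S v (axis i 1) - bary S v 0)"

lemma bary_linear:
  assumes "is_simplex S" shows "linear (\<lambda>x. bary S v x - bary S v 0)"
proof -
  have a: "bary S v (x + y) = bary S v x + bary S v y - bary S v 0" for x y
  proof -
    have "bary S v (0 + 2 *\<^sub>R ((x + (1/2) *\<^sub>R (y - x)) - 0)) = (1 - 2) * bary S v 0 + 2 * ((1 - 1/2) * bary S v x + 1/2 * bary S v y)"
      by (simp only: bary_affine2[OF assms])
    moreover have "0 + 2 *\<^sub>R ((x + (1/2) *\<^sub>R (y - x)) - 0) = x + y"
      by (simp add: scaleR_add_right scaleR_diff_right scaleR_2)
    ultimately show ?thesis by simp
  qed
  have s: "bary S v (c *\<^sub>R x) = (1 - c) * bary S v 0 + c * bary S v x" for c x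
    using bary_affine2[OF assms, of v 0 c x] by simp
  show ?thesis by (rule linearI) (simp_all add: a s algebra_simps)
qed

lemma bary_bgrad:
  assumes "is_simplex S" shows "bary S v x = bary S v 0 + bgrad S v \<bullet> x"
proof -
  note l = bary_linear[OF assms, of v]
  define f where "f x = bary S v x - bary S v 0" for x
  have lf: "linear f" unfolding f_def by (rule l)
  have e: "(\<Sum>i\<in>UNIV. x $ i *\<^sub>R axis i 1) = x"
    using basis_expansion[of x] by (simp add: scalar_mult_eq_scaleR)
  have "f x = f (\<Sum>i\<in>UNIV. x $ i *\<^sub>R axis i 1)" by (simp only: e)
  also have "\<dots> = (\<Sum>i\<in>UNIV. f (x $ i *\<^sub>R axis i 1))" by (rule linear_sum[OF lf])
  also have "\<dots> = (\<Sum>i\<in>UNIV. x $ i *\<^sub>R f (axis i 1))" by (simp only: linear_scale[OF lf])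
  also have "\<dots> = bgrad S v \<bullet> x" by (simp add: inner_vec_def bgrad_def f_def mult.commute)
  finally show ?thesis by (simp add: f_def)
qed

lemma bary_diff:
  assumes "is_simplex S" shows "bary S v y - bary S v x = bgrad S v \<bullet> (y - x)"
  using bary_bgrad[OF assms, of v x] bary_bgrad[OF assms, of v y] unfolding inner_diff_right by linarith

lemma bary_polys: assumes "is_simplex S" shows "bary S v \<in> polys 1"
proof -
  have "bary S v = (\<lambda>x. bary S v 0 + (\<Sum>i\<in>UNIV. bgrad S v $ i * x $ i))"
    by (rule ext, subst bary_bgrad[OF assms]) (simp add: inner_vec_def)
  also have "\<dots> \<in> polys 1" by (intro polys_add polys_sum polys_cmult polys_const polys_coord) auto
  finally show ?thesis .
qed

lemma bary_continuous: "is_simplex S \<Longrightarrow> continuous_on A (bary S v)"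
  using polys_continuous[OF bary_polys] .

lemma bgrad_sum: assumes "is_simplex S" shows "(\<Sum>v\<in>S. bgrad S v) = 0"
  by (simp add: vec_eq_iff bgrad_def sum_subtractf bary_props[OF assms])

text \<open>The linear part of the identity between x and the sum of the vertices weighted by its
  barycentric coordinates.\<close>

lemma bgrad_expand:
  assumes "is_simplex S" shows "(\<Sum>v\<in>S. (bgrad S v \<bullet> e) *\<^sub>R v) = e"
proof -
  have "bgrad S v \<bullet> e = bary S v e - bary S v 0" for v using bary_bgrad[OF assms, of v e] by linarith
  then show ?thesis by (simp add: scaleR_diff_left sum_subtractf bary_props[OF assms])
qed

lemma simplex_hull_iff:
  assumes "is_simplex S" shows "x \<in> convex hull S \<longleftrightarrow> (\<forall>v\<in>S. 0 \<le> bary S v x)"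
proof
  assume "x \<in> convex hull S"
  then obtain u where u: "\<forall>v\<in>S. 0 \<le> u v" "sum u S = 1" "(\<Sum>v\<in>S. u v *\<^sub>R v) = x"
    unfolding convex_hull_finite[OF is_simplexD(1)[OF assms]] mem_Collect_eq by (elim exE conjE)
  show "\<forall>v\<in>S. 0 \<le> bary S v x"
  proof
    fix v assume "v \<in> S"
    with u(1) bary_unique[OF assms u(2,3) this] show "0 \<le> bary S v x" by metis
  qed
next
  assume "\<forall>v\<in>S. 0 \<le> bary S v x"
  then show "x \<in> convex hull S" unfolding convex_hull_finite[OF is_simplexD(1)[OF assms]] mem_Collect_eq
    by (intro exI[of _ "\<lambda>v. bary S v x"] conjI bary_props(2,3)[OF assms])
qed

lemma simplex_face_iff:
  assumes S: "is_simplex S" and "F \<subseteq> S"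
  shows "x \<in> convex hull F \<longleftrightarrow> (\<forall>v\<in>S. 0 \<le> bary S v x) \<and> (\<forall>v\<in>S - F. bary S v x = 0)"
proof -
  have fin: "finite S" "finite F" using is_simplexD(1)[OF S] assms(2) finite_subset by auto
  show ?thesis
  proof
    assume "x \<in> convex hull F"
    then obtain u where u: "\<forall>v\<in>F. 0 \<le> u v" "sum u F = 1" "(\<Sum>v\<in>F. u v *\<^sub>R v) = x"
      unfolding convex_hull_finite[OF fin(2)] mem_Collect_eq by (elim exE conjE)
    define w where "w v = (if v \<in> F then u v else 0)" for v
    have "sum w S = sum u F" "(\<Sum>v\<in>S. w v *\<^sub>R v) = (\<Sum>v\<in>F. u v *\<^sub>R v)"
      using fin assms(2) by (auto simp: w_def intro!: sum.mono_neutral_cong_right)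
    then have w: "sum w S = 1" "(\<Sum>v\<in>S. w v *\<^sub>R v) = x" using u(2,3) by simp_all
    have "bary S v x = w v" if "v \<in> S" for v by (rule bary_unique[OF S w that])
    then show "(\<forall>v\<in>S. 0 \<le> bary S v x) \<and> (\<forall>v\<in>S - F. bary S v x = 0)" using u(1) by (simp add: w_def)
  next
    assume b: "(\<forall>v\<in>S. 0 \<le> bary S v x) \<and> (\<forall>v\<in>S - F. bary S v x = 0)"
    have "(\<Sum>v\<in>F. bary S v x) = (\<Sum>v\<in>S. bary S v x)" "(\<Sum>v\<in>F. bary S v x *\<^sub>R v) = (\<Sum>v\<in>S. bary S v x *\<^sub>R v)"
      using b fin assms(2) by (auto intro!: sum.mono_neutral_left)
    then have "sum (\<lambda>v. bary S v x) F = 1" "(\<Sum>v\<in>F. bary S v x *\<^sub>R v) = x"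
      using bary_props(2,3)[OF S, of x] by simp_all
    moreover have "\<forall>v\<in>F. 0 \<le> bary S v x" using b assms(2) by blast
    ultimately show "x \<in> convex hull F" unfolding convex_hull_finite[OF fin(2)] mem_Collect_eq
      by (intro exI[of _ "\<lambda>v. bary S v x"] conjI)
  qed
qed

lemma bary_le_1:
  assumes "is_simplex S" "x \<in> convex hull S" "v \<in> S" shows "bary S v x \<le> 1"
proof -
  have "bary S v x \<le> (\<Sum>v\<in>S. bary S v x)"
    by (rule member_le_sum) (use assms is_simplexD(1)[OF assms(1)] simplex_hull_iff[OF assms(1), of x] in auto)
  then show ?thesis by (simp add: bary_props[OF assms(1)])
qed

lemma simplex_compact: "is_simplex S \<Longrightarrow> compact (convex hull S)"
  by (simp add: finite_imp_compact_convex_hull is_simplexD(1))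

definition simplex_inner :: "(real,'n::finite) vec set \<Rightarrow> (real,'n) vec set" where
  "simplex_inner S = {x. \<forall>v\<in>S. 0 < bary S v x}"

lemma simplex_inner_open:
  assumes "is_simplex S" shows "open (simplex_inner S)"
proof -
  have "simplex_inner S = (\<Inter>v\<in>S. {x. 0 < bary S v x})" by (auto simp: simplex_inner_def)
  then show ?thesis
    using is_simplexD(1)[OF assms] bary_continuous[OF assms]
    by (auto intro!: open_INT open_Collect_less continuous_on_const)
qed

lemma simplex_inner_subset: "is_simplex S \<Longrightarrow> simplex_inner S \<subseteq> convex hull S"
  by (auto simp: simplex_inner_def simplex_hull_iff less_imp_le)

definition face_center :: "(real,'n::finite) vec set \<Rightarrow> (real,'n) vec" where
  "face_center F = (\<Sum>v\<in>F. (1 / real (card F)) *\<^sub>R v)"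

lemma bary_face_center:
  assumes "is_simplex S" "F \<subseteq> S" "F \<noteq> {}" "v \<in> S"
  shows "bary S v (face_center F) = (if v \<in> F then 1 / real (card F) else 0)"
proof (rule bary_unique[OF assms(1)])
  have fin: "finite F" "finite S" using assms is_simplexD(1) finite_subset by auto
  have "(\<Sum>v\<in>S. if v \<in> F then 1 / real (card F) else 0) = (\<Sum>v\<in>F. 1 / real (card F))"
    using fin assms(2) by (intro sum.mono_neutral_cong_right) auto
  then show "(\<Sum>v\<in>S. if v \<in> F then 1 / real (card F) else 0) = 1" using fin assms(3) by simp
  show "(\<Sum>v\<in>S. (if v \<in> F then 1 / real (card F) else 0) *\<^sub>R v) = face_center F"
    unfolding face_center_def using fin assms(2) by (intro sum.mono_neutral_cong_right) auto
qed fact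

lemma face_center_hull:
  assumes "is_simplex S" "F \<subseteq> S" "F \<noteq> {}" shows "face_center F \<in> convex hull F"
  using assms by (simp add: simplex_face_iff bary_face_center subset_iff)

lemma simplex_inner_center:
  assumes "is_simplex S" shows "face_center S \<in> simplex_inner S"
proof -
  have "card S > 0" using is_simplexD(2)[OF assms] by simp
  then show ?thesis using assms is_simplexD(4)[OF assms] by (simp add: simplex_inner_def bary_face_center)
qed

lemma simplex_inner_segment:
  assumes S: "is_simplex S" and "c \<in> simplex_inner S" "x \<in> convex hull S" "0 \<le> s" "s < 1"
  shows "c + s *\<^sub>R (x - c) \<in> simplex_inner S"
proof -
  have "0 < (1 - s) * bary S v c + s * bary S v x" if "v \<in> S" for v
    using assms that by (intro add_pos_nonneg mult_pos_pos mult_nonneg_nonneg)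
      (auto simp: simplex_inner_def simplex_hull_iff)
  then show ?thesis by (simp add: simplex_inner_def bary_affine2[OF S])
qed

lemma half_cancel: "0 < n \<Longrightarrow> e / (2 * n) * n = e / (2::real)"
  by simp

lemma simplex_inner_meets_ball:
  assumes S: "is_simplex S" and x: "x \<in> convex hull S" and "open U" "x \<in> U"
  shows "simplex_inner S \<inter> U \<noteq> {}"
proof -
  obtain e where e: "e > 0" "ball x e \<subseteq> U" using assms(3,4) open_contains_ball by blast
  define c where "c = face_center S"
  define t where "t = min (1/2) (e / (2 * (norm (c - x) + 1)))"
  have p: "norm (c - x) + 1 > 0" by (simp add: add_nonneg_pos)
  have t: "0 < t" "t \<le> 1/2" unfolding t_def using e p by (simp, intro min.cobounded1)
  have "t * norm (c - x) \<le> (e / (2 * (norm (c - x) + 1))) * (norm (c - x) + 1)"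
    using t by (intro mult_mono) (auto simp: t_def e p less_imp_le)
  also have "\<dots> = e / 2" using p by (rule half_cancel)
  also have "\<dots> < e" using e by simp
  finally have "dist x (c + (1 - t) *\<^sub>R (x - c)) < e"
  proof -
    assume a: "t * norm (c - x) < e"
    have "x - (c + (1 - t) *\<^sub>R (x - c)) = (- t) *\<^sub>R (c - x)" by (simp add: algebra_simps)
    then show ?thesis using a t by (simp add: dist_norm)
  qed
  then show ?thesis
    using simplex_inner_segment[OF S simplex_inner_center[OF S] x, of "1 - t"] t e(2)
    unfolding c_def[symmetric] by auto
qed

lemma simplex_interior: assumes "is_simplex S" shows "interior (convex hull S) = simplex_inner S"
proof
  show "simplex_inner S \<subseteq> interior (convex hull S)"
    by (rule interior_maximal[OF simplex_inner_subset[OF assms] simplex_inner_open[OF assms]])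
  show "interior (convex hull S) \<subseteq> simplex_inner S"
  proof
    fix x assume x: "x \<in> interior (convex hull S)"
    then obtain e where e: "e > 0" "ball x e \<subseteq> convex hull S" by (auto simp: mem_interior)
    have xS: "x \<in> convex hull S" using x interior_subset by blast
    show "x \<in> simplex_inner S"
    proof (rule ccontr)
      assume "x \<notin> simplex_inner S"
      then obtain v where v: "v \<in> S" "bary S v x = 0"
        using xS by (force simp: simplex_inner_def simplex_hull_iff[OF assms] not_less)
      \<comment> \<open>A step of this size from x away from v stays in the ball, but makes the
        coordinate of v negative, since that is 0 at x and 1 at v.\<close>
      define t where "t = e / (2 * (norm (v - x) + 1))"
      have p: "norm (v - x) + 1 > 0" by (simp add: add_nonneg_pos)
      have t: "t > 0" using e p by (simp add: t_def)
      have "t * norm (v - x) \<le> t * (norm (v - x) + 1)" using t by simp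
      also have "\<dots> = e / 2" unfolding t_def using p by (rule half_cancel)
      also have "\<dots> < e" using e by simp
      finally have "x + (- t) *\<^sub>R (v - x) \<in> ball x e" using t by (simp add: dist_norm)
      then have "0 \<le> bary S v (x + (- t) *\<^sub>R (v - x))"
        using e(2) v(1) simplex_hull_iff[OF assms] by blast
      then have "0 \<le> (1 - (- t)) * bary S v x + (- t) * bary S v v" by (simp only: bary_affine2[OF assms])
      then show False using t v by (simp add: bary_vertex[OF assms])
    qed
  qed
qed

subsection \<open>Integrals over a simplex\<close>

definition svol :: "(real,'n::finite) vec set \<Rightarrow> real" where
  "svol S = (LINT x:convex hull S|lborel. 1)"

text \<open>Averages instead of integrals: the Jacobian of an affine map cancels, so an inequality
  between averages carries over from the reference simplex with the same constant.\<close>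

definition savg :: "(real,'n::finite) vec set \<Rightarrow> ((real,'n) vec \<Rightarrow> real) \<Rightarrow> real" where
  "savg S f = (LINT x:convex hull S|lborel. f x) / svol S"

lemma simplex_integrable:
  fixes f :: "(real,'n::finite) vec \<Rightarrow> real"
  shows "is_simplex S \<Longrightarrow> continuous_on (convex hull S) f \<Longrightarrow> set_integrable lborel (convex hull S) f"
  by (rule set_integrable_compact[OF simplex_compact])

lemma svol_measure:
  assumes "is_simplex S" shows "svol S = measure lborel (convex hull S)"
    "emeasure lborel (convex hull S) = ennreal (svol S)"
proof -
  have m: "convex hull S \<in> sets lborel" using simplex_compact[OF assms] by (simp add: borel_compact)
  have f: "emeasure lborel (convex hull S) < \<infinity>" using simplex_compact[OF assms] by (rule emeasure_compact_finite)
  show "svol S = measure lborel (convex hull S)"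
    unfolding svol_def set_lebesgue_integral_def using m f by simp
  then show "emeasure lborel (convex hull S) = ennreal (svol S)" using f by (simp add: emeasure_eq_ennreal_measure)
qed

lemma svol_pos: assumes "is_simplex S" shows "0 < svol S"
proof (rule ccontr)
  assume "\<not> 0 < svol S"
  then have "emeasure lborel (convex hull S) = 0" by (simp add: svol_measure(2)[OF assms] ennreal_neg)
  then have "emeasure lborel (simplex_inner S) = 0"
    using simplex_inner_subset[OF assms] simplex_compact[OF assms] emeasure_mono[of "simplex_inner S" "convex hull S" lborel]
    by (simp add: borel_compact)
  moreover have "simplex_inner S \<in> sets borel" using simplex_inner_open[OF assms] by simp
  ultimately have "negligible (simplex_inner S)"
    by (simp add: negligible_iff_null_sets null_sets_completionI null_setsI)
  then show False
    using open_not_negligible[OF simplex_inner_open[OF assms]] simplex_inner_center[OF assms] by blast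
qed

lemma LINT_nonneg_zero:
  fixes f :: "(real,'n::finite) vec \<Rightarrow> real"
  assumes S: "is_simplex S" and f: "continuous_on UNIV f" "\<And>x. x \<in> convex hull S \<Longrightarrow> 0 \<le> f x"
    and z: "(LINT x:convex hull S|lborel. f x) = 0" and x: "x \<in> simplex_inner S"
  shows "f x = 0"
proof (rule ccontr)
  assume "f x \<noteq> 0"
  let ?K = "convex hull S"
  define U where "U = simplex_inner S \<inter> {x. 0 < f x}"
  have U: "open U" unfolding U_def
    by (intro open_Int simplex_inner_open[OF S] open_Collect_less f continuous_on_const)
  have xU: "x \<in> U" using x f(2)[of x] \<open>f x \<noteq> 0\<close> simplex_inner_subset[OF S] by (auto simp: U_def less_le)
  have "integrable lborel (\<lambda>x. indicator ?K x * f x)"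
    using simplex_integrable[OF S continuous_on_subset[OF f(1)]] by (simp add: set_integrable_def)
  moreover have "(LINT x|lborel. indicator ?K x * f x) = 0" using z by (simp add: set_lebesgue_integral_def)
  ultimately have AE: "AE x in lborel. indicator ?K x * f x = 0"
    using f(2) by (subst (asm) integral_nonneg_eq_0_iff_AE) (auto simp: indicator_def)
  have "AE x in lborel. x \<notin> U"
    by (rule eventually_mono[OF AE])
       (use simplex_inner_subset[OF S] in \<open>auto simp: U_def indicator_def split: if_splits\<close>)
  then have "U \<in> null_sets lborel" using U by (simp add: AE_iff_null_sets)
  then have "negligible U" by (simp add: negligible_iff_null_sets null_sets_completionI)
  then show False using open_not_negligible[OF U] xU by blast
qed

subsection \<open>Affine maps between simplices\<close>

text \<open>The affine map determined by the images of the vertices.\<close>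

definition smap :: "(real,'n::finite) vec set \<Rightarrow> ((real,'n) vec \<Rightarrow> (real,'n) vec) \<Rightarrow> (real,'n) vec \<Rightarrow> (real,'n) vec" where
  "smap S e x = (\<Sum>v\<in>S. bary S v x *\<^sub>R e v)"

lemma bary_smap:
  assumes S: "is_simplex S" "is_simplex S'" and e: "bij_betw e S S'" and v: "v \<in> S"
  shows "bary S' (e v) (smap S e x) = bary S v x"
proof -
  have inv: "the_inv_into S e (e w) = w" if "w \<in> S" for w
    using e that by (simp add: bij_betw_def the_inv_into_f_f)
  have "bary S' (e v) (smap S e x) = bary S (the_inv_into S e (e v)) x"
  proof (rule bary_unique[OF S(2)])
    have "(\<Sum>w\<in>S'. bary S (the_inv_into S e w) x) = (\<Sum>w\<in>S. bary S (the_inv_into S e (e w)) x)"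
      by (rule sum.reindex_bij_betw[OF e, symmetric])
    also have "\<dots> = (\<Sum>w\<in>S. bary S w x)" by (intro sum.cong) (auto simp: inv)
    finally show "(\<Sum>w\<in>S'. bary S (the_inv_into S e w) x) = 1" by (simp add: bary_props[OF S(1)])
    have "(\<Sum>w\<in>S'. bary S (the_inv_into S e w) x *\<^sub>R w) = (\<Sum>w\<in>S. bary S (the_inv_into S e (e w)) x *\<^sub>R e w)"
      by (rule sum.reindex_bij_betw[OF e, symmetric])
    then show "(\<Sum>w\<in>S'. bary S (the_inv_into S e w) x *\<^sub>R w) = smap S e x"
      unfolding smap_def by (auto simp: inv)
    show "e v \<in> S'" using e v by (auto simp: bij_betw_def)
  qed
  then show ?thesis using inv[OF v] by simp
qed

lemma smap_vertex: assumes "is_simplex S" "v \<in> S" shows "smap S e v = e v"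
proof -
  have "smap S e v = (\<Sum>w\<in>S. if w = v then e v else 0)"
    unfolding smap_def by (intro sum.cong) (auto simp: bary_vertex assms)
  then show ?thesis using assms is_simplexD(1)[OF assms(1)] by simp
qed

lemma smap_affine2:
  assumes "is_simplex S"
  shows "smap S e (x + s *\<^sub>R (y - x)) = smap S e x + s *\<^sub>R (smap S e y - smap S e x)"
  unfolding smap_def bary_affine2[OF assms]
  by (simp add: scaleR_add_left scaleR_diff_left sum.distrib sum_subtractf scaleR_sum_right algebra_simps)

lemma smap_polys: "is_simplex S \<Longrightarrow> (\<lambda>x. smap S e x $ i) \<in> polys 1"
  by (auto simp: smap_def intro!: polys_sum polys_multc bary_polys)

lemma smap_decompose:
  assumes "is_simplex S"
  shows "smap S e x = smap S e 0 + (\<Sum>v\<in>S. (bgrad S v \<bullet> x) *\<^sub>R e v)"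
  unfolding smap_def bary_bgrad[OF assms, where x=x] by (simp add: scaleR_add_left sum.distrib)

lemma linear_smap_part: "linear (\<lambda>x. \<Sum>v\<in>S. (bgrad S v \<bullet> x) *\<^sub>R e v)"
  by (rule linearI) (simp_all add: inner_add_right scaleR_add_left sum.distrib scaleR_sum_right)

lemma smap_hull:
  assumes S: "is_simplex S" "is_simplex S'" and e: "bij_betw e S S'"
  shows "smap S e ` (convex hull S) = convex hull S'"
proof
  show "smap S e ` (convex hull S) \<subseteq> convex hull S'"
  proof safe
    fix x assume x: "x \<in> convex hull S"
    have "0 \<le> bary S' w (smap S e x)" if w: "w \<in> S'" for w
    proof -
      obtain v where "v \<in> S" "w = e v" using e w by (auto simp: bij_betw_def)
      then show ?thesis using bary_smap[OF S e] x simplex_hull_iff[OF S(1)] by auto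
    qed
    then show "smap S e x \<in> convex hull S'" by (simp add: simplex_hull_iff[OF S(2)])
  qed
  show "convex hull S' \<subseteq> smap S e ` (convex hull S)"
  proof
    fix y assume y: "y \<in> convex hull S'"
    define x where "x = (\<Sum>v\<in>S. bary S' (e v) y *\<^sub>R v)"
    have s: "(\<Sum>v\<in>S. bary S' (e v) y) = 1"
      using sum.reindex_bij_betw[OF e, of "\<lambda>w. bary S' w y"] by (simp add: bary_props[OF S(2)])
    have b: "bary S v x = bary S' (e v) y" if "v \<in> S" for v
      by (rule bary_unique[OF S(1) s x_def[symmetric] that])
    have "smap S e x = (\<Sum>v\<in>S. bary S' (e v) y *\<^sub>R e v)" unfolding smap_def by (intro sum.cong) (auto simp: b)
    also have "\<dots> = y" using sum.reindex_bij_betw[OF e, of "\<lambda>w. bary S' w y *\<^sub>R w"] by (simp add: bary_props[OF S(2)])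
    finally have "y = smap S e x" by simp
    moreover have "x \<in> convex hull S"
      using y e unfolding simplex_hull_iff[OF S(1)] simplex_hull_iff[OF S(2)] by (auto simp: b bij_betw_def)
    ultimately show "y \<in> smap S e ` (convex hull S)" by blast
  qed
qed

lemma LINT_smap:
  fixes f :: "(real,'n::finite) vec \<Rightarrow> real"
  assumes S: "is_simplex S" "is_simplex S'" and e: "bij_betw e S S'" and f: "continuous_on (convex hull S') f"
  shows "(LINT y:convex hull S'|lborel. f y) =
     \<bar>lin_det (\<lambda>x. \<Sum>v\<in>S. (bgrad S v \<bullet> x) *\<^sub>R e v)\<bar> * (LINT x:convex hull S|lborel. f (smap S e x))"
proof -
  let ?g = "\<lambda>x. \<Sum>v\<in>S. (bgrad S v \<bullet> x) *\<^sub>R e v"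
  have eq: "smap S e = (\<lambda>x. smap S e 0 + ?g x)" using smap_decompose[OF S(1)] by (rule ext)
  have img: "(\<lambda>x. smap S e 0 + ?g x) ` (convex hull S) = convex hull S'"
    using smap_hull[OF S e] eq by metis
  have "(LINT y:(\<lambda>x. smap S e 0 + ?g x) ` (convex hull S)|lborel. f y)
      = \<bar>lin_det ?g\<bar> * (LINT x:convex hull S|lborel. f (smap S e 0 + ?g x))"
    by (rule LINT_affine_image[OF linear_smap_part simplex_compact[OF S(1)]]) (use f img in simp)
  then show ?thesis unfolding img using eq by metis
qed

lemma savg_smap:
  fixes f :: "(real,'n::finite) vec \<Rightarrow> real"
  assumes S: "is_simplex S" "is_simplex S'" and e: "bij_betw e S S'" and f: "continuous_on (convex hull S') f"
  shows "savg S' f = savg S (\<lambda>x. f (smap S e x))"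
proof -
  let ?d = "\<bar>lin_det (\<lambda>x. \<Sum>v\<in>S. (bgrad S v \<bullet> x) *\<^sub>R e v)\<bar>"
  have "svol S' = ?d * svol S" unfolding svol_def by (rule LINT_smap[OF S e]) (rule continuous_on_const)
  then show ?thesis using svol_pos[OF S(2)] LINT_smap[OF S e f] by (auto simp: savg_def)
qed

text \<open>Exchanging v for v' moves x by its coordinate of v times v' - v. This map fixes F
  pointwise and is, up to a translation, a rank one perturbation of the identity, whose determinant
  is the coordinate of v at v'.\<close>

lemma svol_neighbour:
  assumes S: "is_simplex (insert v F)" "is_simplex (insert v' F)" and v: "v \<notin> F" "v' \<notin> F"
  shows "svol (insert v' F) = \<bar>bary (insert v F) v v'\<bar> * svol (insert v F)"
    and "smap (insert v F) (id(v := v')) x = x + bary (insert v F) v x *\<^sub>R (v' - v)"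
    and "bij_betw (id(v := v')) (insert v F) (insert v' F)"
proof -
  let ?S = "insert v F" and ?e = "id(v := v')"
  show b: "bij_betw ?e ?S (insert v' F)"
    using v by (auto simp: bij_betw_def inj_on_def image_def split: if_splits)
  have g: "(\<Sum>w\<in>?S. c w *\<^sub>R ?e w) = (\<Sum>w\<in>?S. c w *\<^sub>R w) + c v *\<^sub>R (v' - v)" for c :: "_ \<Rightarrow> real"
  proof -
    have fin: "finite F" using is_simplexD(1)[OF S(1)] by simp
    have "(\<Sum>w\<in>F. c w *\<^sub>R ?e w) = (\<Sum>w\<in>F. c w *\<^sub>R w)" using v by (intro sum.cong) auto
    then show ?thesis using fin v by (simp add: algebra_simps)
  qed
  show "smap ?S ?e x = x + bary ?S v x *\<^sub>R (v' - v)"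
    unfolding smap_def g by (simp add: bary_props[OF S(1)])
  have "(\<lambda>x. \<Sum>w\<in>?S. (bgrad ?S w \<bullet> x) *\<^sub>R ?e w) = (\<lambda>x. x + (bgrad ?S v \<bullet> x) *\<^sub>R (v' - v))"
    unfolding g by (simp add: bgrad_expand[OF S(1)])
  then have "lin_det (\<lambda>x. \<Sum>w\<in>?S. (bgrad ?S w \<bullet> x) *\<^sub>R ?e w) = 1 + bgrad ?S v \<bullet> (v' - v)"
    by (simp only: lin_det_rank_one)
  also have "\<dots> = bary ?S v v'" using bary_diff[OF S(1), of v v' v] bary_vertex[OF S(1), of v v] by simp
  finally show "svol (insert v' F) = \<bar>bary ?S v v'\<bar> * svol ?S"
    using LINT_smap[OF S b continuous_on_const[of _ 1]] unfolding svol_def by simp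
qed

subsection \<open>The reference simplex\<close>

definition ref_simplex :: "(real,'n::finite) vec set" where
  "ref_simplex = insert 0 (range (\<lambda>i. axis i 1))"

lemma ref_simplex: "is_simplex (ref_simplex :: (real,'n::finite) vec set)"
proof -
  have B: "(Basis :: (real,'n) vec set) = range (\<lambda>i. axis i 1)" by (auto simp: Basis_vec_def)
  have z: "(0 :: (real,'n) vec) \<notin> Basis" by (rule Basis_zero)
  have "\<not> affine_dependent (insert 0 (Basis :: (real,'n) vec set))"
    using independent_Basis affine_dependent_iff_dependent[OF z] by simp
  moreover have "card (insert 0 (Basis :: (real,'n) vec set)) = CARD('n) + 1" using z by simp
  ultimately show ?thesis unfolding is_simplex_def ref_simplex_def B[symmetric] by simp
qed

lemma ref_simplex_bij:
  fixes S :: "(real,'n::finite) vec set"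
  assumes "is_simplex S" "v \<in> S"
  obtains e :: "(real,'n) vec \<Rightarrow> (real,'n) vec" where "bij_betw e ref_simplex S" "e 0 = v"
proof -
  let ?R = "ref_simplex :: (real,'n) vec set"
  have z: "0 \<in> ?R" by (simp add: ref_simplex_def)
  have R: "is_simplex ?R" by (rule ref_simplex)
  have fin: "finite (?R - {0})" "finite (S - {v})" using is_simplexD(1)[OF R] is_simplexD(1)[OF assms(1)] by auto
  have cd: "card (?R - {0}) = card (S - {v})"
    using is_simplexD(1,2)[OF R] is_simplexD(1,2)[OF assms(1)] assms(2) z by (simp add: card_Diff_singleton)
  obtain e where e: "bij_betw e (?R - {0}) (S - {v})" using finite_same_card_bij[OF fin cd] by blast
  have "bij_betw (e(0 := v)) (?R - {0}) (S - {v})"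
    using e by (subst bij_betw_cong[of _ _ e]) auto
  then have "bij_betw (e(0 := v)) ((?R - {0}) \<union> {0}) ((S - {v}) \<union> {(e(0 := v)) 0})"
    by (intro notIn_Un_bij_betw) auto
  moreover have "(?R - {0}) \<union> {0} = ?R" "(S - {v}) \<union> {(e(0 := v)) 0} = S" using z assms(2) by auto
  ultimately show ?thesis using that[of "e(0 := v)"] by simp
qed

subsection \<open>Radial derivatives\<close>

text \<open>For polynomials this is the gradient times x - v. Defined along the ray from v, it
  commutes with affine maps by mere unfolding, without a chain rule for gradients.\<close>

definition rad :: "(real,'n::finite) vec \<Rightarrow> ((real,'n) vec \<Rightarrow> real) \<Rightarrow> (real,'n) vec \<Rightarrow> real" where
  "rad v p x = deriv (\<lambda>s. p (v + s *\<^sub>R (x - v))) 1"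

lemma rad_has_derivative:
  assumes "p \<in> polys m"
  shows "((\<lambda>s. p (v + s *\<^sub>R (x - v))) has_real_derivative pgrad p (v + s *\<^sub>R (x - v)) \<bullet> (x - v)) (at s)"
proof -
  have "((\<lambda>s. v + s *\<^sub>R (x - v)) has_derivative (\<lambda>h. h *\<^sub>R (x - v))) (at s)"
    by (auto intro!: derivative_eq_intros)
  from has_derivative_compose[OF this polys_gradient(2)[OF assms]]
  show ?thesis by (simp add: has_field_derivative_def mult_commute_abs)
qed

lemma rad_polys_eq: "p \<in> polys m \<Longrightarrow> rad v p x = pgrad p x \<bullet> (x - v)"
  using DERIV_imp_deriv[OF rad_has_derivative[of p m v x 1]] by (simp add: rad_def)

lemma rad_polys: assumes "p \<in> polys m" shows "rad v p \<in> polys m"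
proof -
  have "rad v p = (\<lambda>x. pgrad p x \<bullet> (x - v))" using rad_polys_eq[OF assms] by (rule ext)
  also have "\<dots> \<in> polys m"
    by (rule polys_inner[OF polys_gradient(1)[OF assms] vpolys_diff[OF vpolys_id vpolys_const]]) auto
  finally show ?thesis .
qed

lemma rad_smap:
  assumes "is_simplex S" "v \<in> S" shows "rad (e v) p (smap S e x) = rad v (\<lambda>x. p (smap S e x)) x"
  unfolding rad_def smap_affine2[OF assms(1)] smap_vertex[OF assms] ..

lemma rad_add: "p \<in> polys m \<Longrightarrow> q \<in> polys m \<Longrightarrow> rad v (\<lambda>x. p x + q x) x = rad v p x + rad v q x"
  unfolding rad_def by (rule deriv_add[THEN trans])
    (auto simp: real_differentiable_def field_differentiable_def intro: rad_has_derivative)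

lemma rad_cmult: "p \<in> polys m \<Longrightarrow> rad v (\<lambda>x. c * p x) x = c * rad v p x"
  unfolding rad_def by (rule deriv_cmult) (auto simp: field_differentiable_def intro: rad_has_derivative)

section \<open>Divergence theorem on a simplex\<close>

abbreviation sint :: "(real,'n::finite) vec set \<Rightarrow> ((real,'n) vec \<Rightarrow> real) \<Rightarrow> real" where
  "sint S f \<equiv> set_lebesgue_integral lborel (convex hull S) f"

lemma sint_integrable:
  "is_simplex S \<Longrightarrow> continuous_on UNIV f \<Longrightarrow> set_integrable lborel (convex hull S) f"
  for f :: "(real,'n::finite) vec \<Rightarrow> real"
  using simplex_integrable continuous_on_subset by blast

lemma sint_add:
  assumes "is_simplex S" "continuous_on UNIV f" "continuous_on UNIV g"
  shows "sint S (\<lambda>x. f x + g x) = sint S f + sint S g"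
  by (rule set_integral_add(2)[OF sint_integrable[OF assms(1,2)] sint_integrable[OF assms(1,3)]])

lemma sint_diff:
  assumes "is_simplex S" "continuous_on UNIV f" "continuous_on UNIV g"
  shows "sint S (\<lambda>x. f x - g x) = sint S f - sint S g"
  by (rule set_integral_diff(2)[OF sint_integrable[OF assms(1,2)] sint_integrable[OF assms(1,3)]])

lemma sint_sum:
  assumes "is_simplex S" "\<And>i. i \<in> I \<Longrightarrow> continuous_on UNIV (f i)"
  shows "sint S (\<lambda>x. \<Sum>i\<in>I. f i x) = (\<Sum>i\<in>I. sint S (f i))"
  using assms(2)
proof (induction I rule: infinite_finite_induct)
  case (insert i I)
  then have "sint S (\<lambda>x. f i x + (\<Sum>i\<in>I. f i x)) = sint S (f i) + sint S (\<lambda>x. \<Sum>i\<in>I. f i x)"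
    by (intro sint_add[OF assms(1)] continuous_on_sum) auto
  then show ?case using insert by simp
qed (auto simp: set_lebesgue_integral_def)

lemma sint_cong:
  assumes "is_simplex S" "\<And>x. x \<in> convex hull S \<Longrightarrow> f x = g x"
  shows "sint S f = sint S g"
proof (rule set_lebesgue_integral_cong)
  show "convex hull S \<in> sets lborel" using simplex_compact[OF assms(1)] by (simp add: borel_compact)
qed (use assms(2) in auto)

lemma sint_mono:
  assumes "is_simplex S" "continuous_on UNIV f" "continuous_on UNIV g"
    "\<And>x. x \<in> convex hull S \<Longrightarrow> f x \<le> g x"
  shows "sint S f \<le> sint S g"
  by (rule set_integral_mono[OF sint_integrable[OF assms(1,2)] sint_integrable[OF assms(1,3)] assms(4)])

lemma sint_const:
  assumes "is_simplex S" shows "sint S (\<lambda>_. c) = c * svol S"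
  using set_integral_mult_right[of lborel "convex hull S" c "\<lambda>_. 1"] by (simp add: svol_def)

lemma sint_nonneg:
  assumes "is_simplex S" "continuous_on UNIV f" "\<And>x. x \<in> convex hull S \<Longrightarrow> 0 \<le> f x"
  shows "0 \<le> sint S f"
  using sint_mono[OF assms(1) continuous_on_const[of _ 0] assms(2)] assms(3) sint_const[OF assms(1), of 0] by simp

lemma sint_abs_le:
  assumes S: "is_simplex S" and f: "continuous_on UNIV f" "continuous_on UNIV g"
    and b: "\<And>x. x \<in> convex hull S \<Longrightarrow> \<bar>f x\<bar> \<le> g x"
  shows "\<bar>sint S f\<bar> \<le> sint S g"
proof -
  have "sint S f \<le> sint S g" by (rule sint_mono[OF S f]) (use b in force)
  moreover have "sint S (\<lambda>x. - f x) \<le> sint S g"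
    by (rule sint_mono[OF S _ f(2)]) (use b f in \<open>force intro: continuous_intros\<close>)+
  moreover have "sint S (\<lambda>x. - f x) = - sint S f" using set_integral_mult_right[of lborel _ "-1" f] by simp
  ultimately show ?thesis by simp
qed

lemma sint_Cauchy_Schwarz:
  assumes S: "is_simplex S" and f: "continuous_on UNIV f" "continuous_on UNIV g"
  shows "(sint S (\<lambda>x. f x * g x))\<^sup>2 \<le> sint S (\<lambda>x. (f x)\<^sup>2) * sint S (\<lambda>x. (g x)\<^sup>2)"
proof -
  let ?A = "sint S (\<lambda>x. (f x)\<^sup>2)" and ?B = "sint S (\<lambda>x. f x * g x)" and ?C = "sint S (\<lambda>x. (g x)\<^sup>2)"
  have q: "0 \<le> a\<^sup>2 * ?A + 2 * a * b * ?B + b\<^sup>2 * ?C" for a b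
  proof -
    have "0 \<le> sint S (\<lambda>x. (a * f x + b * g x)\<^sup>2)"
      by (rule sint_nonneg[OF S]) (intro continuous_intros f, simp)
    also have "(\<lambda>x. (a * f x + b * g x)\<^sup>2) = (\<lambda>x. (a\<^sup>2 * (f x)\<^sup>2 + (2 * a * b) * (f x * g x)) + b\<^sup>2 * (g x)\<^sup>2)"
      by (auto simp: power2_eq_square algebra_simps)
    also have "sint S \<dots> = a\<^sup>2 * ?A + 2 * a * b * ?B + b\<^sup>2 * ?C"
      by (subst sint_add[OF S], intro continuous_intros f, intro continuous_intros f,
          subst sint_add[OF S], intro continuous_intros f, intro continuous_intros f) simp
    finally show ?thesis .
  qed
  have AC: "0 \<le> ?A" "0 \<le> ?C" by (auto intro!: sint_nonneg[OF S] continuous_intros f)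
  show ?thesis
  proof (cases "?C = 0")
    case True
    have "?B = 0"
    proof (rule ccontr)
      assume n: "?B \<noteq> 0"
      have "0 \<le> 1\<^sup>2 * ?A + 2 * 1 * (- (?A + 1) / (2 * ?B)) * ?B + (- (?A + 1) / (2 * ?B))\<^sup>2 * ?C" by (rule q)
      also have "\<dots> = -1" using n True by (simp add: field_simps)
      finally show False by simp
    qed
    then show ?thesis using True by simp
  next
    case False
    have "0 \<le> ?C\<^sup>2 * ?A + 2 * ?C * (- ?B) * ?B + (- ?B)\<^sup>2 * ?C" by (rule q)
    also have "\<dots> = ?C * (?A * ?C - ?B\<^sup>2)" by (simp add: power2_eq_square algebra_simps)
    finally show ?thesis using False AC by (simp add: zero_le_mult_iff)
  qed
qed

subsection \<open>The flux functional of a facet\<close>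

text \<open>The integrand is the divergence of g (x - v). That field is tangential to the facets
  through v and x - v has a constant normal component on the opposite one, so the value is a fixed
  multiple of the surface integral of g over the facet opposite v. It replaces surface integrals
  throughout.\<close>

definition facet_flux :: "(real,'n::finite) vec set \<Rightarrow> (real,'n) vec \<Rightarrow> ((real,'n) vec \<Rightarrow> real) \<Rightarrow> real" where
  "facet_flux S v g = sint S (\<lambda>x. real CARD('n) * g x + rad v g x)"

lemma flux_continuous:
  assumes "g \<in> polys m" shows "continuous_on A (\<lambda>x. c * g x + rad v g x)"
  by (intro continuous_intros polys_continuous[OF assms] polys_continuous[OF rad_polys[OF assms]])

lemma facet_flux_add:
  assumes "is_simplex S" "g \<in> polys m" "h \<in> polys m"
  shows "facet_flux S v (\<lambda>x. g x + h x) = facet_flux S v g + facet_flux S v h"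
  unfolding facet_flux_def sint_add[OF assms(1) flux_continuous[OF assms(2)] flux_continuous[OF assms(3)], symmetric]
  by (simp add: rad_add[OF assms(2,3)] algebra_simps)

lemma facet_flux_cmult:
  assumes "g \<in> polys m"
  shows "facet_flux S v (\<lambda>x. c * g x) = c * facet_flux S v g"
  unfolding facet_flux_def set_integral_mult_right[symmetric]
  by (simp add: rad_cmult[OF assms] algebra_simps)

lemma lin_det_scale: "lin_det (\<lambda>x :: (real,'n::finite) vec. s *\<^sub>R x) = s ^ CARD('n)"
proof -
  have "(\<lambda>y. reindex (s *\<^sub>R (unindex y :: (real,'n) vec))) = (\<lambda>y. s *\<^sub>R y)"
    by (simp add: linear_scale[OF linear_reindex(1)])
  then show ?thesis unfolding lin_det_def by (simp add: CARD_enum_index)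
qed

lemma sint_scaled:
  fixes f :: "(real,'n::finite) vec \<Rightarrow> real"
  assumes S: "is_simplex S" and f: "continuous_on UNIV f"
  shows "(LINT x:(\<lambda>x. v + s *\<^sub>R (x - v)) ` (convex hull S)|lborel. f x)
       = \<bar>s\<bar> ^ CARD('n) * sint S (\<lambda>x. f (v + s *\<^sub>R (x - v)))"
proof -
  have eq: "v + s *\<^sub>R (x - v) = (v - s *\<^sub>R v) + s *\<^sub>R x" for x by (simp add: algebra_simps)
  have "linear (\<lambda>x :: (real,'n) vec. s *\<^sub>R x)" by (rule linearI) (auto simp: algebra_simps)
  from LINT_affine_image[OF this simplex_compact[OF S] continuous_on_subset[OF f], of "v - s *\<^sub>R v"]
  show ?thesis unfolding eq by (simp add: lin_det_scale power_abs)
qed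

text \<open>The field \<open>\<lambda>\<^sub>v g (x - v)\<close> has no flux. The integral over the simplex shrunk by the factor s
  towards v is a polynomial in s whose derivative at 1 is the claimed integral, and the part cut off
  has volume O(1 - s) while the integrand is O(1 - s) there.\<close>

lemma facet_flux_bary_mult:
  fixes S :: "(real,'n::finite) vec set"
  assumes S: "is_simplex S" and v: "v \<in> S" and g: "g \<in> polys (int n)"
  shows "facet_flux S v (\<lambda>x. bary S v x * g x) = 0"
proof -
  let ?d = "CARD('n)" and ?K = "convex hull S"
  define G where "G x = bary S v x * g x" for x
  have Gp: "G \<in> polys (int (Suc n))" unfolding G_def
    using polys_mult[OF bary_polys[OF S, of v] g] by (simp add: add.commute)
  \<comment> \<open>Homogeneous parts about v: a contraction towards v multiplies the j-th part by
    \<open>s ^ j\<close>, which makes the integrals over shrunk simplices polynomials in s.\<close>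
  obtain H where H: "\<And>j. j \<le> Suc n \<Longrightarrow> H j \<in> polys (int j)" "\<And>j s y. H j (s *\<^sub>R y) = s ^ j * H j y"
     "\<And>y. G (v + y) = (\<Sum>j\<le>Suc n. H j y)"
    using polys_homogeneous_parts[OF polys_shift[OF Gp, of v]] by blast
  define J where "J j = sint S (\<lambda>x. H j (x - v))" for j
  have cH: "continuous_on A (\<lambda>x. H j (x - v))" if "j \<le> Suc n" for A j
    by (rule polys_continuous[OF polys_compose[OF H(1)[OF that]]]) (auto intro!: polys_diff polys_coord polys_const)
  have cG: "continuous_on A G" for A by (rule polys_continuous[OF Gp])
  have expand: "G (v + s *\<^sub>R (x - v)) = (\<Sum>j\<le>Suc n. s ^ j * H j (x - v))" for s x
    using H(3)[of "s *\<^sub>R (x - v)"] H(2) by simp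
  define \<Phi> where "\<Phi> s = s ^ ?d * sint S (\<lambda>x. G (v + s *\<^sub>R (x - v)))" for s
  have \<Phi>: "\<Phi> s = (\<Sum>j\<le>Suc n. J j * s ^ (?d + j))" for s
  proof -
    have "sint S (\<lambda>x. G (v + s *\<^sub>R (x - v))) = (\<Sum>j\<le>Suc n. s ^ j * J j)"
      unfolding expand J_def by (subst sint_sum[OF S]) (auto intro!: continuous_intros cH)
    then show ?thesis unfolding \<Phi>_def by (simp add: sum_distrib_left power_add mult_ac del: sum.atMost_Suc)
  qed
  \<comment> \<open>The derivative of \<Phi> at 1, term by term. It is also the flux of G, because
    the radial derivative multiplies the part of degree j by j.\<close>
  define D where "D = (\<Sum>j\<le>Suc n. J j * real (?d + j))"
  have "((\<lambda>s. J j * s ^ (?d + j)) has_real_derivative J j * real (?d + j)) (at 1)" for j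
    by (auto intro!: derivative_eq_intros)
  then have "((\<lambda>s. \<Sum>j\<le>Suc n. J j * s ^ (?d + j)) has_real_derivative D) (at 1)"
    unfolding D_def by (intro DERIV_sum)
  then have D: "(\<Phi> has_real_derivative D) (at 1)" unfolding \<Phi>[abs_def] .
  have radG: "rad v G x = (\<Sum>j\<le>Suc n. real j * H j (x - v))" for x
  proof -
    have "((\<lambda>s. \<Sum>j\<le>Suc n. s ^ j * H j (x - v)) has_real_derivative
        (\<Sum>j\<le>Suc n. real j * 1 ^ (j - 1) * H j (x - v))) (at 1)"
      by (auto intro!: derivative_eq_intros sum.cong)
    then show ?thesis unfolding rad_def expand by (intro DERIV_imp_deriv) simp
  qed
  have "real ?d * G x + rad v G x = (\<Sum>j\<le>Suc n. real (?d + j) * H j (x - v))" for x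
    using expand[of 1 x] by (simp only: radG) (simp add: sum_distrib_left sum.distrib[symmetric] algebra_simps)
  then have "facet_flux S v G = sint S (\<lambda>x. \<Sum>j\<le>Suc n. real (?d + j) * H j (x - v))"
    by (simp only: facet_flux_def)
  also have "\<dots> = D" unfolding D_def J_def
    by (subst sint_sum[OF S]) (auto intro!: continuous_intros cH simp: mult.commute)
  finally have flux: "facet_flux S v G = D" .
  have "bounded (g ` ?K)"
    by (intro compact_imp_bounded compact_continuous_image simplex_compact S polys_continuous[OF g])
  then obtain B where B: "\<And>x. x \<in> ?K \<Longrightarrow> \<bar>g x\<bar> \<le> B" by (auto simp: bounded_iff)
  have B0: "0 \<le> B" using B[OF subsetD[OF simplex_inner_subset[OF S] simplex_inner_center[OF S]]] by linarith
  have bound: "\<bar>\<Phi> 1 - \<Phi> s\<bar> \<le> (B * real ?d * svol S) * (1 - s)\<^sup>2" if s: "0 < s" "s < 1" for s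
  proof -
    define L where "L = (\<lambda>x. v + s *\<^sub>R (x - v)) ` ?K"
    have cL: "compact L" unfolding L_def by (intro compact_continuous_image continuous_intros simplex_compact S)
    have vK: "v \<in> ?K" using v hull_inc by fast
    have LK: "L \<subseteq> ?K"
      unfolding L_def using s simplex_hull_iff[OF S] v bary_vertex[OF S v]
      by (auto simp: bary_affine2[OF S] intro!: add_nonneg_nonneg mult_nonneg_nonneg)
    have small: "bary S v x \<le> 1 - s" if x: "x \<in> ?K" "x \<notin> L" for x
    proof (rule ccontr)
      assume n: "\<not> bary S v x \<le> 1 - s"
      \<comment> \<open>The preimage of x under the contraction. If the coordinate of v at x
        exceeded 1 - s, all coordinates of y would be nonnegative and x would lie in L.\<close>
      define y where "y = v + (1 / s) *\<^sub>R (x - v)"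
      have "0 \<le> bary S u y" if u: "u \<in> S" for u
      proof (cases "u = v")
        case True
        then have "bary S u y = (1 - 1 / s) + 1 / s * bary S v x"
          unfolding y_def bary_affine2[OF S] using bary_vertex[OF S v v] by simp
        also have "\<dots> = (s - 1 + bary S v x) / s" using s by (simp add: field_simps)
        finally show ?thesis using n s by simp
      next
        case False
        then have "bary S u y = 1 / s * bary S u x"
          unfolding y_def bary_affine2[OF S] using bary_vertex[OF S v u] by simp
        then show ?thesis using x(1) u s simplex_hull_iff[OF S] by simp
      qed
      then have "y \<in> ?K" by (simp add: simplex_hull_iff[OF S])
      moreover have "x = v + s *\<^sub>R (y - v)" using s by (simp add: y_def)
      ultimately show False using x(2) by (auto simp: L_def)
    qed
    have i: "integrable lborel (\<lambda>x. indicator ?K x *\<^sub>R f x)" "integrable lborel (\<lambda>x. indicator L x *\<^sub>R f x)"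
      if "continuous_on UNIV f" for f :: "_ \<Rightarrow> real"
      using borel_integrable_compact[OF simplex_compact[OF S] continuous_on_subset[OF that]]
        borel_integrable_compact[OF cL continuous_on_subset[OF that]] by auto
    have P1: "\<Phi> 1 = (LINT x|lborel. indicator ?K x *\<^sub>R G x)"
      by (simp add: \<Phi>_def set_lebesgue_integral_def)
    have Ps: "\<Phi> s = (LINT x|lborel. indicator L x *\<^sub>R G x)"
      using sint_scaled[OF S cG, of v s] s by (simp add: \<Phi>_def L_def set_lebesgue_integral_def)
    have V: "svol S = (LINT x|lborel. indicator ?K x *\<^sub>R 1)" by (simp add: svol_def set_lebesgue_integral_def)
    have Vs: "s ^ ?d * svol S = (LINT x|lborel. indicator L x *\<^sub>R 1)"
      using sint_scaled[OF S continuous_on_const[of _ 1], of v s] s sint_const[OF S, of 1]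
      by (simp add: L_def set_lebesgue_integral_def)
    have "\<bar>\<Phi> 1 - \<Phi> s\<bar> = \<bar>LINT x|lborel. indicator ?K x *\<^sub>R G x - indicator L x *\<^sub>R G x\<bar>"
      unfolding P1 Ps by (subst Bochner_Integration.integral_diff[OF i(1)[OF cG] i(2)[OF cG]]) simp
    also have "\<dots> \<le> (LINT x|lborel. \<bar>indicator ?K x *\<^sub>R G x - indicator L x *\<^sub>R G x\<bar>)"
      by (rule integral_abs_bound)
    also have "\<dots> \<le> (LINT x|lborel. (1 - s) * B * (indicator ?K x *\<^sub>R 1 - indicator L x *\<^sub>R 1))"
    proof (rule integral_mono)
      show "integrable lborel (\<lambda>x. \<bar>indicator ?K x *\<^sub>R G x - indicator L x *\<^sub>R G x\<bar>)"
        by (intro integrable_abs Bochner_Integration.integrable_diff i cG)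
      show "integrable lborel (\<lambda>x. (1 - s) * B * (indicator ?K x *\<^sub>R 1 - indicator L x *\<^sub>R 1))"
        by (intro integrable_mult_right Bochner_Integration.integrable_diff i continuous_on_const)
      fix x
      show "\<bar>indicator ?K x *\<^sub>R G x - indicator L x *\<^sub>R G x\<bar> \<le> (1 - s) * B * (indicator ?K x *\<^sub>R 1 - indicator L x *\<^sub>R 1)"
      proof (cases "x \<in> ?K \<and> x \<notin> L")
        case True
        then have "\<bar>G x\<bar> \<le> (1 - s) * B" unfolding G_def abs_mult
          using small[of x] B[of x] simplex_hull_iff[OF S, of x] v by (intro mult_mono) auto
        then show ?thesis using True by simp
      qed (use LK in \<open>auto simp: indicator_def\<close>)
    qed
    also have "\<dots> = (1 - s) * B * (svol S - s ^ ?d * svol S)"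
      by (simp only: integral_mult_right_zero V[symmetric] Vs[symmetric]
          Bochner_Integration.integral_diff[OF i(1)[OF continuous_on_const[of _ 1]] i(2)[OF continuous_on_const[of _ 1]]])
    also have "\<dots> = (1 - s) * B * svol S * (1 - s ^ ?d)" by (simp add: algebra_simps)
    also have "\<dots> \<le> (1 - s) * B * svol S * (real ?d * (1 - s))"
    proof (rule mult_left_mono)
      have "1 + real ?d * (s - 1) \<le> (1 + (s - 1)) ^ ?d" by (rule Bernoulli_inequality) (use s in simp)
      then show "1 - s ^ ?d \<le> real ?d * (1 - s)" by (simp add: algebra_simps)
    qed (use s B0 svol_pos[OF S] in auto)
    also have "\<dots> = (B * real ?d * svol S) * (1 - s)\<^sup>2" by (simp add: power2_eq_square)
    finally show ?thesis .
  qed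
  have "((\<lambda>s. (\<Phi> s - \<Phi> 1) / (s - 1)) \<longlongrightarrow> D) (at_left 1)"
    using D unfolding has_field_derivative_iff by (rule tendsto_within_subset) auto
  moreover have "((\<lambda>s. (\<Phi> s - \<Phi> 1) / (s - 1)) \<longlongrightarrow> 0) (at_left 1)"
  proof (rule Lim_null_comparison)
    show "\<forall>\<^sub>F s in at_left 1. norm ((\<Phi> s - \<Phi> 1) / (s - 1)) \<le> (B * real ?d * svol S) * (1 - s)"
    proof (rule eventually_at_leftI)
      fix s :: real assume s: "s \<in> {0<..<1}"
      have "norm ((\<Phi> s - \<Phi> 1) / (s - 1)) = \<bar>\<Phi> 1 - \<Phi> s\<bar> / (1 - s)" using s by (simp add: abs_minus_commute)
      also have "\<dots> \<le> ((B * real ?d * svol S) * (1 - s)\<^sup>2) / (1 - s)"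
        using bound[of s] s by (intro divide_right_mono) auto
      also have "\<dots> = (B * real ?d * svol S) * (1 - s)" using s by (simp add: power2_eq_square)
      finally show "norm ((\<Phi> s - \<Phi> 1) / (s - 1)) \<le> (B * real ?d * svol S) * (1 - s)" .
    qed simp
    have "((\<lambda>s. (B * real ?d * svol S) * (1 - s)) \<longlongrightarrow> (B * real ?d * svol S) * (1 - 1)) (at_left 1)"
      by (intro tendsto_intros)
    then show "((\<lambda>s. (B * real ?d * svol S) * (1 - s)) \<longlongrightarrow> 0) (at_left 1)" by simp
  qed
  ultimately have "D = 0" using tendsto_unique[OF trivial_limit_at_left_real] by blast
  then show ?thesis using flux unfolding G_def[abs_def] by simp
qed

text \<open>The segment from the centre of the facet to any point of its plane starts inside the
  facet, so p has infinitely many zeros on that line.\<close>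

lemma polys_zero_on_facet_plane:
  fixes S :: "(real,'n::finite) vec set"
  assumes S: "is_simplex S" and v: "v \<in> S" and p: "p \<in> polys m"
    and z: "\<And>x. x \<in> convex hull (S - {v}) \<Longrightarrow> p x = 0" and y: "bary S v y = 0"
  shows "p y = 0"
proof -
  let ?F = "S - {v}"
  have fin: "finite ?F" "card ?F = CARD('n)" using is_simplexD(1,2)[OF S] v by auto
  then have ne: "?F \<noteq> {}" by (metis card.empty zero_less_card_finite less_irrefl)
  define c where "c = face_center ?F"
  define U where "U = (\<Inter>u\<in>?F. {s::real. 0 < (1 - s) * bary S u c + s * bary S u y})"
  have bc: "bary S u c = (if u = v then 0 else 1 / real (card ?F))" if "u \<in> S" for u
    using bary_face_center[OF S _ ne that] that by (auto simp: c_def)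
  have "open U" unfolding U_def
    by (intro open_INT fin ballI open_Collect_less continuous_intros)
  moreover have "0 \<in> U" using fin ne by (auto simp: U_def bc card_gt_0_iff)
  ultimately obtain e where e: "e > 0" "ball 0 e \<subseteq> U" using open_contains_ball by blast
  have "{0<..<e} \<subseteq> {s. p (c + s *\<^sub>R (y - c)) = 0}"
  proof safe
    fix s assume s: "s \<in> {0<..<e}"
    then have "s \<in> U" using e by (intro subsetD[OF e(2)]) simp
    then have "c + s *\<^sub>R (y - c) \<in> convex hull ?F"
      unfolding simplex_face_iff[OF S Diff_subset] using bc[OF v] y v
      by (auto simp: bary_affine2[OF S] U_def less_imp_le) (metis Diff_iff less_imp_le singletonD order_refl add_0 mult_zero_right)
    then show "p (c + s *\<^sub>R (y - c)) = 0" by (rule z)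
  qed
  then have "infinite {s. p (c + s *\<^sub>R (y - c)) = 0}"
    using e(1) infinite_Ioo finite_subset by blast
  from polys_zero_on_line[OF p this, of 1] show ?thesis by simp
qed

text \<open>With w another vertex, subtracting the coordinate of v times v - w from x reaches the
  plane of the facet, where p vanishes; the resulting difference of p is divisible by that
  coordinate.\<close>

lemma polys_divisible_by_bary:
  fixes S :: "(real,'n::finite) vec set"
  assumes S: "is_simplex S" and v: "v \<in> S" and p: "p \<in> polys m"
    and z: "\<And>x. x \<in> convex hull (S - {v}) \<Longrightarrow> p x = 0"
  obtains n h where "h \<in> polys (int n)" "p = (\<lambda>x. bary S v x * h x)"
proof -
  have "card (S - {v}) = CARD('n)" using is_simplexD(1,2)[OF S] v by auto
  then have "S - {v} \<noteq> {}" by (metis card.empty zero_less_card_finite less_irrefl)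
  then obtain w where w: "w \<in> S" "w \<noteq> v" by blast
  have pn: "p \<in> polys (int (nat m))" using p by (rule polys_mono) simp
  obtain n h where h: "h \<in> polys (int n)"
    "\<And>x. p x - p (x - bary S v x *\<^sub>R (v - w)) = bary S v x * h x"
    using polys_divide_affine[OF pn bary_polys[OF S, of v], of "v - w"] by blast
  have "bary S v (x - bary S v x *\<^sub>R (v - w)) = 0" for x
  proof -
    have "bgrad S v \<bullet> (v - w) = 1"
      using bary_diff[OF S, of v v w] bary_vertex[OF S v v] bary_vertex[OF S w(1) v] w by simp
    then show ?thesis
      using bary_diff[OF S, of v "x - bary S v x *\<^sub>R (v - w)" x] by simp
  qed
  then have "p (x - bary S v x *\<^sub>R (v - w)) = 0" for x
    using polys_zero_on_facet_plane[OF S v p z] by blast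
  then have "p x = bary S v x * h x" for x using h(2)[of x] by simp
  then show ?thesis using that[OF h(1)] by (simp add: fun_eq_iff)
qed

text \<open>Such a g contains the coordinate of v as a factor. Hence the flux sees only the values
  of g on the facet opposite v.\<close>

lemma facet_flux_zero:
  assumes "is_simplex S" "v \<in> S" "g \<in> polys m" "\<And>x. x \<in> convex hull (S - {v}) \<Longrightarrow> g x = 0"
  shows "facet_flux S v g = 0"
proof -
  obtain n h where h: "h \<in> polys (int n)" "g = (\<lambda>x. bary S v x * h x)"
    using polys_divisible_by_bary[OF assms] by blast
  then show ?thesis using facet_flux_bary_mult[OF assms(1,2) h(1)] by simp
qed

lemma facet_flux_cong:
  assumes "is_simplex S" "v \<in> S" "g \<in> polys m" "h \<in> polys m" "\<And>x. x \<in> convex hull (S - {v}) \<Longrightarrow> g x = h x"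
  shows "facet_flux S v g = facet_flux S v h"
proof -
  have d: "(\<lambda>x. g x - h x) \<in> polys m" by (rule polys_diff[OF assms(3,4)])
  have "facet_flux S v (\<lambda>x. (g x - h x) + h x) = facet_flux S v (\<lambda>x. g x - h x) + facet_flux S v h"
    by (rule facet_flux_add[OF assms(1) d assms(4)])
  moreover have "facet_flux S v (\<lambda>x. g x - h x) = 0"
    by (rule facet_flux_zero[OF assms(1,2) d]) (use assms(5) in simp)
  ultimately show ?thesis by simp
qed

lemma divg_sum:
  assumes "\<And>i. i \<in> I \<Longrightarrow> f i \<in> vpolys m"
  shows "divg (\<lambda>x. \<Sum>i\<in>I. f i x) x = (\<Sum>i\<in>I. divg (f i) x)"
proof -
  have "((\<lambda>x. \<Sum>i\<in>I. f i x) has_derivative (\<lambda>h. \<Sum>i\<in>I. \<chi> j. pgrad (\<lambda>x. f i x $ j) x \<bullet> h)) (at x)"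
    by (rule has_derivative_sum, erule vpolys_has_derivative[OF assms])
  from divg_eq[OF this]
  have "divg (\<lambda>x. \<Sum>i\<in>I. f i x) x = (\<Sum>j\<in>UNIV. \<Sum>i\<in>I. pgrad (\<lambda>x. f i x $ j) x $ j)" by (simp add: inner_axis)
  also have "\<dots> = (\<Sum>i\<in>I. \<Sum>j\<in>UNIV. pgrad (\<lambda>x. f i x $ j) x $ j)" by (rule sum.swap)
  also have "\<dots> = (\<Sum>i\<in>I. divg (f i) x)" by (rule sum.cong[OF refl], rule divg_vpolys[OF assms, symmetric])
  finally show ?thesis .
qed

text \<open>The decomposition \<open>\<tau> = - \<Sum>\<^sub>v (\<tau> \<cdot> \<nabla>\<lambda>\<^sub>v) (x - v)\<close> reduces the divergence
  theorem to the definition of the flux functionals.\<close>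

theorem sint_divg:
  assumes S: "is_simplex S" and \<tau>: "\<tau> \<in> vpolys m"
  shows "sint S (divg \<tau>) = - (\<Sum>v\<in>S. facet_flux S v (\<lambda>x. \<tau> x \<bullet> bgrad S v))"
proof -
  define q where "q v x = \<tau> x \<bullet> bgrad S v" for v x
  have q: "q v \<in> polys m" for v
    unfolding q_def[abs_def] by (rule polys_inner[OF \<tau> vpolys_const[of 0]]) auto
  have xv: "(\<lambda>x. x - v) \<in> vpolys 1" for v by (rule vpolys_diff[OF vpolys_id vpolys_const]) auto
  have dec: "\<tau> x = (\<Sum>v\<in>S. (- q v x) *\<^sub>R (x - v))" for x
  proof -
    have "(\<Sum>v\<in>S. q v x) = \<tau> x \<bullet> (\<Sum>v\<in>S. bgrad S v)" by (simp add: q_def inner_sum_right)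
    then have "(\<Sum>v\<in>S. q v x) = 0" by (simp add: bgrad_sum[OF S])
    moreover have "(\<Sum>v\<in>S. q v x *\<^sub>R v) = \<tau> x"
      using bgrad_expand[OF S, of "\<tau> x"] by (simp add: q_def inner_commute)
    moreover have "(\<Sum>v\<in>S. (- q v x) *\<^sub>R (x - v)) = (\<Sum>v\<in>S. q v x *\<^sub>R v) - (\<Sum>v\<in>S. q v x) *\<^sub>R x"
      by (simp add: scaleR_diff_right sum_subtractf scaleR_sum_left sum_negf)
    ultimately show ?thesis by simp
  qed
  have "divg \<tau> x = (\<Sum>v\<in>S. - (real CARD('a) * q v x + rad v (q v) x))" for x
  proof -
    have t: "\<tau> = (\<lambda>x. \<Sum>v\<in>S. (- q v x) *\<^sub>R (x - v))" using dec by (rule ext)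
    have "divg \<tau> x = (\<Sum>v\<in>S. divg (\<lambda>x. (- q v x) *\<^sub>R (x - v)) x)"
      by (subst t, rule divg_sum[of _ _ "m + 1"]) (rule vpolys_scale[OF polys_minus[OF q] xv], simp)
    also have "\<dots> = (\<Sum>v\<in>S. - (real CARD('a) * q v x + rad v (q v) x))"
    proof (intro sum.cong refl)
      fix v
      have "divg (\<lambda>x. (- q v x) *\<^sub>R (x - v)) x = divg (\<lambda>x. (-1) *\<^sub>R (q v x *\<^sub>R (x - v))) x" by simp
      also have "\<dots> = - divg (\<lambda>x. q v x *\<^sub>R (x - v)) x"
        by (subst divg_cscale[OF vpolys_scale[OF q xv order_refl]]) simp
      finally show "divg (\<lambda>x. (- q v x) *\<^sub>R (x - v)) x = - (real CARD('a) * q v x + rad v (q v) x)"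
        by (simp add: divg_scale[OF q xv] rad_polys_eq[OF q] divg_position)
    qed
    finally show ?thesis .
  qed
  then have "divg \<tau> = (\<lambda>x. \<Sum>v\<in>S. - (real CARD('a) * q v x + rad v (q v) x))" by (rule ext)
  then have "sint S (divg \<tau>) = sint S (\<lambda>x. \<Sum>v\<in>S. - (real CARD('a) * q v x + rad v (q v) x))"
    by (simp only:)
  also have "\<dots> = (\<Sum>v\<in>S. sint S (\<lambda>x. - (real CARD('a) * q v x + rad v (q v) x)))"
    by (rule sint_sum[OF S]) (intro continuous_intros flux_continuous[OF q])
  also have "\<dots> = (\<Sum>v\<in>S. - facet_flux S v (q v))"
  proof (intro sum.cong refl)
    fix v
    show "sint S (\<lambda>x. - (real CARD('a) * q v x + rad v (q v) x)) = - facet_flux S v (q v)"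
      using set_integral_mult_right[of lborel "convex hull S" "-1" "\<lambda>x. real CARD('a) * q v x + rad v (q v) x"]
      by (simp add: facet_flux_def)
  qed
  finally show ?thesis by (simp add: sum_negf q_def[abs_def])
qed

lemma sint_divg_zero:
  assumes S: "is_simplex S" and \<tau>: "\<tau> \<in> vpolys m"
    and n: "\<And>v x. v \<in> S \<Longrightarrow> x \<in> convex hull (S - {v}) \<Longrightarrow> \<tau> x \<bullet> bgrad S v = 0"
  shows "sint S (divg \<tau>) = 0"
proof -
  have "facet_flux S v (\<lambda>x. \<tau> x \<bullet> bgrad S v) = 0" if "v \<in> S" for v
    by (rule facet_flux_zero[OF S that polys_inner[OF \<tau> vpolys_const order_refl]]) (use n that in auto)
  then show ?thesis unfolding sint_divg[OF S \<tau>] by simp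
qed

subsection \<open>Two simplices sharing a facet\<close>

text \<open>Both coordinates are affine and vanish on the plane of F, so they are proportional, and
  the value 1 at v' fixes the factor. The comparison goes through the affine map that exchanges v
  for v'.\<close>

lemma bary_neighbour:
  assumes S: "is_simplex (insert v F)" "is_simplex (insert v' F)" and v: "v \<notin> F" "v' \<notin> F"
    and b: "bary (insert v F) v v' \<noteq> 0"
  shows "bary (insert v' F) v' y = bary (insert v F) v y / bary (insert v F) v v'"
    and "bgrad (insert v' F) v' = (1 / bary (insert v F) v v') *\<^sub>R bgrad (insert v F) v"
proof -
  let ?S = "insert v F" and ?S' = "insert v' F"
  let ?\<beta> = "bary ?S v v'"
  show *: "bary ?S' v' y = bary ?S v y / ?\<beta>" for y
  proof -
    define x where "x = y - (bary ?S v y / ?\<beta>) *\<^sub>R (v' - v)"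
    have g: "bgrad ?S v \<bullet> (v' - v) = ?\<beta> - 1"
      using bary_diff[OF S(1), of v v' v] bary_vertex[OF S(1), of v v] by simp
    have "bary ?S v x = bary ?S v y - (bary ?S v y / ?\<beta>) * (?\<beta> - 1)"
      using bary_diff[OF S(1), of v x y] g by (simp add: x_def)
    then have bx: "bary ?S v x = bary ?S v y / ?\<beta>" using b by (simp add: field_simps)
    have "smap ?S (id(v := v')) x = y" unfolding svol_neighbour(2)[OF S v] bx by (simp add: x_def)
    then show ?thesis
      using bary_smap[OF S svol_neighbour(3)[OF S v], of v x] bx by simp
  qed
  show "bgrad ?S' v' = (1 / ?\<beta>) *\<^sub>R bgrad ?S v"
    by (simp add: bgrad_def vec_eq_iff * diff_divide_distrib)
qed

text \<open>The map that exchanges v for v' scales volumes by the stated factor and carries radial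
  derivatives about v to those about v'. It fixes F, so the transported g agrees with g where the
  flux looks.\<close>

lemma facet_flux_neighbour:
  assumes S: "is_simplex (insert v F)" "is_simplex (insert v' F)" and v: "v \<notin> F" "v' \<notin> F"
    and g: "g \<in> polys m"
  shows "facet_flux (insert v' F) v' g = \<bar>bary (insert v F) v v'\<bar> * facet_flux (insert v F) v g"
proof -
  let ?S = "insert v F" and ?S' = "insert v' F" and ?e = "id(v := v')"
  let ?A = "smap ?S ?e"
  note e = svol_neighbour(3)[OF S v]
  have gA: "(\<lambda>x. g (?A x)) \<in> polys m" by (rule polys_compose[OF g smap_polys[OF S(1)]])
  have "facet_flux ?S' v' g = svol ?S' * savg ?S' (\<lambda>x. real CARD('a) * g x + rad v' g x)"
    using svol_pos[OF S(2)] by (simp add: facet_flux_def savg_def)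
  also have "savg ?S' (\<lambda>x. real CARD('a) * g x + rad v' g x)
      = savg ?S (\<lambda>x. real CARD('a) * g (?A x) + rad v' g (?A x))"
    by (rule savg_smap[OF S e flux_continuous[OF g]])
  also have "(\<lambda>x. rad v' g (?A x)) = rad v (\<lambda>x. g (?A x))"
    using rad_smap[OF S(1), of v ?e g] by (simp add: fun_eq_iff)
  then have "savg ?S (\<lambda>x. real CARD('a) * g (?A x) + rad v' g (?A x))
      = savg ?S (\<lambda>x. real CARD('a) * g (?A x) + rad v (\<lambda>x. g (?A x)) x)" by metis
  also have "svol ?S' * savg ?S (\<lambda>x. real CARD('a) * g (?A x) + rad v (\<lambda>x. g (?A x)) x)
      = \<bar>bary ?S v v'\<bar> * facet_flux ?S v (\<lambda>x. g (?A x))"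
    using svol_pos[OF S(1)] svol_neighbour(1)[OF S v] by (simp add: facet_flux_def savg_def)
  also have "facet_flux ?S v (\<lambda>x. g (?A x)) = facet_flux ?S v g"
  proof (rule facet_flux_cong[OF S(1) _ gA g])
    fix x assume "x \<in> convex hull (?S - {v})"
    then have "bary ?S v x = 0" using simplex_face_iff[OF S(1), of "?S - {v}" x] by auto
    then show "g (?A x) = g x" unfolding svol_neighbour(2)[OF S v] by simp
  qed simp
  finally show ?thesis .
qed

section \<open>Lagrange interpolation on a simplex\<close>

text \<open>Zero off S: this makes the index set finite and lets equality of indices be tested on
  S.\<close>

definition lindex :: "(real,'n::finite) vec set \<Rightarrow> nat \<Rightarrow> ((real,'n) vec \<Rightarrow> nat) set" where
  "lindex S m = {\<beta>. (\<forall>v. v \<notin> S \<longrightarrow> \<beta> v = 0) \<and> sum \<beta> S = m}"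

definition lnode :: "(real,'n::finite) vec set \<Rightarrow> nat \<Rightarrow> ((real,'n) vec \<Rightarrow> nat) \<Rightarrow> (real,'n) vec" where
  "lnode S m \<beta> = (\<Sum>v\<in>S. (real (\<beta> v) / real m) *\<^sub>R v)"

text \<open>The standard product formula: the factors for v vanish at the nodes whose coordinate of
  v is j/m with j below \<open>\<beta> v\<close>, and they are normalised at the node of
  \<beta>.\<close>

definition lbasis :: "(real,'n::finite) vec set \<Rightarrow> nat \<Rightarrow> ((real,'n) vec \<Rightarrow> nat) \<Rightarrow> (real,'n) vec \<Rightarrow> real" where
  "lbasis S m \<beta> x = (\<Prod>v\<in>S. \<Prod>j<\<beta> v. (real m * bary S v x - real j) / (real (\<beta> v) - real j))"

lemma lnodes_eq: "lnodes S m = lnode S m ` lindex S m"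
proof
  show "lnodes S m \<subseteq> lnode S m ` lindex S m"
  proof
    fix y assume "y \<in> lnodes S m"
    then obtain \<beta> where b: "y = lnode S m \<beta>" "sum \<beta> S = m" by (auto simp: lnodes_def lnode_def)
    define \<gamma> where "\<gamma> v = (if v \<in> S then \<beta> v else 0)" for v
    have "sum \<gamma> S = sum \<beta> S" "lnode S m \<gamma> = lnode S m \<beta>"
      unfolding lnode_def \<gamma>_def by (auto intro!: sum.cong)
    then show "y \<in> lnode S m ` lindex S m" using b by (auto simp: lindex_def \<gamma>_def intro!: image_eqI[of _ _ \<gamma>])
  qed
  show "lnode S m ` lindex S m \<subseteq> lnodes S m" by (auto simp: lnodes_def lnode_def lindex_def)
qed

lemma lindex_le: "finite S \<Longrightarrow> \<beta> \<in> lindex S m \<Longrightarrow> \<beta> v \<le> m"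
  by (cases "v \<in> S") (auto simp: lindex_def intro: member_le_sum)

lemma lindex_card:
  assumes "finite S" shows "finite (lindex S m)" "card (lindex S m) \<le> (m + 1) ^ card S"
proof -
  have i: "inj_on (\<lambda>\<beta>. restrict \<beta> S) (lindex S m)"
    by (rule inj_onI) (auto simp: lindex_def fun_eq_iff restrict_def, metis)
  have sub: "(\<lambda>\<beta>. restrict \<beta> S) ` lindex S m \<subseteq> PiE S (\<lambda>_. {..m})"
    using lindex_le[OF assms] by (auto simp: PiE_def)
  have fin: "finite (PiE S (\<lambda>_. {..m}))" using assms by (intro finite_PiE) auto
  show "finite (lindex S m)" using finite_imageD[OF finite_subset[OF sub fin] i] .
  have "card (lindex S m) \<le> card (PiE S (\<lambda>_. {..m}))" by (rule card_inj_on_le[OF i sub fin])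
  then show "card (lindex S m) \<le> (m + 1) ^ card S" using assms by (simp add: card_PiE)
qed

lemma bary_lnode:
  assumes "is_simplex S" "1 \<le> m" "\<beta> \<in> lindex S m" "v \<in> S"
  shows "bary S v (lnode S m \<beta>) = real (\<beta> v) / real m"
proof (rule bary_unique[OF assms(1) _ _ assms(4)])
  have "(\<Sum>v\<in>S. real (\<beta> v) / real m) = real (sum \<beta> S) / real m" by (simp add: sum_divide_distrib)
  also have "sum \<beta> S = m" using assms(3) by (simp add: lindex_def)
  finally show "(\<Sum>v\<in>S. real (\<beta> v) / real m) = 1" using assms(2) by simp
qed (simp add: lnode_def)

lemma lnodes_hull:
  assumes "is_simplex S" "1 \<le> m" shows "lnodes S m \<subseteq> convex hull S"
  unfolding lnodes_eq using bary_lnode[OF assms] by (auto simp: simplex_hull_iff[OF assms(1)])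

lemma lbasis_polys:
  assumes "is_simplex S" "\<beta> \<in> lindex S m" shows "lbasis S m \<beta> \<in> polys (int m)"
proof -
  have "(\<lambda>x. (real m * bary S v x - real j) / (real (\<beta> v) - real j)) \<in> polys (int 1)" for v j
    unfolding divide_inverse
    by (intro polys_multc polys_diff polys_cmult polys_const) (auto intro: bary_polys[OF assms(1)])
  then have "(\<lambda>x. \<Prod>j<\<beta> v. (real m * bary S v x - real j) / (real (\<beta> v) - real j)) \<in> polys (int (\<Sum>j<\<beta> v. 1))" for v
    by (intro polys_prod) auto
  then have *: "lbasis S m \<beta> \<in> polys (int (\<Sum>v\<in>S. \<beta> v))"
    unfolding lbasis_def[abs_def] using is_simplexD(1)[OF assms(1)] by (intro polys_prod) auto
  have "(\<Sum>v\<in>S. \<beta> v) = m" using assms(2) by (simp add: lindex_def)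
  then show ?thesis using * by (simp only:)
qed

lemma lbasis_node:
  assumes S: "is_simplex S" and m: "1 \<le> m" and b: "\<beta> \<in> lindex S m" and g: "\<gamma> \<in> lindex S m"
  shows "lbasis S m \<beta> (lnode S m \<gamma>) = (if \<gamma> = \<beta> then 1 else 0)"
proof -
  have fin: "finite S" by (rule is_simplexD(1)[OF S])
  have eq: "lbasis S m \<beta> (lnode S m \<gamma>) = (\<Prod>v\<in>S. \<Prod>j<\<beta> v. (real (\<gamma> v) - real j) / (real (\<beta> v) - real j))"
    unfolding lbasis_def by (intro prod.cong refl) (use bary_lnode[OF S m g] m in simp)
  show ?thesis
  proof (cases "\<gamma> = \<beta>")
    case True
    then show ?thesis unfolding eq by (auto intro!: prod.neutral)
  next
    case False
    \<comment> \<open>Both indices have the sum m, so a different \<gamma> falls below \<beta>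
      somewhere, and there the factor with \<open>j = \<gamma> v\<close> vanishes.\<close>
    have "\<exists>v\<in>S. \<gamma> v < \<beta> v"
    proof (rule ccontr)
      assume "\<not> (\<exists>v\<in>S. \<gamma> v < \<beta> v)"
      then have le: "\<And>v. v \<in> S \<Longrightarrow> \<beta> v \<le> \<gamma> v" by (auto simp: not_less)
      have "\<gamma> v = \<beta> v" if "v \<in> S" for v
      proof (rule ccontr)
        assume "\<gamma> v \<noteq> \<beta> v"
        then have "\<beta> v < \<gamma> v" using le[OF that] by simp
        then have "sum \<beta> S < sum \<gamma> S" using fin le that by (intro sum_strict_mono_ex1) auto
        then show False using b g by (simp add: lindex_def)
      qed
      then have "\<gamma> v = \<beta> v" for v using b g by (cases "v \<in> S") (auto simp: lindex_def)
      then show False using False by auto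
    qed
    then obtain v where v: "v \<in> S" "\<gamma> v < \<beta> v" by blast
    have "(\<Prod>j<\<beta> v. (real (\<gamma> v) - real j) / (real (\<beta> v) - real j)) = 0"
      using v(2) by (intro prod_zero) auto
    then show ?thesis unfolding eq using False v(1) fin by (auto intro!: prod_zero)
  qed
qed

text \<open>Seen from one vertex v0, the nodes form a lattice with the steps (v - v0)/m and index
  sums up to m, on which a polynomial of degree m is determined. No count of dimensions is
  involved.\<close>

lemma lnodes_unisolvent:
  fixes S :: "(real,'n::finite) vec set"
  assumes S: "is_simplex S" and m: "1 \<le> m" and p: "p \<in> polys (int m)"
    and z: "\<And>y. y \<in> lnodes S m \<Longrightarrow> p y = 0"
  shows "p = (\<lambda>_. 0)"
proof -
  have fin: "finite S" by (rule is_simplexD(1)[OF S])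
  obtain v0 where v0: "v0 \<in> S" using is_simplexD(4)[OF S] by blast
  let ?I = "S - {v0}" and ?d = "\<lambda>v. (1 / real m) *\<^sub>R (v - v0)"
  have "e \<in> span (?d ` ?I)" for e
  proof -
    have "(\<Sum>v\<in>S. (bgrad S v \<bullet> e) *\<^sub>R (v - v0)) = e"
    proof -
      have "(\<Sum>v\<in>S. bgrad S v \<bullet> e) = 0" using bgrad_sum[OF S] by (simp add: inner_sum_left[symmetric])
      then show ?thesis using bgrad_expand[OF S, of e]
        by (simp add: scaleR_diff_right sum_subtractf scaleR_sum_left[symmetric])
    qed
    moreover have "(\<Sum>v\<in>S. (bgrad S v \<bullet> e) *\<^sub>R (v - v0)) = (\<Sum>v\<in>?I. (bgrad S v \<bullet> e) *\<^sub>R (v - v0))"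
      using fin v0 by (subst sum.remove[of S v0]) auto
    moreover have "(\<Sum>v\<in>?I. (bgrad S v \<bullet> e) *\<^sub>R (v - v0)) = (\<Sum>v\<in>?I. (real m * (bgrad S v \<bullet> e)) *\<^sub>R ?d v)"
      using m by (intro sum.cong) auto
    moreover have "(\<Sum>v\<in>?I. (real m * (bgrad S v \<bullet> e)) *\<^sub>R ?d v) \<in> span (?d ` ?I)"
      by (rule span_sum, rule span_scale, rule span_base, rule imageI)
    ultimately show ?thesis by simp
  qed
  then have span: "span (?d ` ?I) = UNIV" by auto
  show ?thesis
  proof (rule polys_zero_on_lattice[OF p _ span])
    show "finite ?I" using fin by simp
    fix \<beta> :: "(real,'n) vec \<Rightarrow> nat" assume le: "sum \<beta> ?I \<le> m"
    \<comment> \<open>The weight of v0 fills the index up to the sum m.\<close>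
    define \<gamma> where "\<gamma> v = (if v = v0 then m - sum \<beta> ?I else \<beta> v)" for v
    have sI: "sum \<gamma> ?I = sum \<beta> ?I" by (intro sum.cong) (auto simp: \<gamma>_def)
    have sg: "sum \<gamma> S = m" using fin v0 le sI by (subst sum.remove[of S v0]) (auto simp: \<gamma>_def)
    have "lnode S m \<gamma> = (\<Sum>v\<in>S. (real (\<gamma> v) / real m) *\<^sub>R (v - v0)) + (\<Sum>v\<in>S. real (\<gamma> v) / real m) *\<^sub>R v0"
      by (simp add: lnode_def scaleR_diff_right sum_subtractf scaleR_sum_left)
    also have "(\<Sum>v\<in>S. real (\<gamma> v) / real m) = real (sum \<gamma> S) / real m" by (simp add: sum_divide_distrib)
    also have "\<dots> = 1" using sg m by simp
    also have "(\<Sum>v\<in>S. (real (\<gamma> v) / real m) *\<^sub>R (v - v0)) = (\<Sum>v\<in>?I. (real (\<gamma> v) / real m) *\<^sub>R (v - v0))"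
      using fin v0 by (subst sum.remove[of S v0]) auto
    also have "\<dots> = (\<Sum>v\<in>?I. real (\<beta> v) *\<^sub>R ?d v)"
      by (intro sum.cong) (auto simp: \<gamma>_def)
    finally have "v0 + (\<Sum>v\<in>?I. real (\<beta> v) *\<^sub>R ?d v) = lnode S m \<gamma>" by (simp add: add.commute)
    moreover have "lnode S m \<gamma> \<in> lnodes S m" using sg by (auto simp: lnodes_def lnode_def)
    ultimately show "p (v0 + (\<Sum>v\<in>?I. real (\<beta> v) *\<^sub>R ?d v)) = 0" using z by simp
  qed
qed

text \<open>Unisolvence lets the definite description in \<open>linterp\<close> denote the explicit
  interpolant. The case m = 0 is excluded because the nodes are formed by division by m.\<close>

lemma linterp_eq:
  assumes S: "is_simplex S" and m: "1 \<le> m"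
  shows "linterp S m g = (\<lambda>x. \<Sum>\<beta>\<in>lindex S m. g (lnode S m \<beta>) * lbasis S m \<beta> x)" (is "_ = ?P")
  unfolding linterp_def
proof (rule the_equality)
  note fin = lindex_card(1)[OF is_simplexD(1)[OF S], of m]
  have P: "?P \<in> polys (int m)" by (intro polys_sum polys_cmult lbasis_polys[OF S])
  have val: "?P y = g y" if y: "y \<in> lnodes S m" for y
  proof -
    obtain \<gamma> where \<gamma>: "\<gamma> \<in> lindex S m" "y = lnode S m \<gamma>" using y unfolding lnodes_eq by blast
    have "?P y = (\<Sum>\<beta>\<in>lindex S m. if \<gamma> = \<beta> then g (lnode S m \<beta>) else 0)"
      unfolding \<gamma>(2) by (intro sum.cong refl) (simp add: lbasis_node[OF S m _ \<gamma>(1)])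
    also have "\<dots> = g (lnode S m \<gamma>)" using fin \<gamma>(1) by simp
    finally show ?thesis by (simp add: \<gamma>(2))
  qed
  show "?P \<in> polys (int m) \<and> (\<forall>y\<in>lnodes S m. ?P y = g y)" using P val by blast
  fix q assume q: "q \<in> polys (int m) \<and> (\<forall>y\<in>lnodes S m. q y = g y)"
  then have "(\<lambda>x. q x - ?P x) = (\<lambda>_. 0)"
    by (intro lnodes_unisolvent[OF S m] polys_diff P) (auto simp: val)
  then show "q = ?P" by (simp add: fun_eq_iff)
qed

lemma linterp_polys: "is_simplex S \<Longrightarrow> 1 \<le> m \<Longrightarrow> linterp S m g \<in> polys (int m)"
  by (subst linterp_eq) (auto intro!: polys_sum polys_cmult lbasis_polys)

lemma linterp_node:
  assumes "is_simplex S" "1 \<le> m" "y \<in> lnodes S m" shows "linterp S m g y = g y"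
proof -
  note fin = lindex_card(1)[OF is_simplexD(1)[OF assms(1)], of m]
  obtain \<gamma> where \<gamma>: "\<gamma> \<in> lindex S m" "y = lnode S m \<gamma>" using assms(3) unfolding lnodes_eq by blast
  have "linterp S m g y = (\<Sum>\<beta>\<in>lindex S m. if \<gamma> = \<beta> then g (lnode S m \<beta>) else 0)"
    unfolding \<gamma>(2) linterp_eq[OF assms(1,2)]
    by (intro sum.cong refl) (simp add: lbasis_node[OF assms(1,2) _ \<gamma>(1)])
  also have "\<dots> = g y" using fin \<gamma> by simp
  finally show ?thesis .
qed

lemma linterp_id:
  assumes "is_simplex S" "1 \<le> m" "p \<in> polys (int m)" "\<And>y. y \<in> lnodes S m \<Longrightarrow> g y = p y"
  shows "linterp S m g = p"
proof -
  have "(\<lambda>x. linterp S m g x - p x) = (\<lambda>_. 0)"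
    by (rule lnodes_unisolvent[OF assms(1,2) polys_diff[OF linterp_polys[OF assms(1,2)] assms(3)]])
       (use linterp_node[OF assms(1,2)] assms(4) in auto)
  then show ?thesis by (simp add: fun_eq_iff)
qed

lemma linterp_add:
  "is_simplex S \<Longrightarrow> 1 \<le> m \<Longrightarrow> linterp S m (\<lambda>y. g y + h y) x = linterp S m g x + linterp S m h x"
  by (simp add: linterp_eq distrib_right sum.distrib)

lemma linterp_cmult:
  "is_simplex S \<Longrightarrow> 1 \<le> m \<Longrightarrow> linterp S m (\<lambda>y. c * g y) x = c * linterp S m g x"
  by (simp add: linterp_eq sum_distrib_left mult.assoc)

text \<open>There are m factors in all, each with numerator at most m and denominator at least
  1.\<close>

lemma lbasis_bound:
  assumes S: "is_simplex S" and b: "\<beta> \<in> lindex S m" and x: "x \<in> convex hull S"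
  shows "\<bar>lbasis S m \<beta> x\<bar> \<le> real m ^ m"
proof -
  have fac: "\<bar>(real m * bary S v x - real j) / (real (\<beta> v) - real j)\<bar> \<le> real m"
    if v: "v \<in> S" and j: "j < \<beta> v" for v j
  proof -
    have "\<beta> v \<le> m" by (rule lindex_le[OF is_simplexD(1)[OF S] b])
    moreover have "0 \<le> real m * bary S v x"
      using x v simplex_hull_iff[OF S, of x] by auto
    moreover have "real m * bary S v x \<le> real m * 1"
      by (rule mult_left_mono[OF bary_le_1[OF S x v]]) simp
    ultimately have n: "\<bar>real m * bary S v x - real j\<bar> \<le> real m" using j by linarith
    have d: "1 \<le> \<bar>real (\<beta> v) - real j\<bar>" using j by simp
    have "\<bar>(real m * bary S v x - real j) / (real (\<beta> v) - real j)\<bar> \<le> \<bar>real m * bary S v x - real j\<bar> / 1"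
      unfolding abs_divide by (rule divide_left_mono) (use d in auto)
    then show ?thesis using n by simp
  qed
  have "\<bar>lbasis S m \<beta> x\<bar> = (\<Prod>v\<in>S. \<Prod>j<\<beta> v. \<bar>(real m * bary S v x - real j) / (real (\<beta> v) - real j)\<bar>)"
    unfolding lbasis_def by (simp only: abs_prod)
  also have "\<dots> \<le> (\<Prod>v\<in>S. \<Prod>j<\<beta> v. real m)"
    by (intro prod_mono conjI prod_nonneg ballI abs_ge_zero fac) auto
  also have "\<dots> = real m ^ (\<Sum>v\<in>S. \<beta> v)" by (simp add: power_sum)
  finally show ?thesis using b by (simp add: lindex_def)
qed

text \<open>The power of m + 1 bounds the number of nodes: an index has CARD('n) + 1 entries, each
  at most m.\<close>

lemma linterp_bound:
  fixes S :: "(real,'n::finite) vec set"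
  assumes S: "is_simplex S" and m: "1 \<le> m" and x: "x \<in> convex hull S"
    and g: "\<And>y. y \<in> lnodes S m \<Longrightarrow> \<bar>g y\<bar> \<le> K"
  shows "\<bar>linterp S m g x\<bar> \<le> real (m + 1) ^ (CARD('n) + 1) * real m ^ m * K"
proof -
  note card = lindex_card[OF is_simplexD(1)[OF S], of m]
  obtain \<beta>0 where "\<beta>0 \<in> lnodes S m"
  proof -
    obtain v where v: "v \<in> S" using is_simplexD(4)[OF S] by blast
    have "(\<Sum>w\<in>S. if w = v then m else 0) = m" using v is_simplexD(1)[OF S] by simp
    then show ?thesis using that unfolding lnodes_def by blast
  qed
  then have K: "0 \<le> K" using g abs_ge_zero order_trans by blast
  have "\<bar>linterp S m g x\<bar> \<le> (\<Sum>\<beta>\<in>lindex S m. \<bar>g (lnode S m \<beta>) * lbasis S m \<beta> x\<bar>)"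
    unfolding linterp_eq[OF S m] by (rule sum_abs)
  also have "\<dots> \<le> (\<Sum>\<beta>\<in>lindex S m. K * real m ^ m)"
  proof (rule sum_mono)
    fix \<beta> assume b: "\<beta> \<in> lindex S m"
    then have "lnode S m \<beta> \<in> lnodes S m" unfolding lnodes_eq by blast
    then show "\<bar>g (lnode S m \<beta>) * lbasis S m \<beta> x\<bar> \<le> K * real m ^ m"
      unfolding abs_mult by (intro mult_mono g lbasis_bound[OF S b x] K) auto
  qed
  also have "\<dots> = real (card (lindex S m)) * (K * real m ^ m)" by simp
  also have "\<dots> \<le> real ((m + 1) ^ card S) * (K * real m ^ m)"
    using card(2) K by (intro mult_right_mono of_nat_mono) auto
  finally show ?thesis by (simp only: is_simplexD(2)[OF S] of_nat_power mult_ac)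
qed

section \<open>Scale invariant inequalities for polynomials on simplices\<close>

text \<open>The supremum over K is a seminorm on X and inherits the bound from
  \<open>seminorm_le_semi_inner\<close>; the hypothesis \<open>bdd\<close> makes this supremum
  meaningful.\<close>

lemma uniform_functional_bound:
  fixes L :: "'k \<Rightarrow> 'a::real_vector \<Rightarrow> real"
  assumes X: "subspace X" "finite_dimensional X" and b: "semi_inner_on X b"
    and L: "\<And>x. x \<in> K \<Longrightarrow> linear_functional_on X (L x)"
    and bdd: "\<And>p. p \<in> X \<Longrightarrow> \<exists>B. \<forall>x\<in>K. \<bar>L x p\<bar> \<le> B"
    and null: "\<And>p x. p \<in> X \<Longrightarrow> b p p = 0 \<Longrightarrow> x \<in> K \<Longrightarrow> L x p = 0"
  shows "\<exists>C\<ge>0. \<forall>p\<in>X. \<forall>x\<in>K. \<bar>L x p\<bar> \<le> C * sqrt (b p p)"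
proof (cases "K = {}")
  case False
  obtain B where B: "finite B" "X = span B" "B \<subseteq> X"
    by (rule finite_dimensional_subspace_span[OF X(2,1)])
  define N where "N p = (SUP x\<in>K. \<bar>L x p\<bar>)" for p
  have bd: "bdd_above ((\<lambda>x. \<bar>L x p\<bar>) ` K)" if "p \<in> X" for p
    using bdd[OF that] by (auto simp: bdd_above_def)
  have up: "\<bar>L x p\<bar> \<le> N p" if "p \<in> X" "x \<in> K" for p x
    unfolding N_def by (rule cSUP_upper[OF that(2) bd[OF that(1)]])
  have least: "N p \<le> c" if "\<And>x. x \<in> K \<Longrightarrow> \<bar>L x p\<bar> \<le> c" for p c
    unfolding N_def by (rule cSUP_least[OF False that])
  have sc: "N (c *\<^sub>R p) \<le> \<bar>c\<bar> * N p" if p: "p \<in> X" for c p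
  proof (rule least)
    fix x assume x: "x \<in> K"
    have "L x (c *\<^sub>R p) = c * L x p" by (rule linear_functional_on_scale[OF L[OF x] p])
    then show "\<bar>L x (c *\<^sub>R p)\<bar> \<le> \<bar>c\<bar> * N p" using up[OF p x] by (simp add: abs_mult mult_left_mono)
  qed
  have "seminorm_on X N"
    unfolding seminorm_on_def
  proof (intro conjI ballI allI)
    fix p q assume pq: "p \<in> X" "q \<in> X"
    show "N (p + q) \<le> N p + N q"
    proof (rule least)
      fix x assume x: "x \<in> K"
      have "L x (p + q) = L x p + L x q" by (rule linear_functional_on_add[OF L[OF x] pq])
      then show "\<bar>L x (p + q)\<bar> \<le> N p + N q" using up[OF pq(1) x] up[OF pq(2) x] by linarith
    qed
  next
    fix c p assume p: "p \<in> X"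
    show "N (c *\<^sub>R p) = \<bar>c\<bar> * N p"
    proof (cases "c = 0")
      case True
      have "L x 0 = 0" if "x \<in> K" for x by (rule linear_functional_on_zero[OF L[OF that] subspace_0[OF X(1)]])
      then have "N 0 \<le> 0" by (intro least) auto
      moreover obtain x where "x \<in> K" using False by blast
      then have "0 \<le> N 0" using up[OF subspace_0[OF X(1)]] abs_ge_zero order_trans by blast
      ultimately show ?thesis using True by simp
    next
      case False
      have cp: "c *\<^sub>R p \<in> X" by (rule subspace_scale[OF X(1) p])
      have "N p = N ((1 / c) *\<^sub>R (c *\<^sub>R p))" using False by simp
      also have "\<dots> \<le> \<bar>1 / c\<bar> * N (c *\<^sub>R p)" by (rule sc[OF cp])
      finally have "\<bar>c\<bar> * N p \<le> N (c *\<^sub>R p)" using False by (simp add: field_simps)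
      then show ?thesis using sc[OF p, of c] by simp
    qed
  qed
  moreover have "N p = 0" if p: "p \<in> X" "b p p = 0" for p
  proof -
    have "N p \<le> 0" by (rule least) (use null[OF p] in simp)
    moreover obtain x where "x \<in> K" using False by blast
    then have "0 \<le> N p" using up[OF p(1)] abs_ge_zero order_trans by blast
    ultimately show ?thesis by simp
  qed
  ultimately obtain C where C: "C \<ge> 0" "\<And>p. p \<in> X \<Longrightarrow> N p \<le> C * sqrt (b p p)"
    using seminorm_le_semi_inner[OF B(1), of b N] b B(2) by blast
  then show ?thesis using up by (meson order_trans)
qed auto

lemma polys_bounded:
  assumes "is_simplex S" "p \<in> polys m" shows "\<exists>B. \<forall>x\<in>convex hull S. \<bar>p x\<bar> \<le> B"
proof -
  have "bounded (p ` (convex hull S))"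
    by (intro compact_imp_bounded compact_continuous_image simplex_compact assms polys_continuous[OF assms(2)])
  then show ?thesis by (auto simp: bounded_iff)
qed

text \<open>Used with T the identity or a radial derivative, and with w a barycentric coordinate or
  1.\<close>

lemma semi_inner_savg:
  fixes S :: "(real,'a::finite) vec set"
    and T :: "((real,'a) vec \<Rightarrow> real) \<Rightarrow> (real,'a) vec \<Rightarrow> real"
  assumes S: "is_simplex S" and w: "w \<in> polys a" "\<And>x. x \<in> convex hull S \<Longrightarrow> 0 \<le> w x"
    and T: "\<And>p. p \<in> polys m \<Longrightarrow> T p \<in> polys m"
      "\<And>p q x. p \<in> polys m \<Longrightarrow> q \<in> polys m \<Longrightarrow> T (p + q) x = T p x + T q x"
      "\<And>c p x. p \<in> polys m \<Longrightarrow> T (c *\<^sub>R p) x = c * T p x"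
  shows "semi_inner_on (polys m) (\<lambda>p q. savg S (\<lambda>x. w x * (T p x * T q x)))"
    and "(\<And>x. x \<in> simplex_inner S \<Longrightarrow> 0 < w x) \<Longrightarrow> p \<in> polys m \<Longrightarrow>
      savg S (\<lambda>x. w x * (T p x * T p x)) = 0 \<Longrightarrow> T p = (\<lambda>_. 0)"
proof -
  have c: "continuous_on UNIV (\<lambda>x. w x * (T p x * T q x))" if "p \<in> polys m" "q \<in> polys m" for p q
    by (intro continuous_intros polys_continuous[OF w(1)] polys_continuous[OF T(1)] that)
  note v = svol_pos[OF S]
  show "semi_inner_on (polys m) (\<lambda>p q. savg S (\<lambda>x. w x * (T p x * T q x)))"
    unfolding semi_inner_on_def linear_functional_on_def
  proof (intro conjI ballI allI)
    fix p q r :: "(real,'a) vec \<Rightarrow> real" and s assume p: "p \<in> polys m" and q: "q \<in> polys m" and r: "r \<in> polys m"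
    have "(\<lambda>x. w x * (T p x * T (q + r) x)) = (\<lambda>x. w x * (T p x * T q x) + w x * (T p x * T r x))"
      by (auto simp: T(2)[OF q r] algebra_simps)
    then show "savg S (\<lambda>x. w x * (T p x * T (q + r) x)) = savg S (\<lambda>x. w x * (T p x * T q x)) + savg S (\<lambda>x. w x * (T p x * T r x))"
      unfolding savg_def using sint_add[OF S c[OF p q] c[OF p r]] by (simp add: add_divide_distrib)
  next
    fix p q :: "(real,'a) vec \<Rightarrow> real" and s assume p: "p \<in> polys m" and q: "q \<in> polys m"
    have "(\<lambda>x. w x * (T p x * T (s *\<^sub>R q) x)) = (\<lambda>x. s * (w x * (T p x * T q x)))"
      by (auto simp: T(3)[OF q] algebra_simps)
    then show "savg S (\<lambda>x. w x * (T p x * T (s *\<^sub>R q) x)) = s * savg S (\<lambda>x. w x * (T p x * T q x))"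
      by (simp add: savg_def)
  next
    fix p q :: "(real,'a) vec \<Rightarrow> real"
    show "savg S (\<lambda>x. w x * (T p x * T q x)) = savg S (\<lambda>x. w x * (T q x * T p x))" by (simp add: mult.commute)
  next
    fix p :: "(real,'a) vec \<Rightarrow> real" assume p: "p \<in> polys m"
    have "0 \<le> sint S (\<lambda>x. w x * (T p x * T p x))" by (rule sint_nonneg[OF S c[OF p p]]) (simp add: w(2))
    then show "0 \<le> savg S (\<lambda>x. w x * (T p x * T p x))" using v by (simp add: savg_def)
  qed
  assume pos: "\<And>x. x \<in> simplex_inner S \<Longrightarrow> 0 < w x" and p: "p \<in> polys m"
    and z: "savg S (\<lambda>x. w x * (T p x * T p x)) = 0"
  have s0: "sint S (\<lambda>x. w x * (T p x * T p x)) = 0" using z v by (simp add: savg_def)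
  have "T p x = 0" if x: "x \<in> simplex_inner S" for x
  proof -
    have "w x * (T p x * T p x) = 0"
      by (rule LINT_nonneg_zero[OF S c[OF p p] _ s0 x]) (simp add: w(2))
    then show ?thesis using pos[OF x] by simp
  qed
  then show "T p = (\<lambda>_. 0)"
    using polys_zero_if_zero_on_open[OF T(1)[OF p] simplex_inner_open[OF S]] simplex_inner_center[OF S] by blast
qed

text \<open>At parameter s > 0 on the ray, s times the derivative along the ray is the radial
  derivative at that point, so p is constant from v to x.\<close>

lemma rad_zero_const:
  assumes p: "p \<in> polys m" and z: "\<And>x. rad v p x = 0" shows "p x = p v"
proof -
  let ?f = "\<lambda>s. p (v + s *\<^sub>R (x - v))"
  have "(?f has_real_derivative 0) (at s)" if "0 < s" for s
  proof -
    have "s * (pgrad p (v + s *\<^sub>R (x - v)) \<bullet> (x - v)) = rad v p (v + s *\<^sub>R (x - v))"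
      by (simp add: rad_polys_eq[OF p])
    then have "pgrad p (v + s *\<^sub>R (x - v)) \<bullet> (x - v) = 0" using z that by simp
    then show ?thesis using rad_has_derivative[OF p, of v x s] by simp
  qed
  moreover have "continuous_on {0..1} ?f"
    using rad_has_derivative[OF p, of v x] by (intro continuous_at_imp_continuous_on ballI) (blast intro: DERIV_isCont)
  ultimately have "?f 1 = ?f 0" by (intro DERIV_isconst_end[of 0 1 ?f]) auto
  then show ?thesis by simp
qed

text \<open>What is used of an affine map from the reference simplex that takes the origin to v: it
  transports averages, the coordinate of v and radial derivatives about v, the only ingredients of
  the three inequalities below.\<close>

definition ref_map :: "(real,'n::finite) vec set \<Rightarrow> (real,'n) vec \<Rightarrow> ((real,'n) vec \<Rightarrow> (real,'n) vec) \<Rightarrow> bool" where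
  "ref_map S v A \<longleftrightarrow> (\<forall>i. (\<lambda>x. A x $ i) \<in> polys 1) \<and> A ` (convex hull ref_simplex) = convex hull S \<and> A 0 = v \<and>
     (\<forall>f. continuous_on UNIV f \<longrightarrow> savg S f = savg ref_simplex (\<lambda>x. f (A x))) \<and>
     (\<forall>x. bary S v (A x) = bary ref_simplex 0 x) \<and> (\<forall>p x. rad v p (A x) = rad 0 (\<lambda>x. p (A x)) x)"

lemma ref_mapD:
  assumes "ref_map S v A"
  shows "(\<lambda>x. A x $ i) \<in> polys 1" "A ` (convex hull ref_simplex) = convex hull S" "A 0 = v"
    "continuous_on UNIV f \<Longrightarrow> savg S f = savg ref_simplex (\<lambda>x. f (A x))"
    "bary S v (A x) = bary ref_simplex 0 x" "rad v p (A x) = rad 0 (\<lambda>x. p (A x)) x"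
  using assms unfolding ref_map_def by blast+

lemma ref_map_exists:
  fixes S :: "(real,'n::finite) vec set"
  assumes S: "is_simplex S" and v: "v \<in> S"
  shows "\<exists>A. ref_map S v A"
proof -
  note R = ref_simplex[where 'n='n]
  have z: "0 \<in> (ref_simplex :: (real,'n) vec set)" by (simp add: ref_simplex_def)
  obtain e :: "(real,'n) vec \<Rightarrow> (real,'n) vec" where e: "bij_betw e ref_simplex S" "e 0 = v"
    by (rule ref_simplex_bij[OF S v])
  let ?A = "smap ref_simplex e"
  have "ref_map S v ?A"
    unfolding ref_map_def
  proof (intro conjI allI impI)
    show "savg S f = savg ref_simplex (\<lambda>x. f (?A x))" if "continuous_on UNIV f" for f
      by (rule savg_smap[OF R S e(1) continuous_on_subset[OF that]]) simp
    show "?A 0 = v" using smap_vertex[OF R z, of e] e(2) by simp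
    show "bary S v (?A x) = bary ref_simplex 0 x" for x using bary_smap[OF R S e(1) z] e(2) by simp
    show "rad v p (?A x) = rad 0 (\<lambda>x. p (?A x)) x" for p x using rad_smap[OF R z, of e p] e(2) by simp
    show "(\<lambda>x. ?A x $ i) \<in> polys 1" for i by (rule smap_polys[OF R])
    show "?A ` (convex hull ref_simplex) = convex hull S" by (rule smap_hull[OF R S e(1)])
  qed
  then show ?thesis by blast
qed

lemma zero_in_ref_simplex: "0 \<in> ref_simplex" by (simp add: ref_simplex_def)

lemma bary_nonneg: "is_simplex S \<Longrightarrow> x \<in> convex hull S \<Longrightarrow> 0 \<le> bary S v x"
  using simplex_hull_iff[of S x] bary_props(1)[of S v x] by (cases "v \<in> S") auto

text \<open>On the reference simplex, zero weighted energy forces the radial derivative to vanish,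
  and then p is constant along the rays from the vertex. The constant survives the affine map
  because every ingredient is transported.\<close>

lemma oscillation_bound:
  "\<exists>C\<ge>0. \<forall>(S :: (real,'n::finite) vec set) v p x. is_simplex S \<and> v \<in> S \<and> p \<in> polys m \<and> x \<in> convex hull S \<longrightarrow>
     \<bar>p x - p v\<bar> \<le> C * sqrt (savg S (\<lambda>x. bary S v x * (rad v p x * rad v p x)))"
proof -
  let ?R = "ref_simplex :: (real,'n) vec set"
  note R = ref_simplex[where 'n='n] and z = zero_in_ref_simplex[where 'a='n]
  have T: "rad 0 p \<in> polys m" "rad 0 (p + q) x = rad 0 p x + rad 0 q x" "rad 0 (c *\<^sub>R p) x = c * rad 0 p x"
    if "p \<in> polys m" "q \<in> polys m" for p q :: "(real,'n) vec \<Rightarrow> real" and c x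
    using rad_polys[OF that(1)] rad_add[OF that] rad_cmult[OF that(1)]
    by (auto simp: plus_fun_def scaleR_fun_def)
  note w = bary_polys[OF R, of 0] bary_nonneg[OF R, of _ 0]
  have "\<exists>C\<ge>0. \<forall>p\<in>polys m. \<forall>x\<in>convex hull ?R.
      \<bar>p x - p 0\<bar> \<le> C * sqrt (savg ?R (\<lambda>x. bary ?R 0 x * (rad 0 p x * rad 0 p x)))"
  proof (rule uniform_functional_bound[OF polys_subspace finite_dimensional_polys,
        where L="\<lambda>x p. p x - p 0" and b="\<lambda>p q. savg ?R (\<lambda>x. bary ?R 0 x * (rad 0 p x * rad 0 q x))"])
    show "semi_inner_on (polys m) (\<lambda>p q. savg ?R (\<lambda>x. bary ?R 0 x * (rad 0 p x * rad 0 q x)))"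
      by (rule semi_inner_savg(1)[OF R w]) (use T in blast)+
    show "linear_functional_on (polys m) (\<lambda>p. p x - p 0)" for x :: "(real,'n) vec"
      by (auto simp: linear_functional_on_def algebra_simps)
    show "\<exists>B. \<forall>x\<in>convex hull ?R. \<bar>p x - p 0\<bar> \<le> B" if p: "p \<in> polys m" for p
    proof -
      have "(\<lambda>x. p x - p 0) \<in> polys (max m 0)" by (intro polys_diff polys_const polys_mono[OF p]) auto
      then show ?thesis using polys_bounded[OF R] by blast
    qed
    show "p x - p 0 = 0" if p: "p \<in> polys m" and 0: "savg ?R (\<lambda>x. bary ?R 0 x * (rad 0 p x * rad 0 p x)) = 0" for p x
    proof -
      have "rad 0 p = (\<lambda>_. 0)"
        by (rule semi_inner_savg(2)[where T="rad 0" and p=p, OF R w _ _ _ _ p 0]) (use T z in \<open>auto simp: simplex_inner_def\<close>)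
      then show ?thesis using rad_zero_const[OF p, of 0 x] by simp
    qed
  qed
  then obtain C where C: "C \<ge> 0" "\<And>p x. p \<in> polys m \<Longrightarrow> x \<in> convex hull ?R \<Longrightarrow>
      \<bar>p x - p 0\<bar> \<le> C * sqrt (savg ?R (\<lambda>x. bary ?R 0 x * (rad 0 p x * rad 0 p x)))" by blast
  have "\<bar>p x - p v\<bar> \<le> C * sqrt (savg S (\<lambda>x. bary S v x * (rad v p x * rad v p x)))"
    if S: "is_simplex S" and v: "v \<in> S" and p: "p \<in> polys m" and x: "x \<in> convex hull S"
    for S :: "(real,'n) vec set" and v p x
  proof -
    obtain A where "ref_map S v A" using ref_map_exists[OF S v] by blast
    note A = ref_mapD[OF this]
    obtain t where t: "t \<in> convex hull ?R" "x = A t" using x A(2) by blast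
    have c: "continuous_on UNIV (\<lambda>x. bary S v x * (rad v p x * rad v p x))"
      by (intro continuous_intros bary_continuous[OF S] polys_continuous[OF rad_polys[OF p]])
    show ?thesis using C(2)[OF polys_compose[OF p A(1)] t(1)]
      by (simp add: A(4)[OF c] A(3,5,6) t(2))
  qed
  then show ?thesis using C(1) by blast
qed

text \<open>The weight is positive inside the simplex, so the weighted average of p^2 is still
  definite on polynomials.\<close>

lemma weighted_sup_bound:
  "\<exists>C\<ge>0. \<forall>(S :: (real,'n::finite) vec set) v p x. is_simplex S \<and> v \<in> S \<and> p \<in> polys m \<and> x \<in> convex hull S \<longrightarrow>
     \<bar>p x\<bar> \<le> C * sqrt (savg S (\<lambda>x. bary S v x * (p x * p x)))"
proof -
  let ?R = "ref_simplex :: (real,'n) vec set"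
  note R = ref_simplex[where 'n='n] and z = zero_in_ref_simplex[where 'a='n]
  note w = bary_polys[OF R, of 0] bary_nonneg[OF R, of _ 0]
  have "\<exists>C\<ge>0. \<forall>p\<in>polys m. \<forall>x\<in>convex hull ?R.
      \<bar>p x\<bar> \<le> C * sqrt (savg ?R (\<lambda>x. bary ?R 0 x * (p x * p x)))"
  proof (rule uniform_functional_bound[OF polys_subspace finite_dimensional_polys,
        where L="\<lambda>x p. p x" and b="\<lambda>p q. savg ?R (\<lambda>x. bary ?R 0 x * (p x * q x))"])
    show "semi_inner_on (polys m) (\<lambda>p q. savg ?R (\<lambda>x. bary ?R 0 x * (p x * q x)))"
      by (rule semi_inner_savg(1)[OF R w, where T="\<lambda>p. p"]) auto
    show "linear_functional_on (polys m) (\<lambda>p. p x)" for x :: "(real,'n) vec"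
      by (auto simp: linear_functional_on_def algebra_simps)
    show "\<exists>B. \<forall>x\<in>convex hull ?R. \<bar>p x\<bar> \<le> B" if "p \<in> polys m" for p by (rule polys_bounded[OF R that])
    show "p x = 0" if p: "p \<in> polys m" and 0: "savg ?R (\<lambda>x. bary ?R 0 x * (p x * p x)) = 0" for p x
    proof -
      have "p = (\<lambda>_. 0)"
        by (rule semi_inner_savg(2)[where T="\<lambda>p. p" and p=p, OF R w _ _ _ _ p 0]) (use z in \<open>auto simp: simplex_inner_def\<close>)
      then show ?thesis by simp
    qed
  qed
  then obtain C where C: "C \<ge> 0" "\<And>p x. p \<in> polys m \<Longrightarrow> x \<in> convex hull ?R \<Longrightarrow>
      \<bar>p x\<bar> \<le> C * sqrt (savg ?R (\<lambda>x. bary ?R 0 x * (p x * p x)))" by blast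
  have "\<bar>p x\<bar> \<le> C * sqrt (savg S (\<lambda>x. bary S v x * (p x * p x)))"
    if S: "is_simplex S" and v: "v \<in> S" and p: "p \<in> polys m" and x: "x \<in> convex hull S"
    for S :: "(real,'n) vec set" and v p x
  proof -
    obtain A where "ref_map S v A" using ref_map_exists[OF S v] by blast
    note A = ref_mapD[OF this]
    obtain t where t: "t \<in> convex hull ?R" "x = A t" using x A(2) by blast
    have c: "continuous_on UNIV (\<lambda>x. bary S v x * (p x * p x))"
      by (intro continuous_intros bary_continuous[OF S] polys_continuous[OF p])
    show ?thesis using C(2)[OF polys_compose[OF p A(1)] t(1)]
      by (simp add: A(4)[OF c] A(5) t(2))
  qed
  then show ?thesis using C(1) by blast
qed

text \<open>An inverse estimate without a power of the diameter, because the radial derivative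
  carries the factor x - v.\<close>

lemma radial_inverse_bound:
  "\<exists>C\<ge>0. \<forall>(S :: (real,'n::finite) vec set) v p x B. is_simplex S \<and> v \<in> S \<and> p \<in> polys m \<and> x \<in> convex hull S \<and>
     (\<forall>y\<in>convex hull S. \<bar>p y\<bar> \<le> B) \<longrightarrow> \<bar>rad v p x\<bar> \<le> C * B"
proof -
  let ?R = "ref_simplex :: (real,'n) vec set"
  note R = ref_simplex[where 'n='n]
  have w: "(\<lambda>_. 1) \<in> polys 0" "\<And>x. x \<in> convex hull ?R \<Longrightarrow> 0 \<le> (1::real)" by (auto intro: polys_const)
  have "\<exists>C\<ge>0. \<forall>p\<in>polys m. \<forall>x\<in>convex hull ?R.
      \<bar>rad 0 p x\<bar> \<le> C * sqrt (savg ?R (\<lambda>x. 1 * (p x * p x)))"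
  proof (rule uniform_functional_bound[OF polys_subspace finite_dimensional_polys,
        where L="\<lambda>x p. rad 0 p x" and b="\<lambda>p q. savg ?R (\<lambda>x. 1 * (p x * q x))"])
    show "semi_inner_on (polys m) (\<lambda>p q. savg ?R (\<lambda>x. 1 * (p x * q x)))"
      by (rule semi_inner_savg(1)[OF R w, where T="\<lambda>p. p"]) auto
    show "linear_functional_on (polys m) (\<lambda>p. rad 0 p x)" for x :: "(real,'n) vec"
      using rad_add[of _ m _ 0 x] rad_cmult[of _ m 0 _ x]
      by (auto simp: linear_functional_on_def plus_fun_def scaleR_fun_def)
    show "\<exists>B. \<forall>x\<in>convex hull ?R. \<bar>rad 0 p x\<bar> \<le> B" if "p \<in> polys m" for p
      by (rule polys_bounded[OF R rad_polys[OF that]])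
    show "rad 0 p x = 0" if p: "p \<in> polys m" and 0: "savg ?R (\<lambda>x. 1 * (p x * p x)) = 0" for p x
    proof -
      have "p = (\<lambda>_. 0)" by (rule semi_inner_savg(2)[where T="\<lambda>p. p" and p=p, OF R w _ _ _ _ p 0]) auto
      then show ?thesis by (simp add: rad_def)
    qed
  qed
  then obtain C where C: "C \<ge> 0" "\<And>p x. p \<in> polys m \<Longrightarrow> x \<in> convex hull ?R \<Longrightarrow>
      \<bar>rad 0 p x\<bar> \<le> C * sqrt (savg ?R (\<lambda>x. 1 * (p x * p x)))" by blast
  have "\<bar>rad v p x\<bar> \<le> C * B"
    if S: "is_simplex S" and v: "v \<in> S" and p: "p \<in> polys m" and x: "x \<in> convex hull S"
      and B: "\<forall>y\<in>convex hull S. \<bar>p y\<bar> \<le> B"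
    for S :: "(real,'n) vec set" and v p x B
  proof -
    obtain A where "ref_map S v A" using ref_map_exists[OF S v] by blast
    note A = ref_mapD[OF this]
    obtain t where t: "t \<in> convex hull ?R" "x = A t" using x A(2) by blast
    have B0: "0 \<le> B" using B x abs_ge_zero order_trans by blast
    have cp: "continuous_on UNIV p" by (rule polys_continuous[OF p])
    have c: "continuous_on UNIV (\<lambda>x. 1 * (p x * p x))" by (intro continuous_intros cp)
    have "sint S (\<lambda>x. 1 * (p x * p x)) \<le> sint S (\<lambda>x. B\<^sup>2)"
      by (rule sint_mono[OF S c continuous_on_const])
         (use B in \<open>auto simp: power2_eq_square[symmetric] abs_le_square_iff[symmetric] B0\<close>)
    then have "savg S (\<lambda>x. 1 * (p x * p x)) \<le> B\<^sup>2"
      unfolding savg_def sint_const[OF S] using svol_pos[OF S] by (simp add: pos_divide_le_eq)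
    then have "sqrt (savg S (\<lambda>x. 1 * (p x * p x))) \<le> B" using B0 real_le_lsqrt real_sqrt_le_iff by (metis real_sqrt_abs abs_of_nonneg)
    then have "C * sqrt (savg S (\<lambda>x. 1 * (p x * p x))) \<le> C * B" using C(1) by (rule mult_left_mono)
    moreover have "\<bar>rad v p x\<bar> \<le> C * sqrt (savg S (\<lambda>x. 1 * (p x * p x)))"
      using C(2)[OF polys_compose[OF p A(1)] t(1)] by (simp only: A(4)[OF c] A(6) t(2))
    ultimately show ?thesis by linarith
  qed
  then show ?thesis using C(1) by blast
qed

section \<open>Geometry of vertex patches\<close>

definition conforming :: "(real,'n::finite) vec set set \<Rightarrow> bool" where
  "conforming M \<longleftrightarrow> finite M \<and> (\<forall>S\<in>M. is_simplex S) \<and>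
     (\<forall>S\<in>M. \<forall>S'\<in>M. convex hull S \<inter> convex hull S' = convex hull (S \<inter> S'))"

lemma conformingD:
  assumes "conforming M"
  shows "finite M" "S \<in> M \<Longrightarrow> is_simplex S"
    "S \<in> M \<Longrightarrow> S' \<in> M \<Longrightarrow> convex hull S \<inter> convex hull S' = convex hull (S \<inter> S')"
  using assms unfolding conforming_def by auto

section \<open>Two simplices on a common facet, and the frontier of a mesh\<close>

lemma bary_positive_nearby:
  assumes S: "is_simplex S" and "finite F" "\<And>u. u \<in> F \<Longrightarrow> 0 < bary S u c"
  shows "\<exists>e>0. \<forall>s u. 0 \<le> s \<longrightarrow> s < e \<longrightarrow> u \<in> F \<longrightarrow> 0 < bary S u (c + s *\<^sub>R (y - c))"
proof -
  define U where "U = (\<Inter>u\<in>F. {s::real. 0 < (1 - s) * bary S u c + s * bary S u y})"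
  have "open U" unfolding U_def by (intro open_INT assms(2) ballI open_Collect_less continuous_intros)
  moreover have "0 \<in> U" using assms(3) by (auto simp: U_def)
  ultimately obtain e where e: "e > 0" "ball 0 e \<subseteq> U" using open_contains_ball by blast
  show ?thesis
  proof (intro exI[of _ e] conjI allI impI e(1))
    fix s u assume "0 \<le> s" "s < e" "u \<in> F"
    then have "s \<in> U" by (intro subsetD[OF e(2)]) simp
    then show "0 < bary S u (c + s *\<^sub>R (y - c))" using \<open>u \<in> F\<close> by (simp add: U_def bary_affine2[OF S])
  qed
qed

lemma facet_nonempty:
  fixes F :: "(real,'n::finite) vec set"
  assumes "is_simplex (insert v F)" "v \<notin> F"
  shows "F \<noteq> {}" "finite F" "card F = CARD('n)"
proof -
  show "finite F" "card F = CARD('n)" using is_simplexD(1,2)[OF assms(1)] assms(2) by auto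
  then show "F \<noteq> {}" by (metis card.empty zero_less_card_finite less_irrefl)
qed

lemma face_center_bary:
  assumes "is_simplex (insert v F)" "v \<notin> F"
  shows "bary (insert v F) v (face_center F) = 0" "u \<in> F \<Longrightarrow> 0 < bary (insert v F) u (face_center F)"
  using bary_face_center[OF assms(1) subset_insertI facet_nonempty(1)[OF assms]] facet_nonempty[OF assms] assms(2)
  by (auto simp: card_gt_0_iff)

text \<open>If v' were not strictly on the other side, a short step from the centre of F towards v'
  would lie in both simplices, hence by conformity in F, where the coordinate of v'
  vanishes.\<close>

lemma neighbours_opposite:
  assumes M: "conforming M" "insert v F \<in> M" "insert v' F \<in> M" and v: "v \<notin> F" "v' \<notin> F" "v \<noteq> v'"
  shows "bary (insert v F) v v' < 0"
proof (rule ccontr)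
  let ?S = "insert v F" and ?S' = "insert v' F"
  note S = conformingD(2)[OF M(1,2)] and S' = conformingD(2)[OF M(1,3)]
  define c where "c = face_center F"
  assume "\<not> bary ?S v v' < 0"
  then have b: "0 \<le> bary ?S v v'" by simp
  note cb = face_center_bary[OF S v(1), folded c_def]
  obtain e where e: "0 < e" "\<And>s u. 0 \<le> s \<Longrightarrow> s < e \<Longrightarrow> u \<in> F \<Longrightarrow> 0 < bary ?S u (c + s *\<^sub>R (v' - c))"
    using bary_positive_nearby[OF S facet_nonempty(2)[OF S v(1)] cb(2), of v'] by blast
  define s where "s = min (e / 2) 1"
  have s: "0 < s" "s < e" "s \<le> 1" using e(1) by (auto simp: s_def)
  define x where "x = c + s *\<^sub>R (v' - c)"
  have "0 \<le> bary ?S u x" if "u \<in> ?S" for u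
  proof (cases "u = v")
    case True
    then show ?thesis using b s cb(1) by (simp add: x_def bary_affine2[OF S])
  next
    case False
    then show ?thesis using that e(2)[of s u] s by (simp add: x_def)
  qed
  then have "x \<in> convex hull ?S" by (simp add: simplex_hull_iff[OF S])
  moreover have "x \<in> convex hull ?S'"
  proof -
    have "c \<in> convex hull ?S'"
      using face_center_hull[OF S' subset_insertI facet_nonempty(1)[OF S v(1)]] hull_mono[OF subset_insertI[of F v']]
      unfolding c_def by blast
    moreover have "v' \<in> convex hull ?S'" by (simp add: hull_inc)
    moreover have "x = (1 - s) *\<^sub>R c + s *\<^sub>R v'" by (simp add: x_def algebra_simps)
    ultimately show ?thesis using convexD_alt[OF convex_convex_hull] s by (metis less_imp_le)
  qed
  moreover have "?S \<inter> ?S' = F" using v by auto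
  ultimately have "x \<in> convex hull F" using conformingD(3)[OF M] by auto
  then have "bary ?S' v' x = 0" using simplex_face_iff[OF S' subset_insertI, of x] v(2) by auto
  moreover have "bary ?S' v' x = s"
    using face_center_bary(1)[OF S' v(2)] bary_vertex[OF S', of v' v'] by (simp add: x_def c_def bary_affine2[OF S'])
  ultimately show False using s by simp
qed

text \<open>Three different apexes would lie pairwise on opposite sides of one plane; the signs of
  the coordinates contradict each other.\<close>

lemma neighbour_unique:
  assumes M: "conforming M" "insert v F \<in> M" "insert v1 F \<in> M" "insert v2 F \<in> M"
    and v: "v \<notin> F" "v1 \<notin> F" "v2 \<notin> F" "v1 \<noteq> v" "v2 \<noteq> v"
  shows "v1 = v2"
proof (rule ccontr)
  assume n: "v1 \<noteq> v2"
  note S = conformingD(2)[OF M(1)]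
  have 1: "bary (insert v F) v v1 < 0" "bary (insert v F) v v2 < 0"
    using neighbours_opposite[OF M(1,2)] M v by blast+
  have "bary (insert v1 F) v1 v2 = bary (insert v F) v v2 / bary (insert v F) v v1"
    by (rule bary_neighbour(1)[OF S[OF M(2)] S[OF M(3)] v(1,2)]) (use 1 in simp)
  moreover have "bary (insert v1 F) v1 v2 < 0" using neighbours_opposite[OF M(1,3,4) v(2,3) n] .
  ultimately show False using 1 by (simp add: divide_less_0_iff)
qed

lemma union_hull_closed: "conforming M \<Longrightarrow> N \<subseteq> M \<Longrightarrow> closed (\<Union>S\<in>N. convex hull S)"
  by (auto intro!: closed_UN compact_imp_closed simplex_compact dest: conformingD(1,2) finite_subset)

text \<open>If x were interior, a nearby point y of F shifted towards the centre of F would be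
  interior too. By conformity y lies in no other simplex, so a whole neighbourhood of y would belong
  to this one, although the coordinate of v is 0 at y.\<close>

lemma unshared_facet_in_frontier:
  assumes M: "conforming M" "insert v F \<in> M" and v: "v \<notin> F"
    and un: "\<And>S'. S' \<in> M \<Longrightarrow> F \<subseteq> S' \<Longrightarrow> S' = insert v F"
  shows "convex hull F \<subseteq> frontier (\<Union>S\<in>M. convex hull S)"
proof
  let ?S = "insert v F" and ?W = "\<Union>S\<in>M. convex hull S"
  note S = conformingD(2)[OF M]
  note cb = face_center_bary[OF S v]
  fix x assume x: "x \<in> convex hull F"
  have xW: "x \<in> ?W" using x M(2) hull_mono[OF subset_insertI[of F v]] by blast
  have cl: "closed ?W" by (rule union_hull_closed[OF M(1) order_refl])
  have "x \<notin> interior ?W"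
  proof
    assume "x \<in> interior ?W"
    then obtain e where e: "e > 0" "ball x e \<subseteq> ?W" by (auto simp: mem_interior)
    define c where "c = face_center F"
    define s where "s = min (1/2) (e / (2 * (norm (c - x) + 1)))"
    have p: "norm (c - x) + 1 > 0" by (simp add: add_nonneg_pos)
    have s: "0 < s" "s \<le> 1/2" unfolding s_def using e p by (simp, intro min.cobounded1)
    have "s * norm (c - x) \<le> (e / (2 * (norm (c - x) + 1))) * (norm (c - x) + 1)"
      using s by (intro mult_mono) (auto simp: s_def e p less_imp_le)
    also have "\<dots> = e / 2" using p by (rule half_cancel)
    finally have n: "s * norm (c - x) < e" using e by simp
    define y where "y = x + s *\<^sub>R (c - x)"
    have yb: "y \<in> ball x e" using n s by (simp add: y_def dist_norm)
    have xF: "\<And>u. u \<in> ?S \<Longrightarrow> 0 \<le> bary ?S u x" "bary ?S v x = 0"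
      using x simplex_face_iff[OF S subset_insertI, of x] v by auto
    have y0: "bary ?S v y = 0" using xF(2) cb(1) by (simp add: y_def bary_affine2[OF S] c_def)
    have yp: "0 < bary ?S u y" if "u \<in> F" for u
      unfolding y_def bary_affine2[OF S] c_def using s cb(2)[OF that] xF(1)[of u] that
      by (intro add_nonneg_pos mult_pos_pos mult_nonneg_nonneg) auto
    have only: "y \<notin> convex hull S'" if S': "S' \<in> M - {?S}" for S'
    proof
      assume "y \<in> convex hull S'"
      moreover have "y \<in> convex hull ?S" using y0 yp by (auto simp: simplex_hull_iff[OF S] less_imp_le)
      ultimately have "y \<in> convex hull (?S \<inter> S')" using conformingD(3)[OF M(1,2)] S' by blast
      then have "\<forall>u\<in>?S - (?S \<inter> S'). bary ?S u y = 0" using simplex_face_iff[OF S, of "?S \<inter> S'" y] by blast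
      then have "F \<subseteq> S'" using yp by (metis DiffI IntE insertI2 less_irrefl subsetI)
      then show False using un S' by blast
    qed
    have "closed (\<Union>S\<in>M - {?S}. convex hull S)" by (rule union_hull_closed[OF M(1)]) auto
    then have "open (ball x e - (\<Union>S\<in>M - {?S}. convex hull S))" by (intro open_Diff) auto
    moreover have "ball x e - (\<Union>S\<in>M - {?S}. convex hull S) \<subseteq> convex hull ?S" using e(2) by blast
    moreover have "y \<in> ball x e - (\<Union>S\<in>M - {?S}. convex hull S)" using yb only by blast
    ultimately have "y \<in> interior (convex hull ?S)" by (meson interior_maximal subsetD)
    then have "0 < bary ?S v y" unfolding simplex_interior[OF S] by (simp add: simplex_inner_def)
    then show False using y0 by simp
  qed
  then show "x \<in> frontier ?W" using xW cl by (simp add: frontier_def)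
qed

text \<open>Near the centre of F the remaining coordinates are positive in both simplices, and the
  coordinates of v and v' have opposite signs, so the two simplices cover both sides.\<close>

lemma shared_facet_not_in_frontier:
  assumes M: "conforming M" "insert v F \<in> M" "insert v' F \<in> M" and v: "v \<notin> F" "v' \<notin> F" "v \<noteq> v'"
  shows "\<not> convex hull F \<subseteq> frontier (\<Union>S\<in>M. convex hull S)"
proof
  let ?S = "insert v F" and ?S' = "insert v' F" and ?W = "\<Union>S\<in>M. convex hull S"
  assume sub: "convex hull F \<subseteq> frontier ?W"
  note S = conformingD(2)[OF M(1,2)] and S' = conformingD(2)[OF M(1,3)]
  define c where "c = face_center F"
  have "c \<in> convex hull F" unfolding c_def by (rule face_center_hull[OF S subset_insertI facet_nonempty(1)[OF S v(1)]])
  then have cn: "c \<notin> interior ?W" using sub by (auto simp: frontier_def)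
  define N where "N = (\<Inter>u\<in>F. {x. 0 < bary ?S u x} \<inter> {x. 0 < bary ?S' u x})"
  have "open N" unfolding N_def
    by (intro open_INT facet_nonempty(2)[OF S v(1)] ballI open_Int open_Collect_less continuous_on_const
        bary_continuous[OF S] bary_continuous[OF S'])
  moreover have "c \<in> N" using face_center_bary(2)[OF S v(1)] face_center_bary(2)[OF S' v(2)] by (simp add: N_def c_def)
  moreover have "N \<subseteq> ?W"
  proof
    fix x assume x: "x \<in> N"
    have b: "bary ?S v v' < 0" by (rule neighbours_opposite[OF M v])
    have b': "bary ?S' v' x = bary ?S v x / bary ?S v v'"
      by (rule bary_neighbour(1)[OF S S' v(1,2)]) (use b in simp)
    have xF: "0 \<le> bary ?S u x" "0 \<le> bary ?S' u x" if "u \<in> F" for u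
      using x that unfolding N_def by (auto intro: less_imp_le)
    show "x \<in> ?W"
    proof (cases "0 \<le> bary ?S v x")
      case True
      then have "x \<in> convex hull ?S" unfolding simplex_hull_iff[OF S] using xF(1) by blast
      then show ?thesis using M(2) by blast
    next
      case False
      then have "0 \<le> bary ?S' v' x" unfolding b' using b by (simp add: zero_le_divide_iff)
      then have "x \<in> convex hull ?S'" unfolding simplex_hull_iff[OF S'] using xF(2) by blast
      then show ?thesis using M(3) by blast
    qed
  qed
  ultimately have "c \<in> interior ?W" by (meson interior_maximal subsetD)
  then show False using cn by blast
qed

subsection \<open>Facet connectedness of a patch in a Lipschitz domain\<close>

text \<open>At a boundary point the domain lies below a Lipschitz graph. Pushing points near V down
  by t leads into one ball below the graph, so the segments described on the way and the ball form a
  connected set.\<close>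

lemma lipschitz_locally_connected:
  fixes \<Omega> :: "(real,'n::finite) vec set"
  assumes op: "open \<Omega>" and lip: "lipschitz_boundary \<Omega>" and V: "V \<in> closure \<Omega>" and \<epsilon>: "0 < \<epsilon>"
  obtains \<delta> C where "0 < \<delta>" "connected C" "\<Omega> \<inter> ball V \<delta> \<subseteq> C" "C \<subseteq> \<Omega> \<inter> ball V \<epsilon>"
proof (cases "V \<in> \<Omega>")
  case True
  then obtain r where r: "r > 0" "ball V r \<subseteq> \<Omega>" using op open_contains_ball by blast
  have "ball V (min r \<epsilon>) \<subseteq> ball V r" "ball V (min r \<epsilon>) \<subseteq> ball V \<epsilon>" by auto
  then show ?thesis using r \<epsilon> by (intro that[of "min r \<epsilon>" "ball V (min r \<epsilon>)"]) auto
next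
  case False
  then have "V \<in> frontier \<Omega>" using V op by (simp add: frontier_def interior_open)
  then obtain r e L and g :: "(real,'n) vec \<Rightarrow> real" where r: "r > 0" and e: "norm e = 1" and L: "L-lipschitz_on UNIV g"
    and graph: "\<And>y. y \<in> ball V r \<Longrightarrow> y \<in> \<Omega> \<longleftrightarrow> y \<bullet> e < g (y - (y \<bullet> e) *\<^sub>R e)"
    using lip unfolding lipschitz_boundary_def by meson
  have L0: "0 \<le> L" by (rule lipschitz_on_nonneg[OF L])
  have ee: "e \<bullet> e = 1" using e by (simp add: norm_eq_1)
  let ?p = "\<lambda>y. y - (y \<bullet> e) *\<^sub>R e"
  have cg: "continuous_on UNIV (\<lambda>y. g (?p y))"
    by (rule continuous_on_compose2[OF lipschitz_on_continuous_on[OF L]]) (auto intro!: continuous_intros)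
  \<comment> \<open>A boundary point cannot satisfy the strict inequality in general, but a point of
    the closure is not strictly above the graph.\<close>
  have Vle: "V \<bullet> e \<le> g (?p V)"
  proof (rule ccontr)
    assume "\<not> V \<bullet> e \<le> g (?p V)"
    then have m: "V \<in> {y. g (?p y) < y \<bullet> e} \<inter> ball V r" using r by simp
    have o: "open ({y. g (?p y) < y \<bullet> e} \<inter> ball V r)"
      by (intro open_Int open_ball open_Collect_less cg continuous_intros)
    have "({y. g (?p y) < y \<bullet> e} \<inter> ball V r) \<inter> closure \<Omega> \<noteq> {}" using V m by blast
    then have "({y. g (?p y) < y \<bullet> e} \<inter> ball V r) \<inter> \<Omega> \<noteq> {}" using open_Int_closure_eq_empty[OF o] by blast
    then obtain y where y: "y \<in> \<Omega>" "g (?p y) < y \<bullet> e" "y \<in> ball V r" by blast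
    then show False using graph[OF y(3)] by simp
  qed
  define \<rho> where "\<rho> = min r \<epsilon>"
  \<comment> \<open>With this choice t + \<delta> < \<rho> keeps all points in the chart. On the
    ball of radius \<delta> about V - t e the height lies more than L \<delta> below that of V, and
    the graph drops by at most L \<delta>.\<close>
  define \<delta> where "\<delta> = \<rho> / (4 + L)"
  define t where "t = (2 + L) * \<delta>"
  have \<rho>: "\<rho> > 0" using r \<epsilon> by (simp add: \<rho>_def)
  have \<delta>: "\<delta> > 0" using \<rho> L0 by (simp add: \<delta>_def)
  have "(4 + L) * \<delta> = \<rho>" using L0 by (simp add: \<delta>_def)
  then have td: "t + \<delta> < \<rho>" using \<delta> by (simp add: t_def algebra_simps)
  have t0: "0 < t" unfolding t_def using \<delta> L0 by (intro mult_pos_pos) auto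
  have inB: "y \<in> ball V r" "y \<in> ball V \<epsilon>" if "norm (y - V) < \<rho>" for y
    using that by (auto simp: \<rho>_def dist_norm norm_minus_commute)
  let ?B = "ball (V - t *\<^sub>R e) \<delta>"
  have B: "y \<in> \<Omega> \<and> y \<in> ball V \<epsilon>" if y: "y \<in> ?B" for y
  proof -
    define q where "q = y - (V - t *\<^sub>R e)"
    have q: "norm q < \<delta>" using y by (simp add: q_def dist_norm norm_minus_commute)
    have yV: "y - V = q - t *\<^sub>R e" by (simp add: q_def)
    have "norm (y - V) \<le> norm q + norm (t *\<^sub>R e)" unfolding yV by (rule norm_triangle_ineq4)
    also have "\<dots> < \<rho>" using q td t0 e by simp
    finally have yr: "norm (y - V) < \<rho>" .
    have qe: "\<bar>q \<bullet> e\<bar> < \<delta>" using Cauchy_Schwarz_ineq2[of q e] q e by simp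
    have ye: "y \<bullet> e = V \<bullet> e + q \<bullet> e - t" using ee by (simp add: q_def inner_diff_left)
    have py: "?p y - ?p V = q - (q \<bullet> e) *\<^sub>R e"
      using yV by (simp add: ye algebra_simps)
    have "(norm (q - (q \<bullet> e) *\<^sub>R e))\<^sup>2 = (norm q)\<^sup>2 - (q \<bullet> e)\<^sup>2"
      by (simp only: power2_norm_eq_inner) (simp add: inner_diff_left inner_diff_right inner_commute ee power2_eq_square)
    then have "norm (q - (q \<bullet> e) *\<^sub>R e) \<le> norm q" by (metis abs_norm_cancel abs_le_square_iff diff_le_eq le_add_same_cancel1 zero_le_power2)
    then have pn: "norm (?p y - ?p V) \<le> \<delta>" unfolding py using q by simp
    have "\<bar>g (?p y) - g (?p V)\<bar> \<le> L * norm (?p y - ?p V)"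
      using lipschitz_onD[OF L, of "?p y" "?p V"] by (simp add: dist_norm)
    also have "\<dots> \<le> L * \<delta>" using pn L0 by (rule mult_left_mono)
    finally have "g (?p V) - L * \<delta> \<le> g (?p y)" by linarith
    moreover have "y \<bullet> e < V \<bullet> e - L * \<delta> "
      using qe \<delta> unfolding ye t_def by (simp add: algebra_simps)
    ultimately have "y \<bullet> e < g (?p y)" using Vle by linarith
    then show ?thesis using graph[OF inB(1)[OF yr]] inB(2)[OF yr] by blast
  qed
  have seg: "closed_segment y (y - t *\<^sub>R e) \<subseteq> \<Omega> \<inter> ball V \<epsilon>" if y: "y \<in> \<Omega> \<inter> ball V \<delta>" for y
  proof
    fix z assume "z \<in> closed_segment y (y - t *\<^sub>R e)"
    then obtain u where u: "0 \<le> u" "u \<le> 1" "z = (1 - u) *\<^sub>R y + u *\<^sub>R (y - t *\<^sub>R e)" by (auto simp: in_segment)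
    have z: "z = y - (u * t) *\<^sub>R e" by (simp add: u(3) algebra_simps)
    have ut: "0 \<le> u * t" "u * t \<le> t" using u t0 by (auto simp: mult_left_le_one_le)
    have "norm (z - V) \<le> norm (y - V) + norm ((u * t) *\<^sub>R e)"
      unfolding z using norm_triangle_ineq4[of "y - V" "(u * t) *\<^sub>R e"] by (simp add: algebra_simps)
    also have "norm ((u * t) *\<^sub>R e) = u * t" using ut(1) e by simp
    also have "norm (y - V) + u * t < \<rho>"
    proof -
      have "norm (y - V) < \<delta>" using y by (simp add: dist_norm norm_minus_commute)
      then show ?thesis using ut td by linarith
    qed
    finally have zr: "norm (z - V) < \<rho>" .
    have yr: "norm (y - V) < \<rho>" using y td t0 by (simp add: dist_norm norm_minus_commute)
    have "?p z = ?p y" by (simp add: z inner_diff_left ee algebra_simps)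
    moreover have "z \<bullet> e \<le> y \<bullet> e" using ut ee by (simp add: z inner_diff_left)
    moreover have "y \<bullet> e < g (?p y)" using graph[OF inB(1)[OF yr]] y by blast
    ultimately have "z \<bullet> e < g (?p z)" by simp
    then show "z \<in> \<Omega> \<inter> ball V \<epsilon>" using graph[OF inB(1)[OF zr]] inB(2)[OF zr] by blast
  qed
  \<comment> \<open>The lower end of each segment lies in the ball, so every member is connected and
    all members share the centre of the ball.\<close>
  define Fam where "Fam = insert ?B ((\<lambda>y. closed_segment y (y - t *\<^sub>R e) \<union> ?B) ` (\<Omega> \<inter> ball V \<delta>))"
  have "connected (\<Union>Fam)"
  proof (rule connected_Union)
    show "\<Inter>Fam \<noteq> {}" using \<delta> by (auto simp: Fam_def intro!: exI[of _ "V - t *\<^sub>R e"])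
    fix s assume "s \<in> Fam"
    then consider "s = ?B" | y where "y \<in> \<Omega> \<inter> ball V \<delta>" "s = closed_segment y (y - t *\<^sub>R e) \<union> ?B"
      unfolding Fam_def by blast
    then show "connected s"
    proof cases
      case 2
      have "y - t *\<^sub>R e \<in> closed_segment y (y - t *\<^sub>R e) \<inter> ?B"
        using 2(1) by (simp add: dist_norm)
      then show ?thesis unfolding 2(2) by (intro connected_Un connected_ball connected_segment) blast
    qed simp
  qed
  moreover have "\<Omega> \<inter> ball V \<delta> \<subseteq> \<Union>Fam" unfolding Fam_def by auto
  moreover have "\<Union>Fam \<subseteq> \<Omega> \<inter> ball V \<epsilon>" using B seg unfolding Fam_def by blast
  ultimately show ?thesis using that \<delta> by blast
qed

lemma low_dimensional_union:
  fixes K :: "'i \<Rightarrow> (real,'n::finite) vec set"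
  assumes "finite I" "\<And>i. i \<in> I \<Longrightarrow> finite (K i) \<and> card (K i) \<le> CARD('n)"
  shows "closed (\<Union>i\<in>I. affine hull (K i))" "interior (\<Union>i\<in>I. affine hull (K i)) = {}"
  using assms
proof (induction I rule: finite_induct)
  case (insert i I)
  {
    case 1
    show ?case using insert by (auto intro!: closed_Un closed_affine_hull)
  next
    case 2
    have "aff_dim (affine hull (K i)) \<le> int (card (K i)) - 1" using aff_dim_le_card[of "K i"] 2 by simp
    also have "\<dots> < int DIM((real,'n) vec)" using 2[of i] by simp
    finally have "interior (affine hull (K i)) = {}" using aff_dim_nonempty_interior by fastforce
    moreover have "closed (\<Union>i\<in>I. affine hull (K i))" "interior (\<Union>i\<in>I. affine hull (K i)) = {}"
      using insert 2 by auto
    ultimately show ?case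
      using interior_closed_Un_empty_interior[of "\<Union>i\<in>I. affine hull (K i)" "affine hull (K i)"]
      by (simp add: Un_commute)
  }
qed auto

lemma patch_conforming:
  assumes "conforming_triangulation T \<Omega>" shows "conforming T" "conforming (patch T V)"
  using assms unfolding conforming_triangulation_def conforming_def patch_def by auto

text \<open>Conformity excludes hanging vertices: a common face contains V only if V is one of its
  vertices.\<close>

lemma mesh_vertex_of_hull:
  assumes T: "conforming T" and V: "V \<in> \<Union>T" and S: "S \<in> T" "V \<in> convex hull S"
  shows "V \<in> S"
proof -
  obtain S1 where S1: "S1 \<in> T" "V \<in> S1" using V by blast
  have "V \<in> convex hull (S1 \<inter> S)" using conformingD(3)[OF T S1(1) S(1)] S(2) S1(2) hull_inc by fastforce
  then have "\<forall>u\<in>S1 - (S1 \<inter> S). bary S1 u V = 0"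
    using simplex_face_iff[OF conformingD(2)[OF T S1(1)], of "S1 \<inter> S" V] by blast
  moreover have "bary S1 V V = 1" using bary_vertex[OF conformingD(2)[OF T S1(1)] S1(2) S1(2)] by simp
  ultimately show ?thesis using S1(2) by force
qed

text \<open>A segment in general position avoids the pairwise intersections of codimension two, so
  inside a convex open set the two families cannot both occur.\<close>

lemma convex_open_one_sided:
  fixes A B :: "(real,'n::finite) vec set set"
  assumes M: "conforming M" "A \<subseteq> M" "B \<subseteq> M"
    and low: "\<And>S1 S2. S1 \<in> A \<Longrightarrow> S2 \<in> B \<Longrightarrow> card (S1 \<inter> S2) < CARD('n)"
    and b: "open b" "convex b" "b \<subseteq> (\<Union>S\<in>A. convex hull S) \<union> (\<Union>S\<in>B. convex hull S)"
    and S: "S \<in> A" "b \<inter> simplex_inner S \<noteq> {}" and S': "S' \<in> B" "b \<inter> simplex_inner S' \<noteq> {}"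
  shows False
proof -
  let ?UA = "\<Union>S\<in>A. convex hull S" and ?UB = "\<Union>S\<in>B. convex hull S"
  have fin: "finite (A \<times> B)" using M conformingD(1) finite_subset by blast
  have fS: "finite S1" if "S1 \<in> A" for S1 using conformingD(2)[OF M(1)] is_simplexD(1) that M(2) by blast
  have cl: "closed ?UA" "closed ?UB" using union_hull_closed[OF M(1)] M by auto
  \<comment> \<open>An intersection has fewer than CARD('n) points, so together with z it still
    spans a proper affine subspace, and y can be chosen off all of these.\<close>
  define N where "N z = (\<Union>P\<in>A \<times> B. affine hull (insert z (fst P \<inter> snd P)))" for z
  define N0 where "N0 = (\<Union>P\<in>A \<times> B. affine hull (fst P \<inter> snd P))"
  have N: "interior (N z) = {}" for z
    unfolding N_def by (rule low_dimensional_union(2)[OF fin])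
      (use low fS in \<open>force simp: card_insert_if less_imp_le Suc_le_eq\<close>)
  have N0: "interior N0 = {}"
    unfolding N0_def by (rule low_dimensional_union(2)[OF fin]) (use low fS in \<open>force simp: less_imp_le\<close>)
  have op: "open (b \<inter> simplex_inner S)" "open (b \<inter> simplex_inner S')"
    using b(1) simplex_inner_open conformingD(2)[OF M(1)] S(1) S'(1) M by blast+
  have "\<not> b \<inter> simplex_inner S' \<subseteq> N0" using op(2) S'(2) N0 interior_maximal by blast
  then obtain z where z: "z \<in> b" "z \<in> simplex_inner S'" "z \<notin> N0" by blast
  have "\<not> b \<inter> simplex_inner S \<subseteq> N z" using op(1) S(2) N interior_maximal by blast
  then obtain y where y: "y \<in> b" "y \<in> simplex_inner S" "y \<notin> N z" by blast
  let ?s = "closed_segment y z"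
  have sb: "?s \<subseteq> ?UA \<union> ?UB" using closed_segment_subset[OF y(1) z(1) b(2)] b(3) by blast
  have yA: "y \<in> ?UA" using simplex_inner_subset conformingD(2)[OF M(1)] S(1) M(2) y(2) by blast
  have zB: "z \<in> ?UB" using simplex_inner_subset conformingD(2)[OF M(1)] S'(1) M(3) z(2) by blast
  have "?UA \<inter> ?UB \<inter> ?s \<noteq> {}"
  proof
    assume "?UA \<inter> ?UB \<inter> ?s = {}"
    moreover have "?UA \<inter> ?s \<noteq> {}" "?UB \<inter> ?s \<noteq> {}" using yA zB ends_in_segment by blast+
    ultimately show False using connected_segment(1)[of y z] cl sb unfolding connected_closed by blast
  qed
  then obtain p S1 S2 where p: "p \<in> ?s" "S1 \<in> A" "S2 \<in> B" "p \<in> convex hull S1" "p \<in> convex hull S2" by blast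
  have "p \<in> convex hull (S1 \<inter> S2)" using conformingD(3)[OF M(1), of S1 S2] p M by blast
  then have pa: "p \<in> affine hull (S1 \<inter> S2)" using convex_hull_subset_affine_hull by blast
  have P: "(S1, S2) \<in> A \<times> B" using p by blast
  have "affine hull (S1 \<inter> S2) \<subseteq> N0" unfolding N0_def using UN_upper[OF P, of "\<lambda>P. affine hull (fst P \<inter> snd P)"] by simp
  then have pz: "p \<noteq> z" using pa z(3) by blast
  have NP: "affine hull (insert z (S1 \<inter> S2)) \<subseteq> N z"
    unfolding N_def using UN_upper[OF P, of "\<lambda>P. affine hull (insert z (fst P \<inter> snd P))"] by simp
  obtain u where u: "0 \<le> u" "u \<le> 1" "p = (1 - u) *\<^sub>R y + u *\<^sub>R z" using p(1) by (auto simp: in_segment)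
  have u1: "u \<noteq> 1" using u(3) pz by auto
  \<comment> \<open>Solved for y, the segment equation puts y on the line through p and z, against
    the choice of y.\<close>
  have "(1 / (1 - u)) *\<^sub>R p = y + (u / (1 - u)) *\<^sub>R z"
    unfolding u(3) scaleR_add_right scaleR_scaleR using u1 by simp
  then have "y = (1 / (1 - u)) *\<^sub>R p + (- (u / (1 - u))) *\<^sub>R z" by (simp add: algebra_simps)
  moreover have "1 / (1 - u) + - (u / (1 - u)) = 1" using u1 by (simp add: diff_divide_distrib[symmetric])
  moreover have "p \<in> affine hull (insert z (S1 \<inter> S2))" by (rule subsetD[OF hull_mono[OF subset_insertI] pa])
  moreover have "z \<in> affine hull (insert z (S1 \<inter> S2))" by (simp add: hull_inc)
  ultimately have "y \<in> affine hull (insert z (S1 \<inter> S2))" using mem_affine[OF affine_affine_hull] by metis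
  then show False using NP y(3) by blast
qed

text \<open>If A were proper, no simplex of A would share a facet with one of the rest B. Near V a
  connected piece of the domain is covered by both families, and every small ball lies on one side,
  so the piece would split into two open parts. The Lipschitz boundary supplies this piece; it
  excludes patches that fall into groups touching only along faces of codimension two or
  more.\<close>

theorem patch_facet_connected:
  fixes \<Omega> :: "(real,'n::finite) vec set"
  assumes op: "open \<Omega>" and lip: "lipschitz_boundary \<Omega>" and T: "conforming_triangulation T \<Omega>"
    and V: "V \<in> mesh_vertices T" and A: "A \<subseteq> patch T V" "A \<noteq> {}"
    and step: "\<And>S S'. S \<in> A \<Longrightarrow> S' \<in> patch T V \<Longrightarrow> card (S \<inter> S') = CARD('n) \<Longrightarrow> S' \<in> A"
  shows "A = patch T V"
proof (rule ccontr)
  assume "A \<noteq> patch T V"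
  define B where "B = patch T V - A"
  have B: "B \<subseteq> patch T V" "B \<noteq> {}" using A \<open>A \<noteq> patch T V\<close> by (auto simp: B_def)
  note cT = patch_conforming(1)[OF T] and cM = patch_conforming(2)[OF T, of V]
  let ?UA = "\<Union>S\<in>A. convex hull S" and ?UB = "\<Union>S\<in>B. convex hull S"
  have low: "card (S1 \<inter> S2) < CARD('n)" if S: "S1 \<in> A" "S2 \<in> B" for S1 S2
  proof -
    have c: "finite S1" "card S1 = CARD('n) + 1" "finite S2" "card S2 = CARD('n) + 1"
      using is_simplexD(1,2) conformingD(2)[OF cM] S A B by blast+
    have "S1 \<noteq> S2" using S by (auto simp: B_def)
    then have "S1 \<inter> S2 \<noteq> S1"
      using card_subset_eq[of S2 S1] c by (metis inf.orderI inf_commute)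
    then have "card (S1 \<inter> S2) < card S1" using c(1) by (intro psubset_card_mono) auto
    moreover have "card (S1 \<inter> S2) \<noteq> CARD('n)" using step[OF S(1)] S by (auto simp: B_def)
    ultimately show ?thesis using c by simp
  qed
  have "closed (\<Union>S\<in>T - patch T V. convex hull S)" by (rule union_hull_closed[OF cT]) auto
  moreover have "V \<notin> (\<Union>S\<in>T - patch T V. convex hull S)"
  proof
    assume "V \<in> (\<Union>S\<in>T - patch T V. convex hull S)"
    then obtain S where S: "S \<in> T" "S \<notin> patch T V" "V \<in> convex hull S" by blast
    have "V \<in> S" by (rule mesh_vertex_of_hull[OF cT _ S(1,3)]) (use V in \<open>simp add: mesh_vertices_def\<close>)
    then show False using S by (simp add: patch_def)
  qed
  ultimately have "open (- (\<Union>S\<in>T - patch T V. convex hull S))" "V \<in> - (\<Union>S\<in>T - patch T V. convex hull S)"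
    by (simp_all only: open_Compl Compl_iff not_False_eq_True)
  \<comment> \<open>Within this ball only simplices of the patch occur.\<close>
  then obtain \<epsilon> where \<epsilon>: "\<epsilon> > 0" "ball V \<epsilon> \<subseteq> - (\<Union>S\<in>T - patch T V. convex hull S)"
    by (rule openE)
  have clT: "(\<Union>S\<in>T. convex hull S) = closure \<Omega>" using T by (simp add: conforming_triangulation_def)
  obtain S0 where S0: "S0 \<in> T" "V \<in> S0" using V by (auto simp: mesh_vertices_def)
  have "V \<in> convex hull S0" using S0(2) by (rule hull_inc)
  then have "V \<in> (\<Union>S\<in>T. convex hull S)" using S0(1) by blast
  then have Vcl: "V \<in> closure \<Omega>" by (simp only: clT)
  obtain \<delta> C where C: "0 < \<delta>" "connected C" "\<Omega> \<inter> ball V \<delta> \<subseteq> C" "C \<subseteq> \<Omega> \<inter> ball V \<epsilon>"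
    by (rule lipschitz_locally_connected[OF op lip Vcl \<epsilon>(1)])
  have cover: "\<Omega> \<inter> ball V \<epsilon> \<subseteq> ?UA \<union> ?UB"
  proof
    fix x assume x: "x \<in> \<Omega> \<inter> ball V \<epsilon>"
    then have "x \<in> (\<Union>S\<in>T. convex hull S)" unfolding clT using closure_subset by blast
    then obtain S where S: "S \<in> T" "x \<in> convex hull S" by blast
    then have "S \<in> patch T V" using x \<epsilon>(2) by blast
    then show "x \<in> ?UA \<union> ?UB" using S(2) by (auto simp: B_def)
  qed
  have innerA: "S \<in> A \<Longrightarrow> is_simplex S" and innerB: "S \<in> B \<Longrightarrow> is_simplex S" for S
    using conformingD(2)[OF cM] A B by blast+
  have miss: "x \<inter> convex hull S = {}" if "is_simplex S" "open x" "x \<inter> simplex_inner S = {}" for S x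
    using simplex_inner_meets_ball[OF that(1) _ that(2)] that(3) by blast
  have one: "b \<subseteq> ?UA \<or> b \<subseteq> ?UB" if b: "open b" "convex b" "b \<subseteq> \<Omega> \<inter> ball V \<epsilon>" for b
  proof (rule ccontr)
    assume n: "\<not> (b \<subseteq> ?UA \<or> b \<subseteq> ?UB)"
    have bAB: "b \<subseteq> ?UA \<union> ?UB" using b(3) cover by blast
    obtain x y where xy: "x \<in> b" "x \<notin> ?UA" "y \<in> b" "y \<notin> ?UB" using n by blast
    have "x \<in> ?UB" "y \<in> ?UA" using xy bAB by auto
    then obtain S S' where "S \<in> A" "y \<in> convex hull S" "S' \<in> B" "x \<in> convex hull S'" by blast
    then have S: "S \<in> A" "b \<inter> convex hull S \<noteq> {}" and S': "S' \<in> B" "b \<inter> convex hull S' \<noteq> {}"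
      using xy by auto
    have "b \<inter> simplex_inner S \<noteq> {}" using miss[OF innerA[OF S(1)] b(1)] S(2) by blast
    moreover have "b \<inter> simplex_inner S' \<noteq> {}" using miss[OF innerB[OF S'(1)] b(1)] S'(2) by blast
    ultimately show False using convex_open_one_sided[OF cM A(1) B(1) low b(1,2) bAB S(1) _ S'(1)] by blast
  qed
  \<comment> \<open>Interiors make the two parts open. They are disjoint, since a common point lies
    in an intersection of too small a dimension, and such points cannot fill an open set.\<close>
  define OA where "OA = interior (?UA \<inter> (\<Omega> \<inter> ball V \<epsilon>))"
  define OB where "OB = interior (?UB \<inter> (\<Omega> \<inter> ball V \<epsilon>))"
  have U: "open (\<Omega> \<inter> ball V \<epsilon>)" using op by auto
  have CO: "C \<subseteq> OA \<union> OB"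
  proof
    fix x assume "x \<in> C"
    then have x: "x \<in> \<Omega> \<inter> ball V \<epsilon>" using C(4) by blast
    then obtain e where e: "e > 0" "ball x e \<subseteq> \<Omega> \<inter> ball V \<epsilon>" using U open_contains_ball by blast
    have xe: "x \<in> ball x e" using e(1) by simp
    have "ball x e \<subseteq> ?UA \<or> ball x e \<subseteq> ?UB" by (rule one) (use e(2) in auto)
    then show "x \<in> OA \<union> OB"
    proof
      assume "ball x e \<subseteq> ?UA"
      then have "ball x e \<subseteq> OA" unfolding OA_def using e(2) by (intro interior_maximal) auto
      then show ?thesis using xe by blast
    next
      assume "ball x e \<subseteq> ?UB"
      then have "ball x e \<subseteq> OB" unfolding OB_def using e(2) by (intro interior_maximal) auto
      then show ?thesis using xe by blast
    qed
  qed
  have disj: "OA \<inter> OB = {}"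
  proof (rule ccontr)
    assume ne: "OA \<inter> OB \<noteq> {}"
    have fin: "finite (A \<times> B)" using A B conformingD(1)[OF cM] finite_subset by blast
    have "interior (\<Union>P\<in>A \<times> B. affine hull (fst P \<inter> snd P)) = {}"
      by (rule low_dimensional_union(2)[OF fin])
        (use low is_simplexD(1)[OF innerA] in \<open>force simp: less_imp_le\<close>)
    moreover have "OA \<inter> OB \<subseteq> (\<Union>P\<in>A \<times> B. affine hull (fst P \<inter> snd P))"
    proof
      fix x assume "x \<in> OA \<inter> OB"
      then have "x \<in> ?UA" "x \<in> ?UB" unfolding OA_def OB_def using interior_subset by blast+
      then obtain S1 S2 where s: "S1 \<in> A" "S2 \<in> B" "x \<in> convex hull S1" "x \<in> convex hull S2" by blast
      then have "x \<in> convex hull (S1 \<inter> S2)" using conformingD(3)[OF cM, of S1 S2] A B by blast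
      then have "x \<in> affine hull (fst (S1, S2) \<inter> snd (S1, S2))" using convex_hull_subset_affine_hull by auto
      then show "x \<in> (\<Union>P\<in>A \<times> B. affine hull (fst P \<inter> snd P))" using s by blast
    qed
    moreover have "open (OA \<inter> OB)" by (simp add: OA_def OB_def open_Int)
    ultimately show False using ne interior_maximal by blast
  qed
  have meet: "\<exists>x\<in>C. x \<in> simplex_inner S" if S: "S \<in> patch T V" for S
  proof -
    have s: "is_simplex S" "V \<in> S" "S \<in> T" using conformingD(2)[OF cM S] S by (auto simp: patch_def)
    have "simplex_inner S \<inter> ball V \<delta> \<noteq> {}"
      by (rule simplex_inner_meets_ball[OF s(1) hull_inc[OF s(2)] open_ball]) (use C(1) in simp)
    moreover have "simplex_inner S \<subseteq> closure \<Omega>" using simplex_inner_subset[OF s(1)] s(3) clT by blast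
    ultimately have "(simplex_inner S \<inter> ball V \<delta>) \<inter> closure \<Omega> \<noteq> {}" by blast
    moreover have "open (simplex_inner S \<inter> ball V \<delta>)" using simplex_inner_open[OF s(1)] by auto
    ultimately have "(simplex_inner S \<inter> ball V \<delta>) \<inter> \<Omega> \<noteq> {}" using open_Int_closure_eq_empty by blast
    then show ?thesis using C(3) by blast
  qed
  obtain SA SB where SAB: "SA \<in> A" "SB \<in> B" using A B by blast
  obtain xa where xa: "xa \<in> C" "xa \<in> simplex_inner SA" using meet SAB A by blast
  obtain xb where xb: "xb \<in> C" "xb \<in> simplex_inner SB" using meet SAB B by blast
  have "xa \<in> OA" unfolding OA_def
  proof (rule interiorI[of "simplex_inner SA \<inter> (\<Omega> \<inter> ball V \<epsilon>)"])
    show "open (simplex_inner SA \<inter> (\<Omega> \<inter> ball V \<epsilon>))" using U simplex_inner_open[OF innerA[OF SAB(1)]] by auto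
    show "simplex_inner SA \<inter> (\<Omega> \<inter> ball V \<epsilon>) \<subseteq> ?UA \<inter> (\<Omega> \<inter> ball V \<epsilon>)"
      using simplex_inner_subset[OF innerA[OF SAB(1)]] SAB(1) by blast
  qed (use xa C(4) in blast)
  moreover have "xb \<in> OB" unfolding OB_def
  proof (rule interiorI[of "simplex_inner SB \<inter> (\<Omega> \<inter> ball V \<epsilon>)"])
    show "open (simplex_inner SB \<inter> (\<Omega> \<inter> ball V \<epsilon>))" using U simplex_inner_open[OF innerB[OF SAB(2)]] by auto
    show "simplex_inner SB \<inter> (\<Omega> \<inter> ball V \<epsilon>) \<subseteq> ?UB \<inter> (\<Omega> \<inter> ball V \<epsilon>)"
      using simplex_inner_subset[OF innerB[OF SAB(2)]] SAB(2) by blast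
  qed (use xb C(4) in blast)
  ultimately show False
    using connectedD[OF C(2), of OA OB] CO disj xa xb by (auto simp: OA_def OB_def)
qed

section \<open>Volumes of shape regular simplices\<close>

lemma two_vertices:
  fixes S :: "(real,'n::finite) vec set"
  assumes "is_simplex S" "u \<in> S" obtains w where "w \<in> S" "w \<noteq> u"
proof -
  have "card (S - {u}) = CARD('n)" using is_simplexD(1,2)[OF assms(1)] assms(2) by auto
  then have "S - {u} \<noteq> {}" by (metis card.empty zero_less_card_finite less_irrefl)
  then show ?thesis using that by blast
qed

text \<open>Along u - w the coordinate of u grows by 1. A ball of larger radius would contain its
  centre shifted by both u - w and w - u, and the coordinate would vary by 2 within [0,1].\<close>

lemma inscribed_radius_le_edge:
  assumes S: "is_simplex S" and uw: "u \<in> S" "w \<in> S" "u \<noteq> w" and b: "ball c r \<subseteq> convex hull S"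
  shows "r \<le> norm (u - w)"
proof (rule ccontr)
  assume "\<not> r \<le> norm (u - w)"
  then have r: "norm (u - w) < r" by simp
  have "bary S u u - bary S u w = bgrad S u \<bullet> (u - w)" by (rule bary_diff[OF S])
  then have g: "bgrad S u \<bullet> (u - w) = 1" using bary_vertex[OF S] uw by simp
  have "norm (w - u) < r" using r by (simp add: norm_minus_commute)
  then have "c + (u - w) \<in> ball c r" "c - (u - w) \<in> ball c r" using r by (auto simp: dist_norm)
  then have h: "c + (u - w) \<in> convex hull S" "c - (u - w) \<in> convex hull S" using b by auto
  have "bary S u (c + (u - w)) - bary S u c = 1" using bary_diff[OF S, of u "c + (u - w)" c] g by simp
  moreover have "bary S u c - bary S u (c - (u - w)) = 1" using bary_diff[OF S, of u c "c - (u - w)"] g by simp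
  moreover have "bary S u (c + (u - w)) \<le> 1" by (rule bary_le_1[OF S h(1) uw(1)])
  moreover have "0 \<le> bary S u (c - (u - w))" by (rule bary_nonneg[OF S h(2)])
  ultimately show False by simp
qed

text \<open>Half the inradius avoids asking whether the supremum is attained; the factors 2 in the
  volume constants stem from here.\<close>

lemma inradius_props:
  assumes S: "is_simplex S"
  shows "0 < inradius S" "u \<in> S \<Longrightarrow> w \<in> S \<Longrightarrow> u \<noteq> w \<Longrightarrow> inradius S \<le> norm (u - w)"
    "\<exists>c. cball c (inradius S / 2) \<subseteq> convex hull S"
proof -
  let ?R = "{r. \<exists>c. ball c r \<subseteq> convex hull S}"
  obtain e where e: "e > 0" "ball (face_center S) e \<subseteq> simplex_inner S"
    using simplex_inner_open[OF S] simplex_inner_center[OF S] open_contains_ball by blast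
  then have eR: "e \<in> ?R" using simplex_inner_subset[OF S] by blast
  obtain u0 where u0: "u0 \<in> S" using is_simplexD(4)[OF S] by blast
  obtain w0 where w0: "w0 \<in> S" "w0 \<noteq> u0" by (rule two_vertices[OF S u0])
  have bd: "bdd_above ?R"
    using inscribed_radius_le_edge[OF S u0 w0(1) w0(2)[symmetric]] by (auto simp: bdd_above_def)
  have "e \<le> inradius S" unfolding inradius_def by (rule cSup_upper[OF eR bd])
  then show p: "0 < inradius S" using e(1) by simp
  show "inradius S \<le> norm (u - w)" if "u \<in> S" "w \<in> S" "u \<noteq> w"
    unfolding inradius_def by (rule cSup_least) (use eR inscribed_radius_le_edge[OF S that] in auto)
  have "inradius S / 2 < Sup ?R" using p by (simp add: inradius_def)
  then obtain r where r: "r \<in> ?R" "inradius S / 2 < r" using less_cSupE[of "inradius S / 2" ?R] eR by blast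
  then obtain c where "ball c r \<subseteq> convex hull S" by blast
  moreover have "cball c (inradius S / 2) \<subseteq> ball c r" using r(2) by auto
  ultimately show "\<exists>c. cball c (inradius S / 2) \<subseteq> convex hull S" by blast
qed

lemma dist_le_diameter:
  assumes "is_simplex S" "x \<in> convex hull S" "y \<in> convex hull S"
  shows "norm (x - y) \<le> diameter (convex hull S)"
  using diameter_bounded_bound[OF compact_imp_bounded[OF simplex_compact[OF assms(1)]] assms(2,3)]
  by (simp add: dist_norm)

lemma svol_bounds:
  fixes S :: "(real,'n::finite) vec set"
  assumes S: "is_simplex S"
  shows "unit_ball_vol CARD('n) * (inradius S / 2) ^ CARD('n) \<le> svol S"
    "svol S \<le> unit_ball_vol CARD('n) * diameter (convex hull S) ^ CARD('n)"
proof -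
  have r: "0 \<le> inradius S / 2" using inradius_props(1)[OF S] by simp
  have meas: "convex hull S \<in> sets lborel" using simplex_compact[OF S] by (simp add: borel_compact)
  obtain c where c: "cball c (inradius S / 2) \<subseteq> convex hull S" using inradius_props(3)[OF S] by blast
  have "emeasure lborel (cball c (inradius S / 2)) \<le> emeasure lborel (convex hull S)"
    by (rule emeasure_mono[OF c meas])
  then show "unit_ball_vol CARD('n) * (inradius S / 2) ^ CARD('n) \<le> svol S"
    using svol_pos[OF S] by (simp add: emeasure_cball[OF r] svol_measure(2)[OF S])
  obtain u where u: "u \<in> S" using is_simplexD(4)[OF S] by blast
  have d: "0 \<le> diameter (convex hull S)" using dist_le_diameter[OF S] u hull_inc norm_ge_zero order_trans by metis
  have "convex hull S \<subseteq> cball u (diameter (convex hull S))"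
    using dist_le_diameter[OF S hull_inc[OF u]] by (auto simp: dist_norm)
  then have "emeasure lborel (convex hull S) \<le> emeasure lborel (cball u (diameter (convex hull S)))"
    by (rule emeasure_mono) simp
  then show "svol S \<le> unit_ball_vol CARD('n) * diameter (convex hull S) ^ CARD('n)"
    using d by (simp add: emeasure_cball[OF d] svol_measure(2)[OF S])
qed

lemma shape_regular:
  assumes S: "is_simplex S" and g: "shape_param S \<le> \<gamma>"
  shows "diameter (convex hull S) \<le> \<gamma> * inradius S" "0 < diameter (convex hull S)" "1 \<le> \<gamma>"
proof -
  note p = inradius_props(1)[OF S]
  show 1: "diameter (convex hull S) \<le> \<gamma> * inradius S"
    using g p by (simp add: shape_param_def pos_divide_le_eq)
  obtain u where u: "u \<in> S" using is_simplexD(4)[OF S] by blast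
  obtain w where w: "w \<in> S" "w \<noteq> u" by (rule two_vertices[OF S u])
  have "inradius S \<le> norm (u - w)" using inradius_props(2)[OF S u w(1)] w(2) by blast
  also have "\<dots> \<le> diameter (convex hull S)" by (rule dist_le_diameter[OF S hull_inc[OF u] hull_inc[OF w(1)]])
  finally have 2: "inradius S \<le> diameter (convex hull S)" .
  then show "0 < diameter (convex hull S)" using p by simp
  have "1 * inradius S \<le> \<gamma> * inradius S" using 1 2 by simp
  then show "1 \<le> \<gamma>" using p by (simp only: mult_le_cancel_right_pos)
qed

text \<open>A shared edge is at least as long as the inradius of S' and at most as long as the
  diameter of S. Each comparison of a diameter with an inradius costs one factor \<gamma>.\<close>

lemma svol_comparable:
  fixes S :: "(real,'n::finite) vec set"
  assumes S: "is_simplex S" "shape_param S \<le> \<gamma>" and S': "is_simplex S'" "shape_param S' \<le> \<gamma>"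
    and uw: "u \<in> S \<inter> S'" "w \<in> S \<inter> S'" "u \<noteq> w"
  shows "svol S' \<le> (2 * \<gamma>\<^sup>2) ^ CARD('n) * svol S"
proof -
  let ?d = "CARD('n)" and ?D = "\<lambda>S. diameter (convex hull S)"
  note g = shape_regular(3)[OF S]
  have "?D S' \<le> \<gamma> * inradius S'" by (rule shape_regular(1)[OF S'])
  also have "\<dots> \<le> \<gamma> * norm (u - w)" using inradius_props(2)[OF S'(1)] uw g by (intro mult_left_mono) auto
  also have "\<dots> \<le> \<gamma> * ?D S"
    using dist_le_diameter[OF S(1)] uw g by (intro mult_left_mono) (auto simp: hull_inc)
  also have "\<dots> \<le> \<gamma> * (\<gamma> * inradius S)" using shape_regular(1)[OF S] g by (intro mult_left_mono) auto
  also have "\<dots> = (2 * \<gamma>\<^sup>2) * (inradius S / 2)" by (simp add: power2_eq_square)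
  finally have le: "?D S' \<le> (2 * \<gamma>\<^sup>2) * (inradius S / 2)" .
  have "svol S' \<le> unit_ball_vol ?d * ?D S' ^ ?d" by (rule svol_bounds(2)[OF S'(1)])
  also have "\<dots> \<le> unit_ball_vol ?d * ((2 * \<gamma>\<^sup>2) * (inradius S / 2)) ^ ?d"
    using le shape_regular(2)[OF S'] by (intro mult_left_mono power_mono) auto
  also have "\<dots> = (2 * \<gamma>\<^sup>2) ^ ?d * (unit_ball_vol ?d * (inradius S / 2) ^ ?d)"
    by (simp only: power_mult_distrib mult_ac)
  also have "\<dots> \<le> (2 * \<gamma>\<^sup>2) ^ ?d * svol S" using svol_bounds(1)[OF S(1)] by (intro mult_left_mono) auto
  finally show ?thesis .
qed

lemma conforming_negligible_Int:
  assumes M: "conforming M" "S \<in> M" "S' \<in> M" "S \<noteq> S'"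
  shows "negligible (convex hull S \<inter> convex hull S')"
proof -
  note s = conformingD(2)[OF M(1)]
  have "\<not> S \<subseteq> S'"
    using card_subset_eq[of S' S] is_simplexD(1,2)[OF s[OF M(2)]] is_simplexD(1,2)[OF s[OF M(3)]] M(4) by auto
  then obtain u where u: "u \<in> S" "u \<notin> S'" by blast
  have "convex hull S \<inter> convex hull S' \<subseteq> frontier (convex hull S)"
  proof
    fix x assume x: "x \<in> convex hull S \<inter> convex hull S'"
    then have "x \<in> convex hull (S \<inter> S')" using conformingD(3)[OF M(1-3)] by blast
    then have "bary S u x = 0" using simplex_face_iff[OF s[OF M(2)], of "S \<inter> S'" x] u by blast
    then have "x \<notin> interior (convex hull S)"
      unfolding simplex_interior[OF s[OF M(2)]] simplex_inner_def using u by force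
    moreover have "closed (convex hull S)" by (rule compact_imp_closed[OF simplex_compact[OF s[OF M(2)]]])
    ultimately show "x \<in> frontier (convex hull S)" using x by (simp add: frontier_def)
  qed
  then show ?thesis using negligible_convex_frontier[OF convex_convex_hull] negligible_subset by blast
qed

text \<open>Shrinking all simplices towards the common vertex to the same diameter makes them comparable
  in volume without comparing their sizes.\<close>

lemma patch_card_bound:
  fixes M :: "(real,'n::finite) vec set set"
  assumes M: "conforming M" and V: "\<And>S. S \<in> M \<Longrightarrow> V \<in> S" and g: "\<And>S. S \<in> M \<Longrightarrow> shape_param S \<le> \<gamma>"
    and ne: "M \<noteq> {}"
  shows "real (card M) \<le> (2 * \<gamma>) ^ CARD('n)"
proof -
  let ?d = "CARD('n)" and ?D = "\<lambda>S. diameter (convex hull S)"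
  let ?\<beta> = "unit_ball_vol (real ?d)"
  note s = conformingD(2)[OF M] and fin = conformingD(1)[OF M]
  have D: "0 < ?D S" if "S \<in> M" for S using shape_regular(2)[OF s[OF that] g[OF that]] .
  define t where "t = Min (?D ` M)"
  have t: "0 < t" unfolding t_def using fin ne D by (subst Min_gr_iff) auto
  have tD: "t \<le> ?D S" if "S \<in> M" for S unfolding t_def using fin that by (intro Min_le) auto
  have g1: "1 \<le> \<gamma>" using shape_regular(3)[OF s g] ne by blast
  define K where "K S = (\<lambda>x. V + (t / ?D S) *\<^sub>R (x - V)) ` (convex hull S)" for S
  have cK: "compact (K S)" if "S \<in> M" for S
    unfolding K_def by (intro compact_continuous_image continuous_intros simplex_compact s that)
  have bK: "K S \<in> sets lborel" if "S \<in> M" for S using borel_compact[OF cK[OF that]] by simp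
  have KS: "K S \<subseteq> convex hull S" if S: "S \<in> M" for S
  proof -
    have "V + c *\<^sub>R (x - V) \<in> convex hull S" if "x \<in> convex hull S" "0 \<le> c" "c \<le> 1" for x c
    proof -
      have "V + c *\<^sub>R (x - V) = (1 - c) *\<^sub>R V + c *\<^sub>R x" by (simp add: algebra_simps)
      then show ?thesis using convexD_alt[OF convex_convex_hull[of S] hull_inc[OF V[OF S]] that(1) that(2,3)] by simp
    qed
    then show ?thesis unfolding K_def using t D[OF S] tD[OF S] by auto
  qed
  have KB: "K S \<subseteq> cball V t" if S: "S \<in> M" for S
  proof
    fix y assume "y \<in> K S"
    then obtain x where x: "x \<in> convex hull S" "y = V + (t / ?D S) *\<^sub>R (x - V)" by (auto simp: K_def)
    have "norm (y - V) = t / ?D S * norm (x - V)" using x(2) t D[OF S] by simp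
    also have "\<dots> \<le> t / ?D S * ?D S"
      using dist_le_diameter[OF s[OF S] x(1) hull_inc[OF V[OF S]]] t D[OF S] by (intro mult_left_mono) auto
    also have "\<dots> = t" using D[OF S] by simp
    finally show "y \<in> cball V t" by (simp add: dist_norm norm_minus_commute)
  qed
  have vK: "?\<beta> * (t / (2 * \<gamma>)) ^ ?d \<le> measure lebesgue (K S)" if S: "S \<in> M" for S
  proof -
    have "?D S \<le> \<gamma> * inradius S" by (rule shape_regular(1)[OF s[OF S] g[OF S]])
    then have i: "?D S / (2 * \<gamma>) \<le> inradius S / 2" using g1 by (simp add: field_simps)
    have "?\<beta> * (t / (2 * \<gamma>)) ^ ?d = (t / ?D S) ^ ?d * (?\<beta> * (?D S / (2 * \<gamma>)) ^ ?d)"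
      using D[OF S] by (simp add: power_divide)
    also have "\<dots> \<le> (t / ?D S) ^ ?d * (?\<beta> * (inradius S / 2) ^ ?d)"
      using i t D[OF S] g1 by (intro mult_left_mono power_mono) auto
    also have "\<dots> \<le> (t / ?D S) ^ ?d * svol S"
      using svol_bounds(1)[OF s[OF S]] t D[OF S] by (intro mult_left_mono) auto
    also have "\<dots> = (LINT x:K S|lborel. 1)"
      using sint_scaled[OF s[OF S] continuous_on_const[of _ 1], of V "t / ?D S"] sint_const[OF s[OF S], of 1] t D[OF S]
      by (simp add: K_def)
    also have "\<dots> = measure lborel (K S)"
      unfolding set_lebesgue_integral_def using bK[OF S] emeasure_compact_finite[OF cK[OF S]] by simp
    finally show ?thesis using bK[OF S] by simp
  qed
  have lm: "K S \<in> lmeasurable" if "S \<in> M" for S using lmeasurable_compact[OF cK[OF that]] .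
  have "real (card M) * (?\<beta> * (t / (2 * \<gamma>)) ^ ?d) = (\<Sum>S\<in>M. ?\<beta> * (t / (2 * \<gamma>)) ^ ?d)" by simp
  also have "\<dots> \<le> (\<Sum>S\<in>M. measure lebesgue (K S))" by (rule sum_mono[OF vK])
  also have "\<dots> = measure lebesgue (\<Union>(K ` M))"
  proof (rule measure_negligible_finite_Union_image[symmetric, OF fin lm])
    show "pairwise (\<lambda>x y. negligible (K x \<inter> K y)) M"
      unfolding pairwise_def using conforming_negligible_Int[OF M] KS
      by (meson Int_mono negligible_subset)
  qed
  also have "\<dots> \<le> measure lebesgue (cball V t)"
    by (rule measure_mono_fmeasurable) (use KB bK fin in \<open>auto intro!: sets.finite_UN sets_completionI_sets\<close>)
  also have "\<dots> = ?\<beta> * t ^ ?d" using content_cball[of t V] t by simp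
  also have "\<dots> = (2 * \<gamma>) ^ ?d * (?\<beta> * (t / (2 * \<gamma>)) ^ ?d)" using g1 by (simp add: power_divide power_mult_distrib)
  finally show ?thesis
    using t g1 by (subst (asm) mult_le_cancel_right_pos) (auto intro!: mult_pos_pos zero_less_power divide_pos_pos)
qed

section \<open>The Koszul decomposition\<close>

lemma coord_bij:
  "bij_betw coord {..<CARD('n)} (UNIV :: 'n::{finite,linorder} set)"
proof -
  let ?l = "sorted_list_of_set (UNIV :: 'n set)"
  have "length ?l = CARD('n)" "distinct ?l" "set ?l = UNIV" by auto
  then show ?thesis using bij_betw_nth[of ?l "{..<CARD('n)}" UNIV] unfolding coord_def[abs_def] by simp
qed

lemma sum_coord2:
  fixes f :: "'n::{finite,linorder} \<Rightarrow> 'b::comm_monoid_add"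
  assumes "CARD('n) = 2" shows "(\<Sum>i\<in>UNIV. f i) = f (coord 0) + f (coord 1)"
  using sum.reindex_bij_betw[OF coord_bij[where 'n='n], of f] assms
  by (simp add: numeral_2_eq_2 lessThan_Suc add.commute)

lemma sum_coord3:
  fixes f :: "'n::{finite,linorder} \<Rightarrow> 'b::comm_monoid_add"
  assumes "CARD('n) = 3" shows "(\<Sum>i\<in>UNIV. f i) = f (coord 0) + f (coord 1) + f (coord 2)"
  using sum.reindex_bij_betw[OF coord_bij[where 'n='n], of f] assms
  by (simp add: numeral_3_eq_3 numeral_2_eq_2 lessThan_Suc add_ac)

lemma coord_cases2:
  assumes "CARD('n::{finite,linorder}) = 2"
  shows "(j :: 'n) = coord 0 \<or> j = coord 1" "(coord 0 :: 'n) \<noteq> coord 1"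
proof -
  have s: "{..<CARD('n)} = {0, 1}" using assms by auto
  show "j = coord 0 \<or> j = coord 1" using coord_bij[where 'n='n] unfolding s bij_betw_def by auto
  show "(coord 0 :: 'n) \<noteq> coord 1" using coord_bij[where 'n='n] unfolding s bij_betw_def by (auto simp: inj_on_def)
qed

lemma coord_cases3:
  assumes "CARD('n::{finite,linorder}) = 3"
  shows "(j :: 'n) = coord 0 \<or> j = coord 1 \<or> j = coord 2"
    "(coord 0 :: 'n) \<noteq> coord 1" "(coord 0 :: 'n) \<noteq> coord 2" "(coord 1 :: 'n) \<noteq> coord 2"
proof -
  have s: "{..<CARD('n)} = {0, 1, 2}" using assms by auto
  show "j = coord 0 \<or> j = coord 1 \<or> j = coord 2" using coord_bij[where 'n='n] unfolding s bij_betw_def by auto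
  show "(coord 0 :: 'n) \<noteq> coord 1" "(coord 0 :: 'n) \<noteq> coord 2" "(coord 1 :: 'n) \<noteq> coord 2"
    using coord_bij[where 'n='n] unfolding s bij_betw_def by (auto simp: inj_on_def)
qed

lemma Wh_orthogonal:
  fixes V :: "(real,'n::{finite,linorder}) vec"
  assumes dim: "CARD('n) = 2 \<or> CARD('n) = 3" and "\<mu> \<in> Wh k V" shows "\<mu> x \<bullet> (x - V) = 0"
proof (cases "CARD('n) = 2")
  case True
  then obtain a where "\<mu> = (\<lambda>x. koszul2 V (a x) x)" using assms(2) by (auto simp: Wh_def)
  then show ?thesis using coord_cases2[OF True]
    by (simp add: inner_vec_def sum_coord2[OF True] koszul2_def)
next
  case False
  then have d3: "CARD('n) = 3" using dim by simp
  obtain a where "\<mu> = (\<lambda>x. koszul3 V (a x) x)" using assms(2) False by (auto simp: Wh_def)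
  then show ?thesis using coord_cases3(2-)[OF d3]
    by (simp add: inner_vec_def sum_coord3[OF d3] koszul3_def Let_def algebra_simps)
qed

lemma koszul2_linear:
  "koszul2 V (a + b) x = koszul2 V a x + koszul2 V b x" "koszul2 V (c * a) x = c *\<^sub>R koszul2 V a x"
  by (auto simp: koszul2_def vec_eq_iff algebra_simps)

lemma koszul3_linear:
  "koszul3 V (a + b) x = koszul3 V a x + koszul3 V b x" "koszul3 V (c *\<^sub>R a) x = c *\<^sub>R koszul3 V a x"
  by (auto simp: koszul3_def vec_eq_iff Let_def algebra_simps)

lemma Wh_subspace: "subspace (Wh k (V :: (real,'n::{finite,linorder}) vec))"
proof (cases "CARD('n) = 2")
  case True
  have W: "Wh k V = {(\<lambda>x. koszul2 V (a x) x) | a. a \<in> polys (int k - 3)}" using True by (simp add: Wh_def)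
  show ?thesis unfolding W subspace_def
  proof (intro conjI ballI allI)
    show "0 \<in> {(\<lambda>x. koszul2 V (a x) x) | a. a \<in> polys (int k - 3)}" 
      by (intro CollectI exI[of _ "\<lambda>_. 0"]) (auto simp: polys_zero koszul2_def vec_eq_iff fun_eq_iff)
  next
    fix f g assume "f \<in> {(\<lambda>x. koszul2 V (a x) x) | a. a \<in> polys (int k - 3)}" "g \<in> {(\<lambda>x. koszul2 V (a x) x) | a. a \<in> polys (int k - 3)}"
    then obtain a b where "a \<in> polys (int k - 3)" "f = (\<lambda>x. koszul2 V (a x) x)" "b \<in> polys (int k - 3)" "g = (\<lambda>x. koszul2 V (b x) x)" by blast
    then show "f + g \<in> {(\<lambda>x. koszul2 V (a x) x) | a. a \<in> polys (int k - 3)}"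
      by (intro CollectI exI[of _ "\<lambda>x. a x + b x"]) (auto simp: koszul2_linear fun_eq_iff intro: polys_add)
  next
    fix c f assume "f \<in> {(\<lambda>x. koszul2 V (a x) x) | a. a \<in> polys (int k - 3)}"
    then obtain a where "a \<in> polys (int k - 3)" "f = (\<lambda>x. koszul2 V (a x) x)" by blast
    then show "c *\<^sub>R f \<in> {(\<lambda>x. koszul2 V (a x) x) | a. a \<in> polys (int k - 3)}"
      by (intro CollectI exI[of _ "\<lambda>x. c * a x"]) (auto simp: koszul2_linear fun_eq_iff intro: polys_cmult)
  qed
next
  case False
  have W: "Wh k V = {(\<lambda>x. koszul3 V (a x) x) | a. a \<in> vpolys (int k - 3)}" using False by (simp add: Wh_def)
  have zv: "(\<lambda>_. 0) \<in> vpolys (int k - 3)" by (simp add: vpolys_def polys_zero)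
  show ?thesis unfolding W subspace_def
  proof (intro conjI ballI allI)
    show "0 \<in> {(\<lambda>x. koszul3 V (a x) x) | a. a \<in> vpolys (int k - 3)}" 
      using zv by (intro CollectI exI[of _ "\<lambda>_. 0"]) (auto simp: koszul3_def vec_eq_iff fun_eq_iff Let_def)
  next
    fix f g assume "f \<in> {(\<lambda>x. koszul3 V (a x) x) | a. a \<in> vpolys (int k - 3)}" "g \<in> {(\<lambda>x. koszul3 V (a x) x) | a. a \<in> vpolys (int k - 3)}"
    then obtain a b where "a \<in> vpolys (int k - 3)" "f = (\<lambda>x. koszul3 V (a x) x)" "b \<in> vpolys (int k - 3)" "g = (\<lambda>x. koszul3 V (b x) x)" by blast
    then show "f + g \<in> {(\<lambda>x. koszul3 V (a x) x) | a. a \<in> vpolys (int k - 3)}"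
      by (intro CollectI exI[of _ "\<lambda>x. a x + b x"]) (auto simp: koszul3_linear fun_eq_iff intro: vpolys_add)
  next
    fix c f assume "f \<in> {(\<lambda>x. koszul3 V (a x) x) | a. a \<in> vpolys (int k - 3)}"
    then obtain a where "a \<in> vpolys (int k - 3)" "f = (\<lambda>x. koszul3 V (a x) x)" by blast
    then show "c *\<^sub>R f \<in> {(\<lambda>x. koszul3 V (a x) x) | a. a \<in> vpolys (int k - 3)}"
      by (intro CollectI exI[of _ "\<lambda>x. c *\<^sub>R a x"]) (auto simp: koszul3_linear fun_eq_iff intro: vpolys_cscale)
  qed
qed

lemma Wh_vpolys:
  fixes V :: "(real,'n::{finite,linorder}) vec"
  assumes "\<mu> \<in> Wh k V" shows "\<mu> \<in> vpolys (int k - 2)"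
proof (cases "CARD('n) = 2")
  case True
  then obtain a where a: "a \<in> polys (int k - 3)" "\<mu> = (\<lambda>x. koszul2 V (a x) x)" using assms by (auto simp: Wh_def)
  have m: "(\<lambda>x. (x $ i - V $ i) * a x) \<in> polys (int k - 2)" for i
    by (rule polys_mult_le[OF polys_diff[OF polys_coord polys_const] a(1), of 1]) auto
  show ?thesis unfolding vpolys_def
  proof (intro CollectI allI)
    fix j show "(\<lambda>x. \<mu> x $ j) \<in> polys (int k - 2)"
      unfolding a(2) koszul2_def using m polys_minus[OF m]
      by (cases "j = coord 0"; cases "j = coord 1") (auto simp: polys_zero)
  qed
next
  case False
  then obtain a where a: "a \<in> vpolys (int k - 3)" "\<mu> = (\<lambda>x. koszul3 V (a x) x)" using assms by (auto simp: Wh_def)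
  have m: "(\<lambda>x. (x $ i - V $ i) * a x $ l) \<in> polys (int k - 2)" for i l
    by (rule polys_mult_le[OF polys_diff[OF polys_coord polys_const], of 1]) (use a(1) in \<open>auto simp: vpolys_def\<close>)
  show ?thesis unfolding vpolys_def
  proof (intro CollectI allI)
    fix j show "(\<lambda>x. \<mu> x $ j) \<in> polys (int k - 2)"
      unfolding a(2) koszul3_def Let_def using polys_diff[OF m m]
      by (cases "j = coord 0"; cases "j = coord 1"; cases "j = coord 2") (auto simp: polys_zero)
  qed
qed

lemma homogeneous_euler:
  assumes G: "G \<in> polys m" and h: "\<And>s y. G (s *\<^sub>R y) = s ^ j * G y"
  shows "pgrad G y \<bullet> y = real j * G y"
proof -
  have "((\<lambda>s. G (0 + s *\<^sub>R (y - 0))) has_real_derivative pgrad G (0 + 1 *\<^sub>R (y - 0)) \<bullet> (y - 0)) (at 1)"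
    by (rule rad_has_derivative[OF G])
  then have "((\<lambda>s. s ^ j * G y) has_real_derivative pgrad G y \<bullet> y) (at 1)" by (simp add: h)
  moreover have "((\<lambda>s. s ^ j * G y) has_real_derivative real j * 1 ^ (j - 1) * G y) (at 1)"
    by (auto intro!: derivative_eq_intros)
  ultimately show ?thesis using DERIV_unique by fastforce
qed

text \<open>With \<open>\<xi>\<^sub>i(V + y) = \<Sum>\<^sub>j G\<^sub>i\<^sub>j(y)\<close> split into homogeneous parts, Euler's identity shows that
  the gradient of \<open>\<Sum>\<^sub>j (j + 1)\<^sup>-\<^sup>1 \<Sum>\<^sub>i y\<^sub>i G\<^sub>i\<^sub>j\<close> differs from \<open>\<xi>\<close> by an antisymmetric
  combination of the coordinates of y.\<close>

lemma antisymmetric_decomposition: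
  fixes \<xi> :: "(real,'n::finite) vec \<Rightarrow> (real,'n) vec"
  assumes \<xi>: "\<xi> \<in> vpolys (int n)"
  shows "\<exists>q R. q \<in> polys (int n + 1) \<and> (\<forall>i l. R i l \<in> polys (int n - 1)) \<and> (\<forall>i l y. R l i y = - R i l y) \<and>
    (\<forall>x l. \<xi> x $ l = pgrad q x $ l + (\<Sum>i\<in>UNIV. (x - V) $ i * R i l (x - V)))"
proof -
  have "\<exists>G. (\<forall>j\<le>n. G j \<in> polys (int j)) \<and> (\<forall>j s y. G j (s *\<^sub>R y) = s ^ j * G j y) \<and>
      (\<forall>y. \<xi> (V + y) $ i = (\<Sum>j\<le>n. G j y))" for i
  proof -
    have "(\<lambda>y. \<xi> (V + y) $ i) \<in> polys (int n)"
      using polys_shift[of "\<lambda>x. \<xi> x $ i" "int n" V] \<xi> by (simp add: vpolys_def)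
    from polys_homogeneous_parts[OF this] show ?thesis by metis
  qed
  then obtain G where G: "\<And>i j. j \<le> n \<Longrightarrow> G i j \<in> polys (int j)" "\<And>i j s y. G i j (s *\<^sub>R y) = s ^ j * G i j y"
      "\<And>i y. \<xi> (V + y) $ i = (\<Sum>j\<le>n. G i j y)" by metis
  define c where "c j = 1 / (real j + 1)" for j :: nat
  define q where "q x = (\<Sum>j\<le>n. c j * (\<Sum>i\<in>UNIV. (x - V) $ i * G i j (x - V)))" for x
  define R where "R i l y = (\<Sum>j\<le>n. c j * (pgrad (G l j) y $ i - pgrad (G i j) y $ l))" for i l y
  have sh: "(\<lambda>x. f (x - V)) \<in> polys a" if "f \<in> polys a" for f a
    using polys_shift[OF that, of "- V"] by simp
  have "q \<in> polys (int n + 1)" unfolding q_def[abs_def]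
  proof (intro polys_sum polys_cmult)
    fix j i assume "j \<in> {..n}"
    then have "(\<lambda>x. x $ i * G i j x) \<in> polys (int n + 1)"
      using polys_mono[OF polys_coord_mult[OF G(1)]] by simp
    from sh[OF this] show "(\<lambda>x. (x - V) $ i * G i j (x - V)) \<in> polys (int n + 1)" .
  qed
  moreover have "R i l \<in> polys (int n - 1)" for i l unfolding R_def[abs_def]
  proof (intro polys_sum polys_cmult polys_diff)
    fix j assume "j \<in> {..n}"
    then have j: "j \<le> n" by simp
    have "pgrad (G a j) \<in> vpolys (int n - 1)" for a
      by (rule vpolys_mono[OF polys_gradient(1)[OF G(1)[OF j]]]) (use j in simp)
    then show "(\<lambda>y. pgrad (G l j) y $ i) \<in> polys (int n - 1)" "(\<lambda>y. pgrad (G i j) y $ l) \<in> polys (int n - 1)"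
      unfolding vpolys_def by blast+
  qed
  moreover have "R l i y = - R i l y" for i l y
    unfolding R_def by (simp add: sum_negf[symmetric] algebra_simps)
  moreover have "\<xi> x $ l = pgrad q x $ l + (\<Sum>i\<in>UNIV. (x - V) $ i * R i l (x - V))" for x l
  proof -
    let ?y = "x - V"
    have d: "((\<lambda>x. (x - V) $ i * G i j (x - V)) has_derivative
        (\<lambda>h. (x - V) $ i * (pgrad (G i j) ?y \<bullet> h) + h $ i * G i j ?y)) (at x)" if "j \<le> n" for i j
    proof (rule has_derivative_mult)
      have s: "((\<lambda>x. x - V) has_derivative (\<lambda>h. h)) (at x)" by (auto intro!: derivative_eq_intros)
      show "((\<lambda>x. (x - V) $ i) has_derivative (\<lambda>h. h $ i)) (at x)"
        by (rule bounded_linear.has_derivative[OF bounded_linear_vec_nth s])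
      show "((\<lambda>x. G i j (x - V)) has_derivative (\<lambda>h. pgrad (G i j) ?y \<bullet> h)) (at x)"
        by (rule has_derivative_compose[OF s polys_gradient(2)[OF G(1)[OF that]]])
    qed
    have "(q has_derivative (\<lambda>h. \<Sum>j\<le>n. c j * (\<Sum>i\<in>UNIV. ?y $ i * (pgrad (G i j) ?y \<bullet> h) + h $ i * G i j ?y))) (at x)"
      unfolding q_def[abs_def]
      by (rule has_derivative_sum, rule has_derivative_mult_right, rule has_derivative_sum, rule d) simp
    then have "pgrad q x $ l = (\<Sum>j\<le>n. c j * (\<Sum>i\<in>UNIV. ?y $ i * (pgrad (G i j) ?y \<bullet> axis l 1) + axis l 1 $ i * G i j ?y))"
      by (simp add: pgrad_def frechet_derivative_at[symmetric])
    also have "\<dots> = (\<Sum>j\<le>n. c j * (G l j ?y + (\<Sum>i\<in>UNIV. ?y $ i * pgrad (G i j) ?y $ l)))"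
    proof (rule sum.cong[OF refl])
      fix j
      have "(\<Sum>i\<in>UNIV. axis l 1 $ i * G i j ?y) = (\<Sum>i\<in>UNIV. if l = i then G i j ?y else 0)"
        by (intro sum.cong) (auto simp: axis_def)
      then have "(\<Sum>i\<in>UNIV. axis l 1 $ i * G i j ?y) = G l j ?y" by simp
      then show "c j * (\<Sum>i\<in>UNIV. ?y $ i * (pgrad (G i j) ?y \<bullet> axis l 1) + axis l 1 $ i * G i j ?y)
          = c j * (G l j ?y + (\<Sum>i\<in>UNIV. ?y $ i * pgrad (G i j) ?y $ l))"
        by (simp add: sum.distrib inner_axis)
    qed
    finally have pq: "pgrad q x $ l = (\<Sum>j\<le>n. c j * (G l j ?y + (\<Sum>i\<in>UNIV. ?y $ i * pgrad (G i j) ?y $ l)))" .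
    have "(\<Sum>i\<in>UNIV. ?y $ i * R i l ?y) = (\<Sum>j\<le>n. c j * (\<Sum>i\<in>UNIV. ?y $ i * (pgrad (G l j) ?y $ i - pgrad (G i j) ?y $ l)))"
      unfolding R_def sum_distrib_left by (subst sum.swap) (simp add: mult_ac)
    also have "\<dots> = (\<Sum>j\<le>n. c j * (real j * G l j ?y - (\<Sum>i\<in>UNIV. ?y $ i * pgrad (G i j) ?y $ l)))"
    proof (rule sum.cong[OF refl])
      fix j assume "j \<in> {..n}"
      then have "pgrad (G l j) ?y \<bullet> ?y = real j * G l j ?y"
        by (intro homogeneous_euler[OF G(1) G(2)]) simp
      then have "(\<Sum>i\<in>UNIV. ?y $ i * pgrad (G l j) ?y $ i) = real j * G l j ?y"
        by (simp add: inner_vec_def mult.commute)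
      then show "c j * (\<Sum>i\<in>UNIV. ?y $ i * (pgrad (G l j) ?y $ i - pgrad (G i j) ?y $ l))
          = c j * (real j * G l j ?y - (\<Sum>i\<in>UNIV. ?y $ i * pgrad (G i j) ?y $ l))"
        by (simp only: right_diff_distrib sum_subtractf)
    qed
    finally have "pgrad q x $ l + (\<Sum>i\<in>UNIV. ?y $ i * R i l ?y)
        = (\<Sum>j\<le>n. c j * (G l j ?y + real j * G l j ?y))"
      unfolding pq by (simp add: sum.distrib[symmetric] algebra_simps)
    also have "\<dots> = (\<Sum>j\<le>n. G l j ?y)"
    proof (rule sum.cong[OF refl])
      fix j
      have "c j * (G l j ?y + real j * G l j ?y) = (c j * (real j + 1)) * G l j ?y" by (simp add: algebra_simps)
      then show "c j * (G l j ?y + real j * G l j ?y) = G l j ?y" by (simp add: c_def)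
    qed
    also have "\<dots> = \<xi> x $ l" using G(3)[of ?y l] by simp
    finally show ?thesis by simp
  qed
  ultimately show ?thesis by (intro exI[of _ q] exI[of _ R]) blast
qed

text \<open>An antisymmetric matrix has one free entry in the plane and three in space, exactly the
  argument of the Koszul operator. For k = 2 the degree int k - 3 is negative, the antisymmetric
  part is 0 and \<xi> is a gradient.\<close>

lemma koszul_decomposition:
  fixes V :: "(real,'n::{finite,linorder}) vec"
  assumes dim: "CARD('n) = 2 \<or> CARD('n) = 3" and k: "2 \<le> k" and \<xi>: "\<xi> \<in> vpolys (int k - 2)"
  obtains q \<mu> where "q \<in> polys (int k - 1)" "\<mu> \<in> Wh k V" "\<And>x. \<xi> x = pgrad q x + \<mu> x"
proof -
  define n where "n = k - 2"
  have n: "int n = int k - 2" using k by (simp add: n_def)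
  have "\<xi> \<in> vpolys (int n)" using \<xi> n by simp
  then obtain q R where q: "q \<in> polys (int n + 1)" and R: "\<And>i l. R i l \<in> polys (int n - 1)" "\<And>i l y. R l i y = - R i l y"
    and dec: "\<And>x l. \<xi> x $ l = pgrad q x $ l + (\<Sum>i\<in>UNIV. (x - V) $ i * R i l (x - V))"
    using antisymmetric_decomposition[of \<xi> n V] by blast
  define \<mu> where "\<mu> x = \<xi> x - pgrad q x" for x
  have \<mu>: "\<mu> x $ l = (\<Sum>i\<in>UNIV. (x - V) $ i * R i l (x - V))" for x l using dec by (simp add: \<mu>_def)
  have sh: "(\<lambda>x. R i l (x - V)) \<in> polys (int k - 3)" for i l
    using polys_shift[OF R(1), of i l "- V"] n by simp
  have z: "R i i y = 0" for i y using R(2)[of i i y] by simp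
  have "\<mu> \<in> Wh k V"
  proof (cases "CARD('n) = 2")
    case True
    have "\<mu> = (\<lambda>x. koszul2 V (R (coord 0) (coord 1) (x - V)) x)"
    proof (intro ext, unfold vec_eq_iff, intro allI)
      fix x and l :: 'n
      show "\<mu> x $ l = koszul2 V (R (coord 0) (coord 1) (x - V)) x $ l"
        using coord_cases2(1)[OF True, of l] coord_cases2(2)[OF True] R(2)[of "coord 0" "coord 1" "x - V"]
        by (auto simp: \<mu> sum_coord2[OF True] koszul2_def z)
    qed
    then show ?thesis using sh True by (auto simp: Wh_def)
  next
    case False
    then have d3: "CARD('n) = 3" using dim by simp
    \<comment> \<open>Entries and signs are such that the cross product of x - V with a reproduces
      the combination with R.\<close>
    define a :: "(real,'n) vec \<Rightarrow> (real,'n) vec" where "a x = (\<chi> j. if j = coord 0 then R (coord 2) (coord 1) (x - V)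
        else if j = coord 1 then R (coord 0) (coord 2) (x - V)
        else R (coord 1) (coord 0) (x - V))" for x
    have av: "a \<in> vpolys (int k - 3)" 
      unfolding vpolys_def
    proof (intro CollectI allI)
      fix j show "(\<lambda>x. a x $ j) \<in> polys (int k - 3)"
        unfolding a_def using sh by (cases "j = coord 0"; cases "j = coord 1") auto
    qed
    have "\<mu> = (\<lambda>x. koszul3 V (a x) x)"
    proof (intro ext, unfold vec_eq_iff, intro allI)
      fix x and l :: 'n
      note c = coord_cases3(2-)[OF d3]
      show "\<mu> x $ l = koszul3 V (a x) x $ l"
        using coord_cases3(1)[OF d3, of l] c c[symmetric] R(2)[of "coord 0" "coord 1" "x - V"]
          R(2)[of "coord 0" "coord 2" "x - V"] R(2)[of "coord 1" "coord 2" "x - V"]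
        by (auto simp: \<mu> sum_coord3[OF d3] koszul3_def Let_def z a_def)
    qed
    then show ?thesis using av False by (auto simp: Wh_def)
  qed
  moreover have "\<xi> x = pgrad q x + \<mu> x" for x by (simp add: \<mu>_def)
  ultimately show ?thesis using that q n by simp
qed

section \<open>The divergence of an arbitrary function is Borel measurable\<close>

text \<open>Nothing is assumed about the values of a velocity field outside the domain, so on the boundary
  of the domain its pointwise divergence is measurable only because this holds for every function.\<close>

definition approx_deriv :: "((real,'n::finite) vec \<Rightarrow> (real,'n) vec) \<Rightarrow> ((real,'n) vec,'n) vec \<Rightarrow> real \<Rightarrow> real \<Rightarrow> (real,'n) vec set" where
  "approx_deriv f A \<epsilon> \<delta> = {x. \<forall>y. norm (y - x) < \<delta> \<longrightarrow> norm (f y - f x - A *v (y - x)) \<le> \<epsilon> * norm (y - x)}"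

text \<open>No continuity of f is given. It comes from the estimate itself: the limit x is an
  admissible test point for late members of the sequence, so f tends to f x along it and the
  inequality passes to the limit.\<close>

lemma approx_deriv_closed:
  assumes "0 < \<delta>" shows "closed (approx_deriv f A \<epsilon> \<delta>)"
  unfolding closed_sequential_limits
proof (intro allI impI, elim conjE)
  fix X x assume X: "\<forall>n. X n \<in> approx_deriv f A \<epsilon> \<delta>" and lim: "X \<longlonglongrightarrow> x"
  have ev: "\<forall>\<^sub>F n in sequentially. norm (y - X n) < \<delta>" if "norm (y - x) < \<delta>" for y
  proof -
    have "((\<lambda>n. norm (y - X n)) \<longlongrightarrow> norm (y - x)) sequentially" by (intro tendsto_intros lim)
    then show ?thesis using that by (rule order_tendstoD(2))
  qed
  have bd: "\<forall>\<^sub>F n in sequentially. norm (f y - f (X n) - A *v (y - X n)) \<le> \<epsilon> * norm (y - X n)"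
    if "norm (y - x) < \<delta>" for y
    using ev[OF that] by eventually_elim (use X in \<open>auto simp: approx_deriv_def\<close>)
  have lA: "(\<lambda>n. A *v (y - X n)) \<longlonglongrightarrow> A *v (y - x)" for y
    by (intro bounded_linear.tendsto[OF matrix_vector_mul_bounded_linear] tendsto_intros lim)
  have "(\<lambda>n. f x - f (X n) - A *v (x - X n)) \<longlonglongrightarrow> 0"
  proof (rule Lim_null_comparison)
    show "\<forall>\<^sub>F n in sequentially. norm (f x - f (X n) - A *v (x - X n)) \<le> \<epsilon> * norm (x - X n)"
      using bd[of x] assms by simp
    have "(\<lambda>n. \<epsilon> * norm (x - X n)) \<longlonglongrightarrow> \<epsilon> * norm (x - x)" by (intro tendsto_intros lim)
    then show "(\<lambda>n. \<epsilon> * norm (x - X n)) \<longlonglongrightarrow> 0" by simp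
  qed
  from tendsto_add[OF this lA[of x]] have "(\<lambda>n. f x - f (X n)) \<longlonglongrightarrow> 0" by simp
  from tendsto_diff[OF tendsto_const[of "f x"] this] have lf: "(\<lambda>n. f (X n)) \<longlonglongrightarrow> f x" by simp
  show "x \<in> approx_deriv f A \<epsilon> \<delta>"
    unfolding approx_deriv_def
  proof (intro CollectI allI impI)
    fix y assume y: "norm (y - x) < \<delta>"
    have "(\<lambda>n. norm (f y - f (X n) - A *v (y - X n))) \<longlonglongrightarrow> norm (f y - f x - A *v (y - x))"
      by (intro tendsto_intros lf lA)
    moreover have "(\<lambda>n. \<epsilon> * norm (y - X n)) \<longlonglongrightarrow> \<epsilon> * norm (y - x)" by (intro tendsto_intros lim)
    ultimately show "norm (f y - f x - A *v (y - x)) \<le> \<epsilon> * norm (y - x)"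
      using tendsto_le[OF trivial_limit_sequentially _ _ bd[OF y]] by blast
  qed
qed

lemma approx_deriv_difference:
  fixes A :: "((real,'n::finite) vec,'n) vec"
  assumes 1: "x \<in> approx_deriv f A \<epsilon> \<delta>" "0 < \<delta>" and L: "linear L"
    and 2: "\<And>y. norm (y - x) < \<delta>' \<Longrightarrow> norm (f y - f x - L (y - x)) \<le> \<epsilon>' * norm (y - x)" "0 < \<delta>'"
  shows "norm (A *v h - L h) \<le> (\<epsilon> + \<epsilon>') * norm h"
proof (cases "h = 0")
  case True
  then show ?thesis using linear_0[OF L] by simp
next
  case False
  define t where "t = min \<delta> \<delta>' / (2 * norm h)"
  have t: "0 < t" using False assms by (simp add: t_def)
  have tn: "norm (t *\<^sub>R h) = min \<delta> \<delta>' / 2" using False t assms(2) 2(2) by (simp add: t_def)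
  define y where "y = x + t *\<^sub>R h"
  have "norm (y - x) < \<delta>" "norm (y - x) < \<delta>'" using tn assms(2) 2(2) by (auto simp: y_def)
  then have "norm (f y - f x - A *v (y - x)) \<le> \<epsilon> * norm (y - x)" "norm (f y - f x - L (y - x)) \<le> \<epsilon>' * norm (y - x)"
    using 1(1) 2(1) by (auto simp: approx_deriv_def)
  then have "norm (A *v (y - x) - L (y - x)) \<le> \<epsilon> * norm (y - x) + \<epsilon>' * norm (y - x)"
    using norm_triangle_ineq4[of "f y - f x - L (y - x)" "f y - f x - A *v (y - x)"] by simp
  also have "A *v (y - x) - L (y - x) = t *\<^sub>R (A *v h - L h)"
    by (simp add: y_def linear_scale[OF L] matrix_vector_mult_scaleR scaleR_diff_right)
  also have "norm (t *\<^sub>R (A *v h - L h)) = t * norm (A *v h - L h)" using t by simp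
  also have "\<epsilon> * norm (y - x) + \<epsilon>' * norm (y - x) = t * ((\<epsilon> + \<epsilon>') * norm h)" using t by (simp add: y_def algebra_simps)
  finally show ?thesis using t by simp
qed

lemma matrix_norm_bound:
  fixes A :: "((real,'n::finite) vec,'n) vec"
  shows "norm (A *v h) \<le> real CARD('n) * norm A * norm h"
proof -
  have "norm (A *v h) \<le> (\<Sum>i\<in>UNIV. \<bar>(A *v h) $ i\<bar>)" by (rule norm_le_l1_cart)
  also have "\<dots> \<le> (\<Sum>i\<in>(UNIV::'n set). norm A * norm h)"
  proof (rule sum_mono)
    fix i
    have "(A *v h) $ i = A $ i \<bullet> h" by (simp add: matrix_vector_mult_def inner_vec_def)
    then have "\<bar>(A *v h) $ i\<bar> \<le> norm (A $ i) * norm h" using Cauchy_Schwarz_ineq2[of "A $ i" h] by simp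
    also have "\<dots> \<le> norm A * norm h" by (intro mult_right_mono Finite_Cartesian_Product.norm_nth_le norm_ge_zero)
    finally show "\<bar>(A *v h) $ i\<bar> \<le> norm A * norm h" .
  qed
  finally show ?thesis by simp
qed

text \<open>Half of the tolerance pays for replacing the derivative by a matrix of the dense set,
  where \<open>matrix_norm_bound\<close> costs the factor CARD('n), and half for the remainder of
  f.\<close>

lemma has_derivative_approx_deriv:
  fixes f :: "(real,'n::finite) vec \<Rightarrow> (real,'n) vec"
  assumes D: "\<And>U. open U \<Longrightarrow> U \<noteq> {} \<Longrightarrow> \<exists>A\<in>D. A \<in> U" and f': "(f has_derivative f') (at x)" and \<epsilon>: "0 < \<epsilon>"
  shows "\<exists>A\<in>D. \<exists>k. x \<in> approx_deriv f A \<epsilon> (1 / real (Suc k))"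
proof -
  let ?d = "real CARD('n)"
  have lin: "linear f'" using f' by (simp add: has_derivative_bounded_linear bounded_linear.linear)
  have f'm: "f' h = matrix f' *v h" for h using lin by (simp add: matrix_works linear_matrix_vector_mul_eq)
  obtain A where A: "A \<in> D" "A \<in> ball (matrix f') (\<epsilon> / (2 * ?d))"
  proof -
    have "0 < \<epsilon> / (2 * ?d)" using \<epsilon> by simp
    then have "ball (matrix f') (\<epsilon> / (2 * ?d)) \<noteq> {}" by (metis centre_in_ball empty_iff)
    from D[OF open_ball this] show ?thesis using that by blast
  qed
  have An: "norm (A *v h - f' h) \<le> \<epsilon> / 2 * norm h" for h
  proof -
    have "A *v h - f' h = (A - matrix f') *v h" by (simp add: f'm matrix_vector_mult_diff_rdistrib)
    then have "norm (A *v h - f' h) \<le> ?d * norm (A - matrix f') * norm h" using matrix_norm_bound by metis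
    also have "\<dots> \<le> ?d * (\<epsilon> / (2 * ?d)) * norm h"
      using A(2) by (intro mult_right_mono mult_left_mono) (auto simp: dist_norm norm_minus_commute)
    finally show ?thesis by simp
  qed
  obtain d where d: "d > 0" "\<And>y. norm (y - x) < d \<Longrightarrow> norm (f y - f x - f' (y - x)) \<le> \<epsilon> / 2 * norm (y - x)"
    using f' \<epsilon> unfolding has_derivative_within_alt by (metis UNIV_I half_gt_zero)
  obtain k where k: "1 / real (Suc k) < d" using d(1) by (metis nat_approx_posE)
  have "x \<in> approx_deriv f A \<epsilon> (1 / real (Suc k))"
    unfolding approx_deriv_def
  proof (intro CollectI allI impI)
    fix y assume "norm (y - x) < 1 / real (Suc k)"
    then have "norm (f y - f x - f' (y - x)) \<le> \<epsilon> / 2 * norm (y - x)" using d(2)[of y] k by simp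
    moreover have "norm (A *v (y - x) - f' (y - x)) \<le> \<epsilon> / 2 * norm (y - x)" by (rule An)
    moreover have "norm (f y - f x - A *v (y - x)) \<le> norm (f y - f x - f' (y - x)) + norm (A *v (y - x) - f' (y - x))"
    proof -
      have "f y - f x - A *v (y - x) = (f y - f x - f' (y - x)) - (A *v (y - x) - f' (y - x))" by simp
      then show ?thesis by (simp only: norm_triangle_ineq4)
    qed
    moreover have "\<epsilon> / 2 * norm (y - x) + \<epsilon> / 2 * norm (y - x) = \<epsilon> * norm (y - x)" by simp
    ultimately show "norm (f y - f x - A *v (y - x)) \<le> \<epsilon> * norm (y - x)" by linarith
  qed
  then show ?thesis using A(1) by blast
qed

text \<open>Two linear approximations at the same point differ by at most the sum of their
  tolerances. Applied to any vector the matrices therefore form Cauchy sequences, and their limit is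
  the derivative.\<close>

lemma approx_deriv_differentiable:
  fixes f :: "(real,'n::finite) vec \<Rightarrow> (real,'n) vec"
  assumes "\<And>n. \<exists>A k. x \<in> approx_deriv f A (1 / real (Suc n)) (1 / real (Suc k))"
  shows "f differentiable (at x)"
proof -
  obtain A K where AK: "\<And>n. x \<in> approx_deriv f (A n) (1 / real (Suc n)) (1 / real (Suc (K n)))"
    using assms by metis
  let ?e = "\<lambda>n. 1 / real (Suc n)"
  have diff: "norm (A n *v h - A m *v h) \<le> (?e n + ?e m) * norm h" for n m h
  proof (rule approx_deriv_difference[where L="(*v) (A m)", OF AK[of n]])
    show "linear ((*v) (A m))" by (rule matrix_vector_mul_linear)
    show "norm (f y - f x - A m *v (y - x)) \<le> ?e m * norm (y - x)" if "norm (y - x) < 1 / real (Suc (K m))" for y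
      using AK[of m] that by (auto simp: approx_deriv_def)
  qed auto
  have e0: "?e \<longlonglongrightarrow> 0" using LIMSEQ_inverse_real_of_nat by (simp add: inverse_eq_divide)
  have "Cauchy (\<lambda>n. A n *v h)" for h
  proof (rule metric_CauchyI)
    fix \<epsilon> :: real assume \<epsilon>: "0 < \<epsilon>"
    define B where "B = norm h + 1"
    have B: "0 < B" "norm h \<le> B" by (auto simp: B_def add_nonneg_pos)
    have "\<epsilon> / (2 * B) > 0" using \<epsilon> B by simp
    then obtain N where N: "?e N < \<epsilon> / (2 * B)" by (metis nat_approx_posE)
    have "dist (A m *v h) (A n *v h) < \<epsilon>" if "N \<le> m" "N \<le> n" for m n
    proof -
      have "?e m \<le> ?e N" "?e n \<le> ?e N" using that by (auto intro!: divide_left_mono)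
      then have "?e m + ?e n \<le> 2 * ?e N" by simp
      have "dist (A m *v h) (A n *v h) \<le> (?e m + ?e n) * norm h" using diff by (simp add: dist_norm)
      also have "\<dots> \<le> (2 * ?e N) * B" using \<open>?e m + ?e n \<le> 2 * ?e N\<close> using B by (intro mult_mono) auto
      also have "\<dots> < (2 * (\<epsilon> / (2 * B))) * B"
        using N by (intro mult_strict_right_mono) (auto simp: B)
      also have "\<dots> = \<epsilon>" using B by simp
      finally show ?thesis .
    qed
    then show "\<exists>N. \<forall>m\<ge>N. \<forall>n\<ge>N. dist (A m *v h) (A n *v h) < \<epsilon>" by blast
  qed
  then have conv: "convergent (\<lambda>n. A n *v h)" for h by (simp add: Cauchy_convergent_iff)
  define L where "L h = lim (\<lambda>n. A n *v h)" for h
  have L: "(\<lambda>n. A n *v h) \<longlonglongrightarrow> L h" for h using conv[of h] unfolding L_def by (simp add: convergent_LIMSEQ_iff)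
  have linL: "linear L"
  proof (rule linearI)
    fix a b :: "(real,'n) vec" and c :: real
    have "(\<lambda>n. A n *v (a + b)) \<longlonglongrightarrow> L a + L b"
      unfolding matrix_vector_right_distrib by (intro tendsto_intros L)
    then show "L (a + b) = L a + L b" using L LIMSEQ_unique by blast
    have "(\<lambda>n. A n *v (c *\<^sub>R a)) \<longlonglongrightarrow> c *\<^sub>R L a"
      unfolding matrix_vector_mult_scaleR by (intro tendsto_intros L)
    then show "L (c *\<^sub>R a) = c *\<^sub>R L a" using L LIMSEQ_unique by blast
  qed
  have AL: "norm (A n *v h - L h) \<le> ?e n * norm h" for n h
  proof (rule LIMSEQ_le)
    show "(\<lambda>m. norm (A n *v h - A m *v h)) \<longlonglongrightarrow> norm (A n *v h - L h)" by (intro tendsto_intros L)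
    have "(\<lambda>m. (?e n + ?e m) * norm h) \<longlonglongrightarrow> (?e n + 0) * norm h" by (intro tendsto_intros e0)
    then show "(\<lambda>m. (?e n + ?e m) * norm h) \<longlonglongrightarrow> ?e n * norm h" by simp
  qed (use diff in blast)
  have "(f has_derivative L) (at x)"
    unfolding has_derivative_within_alt
  proof (intro conjI allI impI)
    show "bounded_linear L" using linL by (simp add: linear_conv_bounded_linear)
    fix \<epsilon> :: real assume "0 < \<epsilon>"
    then obtain n where n: "?e n < \<epsilon> / 2" by (metis nat_approx_posE half_gt_zero)
    show "\<exists>d>0. \<forall>y\<in>UNIV. norm (y - x) < d \<longrightarrow> norm (f y - f x - L (y - x)) \<le> \<epsilon> * norm (y - x)"
    proof (intro exI[of _ "1 / real (Suc (K n))"] conjI ballI impI)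
      fix y assume "norm (y - x) < 1 / real (Suc (K n))"
      then have "norm (f y - f x - A n *v (y - x)) \<le> ?e n * norm (y - x)"
        using AK[of n] by (auto simp: approx_deriv_def)
      moreover have "norm (f y - f x - L (y - x)) \<le> norm (f y - f x - A n *v (y - x)) + norm (A n *v (y - x) - L (y - x))"
      proof -
        have "f y - f x - L (y - x) = (f y - f x - A n *v (y - x)) + (A n *v (y - x) - L (y - x))" by simp
        then show ?thesis by (simp only: norm_triangle_ineq)
      qed
      moreover have "?e n * norm (y - x) + ?e n * norm (y - x) \<le> \<epsilon> * norm (y - x)"
        unfolding distrib_right[symmetric] using n by (intro mult_right_mono) auto
      ultimately show "norm (f y - f x - L (y - x)) \<le> \<epsilon> * norm (y - x)" using AL[of n "y - x"] by linarith
    qed simp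
  qed
  then show ?thesis by (auto simp: differentiable_def)
qed

text \<open>With a countable dense set of matrices and the radii 1/(k + 1), differentiability
  becomes a countable combination of closed conditions. On the differentiability set the divergence
  is approximated by traces of these matrices; elsewhere it is constant.\<close>

theorem divg_borel_measurable:
  fixes f :: "(real,'n::finite) vec \<Rightarrow> (real,'n) vec"
  shows "divg f \<in> borel_measurable borel"
proof -
  obtain D :: "((real,'n) vec,'n) vec set" where D: "countable D" "\<And>U. open U \<Longrightarrow> U \<noteq> {} \<Longrightarrow> \<exists>A\<in>D. A \<in> U"
    using countable_dense_exists[where 'a="((real,'n) vec,'n) vec"] by blast
  let ?e = "\<lambda>n. 1 / real (Suc n)" and ?d = "real CARD('n)"
  define E where "E A n k = approx_deriv f A (?e n) (?e k)" for A n k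
  have Em [measurable]: "E A n k \<in> sets borel" for A n k
    unfolding E_def by (intro borel_closed approx_deriv_closed) simp
  define F where "F = {x. f differentiable (at x)}"
  have FE: "F = (\<Inter>n. \<Union>A\<in>D. \<Union>k. E A n k)"
  proof (intro set_eqI iffI)
    fix x assume "x \<in> F"
    then obtain f' where "(f has_derivative f') (at x)" by (auto simp: F_def differentiable_def)
    then show "x \<in> (\<Inter>n. \<Union>A\<in>D. \<Union>k. E A n k)"
      using has_derivative_approx_deriv[OF D(2)] unfolding E_def by simp
  next
    fix x assume "x \<in> (\<Inter>n. \<Union>A\<in>D. \<Union>k. E A n k)"
    then have "\<exists>A k. x \<in> approx_deriv f A (?e n) (?e k)" for n unfolding E_def by blast
    then show "x \<in> F" unfolding F_def using approx_deriv_differentiable by blast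
  qed
  have UD: "(\<Union>A\<in>D. \<Union>k. E A n k) \<in> sets borel" for n
    using D(1) by (intro sets.countable_UN' sets.countable_UN) auto
  have Fm [measurable]: "F \<in> sets borel" unfolding FE using UD by (intro sets.countable_INT) auto
  let ?tr = "\<lambda>A :: ((real,'n) vec,'n) vec. \<Sum>i\<in>UNIV. (A *v axis i 1) $ i"
  have close: "\<bar>divg f x - ?tr A\<bar> \<le> 2 * ?d * ?e n" if x: "x \<in> F" "x \<in> E A n k" for x A n k
  proof -
    obtain f' where f': "(f has_derivative f') (at x)" using x(1) by (auto simp: F_def differentiable_def)
    have lin: "linear f'" using f' by (simp add: has_derivative_bounded_linear bounded_linear.linear)
    have en: "0 < ?e n" by simp
    obtain d where d: "d > 0" "\<And>y. norm (y - x) < d \<Longrightarrow> norm (f y - f x - f' (y - x)) \<le> ?e n * norm (y - x)"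
      using f' en unfolding has_derivative_within_alt by (metis UNIV_I)
    have "norm (A *v h - f' h) \<le> (?e n + ?e n) * norm h" for h
      by (rule approx_deriv_difference[OF x(2)[unfolded E_def] _ lin d(2) d(1)]) simp
    then have b: "\<bar>(A *v axis i 1) $ i - f' (axis i 1) $ i\<bar> \<le> 2 * ?e n" for i
      using Finite_Cartesian_Product.norm_nth_le[of "A *v axis i 1 - f' (axis i 1)" i]
      by (smt (verit) norm_axis_1 mult_cancel_left2 real_norm_def vector_minus_component)
    have "\<bar>divg f x - ?tr A\<bar> = \<bar>\<Sum>i\<in>UNIV. (f' (axis i 1) $ i - (A *v axis i 1) $ i)\<bar>"
      by (simp add: divg_eq[OF f'] sum_subtractf)
    also have "\<dots> \<le> (\<Sum>i\<in>(UNIV::'n set). 2 * ?e n)"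
      by (rule order_trans[OF sum_abs]) (intro sum_mono, use b in \<open>simp add: abs_minus_commute\<close>)
    finally show ?thesis by (simp add: mult_ac)
  qed
  \<comment> \<open>Off F the derivative is an arbitrary choice without a candidate, hence the same
    choice at every point.\<close>
  define c where "c = (\<Sum>i\<in>UNIV. (SOME f' :: (real,'n) vec \<Rightarrow> (real,'n) vec. False) (axis i 1) $ i)"
  have nF: "divg f x = c" if "x \<notin> F" for x
  proof -
    have "(\<lambda>f'. (f has_derivative f') (at x)) = (\<lambda>_. False)" using that by (auto simp: F_def differentiable_def)
    then show ?thesis by (simp add: divg_def c_def frechet_derivative_def)
  qed
  \<comment> \<open>For large n twice the approximation error fits strictly between a and the
    divergence, so a trace that exceeds a by the error detects the inequality.\<close>
  have gt: "{x \<in> F. a < divg f x} = F \<inter> (\<Union>n. \<Union>A\<in>{A\<in>D. a + 2 * ?d * ?e n < ?tr A}. \<Union>k. E A n k)" for a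
  proof (intro set_eqI iffI)
    fix x assume "x \<in> {x \<in> F. a < divg f x}"
    then have x: "x \<in> F" "a < divg f x" by auto
    have dp: "0 < ?d" by simp
    then have "(divg f x - a) / (4 * ?d) > 0" using x(2) by simp
    then obtain n where n: "?e n < (divg f x - a) / (4 * ?d)" by (metis nat_approx_posE)
    then have n4: "4 * ?d * ?e n < divg f x - a" using dp by (simp add: pos_less_divide_eq mult_ac)
    obtain A k where A: "A \<in> D" "x \<in> E A n k" using x(1) unfolding FE by blast
    have "a + 2 * ?d * ?e n < ?tr A" using close[OF x(1) A(2)] n4 by (simp add: abs_le_iff)
    then show "x \<in> F \<inter> (\<Union>n. \<Union>A\<in>{A\<in>D. a + 2 * ?d * ?e n < ?tr A}. \<Union>k. E A n k)"
      using x(1) A by blast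
  next
    fix x assume "x \<in> F \<inter> (\<Union>n. \<Union>A\<in>{A\<in>D. a + 2 * ?d * ?e n < ?tr A}. \<Union>k. E A n k)"
    then obtain n A k where x: "x \<in> F" "a + 2 * ?d * ?e n < ?tr A" "x \<in> E A n k" by blast
    then have "a < divg f x" using close[OF x(1,3)] by (simp add: abs_le_iff)
    then show "x \<in> {x \<in> F. a < divg f x}" using x(1) by blast
  qed
  have gm: "{x \<in> F. a < divg f x} \<in> sets borel" for a
  proof -
    have "(\<Union>A\<in>{A\<in>D. a + 2 * ?d * ?e n < ?tr A}. \<Union>k. E A n k) \<in> sets borel" for n
      using countable_subset[OF _ D(1), of "{A\<in>D. a + 2 * ?d * ?e n < ?tr A}"]
      by (intro sets.countable_UN' sets.countable_UN) auto
    then show ?thesis unfolding gt using Fm by (intro sets.Int sets.countable_UN) auto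
  qed
  show ?thesis
  proof (rule borel_measurable_iff_greater[THEN iffD2], intro allI)
    fix a
    have "{x \<in> space borel. a < divg f x} = {x \<in> F. a < divg f x} \<union> (if a < c then - F else {})"
      using nF by auto
    also have "\<dots> \<in> sets borel" using gm[of a] Fm by auto
    finally show "{x \<in> space borel. a < divg f x} \<in> sets borel" .
  qed
qed

lemma interior_ae_simplex:
  assumes "is_simplex S" shows "AE x in lborel. x \<in> convex hull S \<longrightarrow> x \<in> simplex_inner S"
proof -
  have "negligible (frontier (convex hull S))" by (rule negligible_convex_frontier[OF convex_convex_hull])
  moreover have "frontier (convex hull S) \<in> sets borel" by simp
  ultimately have "frontier (convex hull S) \<in> null_sets lborel"
    by (simp add: negligible_iff_null_sets null_sets_completion_iff)
  from AE_not_in[OF this] show ?thesis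
    using compact_imp_closed[OF simplex_compact[OF assms]]
    by (elim eventually_mono) (auto simp: frontier_def simplex_interior[OF assms])
qed

text \<open>On the boundary of the simplex the derivative of w depends on values outside it. The
  boundary is a null set, but changing an integrand almost everywhere requires measurability, which
  \<open>divg_borel_measurable\<close> supplies.\<close>

lemma sint_divg_piecewise:
  fixes w :: "(real,'n::finite) vec \<Rightarrow> (real,'n) vec"
  assumes S: "is_simplex S" and p: "p \<in> vpolys m" "\<And>x. x \<in> convex hull S \<Longrightarrow> w x = p x"
    and g: "continuous_on UNIV g"
  shows "sint S (\<lambda>x. divg w x * g x) = sint S (\<lambda>x. divg p x * g x)"
    and "sint S (\<lambda>x. divg w x * divg w x) = sint S (\<lambda>x. divg p x * divg p x)"
proof -
  have eq: "divg w x = divg p x" if "x \<in> simplex_inner S" for x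
  proof -
    have "(p has_derivative (\<lambda>h. \<chi> i. pgrad (\<lambda>x. p x $ i) x \<bullet> h)) (at x)" by (rule vpolys_has_derivative[OF p(1)])
    then have "(w has_derivative (\<lambda>h. \<chi> i. pgrad (\<lambda>x. p x $ i) x \<bullet> h)) (at x)"
      by (rule has_derivative_transform_within_open[OF _ simplex_inner_open[OF S] that])
         (use p(2) simplex_inner_subset[OF S] in force)
    then show ?thesis by (simp add: divg_eq divg_vpolys[OF p(1)] inner_axis)
  qed
  have [measurable]: "convex hull S \<in> sets borel" using simplex_compact[OF S] by (simp add: borel_compact)
  have [measurable]: "divg w \<in> borel_measurable borel" "divg p \<in> borel_measurable borel"
    by (rule divg_borel_measurable)+
  have [measurable]: "g \<in> borel_measurable borel" using g by (rule borel_measurable_continuous_onI)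
  show "sint S (\<lambda>x. divg w x * g x) = sint S (\<lambda>x. divg p x * g x)"
    by (rule set_lebesgue_integral_cong_AE) (use interior_ae_simplex[OF S] in \<open>auto elim!: eventually_mono simp: eq\<close>)
  show "sint S (\<lambda>x. divg w x * divg w x) = sint S (\<lambda>x. divg p x * divg p x)"
    by (rule set_lebesgue_integral_cong_AE) (use interior_ae_simplex[OF S] in \<open>auto elim!: eventually_mono simp: eq\<close>)
qed

section \<open>Raviart--Thomas spaces on conforming meshes\<close>

lemma RT0D:
  fixes F :: "(real,'n::finite) vec set"
  assumes "\<tau> \<in> RT0 M m"
  shows "S \<in> M \<Longrightarrow> \<tau> S \<in> rt_local m" "S \<notin> M \<Longrightarrow> \<tau> S = (\<lambda>_. 0)"
    "S \<in> M \<Longrightarrow> S' \<in> M \<Longrightarrow> F \<subseteq> S \<Longrightarrow> F \<subseteq> S' \<Longrightarrow> card F = CARD('n) \<Longrightarrow> normal_to F n \<Longrightarrow>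
      x \<in> convex hull F \<Longrightarrow> (\<tau> S x - \<tau> S' x) \<bullet> n = 0"
    "S \<in> M \<Longrightarrow> F \<subseteq> S \<Longrightarrow> card F = CARD('n) \<Longrightarrow> convex hull F \<subseteq> frontier (\<Union>S\<in>M. convex hull S) \<Longrightarrow>
      normal_to F n \<Longrightarrow> x \<in> convex hull F \<Longrightarrow> \<tau> S x \<bullet> n = 0"
proof -
  note * = assms[unfolded RT0_def mem_Collect_eq]
  show "S \<in> M \<Longrightarrow> \<tau> S \<in> rt_local m" "S \<notin> M \<Longrightarrow> \<tau> S = (\<lambda>_. 0)" using * by auto
  show "(\<tau> S x - \<tau> S' x) \<bullet> n = 0" if "S \<in> M" "S' \<in> M" "F \<subseteq> S" "F \<subseteq> S'" "card F = CARD('n)" "normal_to F n"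
      "x \<in> convex hull F"
    using *[THEN conjunct2, THEN conjunct2, THEN conjunct1, rule_format, OF that(1,2) _ that(6,7)] that(3-5) by simp
  show "\<tau> S x \<bullet> n = 0" if "S \<in> M" "F \<subseteq> S" "card F = CARD('n)" "convex hull F \<subseteq> frontier (\<Union>S\<in>M. convex hull S)"
      "normal_to F n" "x \<in> convex hull F"
    using *[THEN conjunct2, THEN conjunct2, THEN conjunct2, rule_format, OF that(1) _ that(5,6)] that(2-4) by simp
qed

lemma RT0I:
  fixes \<tau> :: "(real,'n::finite) vec set \<Rightarrow> (real,'n) vec \<Rightarrow> (real,'n) vec"
  assumes "\<And>S. S \<in> M \<Longrightarrow> \<tau> S \<in> rt_local m" "\<And>S. S \<notin> M \<Longrightarrow> \<tau> S = (\<lambda>_. 0)"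
    "\<And>S S' F n x. S \<in> M \<Longrightarrow> S' \<in> M \<Longrightarrow> F \<subseteq> S \<Longrightarrow> F \<subseteq> S' \<Longrightarrow> card F = CARD('n) \<Longrightarrow> normal_to F n \<Longrightarrow>
      x \<in> convex hull F \<Longrightarrow> (\<tau> S x - \<tau> S' x) \<bullet> n = 0"
    "\<And>S F n x. S \<in> M \<Longrightarrow> F \<subseteq> S \<Longrightarrow> card F = CARD('n) \<Longrightarrow> convex hull F \<subseteq> frontier (\<Union>S\<in>M. convex hull S) \<Longrightarrow>
      normal_to F n \<Longrightarrow> x \<in> convex hull F \<Longrightarrow> \<tau> S x \<bullet> n = 0"
  shows "\<tau> \<in> RT0 M m"
  unfolding RT0_def mem_Collect_eq
proof (intro conjI ballI allI impI)
  show "\<tau> S \<in> rt_local m" if "S \<in> M" for S by (rule assms(1)[OF that])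
  show "\<tau> S = (\<lambda>_. 0)" if "S \<notin> M" for S by (rule assms(2)[OF that])
  show "(\<tau> S x - \<tau> S' x) \<bullet> n = 0"
    if "S \<in> M" "S' \<in> M" "F \<subseteq> S \<and> F \<subseteq> S' \<and> card F = CARD('n)" "normal_to F n" "x \<in> convex hull F" for S S' F n x
    using assms(3)[OF that(1,2) _ _ _ that(4,5)] that(3) by simp
  show "\<tau> S x \<bullet> n = 0"
    if "S \<in> M" "F \<subseteq> S \<and> card F = CARD('n) \<and> convex hull F \<subseteq> frontier (\<Union>S\<in>M. convex hull S)"
      "normal_to F n" "x \<in> convex hull F" for S F n x
    using assms(4)[OF that(1) _ _ _ that(3,4)] that(2) by simp
qed

lemma rt_local_vpolys: "\<tau> \<in> rt_local m \<Longrightarrow> \<tau> \<in> vpolys (m + 1)"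
proof -
  assume "\<tau> \<in> rt_local m"
  then obtain a b where *: "a \<in> vpolys m" "b \<in> polys m" "\<tau> = (\<lambda>x. a x + b x *\<^sub>R x)" unfolding rt_local_def by blast
  show ?thesis unfolding *(3)
    by (rule vpolys_add[OF vpolys_mono[OF *(1)] vpolys_scale[OF *(2) vpolys_id[of 1] ]]) auto
qed

lemma rt_localI: "a \<in> vpolys m \<Longrightarrow> b \<in> polys m \<Longrightarrow> (\<lambda>x. a x + b x *\<^sub>R x) \<in> rt_local m"
  unfolding rt_local_def by blast

section \<open>Linear structure and finite dimension of the discrete spaces\<close>

lemma rt_local_subspace: "subspace (rt_local m)"
  unfolding subspace_def
proof (intro conjI ballI allI)
  show "0 \<in> rt_local m"
    using rt_localI[of "\<lambda>_. 0" m "\<lambda>_. 0"] by (simp add: vpolys_def polys_zero zero_fun_def)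
next
  fix f g :: "(real,'a) vec \<Rightarrow> (real,'a) vec" assume "f \<in> rt_local m" "g \<in> rt_local m"
  then obtain a b c d where *: "a \<in> vpolys m" "b \<in> polys m" "f = (\<lambda>x. a x + b x *\<^sub>R x)"
    "c \<in> vpolys m" "d \<in> polys m" "g = (\<lambda>x. c x + d x *\<^sub>R x)" unfolding rt_local_def by blast
  have "f + g = (\<lambda>x. (a x + c x) + (b x + d x) *\<^sub>R x)" by (auto simp: * fun_eq_iff algebra_simps)
  then show "f + g \<in> rt_local m"
    using rt_localI[OF vpolys_add[OF *(1,4)] polys_add[OF *(2,5)]] by simp
next
  fix c and f :: "(real,'a) vec \<Rightarrow> (real,'a) vec" assume "f \<in> rt_local m"
  then obtain a b where *: "a \<in> vpolys m" "b \<in> polys m" "f = (\<lambda>x. a x + b x *\<^sub>R x)" unfolding rt_local_def by blast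
  have "c *\<^sub>R f = (\<lambda>x. c *\<^sub>R a x + (c * b x) *\<^sub>R x)" by (auto simp: * fun_eq_iff algebra_simps)
  then show "c *\<^sub>R f \<in> rt_local m"
    using rt_localI[OF vpolys_cscale[OF *(1), of c] polys_cmult[OF *(2), of c]] by simp
qed

lemma rt_local_zero: "(\<lambda>_. 0) \<in> rt_local m"
  using subspace_0[OF rt_local_subspace] by (simp add: zero_fun_def)

lemma RT0_subspace: "subspace (RT0 M m)"
  unfolding subspace_def
proof (intro conjI ballI allI)
  show "0 \<in> RT0 M m"
    by (rule RT0I) (auto simp: subspace_0[OF rt_local_subspace] zero_fun_def[symmetric])
next
  fix f g assume f: "f \<in> RT0 M m" and g: "g \<in> RT0 M m"
  show "f + g \<in> RT0 M m"
  proof (rule RT0I)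
    show "(f + g) S \<in> rt_local m" if "S \<in> M" for S
      using subspace_add[OF rt_local_subspace RT0D(1)[OF f that] RT0D(1)[OF g that]] by simp
    show "(f + g) S = (\<lambda>_. 0)" if "S \<notin> M" for S
      by (simp add: RT0D(2)[OF f that] RT0D(2)[OF g that] fun_eq_iff)
  next
    fix S S' F n x assume a: "S \<in> M" "S' \<in> M" "F \<subseteq> S" "F \<subseteq> S'" "card F = CARD('a)" "normal_to F n" "x \<in> convex hull F"
    from RT0D(3)[OF f a] RT0D(3)[OF g a] show "((f + g) S x - (f + g) S' x) \<bullet> n = 0"
      by (simp add: inner_add_left inner_diff_left)
  next
    fix S F n x assume a: "S \<in> M" "F \<subseteq> S" "card F = CARD('a)" "convex hull F \<subseteq> frontier (\<Union>S\<in>M. convex hull S)"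
      "normal_to F n" "x \<in> convex hull F"
    from RT0D(4)[OF f a] RT0D(4)[OF g a] show "(f + g) S x \<bullet> n = 0" by (simp add: inner_add_left)
  qed
next
  fix c f assume f: "f \<in> RT0 M m"
  show "c *\<^sub>R f \<in> RT0 M m"
  proof (rule RT0I)
    show "(c *\<^sub>R f) S \<in> rt_local m" if "S \<in> M" for S
      using subspace_scale[OF rt_local_subspace RT0D(1)[OF f that]] by simp
    show "(c *\<^sub>R f) S = (\<lambda>_. 0)" if "S \<notin> M" for S by (simp add: RT0D(2)[OF f that] fun_eq_iff)
  next
    fix S S' F n x assume a: "S \<in> M" "S' \<in> M" "F \<subseteq> S" "F \<subseteq> S'" "card F = CARD('a)" "normal_to F n" "x \<in> convex hull F"
    from RT0D(3)[OF f a] show "((c *\<^sub>R f) S x - (c *\<^sub>R f) S' x) \<bullet> n = 0"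
      by (simp add: inner_diff_left)
  next
    fix S F n x assume a: "S \<in> M" "F \<subseteq> S" "card F = CARD('a)" "convex hull F \<subseteq> frontier (\<Union>S\<in>M. convex hull S)"
      "normal_to F n" "x \<in> convex hull F"
    from RT0D(4)[OF f a] show "(c *\<^sub>R f) S x \<bullet> n = 0" by simp
  qed
qed

lemma finite_dimensional_families:
  fixes X :: "'b::real_vector set"
  assumes M: "finite M" and X: "finite_dimensional X"
  shows "finite_dimensional {f :: 'a \<Rightarrow> 'b. (\<forall>S\<in>M. f S \<in> X) \<and> (\<forall>S. S \<notin> M \<longrightarrow> f S = 0)}"
proof -
  let ?L = "\<lambda>S. \<lambda>x :: 'b. (\<lambda>S'. if S' = S then x else 0)"
  have "linear (?L S)" for S :: 'a by (auto simp: linear_iff fun_eq_iff)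
  then have fd: "finite_dimensional (?L S ` X)" for S :: 'a by (rule finite_dimensional_linear_image[OF X])
  have "{f :: 'a \<Rightarrow> 'b. (\<forall>S\<in>M. f S \<in> X) \<and> (\<forall>S. S \<notin> M \<longrightarrow> f S = 0)} \<subseteq> {\<Sum>S\<in>M. y S | y. \<forall>S\<in>M. y S \<in> ?L S ` X}"
  proof
    fix f :: "'a \<Rightarrow> 'b" assume f: "f \<in> {f. (\<forall>S\<in>M. f S \<in> X) \<and> (\<forall>S. S \<notin> M \<longrightarrow> f S = 0)}"
    have "f = (\<Sum>S\<in>M. ?L S (f S))"
    proof
      fix S'
      have "(\<Sum>S\<in>M. ?L S (f S)) S' = (\<Sum>S\<in>M. if S' = S then f S else 0)" by (simp add: sum_fun_apply)
      then show "f S' = (\<Sum>S\<in>M. ?L S (f S)) S'" using M f by auto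
    qed
    then show "f \<in> {\<Sum>S\<in>M. y S | y. \<forall>S\<in>M. y S \<in> ?L S ` X}" using f
      by (intro CollectI exI[of _ "\<lambda>S. ?L S (f S)"]) auto
  qed
  then show ?thesis
    by (rule finite_dimensional_subset[OF finite_dimensional_family_sum[OF M fd]])
qed

lemma RT0_finite_dimensional:
  assumes "finite M" shows "finite_dimensional (RT0 M m)"
proof (rule finite_dimensional_subset[OF finite_dimensional_families[OF assms finite_dimensional_vpolys[of "m + 1"]]])
  show "RT0 M m \<subseteq> {f. (\<forall>S\<in>M. f S \<in> vpolys (m + 1)) \<and> (\<forall>S. S \<notin> M \<longrightarrow> f S = 0)}"
    using RT0D(1,2) rt_local_vpolys by (fastforce simp: zero_fun_def)
qed

lemma broken_polysD:
  assumes "q \<in> broken_polys M m"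
  shows "S \<in> M \<Longrightarrow> q S \<in> polys m" "S \<notin> M \<Longrightarrow> q S = (\<lambda>_. 0)"
  using assms unfolding broken_polys_def by auto

lemma broken_polys_all: "q \<in> broken_polys M m \<Longrightarrow> q S \<in> polys m"
  using broken_polysD[of q M m S] by (cases "S \<in> M") (auto simp: polys_zero)

lemma Q0_broken: "\<psi> \<in> Q0 M m \<Longrightarrow> \<psi> \<in> broken_polys M m"
  by (simp add: Q0_def)

lemma Q0_finite_dimensional:
  assumes "finite M" shows "finite_dimensional (Q0 M m)"
proof (rule finite_dimensional_subset[OF finite_dimensional_families[OF assms finite_dimensional_polys[of m]]])
  show "Q0 M m \<subseteq> {f. (\<forall>S\<in>M. f S \<in> polys m) \<and> (\<forall>S. S \<notin> M \<longrightarrow> f S = 0)}"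
    by (auto simp: Q0_def broken_polys_def zero_fun_def)
qed

lemma broken_polys_subspace: "subspace (broken_polys M m)"
  by (auto simp: subspace_def broken_polys_def fun_eq_iff polys_zero
      intro: subspace_add[OF polys_subspace] subspace_scale[OF polys_subspace] subspace_0[OF polys_subspace])

lemma Q0_subspace:
  assumes "\<And>S. S \<in> M \<Longrightarrow> is_simplex S" shows "subspace (Q0 M m)"
  unfolding subspace_def
proof (intro conjI ballI allI)
  show "0 \<in> Q0 M m" using subspace_0[OF broken_polys_subspace, of M m] by (simp add: Q0_def zero_fun_def)
next
  fix f g assume fg: "f \<in> Q0 M m" "g \<in> Q0 M m"
  have "(\<Sum>S\<in>M. sint S (\<lambda>x. f S x + g S x)) = (\<Sum>S\<in>M. sint S (f S) + sint S (g S))"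
    by (intro sum.cong refl sint_add assms polys_continuous[of _ m] broken_polys_all[OF Q0_broken[OF fg(1)]]
        broken_polys_all[OF Q0_broken[OF fg(2)]])
  then show "f + g \<in> Q0 M m" using fg subspace_add[OF broken_polys_subspace, of f M m g]
    by (simp add: Q0_def sum.distrib plus_fun_def)
next
  fix c f assume "f \<in> Q0 M m"
  then show "c *\<^sub>R f \<in> Q0 M m" using subspace_scale[OF broken_polys_subspace, of f M m c]
    by (simp add: Q0_def sum_distrib_left[symmetric] scaleR_fun_def)
qed

lemma normal_to_hull:
  assumes "normal_to F n" "x \<in> convex hull F" "y \<in> convex hull F"
  shows "n \<bullet> (x - y) = 0"
proof -
  have "F \<noteq> {}" using assms(2) by auto
  then obtain u where u: "u \<in> F" by blast
  have "n \<bullet> w = n \<bullet> u" if "w \<in> F" for w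
    using assms(1)[unfolded normal_to_def, rule_format, OF that u] by (simp add: inner_diff_right)
  then have "convex hull F \<subseteq> {z. n \<bullet> z = n \<bullet> u}"
    by (intro hull_minimal subsetI CollectI convex_hyperplane)
  then have "n \<bullet> x = n \<bullet> u" "n \<bullet> y = n \<bullet> u" using assms(2,3) by auto
  then show ?thesis by (simp add: inner_diff_right)
qed

lemma bgrad_normal:
  assumes S: "is_simplex S" and v: "v \<in> S" shows "normal_to (S - {v}) (bgrad S v)"
  unfolding normal_to_def
proof (intro ballI)
  fix u w assume "u \<in> S - {v}" "w \<in> S - {v}"
  then show "bgrad S v \<bullet> (u - w) = 0"
    using bary_diff[OF S, of v u w] bary_vertex[OF S, of u v] bary_vertex[OF S, of w v] v by auto
qed

text \<open>The contributions of the facets cancel in pairs or vanish.\<close>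

theorem total_flux_zero:
  fixes \<tau> :: "(real,'n::finite) vec set \<Rightarrow> (real,'n) vec \<Rightarrow> (real,'n) vec"
  assumes M: "conforming M" and poly: "\<And>S. S \<in> M \<Longrightarrow> \<tau> S \<in> vpolys N"
    and cont: "\<And>S S' F n x. S \<in> M \<Longrightarrow> S' \<in> M \<Longrightarrow> F \<subseteq> S \<Longrightarrow> F \<subseteq> S' \<Longrightarrow> card F = CARD('n) \<Longrightarrow> normal_to F n \<Longrightarrow>
      x \<in> convex hull F \<Longrightarrow> (\<tau> S x - \<tau> S' x) \<bullet> n = 0"
    and bdry: "\<And>S F n x. S \<in> M \<Longrightarrow> F \<subseteq> S \<Longrightarrow> card F = CARD('n) \<Longrightarrow> convex hull F \<subseteq> frontier (\<Union>S\<in>M. convex hull S) \<Longrightarrow>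
      normal_to F n \<Longrightarrow> x \<in> convex hull F \<Longrightarrow> \<tau> S x \<bullet> n = 0"
  shows "(\<Sum>S\<in>M. sint S (divg (\<tau> S))) = 0"
proof -
  note s = conformingD(2)[OF M] and fin = conformingD(1)[OF M]
  define t where "t P = facet_flux (fst P) (snd P) (\<lambda>x. \<tau> (fst P) x \<bullet> bgrad (fst P) (snd P))" for P
  define X where "X = Sigma M (\<lambda>S. S)"
  have finX: "finite X" unfolding X_def using fin is_simplexD(1)[OF s] by (intro finite_SigmaI) auto
  have "(\<Sum>S\<in>M. sint S (divg (\<tau> S))) = (\<Sum>S\<in>M. - (\<Sum>v\<in>S. t (S, v)))"
    by (intro sum.cong refl) (simp add: sint_divg[OF s poly] t_def)
  also have "\<dots> = - (\<Sum>S\<in>M. \<Sum>v\<in>S. t (S, v))" by (simp add: sum_negf)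
  also have "(\<Sum>S\<in>M. \<Sum>v\<in>S. t (S, v)) = sum t X"
    unfolding X_def using fin is_simplexD(1)[OF s] by (subst sum.Sigma) auto
  \<comment> \<open>Pairs of a simplex and a vertex are collected by the facet opposite the
    vertex.\<close>
  also have "sum t X = (\<Sum>F\<in>(\<lambda>P. fst P - {snd P}) ` X. sum t {P\<in>X. fst P - {snd P} = F})"
    by (rule sum.group[symmetric]) (use finX in auto)
  also have "\<dots> = (\<Sum>F\<in>(\<lambda>P. fst P - {snd P}) ` X. 0)"
  proof (rule sum.cong[OF refl])
    fix F assume "F \<in> (\<lambda>P. fst P - {snd P}) ` X"
    then obtain P where P: "P \<in> X" "F = fst P - {snd P}" by blast
    define S v where "S = fst P" and "v = snd P"
    then have Sv: "S \<in> M" "v \<in> S" "F = S - {v}" using P unfolding X_def by auto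
    have S: "S = insert v F" "v \<notin> F" using Sv by auto
    have sS: "is_simplex (insert v F)" using s[OF Sv(1)] S by simp
    note nF = facet_nonempty[OF sS S(2)]
    have nrm: "normal_to F (bgrad S v)" using bgrad_normal[OF s[OF Sv(1)] Sv(2)] Sv(3) by simp
    have qp: "(\<lambda>x. \<tau> S' x \<bullet> c) \<in> polys N" if "S' \<in> M" for S' c
      by (rule polys_inner[OF poly[OF that] vpolys_const[of 0]]) auto
    let ?G = "{P\<in>X. fst P - {snd P} = F}"
    show "sum t ?G = 0"
    proof (cases "\<exists>S'\<in>M. S' \<noteq> S \<and> F \<subseteq> S'")
      \<comment> \<open>F belongs to one simplex only, so it lies in the frontier and the boundary
        condition removes its flux.\<close>
      case False
      have "?G = {(S, v)}"
      proof (intro set_eqI iffI)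
        fix P assume P: "P \<in> ?G"
        then have "fst P = S" using False unfolding X_def by auto
        moreover have "snd P = v" using P calculation Sv unfolding X_def by auto
        ultimately show "P \<in> {(S, v)}" by (simp add: prod_eq_iff)
      qed (use Sv in \<open>auto simp: X_def\<close>)
      moreover have "convex hull F \<subseteq> frontier (\<Union>S\<in>M. convex hull S)"
      proof (rule unshared_facet_in_frontier[OF M _ S(2)])
        show "insert v F \<in> M" using Sv(1) S(1) by simp
        show "S' = insert v F" if "S' \<in> M" "F \<subseteq> S'" for S' using False that S(1)[symmetric] by blast
      qed
      then have "\<tau> S x \<bullet> bgrad S v = 0" if "x \<in> convex hull (S - {v})" for x
        using bdry[OF Sv(1) _ nF(3) _ nrm, of x] that unfolding Sv(3) by blast
      then have "t (S, v) = 0" unfolding t_def fst_conv snd_conv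
        by (rule facet_flux_zero[OF s[OF Sv(1)] Sv(2) qp[OF Sv(1)]])
      ultimately show ?thesis by simp
    next
      case True
      then obtain S' where S': "S' \<in> M" "S' \<noteq> S" "F \<subseteq> S'" by blast
      have "card (S' - F) = 1"
        using is_simplexD(1,2)[OF s[OF S'(1)]] nF S'(3) by (simp add: card_Diff_subset)
      then obtain v' where v': "S' - F = {v'}" using card_1_singletonE by blast
      then have S'i: "S' = insert v' F" "v' \<notin> F" using S'(3) by auto
      have vv: "v \<noteq> v'" using S'(2) S S'i by auto
      have MM: "insert v F \<in> M" "insert v' F \<in> M" using Sv(1) S'(1) S S'i by auto
      have sS': "is_simplex (insert v' F)" using s MM by blast
      have "?G = {(S, v), (S', v')}"
      proof (intro set_eqI iffI)
        fix P assume P: "P \<in> ?G"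
        obtain A w where Aw: "P = (A, w)" by (cases P)
        have A: "A = insert w F" "w \<notin> F" "A \<in> M" using P Aw unfolding X_def by auto
        show "P \<in> {(S, v), (S', v')}"
        proof (cases "w = v")
          case True
          then show ?thesis using A Aw S by simp
        next
          case False
          have "w = v'"
            by (rule neighbour_unique[OF M MM(1) _ MM(2) S(2) A(2) S'i(2) False vv[symmetric]]) (use A in simp)
          then show ?thesis using A Aw S'i by simp
        qed
      next
        fix P assume P: "P \<in> {(S, v), (S', v')}"
        have "insert v F - {v} = F" "insert v' F - {v'} = F" using S(2) S'i(2) by auto
        then have "(S, v) \<in> ?G" "(S', v') \<in> ?G" using MM unfolding X_def S(1) S'i(1) by simp_all
        then show "P \<in> ?G" using P by blast
      qed
      then have "sum t ?G = t (S, v) + t (S', v')" using vv by simp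
      \<comment> \<open>The gradient changes by the factor 1/\<beta> and the flux by the absolute
        value of \<beta>. Since \<beta> is negative, only a sign remains.\<close>
      moreover have "t (S', v') = - t (S, v)"
      proof -
        define \<beta> where "\<beta> = bary (insert v F) v v'"
        have b: "\<beta> < 0" unfolding \<beta>_def by (rule neighbours_opposite[OF M MM S(2) S'i(2) vv])
        have g: "bgrad (insert v' F) v' = (1 / \<beta>) *\<^sub>R bgrad (insert v F) v"
          unfolding \<beta>_def by (rule bary_neighbour(2)[OF sS sS' S(2) S'i(2)]) (use b \<beta>_def in simp)
        have "t (S', v') = facet_flux (insert v' F) v' (\<lambda>x. (1 / \<beta>) * (\<tau> S' x \<bullet> bgrad (insert v F) v))"
          unfolding t_def fst_conv snd_conv S'i(1) g by simp
        also have "\<dots> = (1 / \<beta>) * facet_flux (insert v' F) v' (\<lambda>x. \<tau> S' x \<bullet> bgrad (insert v F) v)"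
          by (rule facet_flux_cmult[OF qp[OF S'(1)]])
        also have "facet_flux (insert v' F) v' (\<lambda>x. \<tau> S' x \<bullet> bgrad (insert v F) v)
            = \<bar>\<beta>\<bar> * facet_flux (insert v F) v (\<lambda>x. \<tau> S' x \<bullet> bgrad (insert v F) v)"
          unfolding \<beta>_def by (rule facet_flux_neighbour[OF sS sS' S(2) S'i(2) qp[OF S'(1)]])
        also have "facet_flux (insert v F) v (\<lambda>x. \<tau> S' x \<bullet> bgrad (insert v F) v)
            = facet_flux (insert v F) v (\<lambda>x. \<tau> S x \<bullet> bgrad (insert v F) v)"
        proof (rule facet_flux_cong[OF sS insertI1 qp[OF S'(1)] qp[OF Sv(1)]])
          fix x assume "x \<in> convex hull (insert v F - {v})"
          then have x: "x \<in> convex hull F" using S(2) by simp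
          have "(\<tau> S x - \<tau> S' x) \<bullet> bgrad S v = 0"
            by (rule cont[OF Sv(1) S'(1) _ S'(3) nF(3) nrm x]) (use Sv in auto)
          then show "\<tau> S' x \<bullet> bgrad (insert v F) v = \<tau> S x \<bullet> bgrad (insert v F) v"
            using S(1) by (simp add: inner_diff_left)
        qed
        also have "facet_flux (insert v F) v (\<lambda>x. \<tau> S x \<bullet> bgrad (insert v F) v) = t (S, v)"
          unfolding t_def fst_conv snd_conv S(1) by simp
        finally show ?thesis using b by simp
      qed
      ultimately show ?thesis by simp
    qed
  qed
  finally show ?thesis by simp
qed

text \<open>A factor that is one polynomial on the whole patch preserves both normal conditions, so
  the total flux of q \<tau> vanishes as well: integration by parts over the patch without boundary
  terms.\<close>

lemma RT0_total_flux_zero: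
  assumes M: "conforming M" and \<tau>: "\<tau> \<in> RT0 M m" and q: "q \<in> polys n"
  shows "(\<Sum>S\<in>M. sint S (\<lambda>x. pgrad q x \<bullet> \<tau> S x + q x * divg (\<tau> S) x)) = 0"
proof -
  have v: "\<tau> S \<in> vpolys (m + 1)" if "S \<in> M" for S using rt_local_vpolys[OF RT0D(1)[OF \<tau> that]] .
  have "(\<Sum>S\<in>M. sint S (divg (\<lambda>x. q x *\<^sub>R \<tau> S x))) = 0"
  proof (rule total_flux_zero[OF M, where \<tau>="\<lambda>S x. q x *\<^sub>R \<tau> S x"])
    show "(\<lambda>x. q x *\<^sub>R \<tau> S x) \<in> vpolys (n + (m + 1))" if "S \<in> M" for S
      by (rule vpolys_scale[OF q v[OF that] order_refl])
  next
    fix S S' F n x assume a: "S \<in> M" "S' \<in> M" "F \<subseteq> S" "F \<subseteq> S'" "card F = CARD('a)" "normal_to F n" "x \<in> convex hull F"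
    from RT0D(3)[OF \<tau> a] show "(q x *\<^sub>R \<tau> S x - q x *\<^sub>R \<tau> S' x) \<bullet> n = 0"
      by (simp add: scaleR_diff_right[symmetric])
  next
    fix S F n x assume a: "S \<in> M" "F \<subseteq> S" "card F = CARD('a)" "convex hull F \<subseteq> frontier (\<Union>S\<in>M. convex hull S)"
      "normal_to F n" "x \<in> convex hull F"
    from RT0D(4)[OF \<tau> a] show "(q x *\<^sub>R \<tau> S x) \<bullet> n = 0" by simp
  qed
  moreover have "divg (\<lambda>x. q x *\<^sub>R \<tau> S x) = (\<lambda>x. pgrad q x \<bullet> \<tau> S x + q x * divg (\<tau> S) x)" if "S \<in> M" for S
    by (rule ext, rule divg_scale[OF q v[OF that]])
  ultimately show ?thesis by simp
qed

subsection \<open>Element bubbles and facet functions\<close>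

text \<open>The matrix \<open>\<Sum>\<^sub>v \<lambda>\<^sub>v (v - x)(v - x)\<^sup>T\<close> is a covariance matrix: it is positive definite inside the simplex,
  annihilates the normals on the facets, and since \<open>\<Sum>\<^sub>v \<lambda>\<^sub>v (v - x) = 0\<close> it equals
  \<open>\<Sum>\<^sub>v \<lambda>\<^sub>v v v\<^sup>T - x x\<^sup>T\<close>, so it maps polynomials of degree k - 2 into the Raviart--Thomas space of index k - 1.\<close>

definition bubble_field :: "(real,'n::finite) vec set \<Rightarrow> ((real,'n) vec \<Rightarrow> (real,'n) vec) \<Rightarrow> (real,'n) vec \<Rightarrow> (real,'n) vec" where
  "bubble_field S \<xi> x = (\<Sum>v\<in>S. (bary S v x * ((v - x) \<bullet> \<xi> x)) *\<^sub>R (v - x))"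

lemma bubble_field_rt:
  assumes S: "is_simplex S" and \<xi>: "\<xi> \<in> vpolys (m - 1)"
  shows "bubble_field S \<xi> \<in> rt_local m"
proof -
  define a where "a x = (\<Sum>v\<in>S. (bary S v x * (v \<bullet> \<xi> x)) *\<^sub>R v)" for x
  define b where "b x = - (x \<bullet> \<xi> x)" for x
  have "bubble_field S \<xi> x = a x + b x *\<^sub>R x" for x
  proof -
    let ?l = "\<lambda>v. bary S v x" and ?c = "x \<bullet> \<xi> x"
    have "bubble_field S \<xi> x = (\<Sum>v\<in>S. ((?l v * (v \<bullet> \<xi> x)) *\<^sub>R v - ?c *\<^sub>R (?l v *\<^sub>R v)) - ((?l v * (v \<bullet> \<xi> x)) *\<^sub>R x - (?c * ?l v) *\<^sub>R x))"
      unfolding bubble_field_def by (intro sum.cong refl) (simp add: inner_diff_left algebra_simps)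
    also have "\<dots> = (a x - ?c *\<^sub>R (\<Sum>v\<in>S. ?l v *\<^sub>R v)) - ((\<Sum>v\<in>S. ?l v * (v \<bullet> \<xi> x)) *\<^sub>R x - (?c * (\<Sum>v\<in>S. ?l v)) *\<^sub>R x)"
      unfolding a_def by (simp add: sum_subtractf scaleR_sum_right scaleR_sum_left sum_distrib_left)
    also have "(\<Sum>v\<in>S. ?l v * (v \<bullet> \<xi> x)) = (\<Sum>v\<in>S. ?l v *\<^sub>R v) \<bullet> \<xi> x" by (simp add: inner_sum_left)
    finally show ?thesis by (simp add: bary_props[OF S] b_def)
  qed
  then have eq: "bubble_field S \<xi> = (\<lambda>x. a x + b x *\<^sub>R x)" by (rule ext)
  have "(\<lambda>x. bary S v x * (v \<bullet> \<xi> x)) \<in> polys m" for v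
    by (rule polys_mult_le[OF bary_polys[OF S] polys_inner[OF vpolys_const[of 0] \<xi> order_refl]]) auto
  then have "a \<in> vpolys m" unfolding a_def[abs_def]
    by (intro vpolys_sum vpolys_scale[OF _ vpolys_const[of 0]]) auto
  moreover have "b \<in> polys m" unfolding b_def[abs_def]
    by (intro polys_minus polys_inner[OF vpolys_id \<xi>]) auto
  ultimately show ?thesis unfolding eq by (rule rt_localI)
qed

text \<open>At a point of the face spanned by F, v - x is tangential for v in F, and the coordinates
  of the other vertices vanish.\<close>

lemma bubble_field_normal:
  assumes S: "is_simplex S" and F: "F \<subseteq> S" "normal_to F n" "x \<in> convex hull F"
  shows "bubble_field S \<xi> x \<bullet> n = 0"
  unfolding bubble_field_def inner_sum_left
proof (rule sum.neutral, rule ballI)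
  fix v assume v: "v \<in> S"
  show "((bary S v x * ((v - x) \<bullet> \<xi> x)) *\<^sub>R (v - x)) \<bullet> n = 0"
  proof (cases "v \<in> F")
    case True
    then have "n \<bullet> (v - x) = 0" by (intro normal_to_hull[OF F(2) _ F(3)] hull_inc)
    then show ?thesis by (simp add: inner_commute)
  next
    case False
    then have "bary S v x = 0" using simplex_face_iff[OF S F(1), of x] F(3) v by blast
    then show ?thesis by simp
  qed
qed

lemma bubble_field_energy: "\<xi> x \<bullet> bubble_field S \<xi> x = (\<Sum>v\<in>S. bary S v x * ((v - x) \<bullet> \<xi> x)\<^sup>2)"
  by (simp add: bubble_field_def inner_sum_right inner_commute power2_eq_square mult_ac)

text \<open>One factor v - x is bounded by h; what remains is a weighted mean, whose square is at
  most the weighted mean of the squares.\<close>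

lemma bubble_field_norm:
  assumes S: "is_simplex S" and x: "x \<in> convex hull S" and h: "\<And>v. v \<in> S \<Longrightarrow> norm (v - x) \<le> h"
  shows "(norm (bubble_field S \<xi> x))\<^sup>2 \<le> h\<^sup>2 * (\<xi> x \<bullet> bubble_field S \<xi> x)"
proof -
  let ?l = "\<lambda>v. bary S v x" and ?c = "\<lambda>v. \<bar>(v - x) \<bullet> \<xi> x\<bar>"
  have l: "0 \<le> ?l v" for v by (rule bary_nonneg[OF S x])
  define m where "m = (\<Sum>v\<in>S. ?l v * ?c v)"
  have "norm (bubble_field S \<xi> x) \<le> (\<Sum>v\<in>S. norm ((?l v * ((v - x) \<bullet> \<xi> x)) *\<^sub>R (v - x)))"
    unfolding bubble_field_def by (rule norm_sum)
  also have "\<dots> \<le> (\<Sum>v\<in>S. (?l v * ?c v) * h)"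
    by (rule sum_mono) (use h l in \<open>auto simp: abs_mult intro!: mult_left_mono mult_nonneg_nonneg\<close>)
  also have "\<dots> = h * m" by (simp add: m_def sum_distrib_left mult.commute)
  finally have "(norm (bubble_field S \<xi> x))\<^sup>2 \<le> (h * m)\<^sup>2" by (intro power_mono) auto
  also have "\<dots> = h\<^sup>2 * m\<^sup>2" by (simp add: power_mult_distrib)
  also have "m\<^sup>2 \<le> (\<Sum>v\<in>S. ?l v * (?c v)\<^sup>2)"
  proof -
    \<comment> \<open>Nonnegativity of the variance for the weights given by the barycentric
      coordinates.\<close>
    have "0 \<le> (\<Sum>v\<in>S. ?l v * (?c v - m)\<^sup>2)" by (intro sum_nonneg mult_nonneg_nonneg l) auto
    also have "\<dots> = (\<Sum>v\<in>S. ?l v * (?c v)\<^sup>2 - (2 * m) * (?l v * ?c v) + m\<^sup>2 * ?l v)"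
      by (intro sum.cong refl) (simp add: power2_diff algebra_simps)
    also have "\<dots> = (\<Sum>v\<in>S. ?l v * (?c v)\<^sup>2) - 2 * m * m + m\<^sup>2 * (\<Sum>v\<in>S. ?l v)"
      by (simp add: sum.distrib sum_subtractf sum_distrib_left[symmetric] m_def)
    finally show ?thesis by (simp add: bary_props[OF S] power2_eq_square)
  qed
  finally show ?thesis unfolding bubble_field_energy by (simp add: mult_left_mono)
qed

definition on_element :: "(real,'n::finite) vec set \<Rightarrow> ((real,'n) vec \<Rightarrow> (real,'n) vec) \<Rightarrow> (real,'n) vec set \<Rightarrow> (real,'n) vec \<Rightarrow> (real,'n) vec" where
  "on_element S \<tau> = (\<lambda>S'. if S' = S then \<tau> else (\<lambda>_. 0))"

lemma bubble_RT0:
  assumes M: "conforming M" and S: "S \<in> M" and \<xi>: "\<xi> \<in> vpolys (m - 1)"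
  shows "on_element S (bubble_field S \<xi>) \<in> RT0 M m"
proof (rule RT0I)
  note s = conformingD(2)[OF M S]
  have n: "on_element S (bubble_field S \<xi>) S' x \<bullet> n = 0" if "F \<subseteq> S'" "normal_to F n" "x \<in> convex hull F" for S' F n x
    using bubble_field_normal[OF s _ that(2,3)] that(1) by (auto simp: on_element_def)
  show "on_element S (bubble_field S \<xi>) S' \<in> rt_local m" for S'
    using bubble_field_rt[OF s \<xi>] by (simp add: on_element_def rt_local_zero)
  show "on_element S (bubble_field S \<xi>) S' = (\<lambda>_. 0)" if "S' \<notin> M" for S' using that S by (auto simp: on_element_def)
  show "(on_element S (bubble_field S \<xi>) S1 x - on_element S (bubble_field S \<xi>) S2 x) \<bullet> n = 0"
    if "F \<subseteq> S1" "F \<subseteq> S2" "normal_to F n" "x \<in> convex hull F" for S1 S2 F n x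
    using n[OF that(1,3,4)] n[OF that(2,3,4)] by (simp add: inner_diff_left)
  show "on_element S (bubble_field S \<xi>) S' x \<bullet> n = 0" if "F \<subseteq> S'" "normal_to F n" "x \<in> convex hull F" for S' F n x
    by (rule n[OF that])
qed

lemma bubble_integration_by_parts:
  assumes S: "is_simplex S" and \<xi>: "\<xi> \<in> vpolys (m - 1)" and q: "q \<in> polys n"
  shows "sint S (\<lambda>x. divg (bubble_field S \<xi>) x * q x) = - sint S (\<lambda>x. pgrad q x \<bullet> bubble_field S \<xi> x)"
proof -
  have v: "bubble_field S \<xi> \<in> vpolys (m + 1)" by (rule rt_local_vpolys[OF bubble_field_rt[OF S \<xi>]])
  have "sint S (divg (\<lambda>x. q x *\<^sub>R bubble_field S \<xi> x)) = 0"
  proof (rule sint_divg_zero[OF S vpolys_scale[OF q v order_refl]])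
    fix u x assume "u \<in> S" "x \<in> convex hull (S - {u})"
    then show "(q x *\<^sub>R bubble_field S \<xi> x) \<bullet> bgrad S u = 0"
      using bubble_field_normal[OF S Diff_subset bgrad_normal[OF S]] by simp
  qed
  moreover have "divg (\<lambda>x. q x *\<^sub>R bubble_field S \<xi> x) = (\<lambda>x. pgrad q x \<bullet> bubble_field S \<xi> x + divg (bubble_field S \<xi>) x * q x)"
    by (rule ext) (simp add: divg_scale[OF q v] mult.commute)
  moreover have "sint S (\<lambda>x. pgrad q x \<bullet> bubble_field S \<xi> x + divg (bubble_field S \<xi>) x * q x)
      = sint S (\<lambda>x. pgrad q x \<bullet> bubble_field S \<xi> x) + sint S (\<lambda>x. divg (bubble_field S \<xi>) x * q x)"
    by (rule sint_add[OF S]) (intro continuous_intros vpolys_continuous[OF v] vpolys_continuous[OF polys_gradient(1)[OF q]]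
        polys_continuous[OF divg_polys[OF v]] polys_continuous[OF q])+
  ultimately show ?thesis by simp
qed

text \<open>The lowest order Raviart--Thomas function of the facet F. Division by the volumes makes
  the integrals of its divergence CARD('n) and -CARD('n), so that testing compares averages of
  \<phi> on the two sides.\<close>

definition facet_field :: "(real,'n::finite) vec set \<Rightarrow> (real,'n) vec \<Rightarrow> (real,'n) vec \<Rightarrow> (real,'n) vec set \<Rightarrow> (real,'n) vec \<Rightarrow> (real,'n) vec" where
  "facet_field F v v' = (\<lambda>S x. if S = insert v F then (1 / svol (insert v F)) *\<^sub>R (x - v)
     else if S = insert v' F then (- 1 / svol (insert v' F)) *\<^sub>R (x - v') else 0)"

text \<open>A facet other than F of one of the two simplices contains the apex v or v', so the field
  is tangential there. On F the heights of the two apexes and the volumes have the same ratio, so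
  the normal components agree. A shared facet is not a boundary facet.\<close>

lemma facet_field_RT0:
  fixes F :: "(real,'n::finite) vec set"
  assumes M: "conforming M" "insert v F \<in> M" "insert v' F \<in> M" and v: "v \<notin> F" "v' \<notin> F" "v \<noteq> v'" and m: "0 \<le> m"
  shows "facet_field F v v' \<in> RT0 M m"
proof -
  let ?S = "insert v F" and ?S' = "insert v' F" and ?\<tau> = "facet_field F v v'"
  note s = conformingD(2)[OF M(1)]
  have ne: "?S \<noteq> ?S'" using v by auto
  have rt: "(\<lambda>x. c *\<^sub>R (x - w)) \<in> rt_local m" for c and w :: "(real,'n) vec"
    using rt_localI[OF vpolys_const[OF m] polys_const[OF m], of "- c *\<^sub>R w" c] by (simp add: scaleR_diff_right)
  have nF: "card F = CARD('n)" "finite F" using facet_nonempty[OF s[OF M(2)] v(1)] by auto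
  have other: "?\<tau> S x \<bullet> n = 0"
    if S: "S \<in> M" and G: "G \<subseteq> S" "card G = CARD('n)" "G \<noteq> F" "normal_to G n" "x \<in> convex hull G" for S G n x
  proof -
    have "w \<in> G" if "S = insert w F" "w \<notin> F" for w
    proof (rule ccontr)
      assume "w \<notin> G"
      then have "G \<subseteq> F" using G(1) that by auto
      then show False using card_subset_eq[OF nF(2)] G(2,3) nF(1) by auto
    qed
    then have "n \<bullet> (x - w) = 0" if "S = insert w F" "w \<notin> F" for w
      using normal_to_hull[OF G(4,5) hull_inc] that by blast
    then show ?thesis using v by (auto simp: facet_field_def inner_commute)
  qed
  have same: "?\<tau> ?S x \<bullet> n = ?\<tau> ?S' x \<bullet> n" if n: "normal_to F n" "x \<in> convex hull F" for n x
  proof -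
    let ?\<beta> = "bary ?S v v'"
    have b: "?\<beta> < 0" by (rule neighbours_opposite[OF M v])
    have vol: "svol ?S' = - ?\<beta> * svol ?S" using svol_neighbour(1)[OF s[OF M(2)] s[OF M(3)] v(1,2)] b by simp
    have fin: "finite F" by (rule nF(2))
    have "v' - x = (\<Sum>u\<in>?S. bary ?S u v' *\<^sub>R (u - x))"
      using bary_props(2,3)[OF s[OF M(2)], of v'] by (simp add: scaleR_diff_right sum_subtractf scaleR_sum_left[symmetric] del: sum.insert)
    then have "n \<bullet> (v' - x) = (\<Sum>u\<in>?S. bary ?S u v' * (n \<bullet> (u - x)))" by (simp add: inner_sum_right del: sum.insert)
    also have "\<dots> = ?\<beta> * (n \<bullet> (v - x)) + (\<Sum>u\<in>F. bary ?S u v' * (n \<bullet> (u - x)))"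
      using fin v(1) by simp
    also have "(\<Sum>u\<in>F. bary ?S u v' * (n \<bullet> (u - x))) = 0"
      using normal_to_hull[OF n(1) hull_inc n(2)] by (intro sum.neutral) auto
    finally have e: "n \<bullet> (v' - x) = ?\<beta> * (n \<bullet> (v - x))" by simp
    have "n \<bullet> (x - v') = ?\<beta> * (n \<bullet> (x - v))" using e by (simp add: inner_diff_right algebra_simps)
    moreover have "?\<tau> ?S x \<bullet> n = (n \<bullet> (x - v)) / svol ?S" by (simp add: facet_field_def inner_commute)
    moreover have "?\<tau> ?S' x \<bullet> n = - (n \<bullet> (x - v')) / svol ?S'" using ne by (simp add: facet_field_def inner_commute)
    ultimately show ?thesis using b svol_pos[OF s[OF M(2)]] by (simp add: vol)
  qed
  show ?thesis
  proof (rule RT0I)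
    show "?\<tau> S \<in> rt_local m" for S
      unfolding facet_field_def
      using rt[of "1 / svol ?S" v] rt[of "- 1 / svol ?S'" v'] rt_local_zero[of m]
      by (cases "S = ?S"; cases "S = ?S'") simp_all
    show "?\<tau> S = (\<lambda>_. 0)" if "S \<notin> M" for S using that M by (auto simp: facet_field_def)
  next
    fix S1 S2 G n x assume S: "S1 \<in> M" "S2 \<in> M" and G: "G \<subseteq> S1" "G \<subseteq> S2" "card G = CARD('n)" "normal_to G n" "x \<in> convex hull G"
    show "(?\<tau> S1 x - ?\<tau> S2 x) \<bullet> n = 0"
    proof (cases "G = F")
      case False
      show ?thesis using other[OF S(1) G(1,3) False G(4,5)] other[OF S(2) G(2,3) False G(4,5)]
        by (simp add: inner_diff_left)
    next
      case True
      have cases: "A = ?S \<or> A = ?S'" if A: "A \<in> M" "F \<subseteq> A" for A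
      proof -
        have "card (A - F) = 1" using is_simplexD(1,2)[OF s[OF A(1)]] nF A(2) by (simp add: card_Diff_subset)
        then obtain w where "A - F = {w}" using card_1_singletonE by blast
        then have w: "A = insert w F" "w \<notin> F" using A(2) by auto
        show ?thesis
        proof (cases "w = v")
          case False
          have "w = v'" by (rule neighbour_unique[OF M(1,2) _ M(3) v(1) w(2) v(2) False v(3)[symmetric]]) (use A w in simp)
          then show ?thesis using w by simp
        qed (use w in simp)
      qed
      have n: "normal_to F n" "x \<in> convex hull F" using G True by auto
      show ?thesis using cases[OF S(1)] cases[OF S(2)] G True same[OF n] by (auto simp: inner_diff_left)
    qed
  next
    fix S G n x assume S: "S \<in> M" and G: "G \<subseteq> S" "card G = CARD('n)" "convex hull G \<subseteq> frontier (\<Union>S\<in>M. convex hull S)"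
      "normal_to G n" "x \<in> convex hull G"
    have "G \<noteq> F" using shared_facet_not_in_frontier[OF M v] G(3) by auto
    then show "?\<tau> S x \<bullet> n = 0" using other[OF S G(1,2) _ G(4,5)] by blast
  qed
qed

section \<open>Stability of the local saddle point problem\<close>

text \<open>The polynomial inequalities and the bounds N and \<rho> are parameters, so that the
  constants derived here are functions of data fixed before the patch. The geometry of the domain
  enters through \<open>facet_connected\<close>.\<close>

locale vertex_patch =
  fixes M :: "(real,'n::{finite,linorder}) vec set set" and V :: "(real,'n) vec" and k N :: nat
    and C1 C2 C3 h \<rho> :: real
  assumes dim: "CARD('n) = 2 \<or> CARD('n) = 3" and k: "2 \<le> k"
    and M: "conforming M" "M \<noteq> {}" "card M \<le> N" and V: "\<And>S. S \<in> M \<Longrightarrow> V \<in> S"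
    and facet_connected: "\<And>A. A \<subseteq> M \<Longrightarrow> A \<noteq> {} \<Longrightarrow>
      (\<And>S S'. S \<in> A \<Longrightarrow> S' \<in> M \<Longrightarrow> card (S \<inter> S') = CARD('n) \<Longrightarrow> S' \<in> A) \<Longrightarrow> A = M"
    and C_nonneg: "0 \<le> C1" "0 \<le> C2" "0 \<le> C3"
    and oscillation: "\<And>(S :: (real,'n) vec set) v p x. is_simplex S \<Longrightarrow> v \<in> S \<Longrightarrow> p \<in> polys (int k - 1) \<Longrightarrow> x \<in> convex hull S \<Longrightarrow>
      \<bar>p x - p v\<bar> \<le> C1 * sqrt (savg S (\<lambda>x. bary S v x * (rad v p x * rad v p x)))"
    and weighted: "\<And>(S :: (real,'n) vec set) v p x. is_simplex S \<Longrightarrow> v \<in> S \<Longrightarrow> p \<in> polys (int k - 1) \<Longrightarrow> x \<in> convex hull S \<Longrightarrow>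
      \<bar>p x\<bar> \<le> C2 * sqrt (savg S (\<lambda>x. bary S v x * (p x * p x)))"
    and inverse: "\<And>(S :: (real,'n) vec set) v p x B. is_simplex S \<Longrightarrow> v \<in> S \<Longrightarrow> p \<in> polys (int k - 1) \<Longrightarrow> x \<in> convex hull S \<Longrightarrow>
      (\<And>y. y \<in> convex hull S \<Longrightarrow> \<bar>p y\<bar> \<le> B) \<Longrightarrow> \<bar>rad v p x\<bar> \<le> C3 * B"
    and h: "\<And>S x y. S \<in> M \<Longrightarrow> x \<in> convex hull S \<Longrightarrow> y \<in> convex hull S \<Longrightarrow> norm (x - y) \<le> h"
    and \<rho>: "1 \<le> \<rho>" "\<And>S S'. S \<in> M \<Longrightarrow> S' \<in> M \<Longrightarrow> card (S \<inter> S') = CARD('n) \<Longrightarrow> svol S' \<le> \<rho> * svol S"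
begin

lemmas finM = conformingD(1)[OF M(1)] and simplexM = conformingD(2)[OF M(1)]

lemma h_nonneg: "0 \<le> h"
proof -
  obtain S where "S \<in> M" using M(2) by blast
  then show ?thesis using h[of S V V] V hull_inc[of V S] by simp
qed

definition neighbours :: "((real,'n) vec set \<times> (real,'n) vec set) set" where
  "neighbours = {(S, S'). S \<in> M \<and> S' \<in> M \<and> card (S \<inter> S') = CARD('n)}"

text \<open>Reachability across facets is closed under the step of \<open>facet_connected\<close>,
  hence exhausts M. A chain takes no more steps than the relation has pairs, and there are at most
  N^2 of them.\<close>

lemma facet_chain:
  assumes "S \<in> M" "S' \<in> M" shows "\<exists>n\<le>N\<^sup>2. (S, S') \<in> neighbours ^^ n"
proof -
  have sub: "neighbours \<subseteq> M \<times> M" unfolding neighbours_def by auto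
  then have fin: "finite neighbours" using finM by (meson finite_SigmaI finite_subset)
  have "{A. (S, A) \<in> neighbours\<^sup>*} = M"
  proof (rule facet_connected)
    show "{A. (S, A) \<in> neighbours\<^sup>*} \<subseteq> M"
    proof
      fix A assume "A \<in> {A. (S, A) \<in> neighbours\<^sup>*}"
      then have "(S, A) \<in> neighbours\<^sup>*" by simp
      then show "A \<in> M" by (cases rule: rtranclE) (use assms(1) sub in auto)
    qed
    show "{A. (S, A) \<in> neighbours\<^sup>*} \<noteq> {}" by blast
    fix A B assume A: "A \<in> {A. (S, A) \<in> neighbours\<^sup>*}" and B: "B \<in> M" "card (A \<inter> B) = CARD('n)"
    have "(S, A) \<in> neighbours\<^sup>*" using A by simp
    moreover have "A \<in> M" using calculation by (cases rule: rtranclE) (use assms(1) sub in auto)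
    then have "(A, B) \<in> neighbours" using B by (simp add: neighbours_def)
    ultimately show "B \<in> {A. (S, A) \<in> neighbours\<^sup>*}" by (simp add: rtrancl.rtrancl_into_rtrancl)
  qed
  then have "(S, S') \<in> neighbours\<^sup>*" using assms(2) by blast
  then obtain n where n: "n \<le> card neighbours" "(S, S') \<in> neighbours ^^ n"
    unfolding rtrancl_finite_eq_relpow[OF fin] by auto
  have "card neighbours \<le> card (M \<times> M)" by (rule card_mono[OF _ sub]) (use finM in auto)
  also have "\<dots> = card M * card M" by (rule card_cartesian_product)
  also have "\<dots> \<le> N * N" using M(3) by (intro mult_mono) auto
  finally show ?thesis using n by (auto simp: power2_eq_square intro!: exI[of _ n])
qed

lemma chain_estimate:
  assumes "(S, S') \<in> neighbours ^^ n" and step: "\<And>A B. (A, B) \<in> neighbours \<Longrightarrow> \<bar>c A - c B\<bar> \<le> (D::real)"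
  shows "\<bar>c S - c S'\<bar> \<le> real n * D"
  using assms(1)
proof (induction n arbitrary: S')
  case (Suc n)
  then obtain A where A: "(S, A) \<in> neighbours ^^ n" "(A, S') \<in> neighbours" by auto
  then show ?case using Suc.IH[OF A(1)] step[OF A(2)] by (simp add: distrib_right)
qed simp

lemma volume_chain:
  assumes "(S, S') \<in> neighbours ^^ n" shows "svol S' \<le> \<rho> ^ n * svol S"
  using assms
proof (induction n arbitrary: S')
  case (Suc n)
  then obtain A where A: "(S, A) \<in> neighbours ^^ n" "(A, S') \<in> neighbours" by auto
  have "svol S' \<le> \<rho> * svol A" using \<rho>(2) A(2) by (auto simp: neighbours_def)
  also have "\<dots> \<le> \<rho> * (\<rho> ^ n * svol S)" using Suc.IH[OF A(1)] \<rho>(1) by (intro mult_left_mono) auto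
  finally show ?case by (simp add: mult.assoc)
qed simp

lemma volumes_comparable:
  assumes "S \<in> M" "S' \<in> M" shows "svol S' \<le> \<rho> ^ (N\<^sup>2) * svol S"
proof -
  obtain n where n: "n \<le> N\<^sup>2" "(S, S') \<in> neighbours ^^ n" using facet_chain[OF assms] by blast
  have "svol S' \<le> \<rho> ^ n * svol S" by (rule volume_chain[OF n(2)])
  also have "\<dots> \<le> \<rho> ^ (N\<^sup>2) * svol S"
    using n(1) \<rho>(1) svol_pos[OF simplexM[OF assms(1)]] by (intro mult_right_mono power_increasing) auto
  finally show ?thesis .
qed

end

text \<open>The locale records the first equation alone, so that one estimate serves the homogeneous
  problem in the uniqueness proof and the actual solution in (i).\<close>

locale patch_equation = vertex_patch M V k N C1 C2 C3 h \<rho>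
  for M :: "(real,'n::{finite,linorder}) vec set set" and V and k N and C1 C2 C3 h \<rho> +
  fixes \<sigma> :: "(real,'n) vec set \<Rightarrow> (real,'n) vec \<Rightarrow> (real,'n) vec"
    and \<phi> :: "(real,'n) vec set \<Rightarrow> (real,'n) vec \<Rightarrow> real" and lam :: "(real,'n) vec \<Rightarrow> (real,'n) vec"
  assumes \<sigma>: "\<sigma> \<in> RT0 M (int k - 1)" and \<phi>: "\<phi> \<in> broken_polys M (int k - 1)" and lam: "lam \<in> Wh k V"
    and eq: "\<And>\<tau>. \<tau> \<in> RT0 M (int k - 1) \<Longrightarrow> bvip M \<sigma> \<tau> + bip M (bdiv \<tau>) \<phi> + bvip M \<tau> (\<lambda>_. lam) = 0"
begin

definition s :: real where "s = sqrt (bvip M \<sigma> \<sigma>)"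

lemma \<sigma>_vpolys: "S \<in> M \<Longrightarrow> \<sigma> S \<in> vpolys (int k)"
  using rt_local_vpolys[OF RT0D(1)[OF \<sigma>]] by simp

lemma \<phi>_polys: "\<phi> S \<in> polys (int k - 1)" by (rule broken_polys_all[OF \<phi>])

lemma lam_vpolys: "lam \<in> vpolys (int k - 2)" by (rule Wh_vpolys[OF lam])

lemmas \<sigma>_continuous = vpolys_continuous[OF \<sigma>_vpolys] and \<phi>_continuous = polys_continuous[OF \<phi>_polys]
  and lam_continuous = vpolys_continuous[OF lam_vpolys]

lemma element_norm:
  assumes "S \<in> M" shows "sint S (\<lambda>x. \<sigma> S x \<bullet> \<sigma> S x) \<le> s\<^sup>2"
proof -
  have nn: "0 \<le> sint A (\<lambda>x. \<sigma> A x \<bullet> \<sigma> A x)" if "A \<in> M" for A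
    by (rule sint_nonneg[OF simplexM[OF that]]) (auto intro!: continuous_intros \<sigma>_continuous[OF that])
  have "sint S (\<lambda>x. \<sigma> S x \<bullet> \<sigma> S x) \<le> bvip M \<sigma> \<sigma>"
    unfolding bvip_def by (rule member_le_sum[OF assms _ finM]) (use nn in auto)
  moreover have "0 \<le> bvip M \<sigma> \<sigma>" unfolding bvip_def by (rule sum_nonneg) (use nn in auto)
  ultimately show ?thesis by (simp add: s_def)
qed

lemma s_nonneg: "0 \<le> s"
proof -
  have "0 \<le> bvip M \<sigma> \<sigma>" unfolding bvip_def
    by (intro sum_nonneg sint_nonneg simplexM) (auto intro!: continuous_intros \<sigma>_continuous)
  then show ?thesis by (simp add: s_def)
qed

text \<open>The scale for pointwise values of \<phi>: h times the root mean square of \<sigma> over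
  the element, with the norm on the element enlarged to the norm on the patch.\<close>

definition \<delta> :: "(real,'n) vec set \<Rightarrow> real" where "\<delta> S = h * s / sqrt (svol S)"

definition \<xi> :: "(real,'n) vec set \<Rightarrow> (real,'n) vec \<Rightarrow> (real,'n) vec" where "\<xi> S x = pgrad (\<phi> S) x - lam x"

lemma \<xi>_vpolys: "\<xi> S \<in> vpolys (int k - 1 - 1)"
  unfolding \<xi>_def[abs_def]
  by (rule vpolys_diff[OF polys_gradient(1)[OF \<phi>_polys]]) (use lam_vpolys in simp)

text \<open>Testing with the element bubble of \<open>\<xi>\<close> bounds the energy of \<open>\<xi>\<close> by that of \<open>\<sigma>\<close>.\<close>

lemma bubble_energy:
  assumes S: "S \<in> M"
  shows "sint S (\<lambda>x. \<xi> S x \<bullet> bubble_field S (\<xi> S) x) \<le> h\<^sup>2 * s\<^sup>2"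
proof -
  let ?b = "bubble_field S (\<xi> S)"
  let ?\<tau> = "on_element S ?b"
  note S' = simplexM[OF S]
  have b: "?b \<in> vpolys (int k)" using rt_local_vpolys[OF bubble_field_rt[OF S' \<xi>_vpolys]] by simp
  note cb = vpolys_continuous[OF b] and cs = \<sigma>_continuous[OF S] and cx = vpolys_continuous[OF \<xi>_vpolys]
    and cg = vpolys_continuous[OF polys_gradient(1)[OF \<phi>_polys]]
  have single: "(\<Sum>A\<in>M. g A) = g S" if "\<And>A. A \<noteq> S \<Longrightarrow> g A = 0" for g :: "_ \<Rightarrow> real"
  proof -
    have "(\<Sum>A\<in>M. g A) = (\<Sum>A\<in>{S}. g A)"
      by (rule sum.mono_neutral_right[OF finM]) (use S that in auto)
    then show ?thesis by simp
  qed
  have z: "divg (\<lambda>_. 0 :: (real,'n) vec) x = 0" for x by (simp add: divg_def frechet_derivative_const)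
  have "bvip M \<sigma> ?\<tau> = sint S (\<lambda>x. \<sigma> S x \<bullet> ?b x)"
    unfolding bvip_def by (subst single) (auto simp: on_element_def)
  moreover have "bip M (bdiv ?\<tau>) \<phi> = sint S (\<lambda>x. divg ?b x * \<phi> S x)"
    unfolding bip_def bdiv_def by (subst single) (auto simp: on_element_def z)
  moreover have "bvip M ?\<tau> (\<lambda>_. lam) = sint S (\<lambda>x. ?b x \<bullet> lam x)"
    unfolding bvip_def by (subst single) (auto simp: on_element_def)
  ultimately have "sint S (\<lambda>x. \<sigma> S x \<bullet> ?b x) - sint S (\<lambda>x. pgrad (\<phi> S) x \<bullet> ?b x) + sint S (\<lambda>x. ?b x \<bullet> lam x) = 0"
    using eq[OF bubble_RT0[OF M(1) S \<xi>_vpolys[of S]]] bubble_integration_by_parts[OF S' \<xi>_vpolys \<phi>_polys, of S S] by simp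
  moreover have "sint S (\<lambda>x. pgrad (\<phi> S) x \<bullet> ?b x) - sint S (\<lambda>x. ?b x \<bullet> lam x) = sint S (\<lambda>x. \<xi> S x \<bullet> ?b x)"
  proof -
    have "(\<lambda>x. \<xi> S x \<bullet> ?b x) = (\<lambda>x. pgrad (\<phi> S) x \<bullet> ?b x - ?b x \<bullet> lam x)"
      unfolding \<xi>_def by (simp add: inner_diff_left inner_commute)
    then show ?thesis
      by (simp only:) (rule sint_diff[OF S', symmetric]; intro continuous_intros cb cg lam_continuous)
  qed
  ultimately have e: "sint S (\<lambda>x. \<xi> S x \<bullet> ?b x) = sint S (\<lambda>x. \<sigma> S x \<bullet> ?b x)" by linarith
  \<comment> \<open>A pointwise Young inequality. Its last term has the same integral as the product
    of \<sigma> with the bubble, by e, and is absorbed on the left.\<close>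
  have "2 * (\<sigma> S x \<bullet> ?b x) \<le> h\<^sup>2 * (\<sigma> S x \<bullet> \<sigma> S x) + \<xi> S x \<bullet> ?b x" if x: "x \<in> convex hull S" for x
  proof -
    have n: "(norm (?b x))\<^sup>2 \<le> h\<^sup>2 * (\<xi> S x \<bullet> ?b x)"
      by (rule bubble_field_norm[OF S' x]) (use h[OF S hull_inc x] in blast)
    have E: "0 \<le> \<xi> S x \<bullet> ?b x"
      unfolding bubble_field_energy by (intro sum_nonneg mult_nonneg_nonneg bary_nonneg[OF S' x]) auto
    have "norm (?b x) \<le> sqrt (h\<^sup>2 * (\<xi> S x \<bullet> ?b x))" by (rule real_le_rsqrt[OF n])
    then have nb: "norm (?b x) \<le> h * sqrt (\<xi> S x \<bullet> ?b x)" using h_nonneg by (simp add: real_sqrt_mult)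
    have "\<sigma> S x \<bullet> ?b x \<le> norm (\<sigma> S x) * norm (?b x)" by (rule norm_cauchy_schwarz)
    also have "\<dots> \<le> norm (\<sigma> S x) * (h * sqrt (\<xi> S x \<bullet> ?b x))" using nb by (rule mult_left_mono) auto
    finally have "2 * (\<sigma> S x \<bullet> ?b x) \<le> 2 * (h * norm (\<sigma> S x)) * sqrt (\<xi> S x \<bullet> ?b x)" by (simp add: mult_ac)
    also have "\<dots> \<le> (h * norm (\<sigma> S x))\<^sup>2 + (sqrt (\<xi> S x \<bullet> ?b x))\<^sup>2" by (rule sum_squares_bound)
    finally show ?thesis using E by (simp add: power_mult_distrib power2_norm_eq_inner)
  qed
  then have "sint S (\<lambda>x. 2 * (\<sigma> S x \<bullet> ?b x)) \<le> sint S (\<lambda>x. h\<^sup>2 * (\<sigma> S x \<bullet> \<sigma> S x) + \<xi> S x \<bullet> ?b x)"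
    by (intro sint_mono[OF S'] continuous_intros cb cs cx)
  also have "\<dots> = sint S (\<lambda>x. h\<^sup>2 * (\<sigma> S x \<bullet> \<sigma> S x)) + sint S (\<lambda>x. \<xi> S x \<bullet> ?b x)"
    by (intro sint_add[OF S'] continuous_intros cb cs cx)
  finally have "sint S (\<lambda>x. \<xi> S x \<bullet> ?b x) \<le> h\<^sup>2 * sint S (\<lambda>x. \<sigma> S x \<bullet> \<sigma> S x)" by (simp add: e)
  also have "\<dots> \<le> h\<^sup>2 * s\<^sup>2" using element_norm[OF S] by (rule mult_left_mono) auto
  finally show ?thesis .
qed

text \<open>The bubble energy is a sum of nonnegative terms, one per vertex, of which only the one
  for v is kept.\<close>

lemma radial_energy:
  assumes S: "S \<in> M" and v: "v \<in> S" and r: "\<And>x. r x = \<xi> S x \<bullet> (x - v)"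
  shows "sqrt (savg S (\<lambda>x. bary S v x * (r x * r x))) \<le> \<delta> S"
proof -
  note S' = simplexM[OF S]
  have cr: "continuous_on UNIV r" unfolding r[abs_def] by (intro continuous_intros vpolys_continuous[OF \<xi>_vpolys])
  have b: "bubble_field S (\<xi> S) \<in> vpolys (int k)" using rt_local_vpolys[OF bubble_field_rt[OF S' \<xi>_vpolys]] by simp
  have "sint S (\<lambda>x. bary S v x * (r x * r x)) \<le> sint S (\<lambda>x. \<xi> S x \<bullet> bubble_field S (\<xi> S) x)"
  proof (rule sint_mono[OF S'])
    fix x assume x: "x \<in> convex hull S"
    have e: "r x * r x = ((v - x) \<bullet> \<xi> S x)\<^sup>2"
      unfolding r power2_eq_square by (simp add: inner_commute inner_diff_left algebra_simps)
    have "bary S v x * ((v - x) \<bullet> \<xi> S x)\<^sup>2 \<le> (\<Sum>v\<in>S. bary S v x * ((v - x) \<bullet> \<xi> S x)\<^sup>2)"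
      by (rule member_le_sum[OF v _ is_simplexD(1)[OF S']]) (intro mult_nonneg_nonneg bary_nonneg[OF S' x] zero_le_power2)
    then show "bary S v x * (r x * r x) \<le> \<xi> S x \<bullet> bubble_field S (\<xi> S) x"
      unfolding e bubble_field_energy .
  qed (intro continuous_intros bary_continuous[OF S'] cr vpolys_continuous[OF b] vpolys_continuous[OF \<xi>_vpolys])+
  also have "\<dots> \<le> (h * s)\<^sup>2" using bubble_energy[OF S] by (simp add: power_mult_distrib)
  finally have "savg S (\<lambda>x. bary S v x * (r x * r x)) \<le> (h * s)\<^sup>2 / svol S"
    unfolding savg_def using svol_pos[OF S'] by (intro divide_right_mono) auto
  then have "sqrt (savg S (\<lambda>x. bary S v x * (r x * r x))) \<le> sqrt ((h * s)\<^sup>2 / svol S)" by (rule real_sqrt_le_mono)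
  also have "\<dots> = \<delta> S" unfolding \<delta>_def using h_nonneg s_nonneg by (simp add: real_sqrt_divide)
  finally show ?thesis .
qed

lemma \<phi>_oscillation:
  assumes S: "S \<in> M" and x: "x \<in> convex hull S"
  shows "\<bar>\<phi> S x - \<phi> S V\<bar> \<le> C1 * \<delta> S"
proof -
  have "rad V (\<phi> S) x = \<xi> S x \<bullet> (x - V)" for x
    unfolding rad_polys_eq[OF \<phi>_polys] \<xi>_def using Wh_orthogonal[OF dim lam, of x] by (simp add: inner_diff_left)
  then have "sqrt (savg S (\<lambda>x. bary S V x * (rad V (\<phi> S) x * rad V (\<phi> S) x))) \<le> \<delta> S"
    by (rule radial_energy[OF S V[OF S]])
  then show ?thesis
    using oscillation[OF simplexM[OF S] V[OF S] \<phi>_polys x] mult_left_mono[OF _ C_nonneg(1)] order_trans by blast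
qed

text \<open>The product is the radial derivative of \<phi> about v minus \<xi> S x . (x - v). The
  latter is bounded by its energy, the former by the inverse estimate for \<phi> - \<phi>(V), whose
  size is the oscillation already known.\<close>

lemma lam_moment:
  assumes S: "S \<in> M" and v: "v \<in> S" and x: "x \<in> convex hull S"
  shows "\<bar>lam x \<bullet> (x - v)\<bar> \<le> (C3 * C1 + C2) * \<delta> S"
proof -
  note S' = simplexM[OF S]
  define r where "r x = \<xi> S x \<bullet> (x - v)" for x
  have rp: "r \<in> polys (int k - 1)" unfolding r_def[abs_def]
    by (rule polys_inner[OF \<xi>_vpolys vpolys_diff[OF vpolys_id[of 1] vpolys_const[of 1]]]) auto
  have "\<bar>r x\<bar> \<le> C2 * \<delta> S"
    using weighted[OF S' v rp x] mult_left_mono[OF radial_energy[OF S v r_def] C_nonneg(2)] by linarith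
  moreover have "\<bar>rad v (\<phi> S) x\<bar> \<le> C3 * (C1 * \<delta> S)"
  proof -
    have c: "(\<lambda>x. - \<phi> S V) \<in> polys (int k - 1)" using k by (intro polys_const) auto
    have p: "(\<lambda>x. \<phi> S x + - \<phi> S V) \<in> polys (int k - 1)" by (rule polys_add[OF \<phi>_polys c])
    have "rad v (\<lambda>x. \<phi> S x + - \<phi> S V) x = rad v (\<phi> S) x + rad v (\<lambda>x. - \<phi> S V) x"
      by (rule rad_add[OF \<phi>_polys c])
    moreover have "rad v (\<lambda>x. - \<phi> S V) x = 0" by (simp add: rad_def)
    moreover have "\<bar>rad v (\<lambda>x. \<phi> S x + - \<phi> S V) x\<bar> \<le> C3 * (C1 * \<delta> S)"
      by (rule inverse[OF S' v p x]) (use \<phi>_oscillation[OF S] in simp)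
    ultimately show ?thesis by simp
  qed
  moreover have "lam x \<bullet> (x - v) = rad v (\<phi> S) x - r x"
    unfolding rad_polys_eq[OF \<phi>_polys] r_def \<xi>_def by (simp add: inner_diff_left)
  ultimately have "\<bar>lam x \<bullet> (x - v)\<bar> \<le> C3 * (C1 * \<delta> S) + C2 * \<delta> S" by linarith
  then show ?thesis by (simp add: distrib_right mult.assoc)
qed

text \<open>What the equation says for the test field that equals \<open>x - v\<close> on \<open>S\<close>.\<close>

definition moment :: "(real,'n) vec set \<Rightarrow> (real,'n) vec \<Rightarrow> real" where
  "moment S v = sint S (\<lambda>x. \<sigma> S x \<bullet> (x - v)) + sint S (\<lambda>x. real CARD('n) * \<phi> S x) + sint S (\<lambda>x. (x - v) \<bullet> lam x)"

text \<open>One summand for each part of \<open>moment\<close>: 1 for \<sigma>, CARD('n) times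
  \<open>C1\<close> for the oscillation of \<phi>, the rest for lam.\<close>

definition K :: real where "K = 1 + real CARD('n) * C1 + C3 * C1 + C2"

lemma K_nonneg: "0 \<le> K" unfolding K_def using C_nonneg by simp

lemma moment_estimate:
  assumes S: "S \<in> M" and v: "v \<in> S"
  shows "\<bar>moment S v / svol S - real CARD('n) * \<phi> S V\<bar> \<le> K * \<delta> S"
proof -
  note S' = simplexM[OF S] and cs = \<sigma>_continuous[OF S]
  note vol = svol_pos[OF S']
  let ?n = "real CARD('n)"
  have "\<bar>sint S (\<lambda>x. \<sigma> S x \<bullet> (x - v))\<bar> \<le> \<delta> S * svol S"
  proof -
    have "\<bar>sint S (\<lambda>x. \<sigma> S x \<bullet> (x - v))\<bar> \<le> sint S (\<lambda>x. h * norm (\<sigma> S x))"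
    proof (rule sint_abs_le[OF S'])
      fix x assume x: "x \<in> convex hull S"
      have "\<bar>\<sigma> S x \<bullet> (x - v)\<bar> \<le> norm (\<sigma> S x) * norm (x - v)" by (rule Cauchy_Schwarz_ineq2)
      also have "\<dots> \<le> norm (\<sigma> S x) * h" using h[OF S x hull_inc[OF v]] by (rule mult_left_mono) auto
      finally show "\<bar>\<sigma> S x \<bullet> (x - v)\<bar> \<le> h * norm (\<sigma> S x)" by (simp add: mult.commute)
    qed (intro continuous_intros cs)+
    also have "\<dots> = h * sint S (\<lambda>x. norm (\<sigma> S x))" by simp
    also have "sint S (\<lambda>x. norm (\<sigma> S x)) \<le> s * sqrt (svol S)"
    proof (rule power2_le_imp_le)
      have "(sint S (\<lambda>x. norm (\<sigma> S x) * 1))\<^sup>2 \<le> sint S (\<lambda>x. (norm (\<sigma> S x))\<^sup>2) * sint S (\<lambda>x. 1\<^sup>2)"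
        by (rule sint_Cauchy_Schwarz[OF S']) (intro continuous_intros cs)+
      also have "\<dots> \<le> s\<^sup>2 * svol S"
        using element_norm[OF S] sint_const[OF S', of 1] vol
        by (simp add: power2_norm_eq_inner mult_right_mono)
      finally show "(sint S (\<lambda>x. norm (\<sigma> S x)))\<^sup>2 \<le> (s * sqrt (svol S))\<^sup>2" using vol by (simp add: power_mult_distrib)
      show "0 \<le> s * sqrt (svol S)" using s_nonneg vol by simp
    qed
    finally have "\<bar>sint S (\<lambda>x. \<sigma> S x \<bullet> (x - v))\<bar> \<le> h * (s * sqrt (svol S))" using h_nonneg by (simp add: mult_left_mono)
    moreover have "\<delta> S * svol S = h * (s * sqrt (svol S))"
      unfolding \<delta>_def using vol by (simp add: field_simps real_sqrt_mult[symmetric])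
    ultimately show ?thesis by simp
  qed
  moreover have "\<bar>sint S (\<lambda>x. ?n * \<phi> S x) - ?n * \<phi> S V * svol S\<bar> \<le> ?n * C1 * \<delta> S * svol S"
  proof -
    have "\<bar>sint S (\<lambda>x. ?n * \<phi> S x - ?n * \<phi> S V)\<bar> \<le> sint S (\<lambda>x. ?n * C1 * \<delta> S)"
    proof (rule sint_abs_le[OF S'])
      fix x assume x: "x \<in> convex hull S"
      have "\<bar>?n * \<phi> S x - ?n * \<phi> S V\<bar> = ?n * \<bar>\<phi> S x - \<phi> S V\<bar>" by (simp add: abs_mult right_diff_distrib[symmetric])
      also have "\<dots> \<le> ?n * (C1 * \<delta> S)" using \<phi>_oscillation[OF S x] by (rule mult_left_mono) auto
      finally show "\<bar>?n * \<phi> S x - ?n * \<phi> S V\<bar> \<le> ?n * C1 * \<delta> S" by (simp add: mult.assoc)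
    qed (intro continuous_intros \<phi>_continuous)+
    moreover have "sint S (\<lambda>x. ?n * \<phi> S x - ?n * \<phi> S V) = sint S (\<lambda>x. ?n * \<phi> S x) - sint S (\<lambda>x. ?n * \<phi> S V)"
      by (rule sint_diff[OF S']) (intro continuous_intros \<phi>_continuous)+
    ultimately show ?thesis unfolding sint_const[OF S'] by simp
  qed
  moreover have "\<bar>sint S (\<lambda>x. (x - v) \<bullet> lam x)\<bar> \<le> (C3 * C1 + C2) * \<delta> S * svol S"
  proof -
    have "\<bar>sint S (\<lambda>x. (x - v) \<bullet> lam x)\<bar> \<le> sint S (\<lambda>x. (C3 * C1 + C2) * \<delta> S)"
      by (rule sint_abs_le[OF S']) (use lam_moment[OF S v] in \<open>auto simp: inner_commute intro!: continuous_intros lam_continuous\<close>)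
    then show ?thesis unfolding sint_const[OF S'] by simp
  qed
  ultimately have "\<bar>moment S v - ?n * \<phi> S V * svol S\<bar>
      \<le> \<delta> S * svol S + ?n * C1 * \<delta> S * svol S + (C3 * C1 + C2) * \<delta> S * svol S"
    unfolding moment_def by linarith
  also have "\<dots> = K * \<delta> S * svol S" unfolding K_def by (simp add: algebra_simps)
  finally have "\<bar>moment S v - ?n * \<phi> S V * svol S\<bar> / svol S \<le> K * \<delta> S"
    using vol by (simp add: pos_divide_le_eq)
  moreover have "\<bar>moment S v - ?n * \<phi> S V * svol S\<bar> / svol S = \<bar>moment S v / svol S - ?n * \<phi> S V\<bar>"
  proof -
    have "(moment S v - ?n * \<phi> S V * svol S) / svol S = moment S v / svol S - ?n * \<phi> S V"
      using vol by (simp add: diff_divide_distrib)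
    then show ?thesis using vol abs_divide[of "moment S v - ?n * \<phi> S V * svol S" "svol S"] by simp
  qed
  ultimately show ?thesis by simp
qed

text \<open>The first equation tested with the facet field of F.\<close>

lemma moment_neighbour:
  assumes S: "insert v F \<in> M" "insert v' F \<in> M" "v \<notin> F" "v' \<notin> F" "v \<noteq> v'"
  shows "moment (insert v F) v / svol (insert v F) = moment (insert v' F) v' / svol (insert v' F)"
proof -
  let ?S = "insert v F" and ?S' = "insert v' F" and ?\<tau> = "facet_field F v v'"
  define a a' where "a = 1 / svol ?S" and "a' = - 1 / svol ?S'"
  have ne: "?S \<noteq> ?S'" using S by auto
  have two: "(\<Sum>A\<in>M. g A) = g ?S + g ?S'" if "\<And>A. A \<noteq> ?S \<Longrightarrow> A \<noteq> ?S' \<Longrightarrow> g A = 0" for g :: "_ \<Rightarrow> real"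
  proof -
    have "(\<Sum>A\<in>M. g A) = (\<Sum>A\<in>{?S, ?S'}. g A)"
      by (rule sum.mono_neutral_right[OF finM]) (use S that in auto)
    then show ?thesis using ne by simp
  qed
  have \<tau>1: "?\<tau> ?S = (\<lambda>x. a *\<^sub>R (x - v))" by (simp add: facet_field_def a_def)
  have \<tau>2: "?\<tau> ?S' = (\<lambda>x. a' *\<^sub>R (x - v'))" using ne by (simp add: facet_field_def fun_eq_iff a'_def)
  have \<tau>3: "?\<tau> A = (\<lambda>x. 0)" if "A \<noteq> ?S" "A \<noteq> ?S'" for A using that by (simp add: facet_field_def)
  have id: "(\<lambda>x. x - w) \<in> vpolys 1" for w :: "(real,'n) vec" by (intro vpolys_diff vpolys_id vpolys_const) auto
  have d: "divg (\<lambda>x :: (real,'n) vec. c *\<^sub>R (x - w)) = (\<lambda>x. c * real CARD('n))" for c w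
    by (rule ext) (simp add: divg_cscale[OF id] divg_position)
  have z: "divg (\<lambda>_. 0 :: (real,'n) vec) x = 0" for x by (simp add: divg_def frechet_derivative_const)
  have "bvip M \<sigma> ?\<tau> = a * sint ?S (\<lambda>x. \<sigma> ?S x \<bullet> (x - v)) + a' * sint ?S' (\<lambda>x. \<sigma> ?S' x \<bullet> (x - v'))"
    unfolding bvip_def by (subst two) (simp_all add: \<tau>1 \<tau>2 \<tau>3)
  moreover have "bip M (bdiv ?\<tau>) \<phi> = a * sint ?S (\<lambda>x. real CARD('n) * \<phi> ?S x) + a' * sint ?S' (\<lambda>x. real CARD('n) * \<phi> ?S' x)"
    unfolding bip_def bdiv_def by (subst two) (simp_all add: \<tau>1 \<tau>2 \<tau>3 d z)
  moreover have "bvip M ?\<tau> (\<lambda>_. lam) = a * sint ?S (\<lambda>x. (x - v) \<bullet> lam x) + a' * sint ?S' (\<lambda>x. (x - v') \<bullet> lam x)"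
    unfolding bvip_def by (subst two) (simp_all add: \<tau>1 \<tau>2 \<tau>3)
  moreover have "bvip M \<sigma> ?\<tau> + bip M (bdiv ?\<tau>) \<phi> + bvip M ?\<tau> (\<lambda>_. lam) = 0"
    by (rule eq[OF facet_field_RT0[OF M(1) S]]) (use k in simp)
  ultimately have "a * moment ?S v + a' * moment ?S' v' = 0" unfolding moment_def by (simp add: algebra_simps)
  then show ?thesis by (simp add: a_def a'_def)
qed

section \<open>From neighbouring simplices to the whole patch\<close>

definition \<mu> :: real where "\<mu> = Min (svol ` M)"

lemma \<mu>: "S \<in> M \<Longrightarrow> \<mu> \<le> svol S" "0 < \<mu>" "S \<in> M \<Longrightarrow> svol S \<le> \<rho> ^ (N\<^sup>2) * \<mu>"
proof -
  show "\<mu> \<le> svol S" if "S \<in> M" unfolding \<mu>_def using finM that by simp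
  have "\<mu> \<in> svol ` M" unfolding \<mu>_def using finM M(2) by (intro Min_in) auto
  then obtain A where A: "A \<in> M" "\<mu> = svol A" by blast
  then show "0 < \<mu>" using svol_pos[OF simplexM] by simp
  show "svol S \<le> \<rho> ^ (N\<^sup>2) * \<mu>" if "S \<in> M" unfolding A(2) by (rule volumes_comparable[OF A(1) that])
qed

lemma \<delta>_le: assumes "S \<in> M" shows "\<delta> S \<le> h * s / sqrt \<mu>"
  unfolding \<delta>_def using \<mu>(1)[OF assms] \<mu>(2) h_nonneg s_nonneg by (intro divide_left_mono) auto

lemma neighbour_estimate:
  assumes "(S, S') \<in> neighbours" shows "\<bar>\<phi> S V - \<phi> S' V\<bar> \<le> 2 * K * (h * s / sqrt \<mu>)"
proof (cases "S = S'")
  case True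
  then show ?thesis using K_nonneg h_nonneg s_nonneg \<mu>(2) by simp
next
  case False
  define F where "F = S \<inter> S'"
  have S: "S \<in> M" "S' \<in> M" "card F = CARD('n)" using assms by (auto simp: neighbours_def F_def)
  have "\<exists>v. A = insert v F \<and> v \<notin> F" if "A \<in> M" "F \<subseteq> A" for A
  proof -
    have "card (A - F) = 1" using is_simplexD(1,2)[OF simplexM[OF that(1)]] S(3) that(2)
      by (simp add: card_Diff_subset finite_subset)
    then obtain v where "A - F = {v}" using card_1_singletonE by blast
    then show ?thesis using that(2) by (intro exI[of _ v]) auto
  qed
  from this[OF S(1)] this[OF S(2)] obtain v v' where v: "S = insert v F" "v \<notin> F" "S' = insert v' F" "v' \<notin> F"
    unfolding F_def by auto
  have vv: "v \<noteq> v'" using False v by auto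
  let ?n = "real CARD('n)"
  define D where "D = h * s / sqrt \<mu>"
  have D: "\<delta> A \<le> D" if "A \<in> M" for A unfolding D_def by (rule \<delta>_le[OF that])
  have "moment S v / svol S = moment S' v' / svol S'"
    unfolding v(1,3) by (rule moment_neighbour) (use S(1,2) v vv in simp_all)
  moreover have "\<bar>moment S v / svol S - ?n * \<phi> S V\<bar> \<le> K * \<delta> S" by (rule moment_estimate[OF S(1)]) (simp add: v)
  moreover have "\<bar>moment S' v' / svol S' - ?n * \<phi> S' V\<bar> \<le> K * \<delta> S'" by (rule moment_estimate[OF S(2)]) (simp add: v)
  ultimately have "\<bar>?n * \<phi> S V - ?n * \<phi> S' V\<bar> \<le> K * \<delta> S + K * \<delta> S'" by linarith
  also have "\<dots> \<le> K * D + K * D"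
    by (intro add_mono mult_left_mono D S K_nonneg)
  finally have "?n * \<bar>\<phi> S V - \<phi> S' V\<bar> \<le> 2 * K * D"
    by (simp add: abs_mult right_diff_distrib[symmetric] mult_ac)
  moreover have "1 * \<bar>\<phi> S V - \<phi> S' V\<bar> \<le> ?n * \<bar>\<phi> S V - \<phi> S' V\<bar>" using dim by (intro mult_right_mono) auto
  ultimately have "\<bar>\<phi> S V - \<phi> S' V\<bar> \<le> 2 * K * D" by (simp only: mult_1)
  then show ?thesis unfolding D_def .
qed

lemma \<phi>_almost_constant:
  assumes S: "S \<in> M" "S' \<in> M" and x: "x \<in> convex hull S"
  shows "\<bar>\<phi> S x - \<phi> S' V\<bar> \<le> (C1 + 2 * real (N\<^sup>2) * K) * (h * s / sqrt \<mu>)"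
proof -
  define D where "D = h * s / sqrt \<mu>"
  have D: "0 \<le> D" unfolding D_def using h_nonneg s_nonneg \<mu>(2) by simp
  obtain n where n: "n \<le> N\<^sup>2" "(S, S') \<in> neighbours ^^ n" using facet_chain[OF S] by blast
  have "\<bar>\<phi> S V - \<phi> S' V\<bar> \<le> real n * (2 * K * D)"
    by (rule chain_estimate[OF n(2), where c="\<lambda>A. \<phi> A V"]) (unfold D_def, rule neighbour_estimate)
  also have "\<dots> \<le> real (N\<^sup>2) * (2 * K * D)"
    using n(1) K_nonneg D by (intro mult_right_mono mult_nonneg_nonneg) (auto simp del: of_nat_power)
  finally have 1: "\<bar>\<phi> S V - \<phi> S' V\<bar> \<le> real (N\<^sup>2) * (2 * K * D)" .
  have "\<bar>\<phi> S x - \<phi> S V\<bar> \<le> C1 * \<delta> S" by (rule \<phi>_oscillation[OF S(1) x])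
  also have "\<dots> \<le> C1 * D" unfolding D_def by (rule mult_left_mono[OF \<delta>_le[OF S(1)] C_nonneg(1)])
  finally have "\<bar>\<phi> S x - \<phi> S' V\<bar> \<le> C1 * D + real (N\<^sup>2) * (2 * K * D)" using 1 by linarith
  also have "\<dots> = (C1 + 2 * real (N\<^sup>2) * K) * D" by (simp add: algebra_simps del: of_nat_power)
  finally show ?thesis unfolding D_def .
qed

lemma polys_zero_on_hull:
  assumes "S \<in> M" "p \<in> polys m" "\<And>x. x \<in> convex hull S \<Longrightarrow> p x = 0" shows "p = (\<lambda>_. 0)"
  by (rule polys_zero_if_zero_on_open[OF assms(2) simplex_inner_open[OF simplexM[OF assms(1)]]])
    (use simplex_inner_center[OF simplexM[OF assms(1)]] simplex_inner_subset[OF simplexM[OF assms(1)]] assms(3) in auto)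

text \<open>With s = 0 the estimates become identities: \<phi> is a single constant, zero by its
  mean, and lam x is orthogonal to x - v for all vertices v of one simplex, hence zero there and,
  being polynomial, everywhere.\<close>

lemma vanishing:
  assumes s0: "s = 0" and mean: "(\<Sum>S\<in>M. sint S (\<phi> S)) = 0"
  shows "\<sigma> = (\<lambda>_ _. 0)" "\<phi> = (\<lambda>_ _. 0)" "lam = (\<lambda>_. 0)"
proof -
  obtain S0 where S0: "S0 \<in> M" using M(2) by blast
  have c: "\<phi> S x = \<phi> S0 V" if "S \<in> M" "x \<in> convex hull S" for S x
    using \<phi>_almost_constant[OF that(1) S0 that(2)] by (simp add: s0)
  have "(\<Sum>S\<in>M. sint S (\<phi> S)) = (\<Sum>S\<in>M. \<phi> S0 V * svol S)"
  proof (rule sum.cong[OF refl])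
    fix S assume S: "S \<in> M"
    have "sint S (\<phi> S) = sint S (\<lambda>_. \<phi> S0 V)" by (rule sint_cong[OF simplexM[OF S]]) (rule c[OF S])
    then show "sint S (\<phi> S) = \<phi> S0 V * svol S" by (simp add: sint_const[OF simplexM[OF S]])
  qed
  then have "\<phi> S0 V * (\<Sum>S\<in>M. svol S) = 0" using mean by (simp add: sum_distrib_left)
  moreover have "0 < (\<Sum>S\<in>M. svol S)" using finM M(2) svol_pos[OF simplexM] by (intro sum_pos) auto
  ultimately have c0: "\<phi> S0 V = 0" by simp
  show "\<phi> = (\<lambda>_ _. 0)"
  proof (rule ext)
    fix S show "\<phi> S = (\<lambda>_. 0)"
    proof (cases "S \<in> M")
      case True
      show ?thesis by (rule polys_zero_on_hull[OF True \<phi>_polys]) (simp add: c[OF True] c0)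
    qed (rule broken_polysD(2)[OF \<phi>])
  qed
  have "lam x = 0" if x: "x \<in> convex hull S0" for x
  proof -
    note S' = simplexM[OF S0]
    have l: "lam x \<bullet> (x - v) = 0" if "v \<in> S0" for v
      using lam_moment[OF S0 that x] by (simp add: \<delta>_def s0)
    \<comment> \<open>In this expansion v may be replaced by v - x, because the gradients of the
      coordinates sum to zero; lam x is then a combination of vectors orthogonal to it.\<close>
    have "lam x = (\<Sum>v\<in>S0. (bgrad S0 v \<bullet> lam x) *\<^sub>R v)" by (rule bgrad_expand[OF S', symmetric])
    also have "\<dots> = (\<Sum>v\<in>S0. (bgrad S0 v \<bullet> lam x) *\<^sub>R x) - (\<Sum>v\<in>S0. (bgrad S0 v \<bullet> lam x) *\<^sub>R (x - v))"
      by (simp add: scaleR_diff_right sum_subtractf)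
    also have "(\<Sum>v\<in>S0. (bgrad S0 v \<bullet> lam x) *\<^sub>R x) = ((\<Sum>v\<in>S0. bgrad S0 v) \<bullet> lam x) *\<^sub>R x"
      by (simp add: inner_sum_left scaleR_sum_left)
    finally have e: "lam x = - (\<Sum>v\<in>S0. (bgrad S0 v \<bullet> lam x) *\<^sub>R (x - v))" by (simp add: bgrad_sum[OF S'])
    have "lam x \<bullet> lam x = - (\<Sum>v\<in>S0. (bgrad S0 v \<bullet> lam x) * (lam x \<bullet> (x - v)))"
      by (subst (2) e) (simp add: inner_sum_right)
    also have "\<dots> = 0" using l by simp
    finally show ?thesis by simp
  qed
  then show "lam = (\<lambda>_. 0)"
    by (intro vpolys_zero_if_zero_on_open[OF lam_vpolys simplex_inner_open[OF simplexM[OF S0]]])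
      (use simplex_inner_center[OF simplexM[OF S0]] simplex_inner_subset[OF simplexM[OF S0]] in auto)
  show "\<sigma> = (\<lambda>_ _. 0)"
  proof (rule ext)
    fix S show "\<sigma> S = (\<lambda>_. 0)"
    proof (cases "S \<in> M")
      case True
      note S' = simplexM[OF True]
      have "0 \<le> sint S (\<lambda>x. \<sigma> S x \<bullet> \<sigma> S x)"
        by (rule sint_nonneg[OF S']) (auto intro!: continuous_intros \<sigma>_continuous[OF True])
      then have z: "sint S (\<lambda>x. \<sigma> S x \<bullet> \<sigma> S x) = 0" using element_norm[OF True] by (simp add: s0)
      have "\<sigma> S x = 0" if x: "x \<in> simplex_inner S" for x
        using LINT_nonneg_zero[OF S' _ _ z x] \<sigma>_continuous[OF True] by (auto intro!: continuous_intros)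
      then show ?thesis
        by (intro vpolys_zero_if_zero_on_open[OF \<sigma>_vpolys[OF True] simplex_inner_open[OF S']])
          (use simplex_inner_center[OF S'] in auto)
    qed (rule RT0D(2)[OF \<sigma>])
  qed
qed

end

section \<open>The bubble residual\<close>

lemma linterp_cong: "(\<And>y. y \<in> lnodes S m \<Longrightarrow> g y = h y) \<Longrightarrow> linterp S m g = linterp S m h"
  by (simp add: linterp_def)

definition node_avg :: "(real,'n::finite) vec set set \<Rightarrow> ((real,'n) vec set \<Rightarrow> (real,'n) vec \<Rightarrow> real) \<Rightarrow> (real,'n) vec \<Rightarrow> real" where
  "node_avg M \<psi> y = (\<Sum>S\<in>{S\<in>M. y \<in> convex hull S}. \<psi> S y) / real (card {S\<in>M. y \<in> convex hull S})"

text \<open>The bubble projector applied to \<psi> minus its Oswald interpolant. Interpolation reads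
  only nodal values, at which the Oswald interpolant is the plain average, so one of the two
  interpolations drops out.\<close>

definition residual :: "(real,'n::finite) vec set set \<Rightarrow> (real,'n) vec \<Rightarrow> nat \<Rightarrow>
    ((real,'n) vec set \<Rightarrow> (real,'n) vec \<Rightarrow> real) \<Rightarrow> (real,'n) vec set \<Rightarrow> (real,'n) vec \<Rightarrow> real" where
  "residual M V m \<psi> S = linterp S m (\<lambda>y. (\<psi> S y - node_avg M \<psi> y) * bary S V y)"

lemma bubbleP_eq_residual:
  assumes T: "conforming T" and S: "S \<in> patch T V" and m: "1 \<le> m"
  shows "bubbleP T V m (bminus \<psi> (oswald (patch T V) m \<psi>)) S = residual (patch T V) V m \<psi> S"
proof -
  have S': "is_simplex S" "S \<in> T \<and> V \<in> S" using conformingD(2)[OF T] S by (auto simp: patch_def)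
  have "bubbleP T V m (bminus \<psi> (oswald (patch T V) m \<psi>)) S
      = linterp S m (\<lambda>y. (\<psi> S y - linterp S m (node_avg (patch T V) \<psi>) y) * bary S V y)"
    using S' S by (simp add: bubbleP_def bubble_T_def bminus_def oswald_def node_avg_def[abs_def])
  also have "\<dots> = residual (patch T V) V m \<psi> S"
    unfolding residual_def by (rule linterp_cong) (simp add: linterp_node[OF S'(1) m])
  finally show ?thesis .
qed

lemma residual_polys: "is_simplex S \<Longrightarrow> 1 \<le> m \<Longrightarrow> residual M V m \<psi> S \<in> polys (int m)"
  unfolding residual_def by (rule linterp_polys)

lemma residual_add:
  assumes "is_simplex S" "1 \<le> m"
  shows "residual M V m (\<lambda>S x. \<psi> S x + \<psi>' S x) S x = residual M V m \<psi> S x + residual M V m \<psi>' S x"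
proof -
  have "node_avg M (\<lambda>S x. \<psi> S x + \<psi>' S x) y = node_avg M \<psi> y + node_avg M \<psi>' y" for y
    by (simp add: node_avg_def sum.distrib add_divide_distrib)
  then show ?thesis
    unfolding residual_def linterp_add[OF assms, symmetric] by (simp add: algebra_simps)
qed

lemma residual_scale:
  assumes "is_simplex S" "1 \<le> m"
  shows "residual M V m (\<lambda>S x. c * \<psi> S x) S x = c * residual M V m \<psi> S x"
proof -
  have "node_avg M (\<lambda>S x. c * \<psi> S x) y = c * node_avg M \<psi> y" for y
    by (simp add: node_avg_def sum_distrib_left)
  then show ?thesis
    unfolding residual_def linterp_cmult[OF assms, symmetric] by (simp add: algebra_simps)
qed

lemma node_avg_close:
  assumes M: "finite M" "S \<in> M" "y \<in> convex hull S"
    and b: "\<And>A. A \<in> M \<Longrightarrow> y \<in> convex hull A \<Longrightarrow> \<bar>\<psi> A y - c\<bar> \<le> B"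
  shows "\<bar>node_avg M \<psi> y - c\<bar> \<le> B"
proof -
  let ?A = "{A\<in>M. y \<in> convex hull A}"
  have n: "0 < card ?A" using M by (auto simp: card_gt_0_iff)
  have "node_avg M \<psi> y - c = (\<Sum>A\<in>?A. \<psi> A y - c) / real (card ?A)"
    using n by (simp add: node_avg_def sum_subtractf field_simps)
  moreover have "\<bar>\<Sum>A\<in>?A. \<psi> A y - c\<bar> \<le> (\<Sum>A\<in>?A. B)" by (rule order_trans[OF sum_abs sum_mono]) (use b in auto)
  then have "\<bar>\<Sum>A\<in>?A. \<psi> A y - c\<bar> \<le> B * real (card ?A)" by (simp add: mult.commute)
  ultimately show ?thesis using n by (simp add: abs_divide pos_divide_le_eq)
qed

text \<open>Averaging reproduces constants, so the shift cancels in the nodal differences.\<close>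

lemma residual_shift:
  assumes M: "conforming M" and S: "S \<in> M" and m: "1 \<le> m"
    and e: "\<And>A x. A \<in> M \<Longrightarrow> \<psi> A x = q A x - c"
  shows "residual M V m \<psi> S = residual M V m q S"
  unfolding residual_def
proof (rule linterp_cong)
  fix y assume "y \<in> lnodes S m"
  then have y: "y \<in> convex hull S" using lnodes_hull[OF conformingD(2)[OF M S] m] by blast
  let ?A = "{A\<in>M. y \<in> convex hull A}"
  have n: "0 < card ?A" using S y conformingD(1)[OF M] by (auto simp: card_gt_0_iff)
  have "(\<Sum>A\<in>?A. \<psi> A y) = (\<Sum>A\<in>?A. q A y - c)" by (rule sum.cong) (auto simp: e)
  then have "node_avg M \<psi> y = node_avg M q y - c"
    using n by (simp add: node_avg_def sum_subtractf diff_divide_distrib)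
  then show "(\<psi> S y - node_avg M \<psi> y) * bary S V y = (q S y - node_avg M q y) * bary S V y" by (simp add: e[OF S])
qed

lemma residual_global:
  assumes M: "conforming M" and S: "S \<in> M" and m: "1 \<le> m"
  shows "residual M V m (\<lambda>_. q) S = (\<lambda>_. 0)"
  unfolding residual_def
proof (rule linterp_id[OF conformingD(2)[OF M S] m])
  show "(\<lambda>_. 0) \<in> polys (int m)" by (rule polys_zero)
  fix y assume "y \<in> lnodes S m"
  then have "y \<in> convex hull S" using lnodes_hull[OF conformingD(2)[OF M S] m] by blast
  then have "\<bar>node_avg M (\<lambda>_. q) y - q y\<bar> \<le> 0"
    by (intro node_avg_close[OF conformingD(1)[OF M] S]) auto
  then show "(q y - node_avg M (\<lambda>_. q) y) * bary S V y = 0" by simp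
qed

text \<open>The factor 2 arises because a nodal value and the nodal average are each within B of c;
  the weight lies in [0,1]. Closeness to a constant is what \<open>\<phi>_almost_constant\<close>
  provides.\<close>

lemma residual_bound:
  fixes M :: "(real,'n::finite) vec set set"
  assumes M: "conforming M" and S: "S \<in> M" "V \<in> S" and m: "1 \<le> m" and x: "x \<in> convex hull S"
    and b: "\<And>A y. A \<in> M \<Longrightarrow> y \<in> convex hull A \<Longrightarrow> \<bar>\<psi> A y - c\<bar> \<le> B"
  shows "\<bar>residual M V m \<psi> S x\<bar> \<le> real (m + 1) ^ (CARD('n) + 1) * real m ^ m * (2 * B)"
  unfolding residual_def
proof (rule linterp_bound[OF conformingD(2)[OF M S(1)] m x])
  note S' = conformingD(2)[OF M S(1)]
  fix y assume "y \<in> lnodes S m"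
  then have y: "y \<in> convex hull S" using lnodes_hull[OF S' m] by blast
  have "\<bar>node_avg M \<psi> y - c\<bar> \<le> B" by (rule node_avg_close[OF conformingD(1)[OF M] S(1) y b])
  then have d: "\<bar>\<psi> S y - node_avg M \<psi> y\<bar> \<le> 2 * B" using b[OF S(1) y] by linarith
  have "\<bar>(\<psi> S y - node_avg M \<psi> y) * bary S V y\<bar> = \<bar>\<psi> S y - node_avg M \<psi> y\<bar> * bary S V y"
    using bary_nonneg[OF S' y, of V] by (simp add: abs_mult)
  also have "\<dots> \<le> \<bar>\<psi> S y - node_avg M \<psi> y\<bar> * 1"
    by (rule mult_left_mono[OF bary_le_1[OF S' y S(2)]]) simp
  finally show "\<bar>(\<psi> S y - node_avg M \<psi> y) * bary S V y\<bar> \<le> 2 * B"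
    using d unfolding mult_1_right by (rule order_trans)
qed

section \<open>Well-posedness\<close>

context
  fixes M :: "(real,'n::finite) vec set set"
  assumes M: "\<And>S. S \<in> M \<Longrightarrow> is_simplex S"
begin

lemma bvip_add:
  assumes "\<And>S. S \<in> M \<Longrightarrow> continuous_on UNIV (f S)" "\<And>S. S \<in> M \<Longrightarrow> continuous_on UNIV (g S)"
    "\<And>S. S \<in> M \<Longrightarrow> continuous_on UNIV (g' S)"
  shows "bvip M f (\<lambda>S x. g S x + g' S x) = bvip M f g + bvip M f g'"
  unfolding bvip_def sum.distrib[symmetric] inner_add_right
  by (intro sum.cong refl sint_add[OF M] continuous_intros assms)

lemma bip_add:
  assumes "\<And>S. S \<in> M \<Longrightarrow> continuous_on UNIV (f S)" "\<And>S. S \<in> M \<Longrightarrow> continuous_on UNIV (g S)"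
    "\<And>S. S \<in> M \<Longrightarrow> continuous_on UNIV (g' S)"
  shows "bip M f (\<lambda>S x. g S x + g' S x) = bip M f g + bip M f g'"
  unfolding bip_def sum.distrib[symmetric] distrib_left
  by (intro sum.cong refl sint_add[OF M] continuous_intros assms)

end

lemma bvip_scale: "bvip M f (\<lambda>S x. c *\<^sub>R g S x) = c * bvip M f g"
  by (simp add: bvip_def sum_distrib_left)

lemma bip_scale: "bip M f (\<lambda>S x. c * g S x) = c * bip M f g"
  by (simp add: bip_def sum_distrib_left mult.left_commute[of _ c])

lemma bvip_commute: "bvip M f g = bvip M g f"
  by (simp add: bvip_def inner_commute)

lemma bip_commute: "bip M f g = bip M g f"
  by (simp add: bip_def mult.commute)

lemma bip_cong: "(\<And>S x. S \<in> M \<Longrightarrow> f S x = f' S x) \<Longrightarrow> (\<And>S x. S \<in> M \<Longrightarrow> g S x = g' S x) \<Longrightarrow> bip M f g = bip M f' g'"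
  unfolding bip_def by (intro sum.cong refl) simp

context vertex_patch
begin

definition form where
  "form x y = bvip M (fst x) (fst y) + bip M (bdiv (fst y)) (fst (snd x)) + bvip M (fst y) (\<lambda>_. snd (snd x))
    + bip M (bdiv (fst x)) (fst (snd y)) + bvip M (fst x) (\<lambda>_. snd (snd y))"

definition trial where "trial = RT0 M (int k - 1) \<times> Q0 M (int k - 1) \<times> Wh k V"

lemma form_symmetric: "form x y = form y x"
  by (simp add: form_def bvip_commute)

lemma trial_subspace: "subspace trial"
proof -
  note 1 = RT0_subspace[of M "int k - 1"] and 2 = Q0_subspace[OF simplexM] and 3 = Wh_subspace[of k V]
  show ?thesis unfolding trial_def
    using 1 2 3 by (intro subspace_Times)
qed

lemma trial_finite_dimensional: "finite_dimensional trial"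
  unfolding trial_def
proof (intro finite_dimensional_Times)
  show "finite_dimensional (RT0 M (int k - 1))" by (rule RT0_finite_dimensional[OF finM])
  show "finite_dimensional (Q0 M (int k - 1))" by (rule Q0_finite_dimensional[OF finM])
  show "finite_dimensional (Wh k V)"
    by (rule finite_dimensional_subset[OF finite_dimensional_vpolys[of "int k - 2"]]) (use Wh_vpolys in blast)
qed

lemma trial_continuous:
  assumes "x \<in> trial" "S \<in> M"
  shows "fst x S \<in> vpolys (int k)" "continuous_on UNIV (fst x S)" "continuous_on UNIV (bdiv (fst x) S)"
    "continuous_on UNIV (fst (snd x) S)" "continuous_on UNIV (snd (snd x))"
proof -
  have x: "fst x \<in> RT0 M (int k - 1)" "fst (snd x) \<in> Q0 M (int k - 1)" "snd (snd x) \<in> Wh k V"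
    using assms(1) by (auto simp: trial_def)
  show v: "fst x S \<in> vpolys (int k)" using rt_local_vpolys[OF RT0D(1)[OF x(1) assms(2)]] by simp
  show "continuous_on UNIV (fst x S)" by (rule vpolys_continuous[OF v])
  show "continuous_on UNIV (bdiv (fst x) S)" unfolding bdiv_def by (rule polys_continuous[OF divg_polys[OF v]])
  show "continuous_on UNIV (fst (snd x) S)" by (rule polys_continuous[OF broken_polysD(1)[OF Q0_broken[OF x(2)] assms(2)]])
  show "continuous_on UNIV (snd (snd x))" by (rule vpolys_continuous[OF Wh_vpolys[OF x(3)]])
qed

lemma form_linear: assumes x: "x \<in> trial" shows "linear_functional_on trial (form x)"
  unfolding linear_functional_on_def
proof (intro conjI ballI allI)
  fix y z assume y: "y \<in> trial" and z: "z \<in> trial"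
  note c = trial_continuous(2-)[OF x] trial_continuous(2-)[OF y] trial_continuous(2-)[OF z]
  have e: "fst (y + z) = (\<lambda>S x. fst y S x + fst z S x)" "fst (snd (y + z)) = (\<lambda>S x. fst (snd y) S x + fst (snd z) S x)"
    "snd (snd (y + z)) = (\<lambda>x. snd (snd y) x + snd (snd z) x)" by (auto simp: fun_eq_iff)
  have "bip M (bdiv (fst (y + z))) (fst (snd x)) = bip M (\<lambda>S x. bdiv (fst y) S x + bdiv (fst z) S x) (fst (snd x))"
    by (rule bip_cong)
      (simp_all only: e bdiv_def divg_add[OF trial_continuous(1)[OF y] trial_continuous(1)[OF z]])
  then have 1: "bip M (bdiv (fst (y + z))) (fst (snd x)) = bip M (bdiv (fst y)) (fst (snd x)) + bip M (bdiv (fst z)) (fst (snd x))"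
    using bip_add[OF simplexM, where f="fst (snd x)" and g="bdiv (fst y)" and g'="bdiv (fst z)"] c
    by (simp only: bip_commute[of M _ "fst (snd x)"])
  have 2: "bvip M (fst x) (fst (y + z)) = bvip M (fst x) (fst y) + bvip M (fst x) (fst z)"
    unfolding e by (rule bvip_add) (auto intro: simplexM c)
  have 3: "bvip M (fst (y + z)) (\<lambda>_. snd (snd x)) = bvip M (fst y) (\<lambda>_. snd (snd x)) + bvip M (fst z) (\<lambda>_. snd (snd x))"
    unfolding e bvip_commute[of M _ "\<lambda>_. snd (snd x)"] by (rule bvip_add) (auto intro: simplexM c)
  have 4: "bip M (bdiv (fst x)) (fst (snd (y + z))) = bip M (bdiv (fst x)) (fst (snd y)) + bip M (bdiv (fst x)) (fst (snd z))"
    unfolding e by (rule bip_add) (auto intro: simplexM c)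
  have 5: "bvip M (fst x) (\<lambda>_. snd (snd (y + z))) = bvip M (fst x) (\<lambda>_. snd (snd y)) + bvip M (fst x) (\<lambda>_. snd (snd z))"
    unfolding e by (rule bvip_add[where g="\<lambda>_. snd (snd y)" and g'="\<lambda>_. snd (snd z)"]) (auto intro: simplexM c)
  show "form x (y + z) = form x y + form x z" unfolding form_def 1 2 3 4 5 by simp
next
  fix a y assume y: "y \<in> trial"
  have e: "fst (a *\<^sub>R y) = (\<lambda>S x. a *\<^sub>R fst y S x)" "fst (snd (a *\<^sub>R y)) = (\<lambda>S x. a * fst (snd y) S x)"
    "snd (snd (a *\<^sub>R y)) = (\<lambda>x. a *\<^sub>R snd (snd y) x)" by (auto simp: fun_eq_iff)
  have "bip M (bdiv (fst (a *\<^sub>R y))) (fst (snd x)) = bip M (\<lambda>S x. a * bdiv (fst y) S x) (fst (snd x))"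
    by (rule bip_cong) (simp_all only: e bdiv_def divg_cscale[OF trial_continuous(1)[OF y]])
  then have 1: "bip M (bdiv (fst (a *\<^sub>R y))) (fst (snd x)) = a * bip M (bdiv (fst y)) (fst (snd x))"
    by (simp only: bip_commute[of M _ "fst (snd x)"] bip_scale)
  have 2: "bvip M (fst x) (fst (a *\<^sub>R y)) = a * bvip M (fst x) (fst y)" unfolding e bvip_scale ..
  have 3: "bvip M (fst (a *\<^sub>R y)) (\<lambda>_. snd (snd x)) = a * bvip M (fst y) (\<lambda>_. snd (snd x))"
    unfolding e bvip_commute[of M _ "\<lambda>_. snd (snd x)"] bvip_scale ..
  have 4: "bip M (bdiv (fst x)) (fst (snd (a *\<^sub>R y))) = a * bip M (bdiv (fst x)) (fst (snd y))" unfolding e bip_scale ..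
  have 5: "bvip M (fst x) (\<lambda>_. snd (snd (a *\<^sub>R y))) = a * bvip M (fst x) (\<lambda>_. snd (snd y))"
    unfolding e by (rule bvip_scale[where g="\<lambda>_. snd (snd y)"])
  show "form x (a *\<^sub>R y) = a * form x y" unfolding form_def 1 2 3 4 5 by (simp add: distrib_left)
qed

text \<open>Triples with a single nonzero component separate the three equations. For the energy
  identity the solution is its own test function: the divergence term becomes the load and the
  multiplier term vanishes by the third equation.\<close>

lemma form_solution:
  assumes x: "(\<sigma>, \<phi>, lam) \<in> trial" and f: "\<And>y. y \<in> trial \<Longrightarrow> form (\<sigma>, \<phi>, lam) y = f (fst (snd y))" and f0: "f (\<lambda>_ _. 0) = 0"
  shows "\<tau> \<in> RT0 M (int k - 1) \<Longrightarrow> bvip M \<sigma> \<tau> + bip M (bdiv \<tau>) \<phi> + bvip M \<tau> (\<lambda>_. lam) = 0"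
    "\<psi> \<in> Q0 M (int k - 1) \<Longrightarrow> bip M (bdiv \<sigma>) \<psi> = f \<psi>"
    "\<eta> \<in> Wh k V \<Longrightarrow> bvip M \<sigma> (\<lambda>_. \<eta>) = 0"
    "bvip M \<sigma> \<sigma> = - f \<phi>"
proof -
  have x': "\<sigma> \<in> RT0 M (int k - 1)" "\<phi> \<in> Q0 M (int k - 1)" "lam \<in> Wh k V" using x by (auto simp: trial_def)
  have "(\<lambda>_ _. 0) \<in> RT0 M (int k - 1)" using subspace_0[OF RT0_subspace] by (simp add: zero_fun_def)
  moreover have "(\<lambda>_ _. 0) \<in> Q0 M (int k - 1)" using subspace_0[OF Q0_subspace[OF simplexM]] by (simp add: zero_fun_def)
  moreover have "(\<lambda>_. 0) \<in> Wh k V" using subspace_0[OF Wh_subspace] by (simp add: zero_fun_def)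
  ultimately have t: "(\<tau>, (\<lambda>_ _. 0), (\<lambda>_. 0)) \<in> trial" "((\<lambda>_ _. 0), \<psi>, (\<lambda>_. 0)) \<in> trial" "((\<lambda>_ _. 0), (\<lambda>_ _. 0), \<eta>) \<in> trial"
    if "\<tau> \<in> RT0 M (int k - 1)" "\<psi> \<in> Q0 M (int k - 1)" "\<eta> \<in> Wh k V" for \<tau> \<psi> \<eta>
    using that by (auto simp: trial_def)
  have d: "bdiv (\<lambda>_ _. 0 :: (real,'n) vec) = (\<lambda>_ _. 0)" by (auto simp: bdiv_def divg_def frechet_derivative_const fun_eq_iff)
  have z: "bvip M g (\<lambda>_ _. 0) = 0" "bvip M (\<lambda>_ _. 0) g = 0" "bip M q (\<lambda>_ _. 0) = 0" "bip M (\<lambda>_ _. 0) q = 0" for g q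
    by (simp_all add: bvip_def bip_def)
  show 1: "bvip M \<sigma> \<tau> + bip M (bdiv \<tau>) \<phi> + bvip M \<tau> (\<lambda>_. lam) = 0" if "\<tau> \<in> RT0 M (int k - 1)" for \<tau>
    using f[OF t(1)[OF that x'(2,3)]] by (simp add: form_def z f0)
  show 2: "bip M (bdiv \<sigma>) \<psi> = f \<psi>" if "\<psi> \<in> Q0 M (int k - 1)" for \<psi>
    using f[OF t(2)[OF x'(1) that x'(3)]] by (simp add: form_def z d)
  show 3: "bvip M \<sigma> (\<lambda>_. \<eta>) = 0" if "\<eta> \<in> Wh k V" for \<eta>
    using f[OF t(3)[OF x'(1,2) that]] by (simp add: form_def z d f0)
  show "bvip M \<sigma> \<sigma> = - f \<phi>" using 1[OF x'(1)] 2[OF x'(2)] 3[OF x'(3)] by simp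
qed

text \<open>A zero load makes the energy of \<sigma> zero, and \<open>vanishing\<close> does the
  rest.\<close>

lemma form_nondegenerate:
  assumes x: "x \<in> trial" and z: "\<And>y. y \<in> trial \<Longrightarrow> form x y = 0" shows "x = 0"
proof -
  obtain \<sigma> \<phi> lam where e: "x = (\<sigma>, \<phi>, lam)" by (cases x)
  have x': "\<sigma> \<in> RT0 M (int k - 1)" "\<phi> \<in> Q0 M (int k - 1)" "lam \<in> Wh k V" using x by (auto simp: trial_def e)
  note sol = form_solution[where f="\<lambda>_. 0", OF x[unfolded e] z[unfolded e]]
  interpret patch_equation M V k N C1 C2 C3 h \<rho> \<sigma> \<phi> lam
    by unfold_locales (use x' Q0_broken sol(1) in auto)
  have "s = 0" using sol(4) by (simp add: s_def)
  moreover have "(\<Sum>S\<in>M. sint S (\<phi> S)) = 0" using x'(2) by (simp add: Q0_def)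
  ultimately show ?thesis using vanishing by (simp add: e prod_eq_iff zero_fun_def)
qed

lemma form_unique_solution:
  assumes f: "linear_functional_on (Q0 M (int k - 1)) f"
  shows "\<exists>!x. x \<in> trial \<and> (\<forall>y\<in>trial. form x y = f (fst (snd y)))"
proof -
  have "linear_functional_on trial (\<lambda>y. f (fst (snd y)))"
    using f by (auto simp: linear_functional_on_def trial_def)
  then obtain u where u: "u \<in> trial" "\<And>y. y \<in> trial \<Longrightarrow> form u y = f (fst (snd y))"
    using symmetric_form_represents[where b=form, OF trial_subspace trial_finite_dimensional form_linear form_symmetric form_nondegenerate]
    by blast
  show ?thesis
  proof (rule ex1I[of _ u])
    show "u \<in> trial \<and> (\<forall>y\<in>trial. form u y = f (fst (snd y)))" using u by blast
    fix x assume x: "x \<in> trial \<and> (\<forall>y\<in>trial. form x y = f (fst (snd y)))"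
    have "x + (- 1) *\<^sub>R u = 0"
    proof (rule form_nondegenerate)
      have n: "(- 1) *\<^sub>R u \<in> trial" by (rule subspace_scale[OF trial_subspace u(1)])
      then show "x + (- 1) *\<^sub>R u \<in> trial" using subspace_add[OF trial_subspace] x by blast
      fix y assume y: "y \<in> trial"
      note l = form_linear[OF y, unfolded linear_functional_on_def]
      have "form (x + (- 1) *\<^sub>R u) y = form y (x + (- 1) *\<^sub>R u)" by (rule form_symmetric)
      also have "\<dots> = form y x + form y ((- 1) *\<^sub>R u)" using l x n by blast
      also have "form y ((- 1) *\<^sub>R u) = (- 1) * form y u" using l u(1) by blast
      finally show "form (x + (- 1) *\<^sub>R u) y = 0"
        using x u(2)[OF y] y by (simp add: form_symmetric[of y])
    qed
    then show "x = u" by (simp add: eq_neg_iff_add_eq_0[symmetric] add_eq_0_iff)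
  qed
qed

end

context patch_equation
begin

text \<open>The energy is bounded by a multiple of s itself, and one factor s is divided out. In the
  constant, N counts the elements, the powers of k and k - 1 bound nodal interpolation of degree k -
  1, and the power of \<rho> compares the volumes.\<close>

lemma stability:
  assumes p: "\<And>S. S \<in> M \<Longrightarrow> p S \<in> vpolys (int k)"
    and energy: "bvip M \<sigma> \<sigma> = - bip M (\<lambda>S. divg (p S)) (residual M V (k - 1) \<phi>)"
  shows "sqrt (bvip M \<sigma> \<sigma>) \<le> 2 * real N * (real k ^ (CARD('n) + 1) * real (k - 1) ^ (k - 1)) *
      (C1 + 2 * real (N\<^sup>2) * (1 + real CARD('n) * C1 + C3 * C1 + C2)) * sqrt (\<rho> ^ (N\<^sup>2)) *
      h * sqrt (bip M (\<lambda>S. divg (p S)) (\<lambda>S. divg (p S)))"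
proof -
  define E where "E = bip M (\<lambda>S. divg (p S)) (\<lambda>S. divg (p S))"
  define C4 where "C4 = real k ^ (CARD('n) + 1) * real (k - 1) ^ (k - 1)"
  define C5 where "C5 = C1 + 2 * real (N\<^sup>2) * K"
  define B where "B = C5 * (h * s / sqrt \<mu>)"
  have C4: "0 \<le> C4" unfolding C4_def by simp
  have C5: "0 \<le> C5" unfolding C5_def using C_nonneg K_nonneg by simp
  have B: "0 \<le> B" unfolding B_def using C5 h_nonneg s_nonneg \<mu>(2) by simp
  obtain S0 where S0: "S0 \<in> M" using M(2) by blast
  have m: "1 \<le> k - 1" "k - 1 + 1 = k" using k by auto
  note cd = polys_continuous[OF divg_polys[OF p]]
  have nn: "0 \<le> sint S (\<lambda>x. divg (p S) x * divg (p S) x)" if "S \<in> M" for S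
    by (rule sint_nonneg[OF simplexM[OF that]]) (auto intro!: continuous_intros cd[OF that])
  have E0: "0 \<le> E" unfolding E_def bip_def by (rule sum_nonneg) (rule nn)
  have ES: "sint S (\<lambda>x. divg (p S) x * divg (p S) x) \<le> E" if "S \<in> M" for S
    unfolding E_def bip_def by (rule member_le_sum[OF that _ finM]) (use nn in auto)
  \<comment> \<open>Bound for the load on one element: the full divergence norm, the maximum of the
    residual and the largest volume. B contains the inverse root of \<mu>, so the unknown scale of
    the volumes cancels.\<close>
  define Z where "Z = sqrt E * (C4 * (2 * B) * sqrt (\<rho> ^ (N\<^sup>2) * \<mu>))"
  have pos: "0 \<le> \<rho> ^ (N\<^sup>2)" "0 \<le> \<rho> ^ (N\<^sup>2) * \<mu>" using \<rho>(1) \<mu>(2) by auto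
  have Z0: "0 \<le> Z" unfolding Z_def using C4 B E0 pos by simp
  have loc: "\<bar>sint S (\<lambda>x. divg (p S) x * residual M V (k - 1) \<phi> S x)\<bar> \<le> Z" if S: "S \<in> M" for S
  proof (rule power2_le_imp_le[OF _ Z0])
    note S' = simplexM[OF S]
    let ?r = "residual M V (k - 1) \<phi> S"
    have cr: "continuous_on UNIV ?r" by (rule polys_continuous[OF residual_polys[OF S' m(1)]])
    have r: "\<bar>?r x\<bar> \<le> C4 * (2 * B)" if x: "x \<in> convex hull S" for x
      using residual_bound[OF M(1) S V[OF S] m(1) x, of \<phi> "\<phi> S0 V" B] \<phi>_almost_constant[OF _ S0]
      unfolding C4_def B_def C5_def m(2) by blast
    have "sint S (\<lambda>x. (?r x)\<^sup>2) \<le> sint S (\<lambda>x. (C4 * (2 * B))\<^sup>2)"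
    proof (rule sint_mono[OF S'])
      fix x assume "x \<in> convex hull S"
      then have "\<bar>?r x\<bar> \<le> \<bar>C4 * (2 * B)\<bar>" using r C4 B by simp
      then show "(?r x)\<^sup>2 \<le> (C4 * (2 * B))\<^sup>2" by (simp only: abs_le_square_iff)
    qed (intro continuous_intros cr)+
    also have "\<dots> = (C4 * (2 * B))\<^sup>2 * svol S" by (rule sint_const[OF S'])
    also have "\<dots> \<le> (C4 * (2 * B))\<^sup>2 * (\<rho> ^ (N\<^sup>2) * \<mu>)" by (rule mult_left_mono[OF \<mu>(3)[OF S]]) simp
    finally have 1: "sint S (\<lambda>x. (?r x)\<^sup>2) \<le> (C4 * (2 * B))\<^sup>2 * (\<rho> ^ (N\<^sup>2) * \<mu>)" .
    have "\<bar>sint S (\<lambda>x. divg (p S) x * ?r x)\<bar>\<^sup>2 = (sint S (\<lambda>x. divg (p S) x * ?r x))\<^sup>2" by simp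
    also have "\<dots> \<le> sint S (\<lambda>x. (divg (p S) x)\<^sup>2) * sint S (\<lambda>x. (?r x)\<^sup>2)"
      by (rule sint_Cauchy_Schwarz[OF S' cd[OF S] cr])
    also have "\<dots> \<le> E * ((C4 * (2 * B))\<^sup>2 * (\<rho> ^ (N\<^sup>2) * \<mu>))"
    proof (intro mult_mono)
      show "sint S (\<lambda>x. (divg (p S) x)\<^sup>2) \<le> E" using ES[OF S] by (simp add: power2_eq_square)
      show "0 \<le> sint S (\<lambda>x. (?r x)\<^sup>2)" by (rule sint_nonneg[OF S']) (intro continuous_intros cr zero_le_power2)+
    qed (use 1 E0 in auto)
    also have "\<dots> = Z\<^sup>2" unfolding Z_def using E0 pos by (simp add: power_mult_distrib)
    finally show "\<bar>sint S (\<lambda>x. divg (p S) x * ?r x)\<bar>\<^sup>2 \<le> Z\<^sup>2" .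
  qed
  have "s\<^sup>2 = bvip M \<sigma> \<sigma>"
  proof -
    have "0 \<le> bvip M \<sigma> \<sigma>" using s_nonneg by (simp add: s_def)
    then show ?thesis by (simp add: s_def)
  qed
  also have "\<dots> \<le> \<bar>bip M (\<lambda>S. divg (p S)) (residual M V (k - 1) \<phi>)\<bar>" unfolding energy by simp
  also have "\<dots> \<le> (\<Sum>S\<in>M. Z)" unfolding bip_def by (rule order_trans[OF sum_abs sum_mono[OF loc]])
  also have "\<dots> \<le> real N * Z" using M(3) Z0 by (simp add: mult_right_mono)
  also have "Z = 2 * C4 * C5 * sqrt (\<rho> ^ (N\<^sup>2)) * h * sqrt E * s"
    unfolding Z_def B_def using \<mu>(2) by (simp add: real_sqrt_mult)
  finally have "s * s \<le> (2 * real N * C4 * C5 * sqrt (\<rho> ^ (N\<^sup>2)) * h * sqrt E) * s"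
    by (simp add: power2_eq_square mult_ac)
  moreover have "0 \<le> 2 * real N * C4 * C5 * sqrt (\<rho> ^ (N\<^sup>2)) * h * sqrt E"
    using C4 C5 h_nonneg E0 pos by simp
  ultimately have "s \<le> 2 * real N * C4 * C5 * sqrt (\<rho> ^ (N\<^sup>2)) * h * sqrt E"
    using s_nonneg by (cases "s = 0") (auto simp: mult_le_cancel_right)
  then show ?thesis unfolding s_def C4_def C5_def K_def E_def .
qed

end

context vertex_patch
begin

lemma residual_functional_linear:
  assumes p: "\<And>S. S \<in> M \<Longrightarrow> p S \<in> vpolys (int k)"
  shows "linear_functional_on X (\<lambda>\<psi>. bip M (\<lambda>S. divg (p S)) (residual M V (k - 1) \<psi>))"
proof -
  have m: "1 \<le> k - 1" using k by simp
  have c: "continuous_on UNIV (divg (p S))" if "S \<in> M" for S by (rule polys_continuous[OF divg_polys[OF p[OF that]]])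
  have r: "continuous_on UNIV (residual M V (k - 1) \<psi> S)" if "S \<in> M" for S \<psi>
    by (rule polys_continuous[OF residual_polys[OF simplexM[OF that] m]])
  show ?thesis unfolding linear_functional_on_def
  proof (intro conjI ballI allI)
    fix f g :: "(real,'n) vec set \<Rightarrow> (real,'n) vec \<Rightarrow> real"
    have e: "f + g = (\<lambda>S x. f S x + g S x)" by (simp add: fun_eq_iff)
    have "bip M (\<lambda>S. divg (p S)) (residual M V (k - 1) (f + g))
        = bip M (\<lambda>S. divg (p S)) (\<lambda>S x. residual M V (k - 1) f S x + residual M V (k - 1) g S x)"
      unfolding e by (rule bip_cong[OF refl]) (rule residual_add[OF simplexM m])
    also have "\<dots> = bip M (\<lambda>S. divg (p S)) (residual M V (k - 1) f) + bip M (\<lambda>S. divg (p S)) (residual M V (k - 1) g)"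
      by (rule bip_add; (rule simplexM c r); assumption)
    finally show "bip M (\<lambda>S. divg (p S)) (residual M V (k - 1) (f + g))
      = bip M (\<lambda>S. divg (p S)) (residual M V (k - 1) f) + bip M (\<lambda>S. divg (p S)) (residual M V (k - 1) g)" .
  next
    fix a and f :: "(real,'n) vec set \<Rightarrow> (real,'n) vec \<Rightarrow> real"
    have e: "a *\<^sub>R f = (\<lambda>S x. a * f S x)" by (simp add: fun_eq_iff)
    have "bip M (\<lambda>S. divg (p S)) (residual M V (k - 1) (a *\<^sub>R f))
        = bip M (\<lambda>S. divg (p S)) (\<lambda>S x. a * residual M V (k - 1) f S x)"
      unfolding e by (rule bip_cong[OF refl]) (rule residual_scale[OF simplexM m])
    then show "bip M (\<lambda>S. divg (p S)) (residual M V (k - 1) (a *\<^sub>R f))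
      = a * bip M (\<lambda>S. divg (p S)) (residual M V (k - 1) f)" by (simp only: bip_scale)
  qed
qed

text \<open>Testing with constants is no restriction: both sides vanish on them.\<close>

lemma divergence_identity:
  assumes \<sigma>: "\<sigma> \<in> RT0 M (int k - 1)"
    and eq: "\<And>\<psi>. \<psi> \<in> Q0 M (int k - 1) \<Longrightarrow> bip M (bdiv \<sigma>) \<psi> = bip M f (residual M V (k - 1) \<psi>)"
    and q: "\<And>S. S \<in> M \<Longrightarrow> q S \<in> polys (int k - 1)"
  shows "bip M (bdiv \<sigma>) q = bip M f (residual M V (k - 1) q)"
proof -
  have m: "1 \<le> k - 1" using k by simp
  define c where "c = (\<Sum>S\<in>M. sint S (q S)) / (\<Sum>S\<in>M. svol S)"
  \<comment> \<open>The mean c is subtracted inside M only, since members of \<open>Q0\<close> are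
    zero off M.\<close>
  define \<psi> where "\<psi> S x = (if S \<in> M then q S x - c else 0)" for S x
  have vol: "0 < (\<Sum>S\<in>M. svol S)" using finM M(2) svol_pos[OF simplexM] by (intro sum_pos) auto
  have \<psi>M: "\<psi> S = (\<lambda>x. q S x - c)" if "S \<in> M" for S using that by (simp add: \<psi>_def fun_eq_iff)
  have cp: "(\<lambda>_. c) \<in> polys (int k - 1)" using k by (intro polys_const) auto
  have cq: "continuous_on UNIV (q S)" if "S \<in> M" for S by (rule polys_continuous[OF q[OF that]])
  have "(\<Sum>S\<in>M. sint S (\<psi> S)) = (\<Sum>S\<in>M. sint S (q S) - c * svol S)"
  proof (rule sum.cong[OF refl])
    fix S assume S: "S \<in> M"
    have "sint S (\<lambda>x. q S x - c) = sint S (q S) - sint S (\<lambda>_. c)"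
      by (rule sint_diff[OF simplexM[OF S]]) (intro cq[OF S] continuous_intros)+
    then show "sint S (\<psi> S) = sint S (q S) - c * svol S" unfolding \<psi>M[OF S] sint_const[OF simplexM[OF S]] .
  qed
  also have "\<dots> = (\<Sum>S\<in>M. sint S (q S)) - c * (\<Sum>S\<in>M. svol S)" by (simp only: sum_subtractf sum_distrib_left)
  also have "\<dots> = 0" using vol by (simp add: c_def)
  finally have "\<psi> \<in> Q0 M (int k - 1)"
    using polys_diff[OF q cp] by (auto simp: Q0_def broken_polys_def \<psi>M) (simp add: \<psi>_def fun_eq_iff)
  then have "bip M (bdiv \<sigma>) \<psi> = bip M f (residual M V (k - 1) \<psi>)" by (rule eq)
  also have "\<dots> = bip M f (residual M V (k - 1) q)"
  proof (rule bip_cong[OF refl])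
    fix S x assume S: "S \<in> M"
    have "residual M V (k - 1) \<psi> S = residual M V (k - 1) q S"
      by (rule residual_shift[OF M(1) S m, where c=c]) (simp add: \<psi>M)
    then show "residual M V (k - 1) \<psi> S x = residual M V (k - 1) q S x" by simp
  qed
  also have "bip M (bdiv \<sigma>) \<psi> = bip M (bdiv \<sigma>) q"
  proof -
    have v: "\<sigma> S \<in> vpolys (int k)" if "S \<in> M" for S using rt_local_vpolys[OF RT0D(1)[OF \<sigma> that]] by simp
    have cd: "continuous_on UNIV (divg (\<sigma> S))" if "S \<in> M" for S by (rule polys_continuous[OF divg_polys[OF v[OF that]]])
    have one: "(\<lambda>_. 1) \<in> polys 0" by (rule polys_const) simp
    have g: "pgrad (\<lambda>_. 1 :: real) x = 0" for x :: "(real,'n) vec"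
      by (rule pgrad_eq) simp
    have "(\<Sum>S\<in>M. sint S (divg (\<sigma> S))) = 0"
      using RT0_total_flux_zero[OF M(1) \<sigma> one] by (simp add: g)
    moreover have "bip M (bdiv \<sigma>) \<psi> = (\<Sum>S\<in>M. sint S (\<lambda>x. bdiv \<sigma> S x * q S x) - c * sint S (divg (\<sigma> S)))"
      unfolding bip_def
    proof (rule sum.cong[OF refl])
      fix S assume S: "S \<in> M"
      have "sint S (\<lambda>x. bdiv \<sigma> S x * q S x - c * divg (\<sigma> S) x)
          = sint S (\<lambda>x. bdiv \<sigma> S x * q S x) - sint S (\<lambda>x. c * divg (\<sigma> S) x)"
        unfolding bdiv_def by (rule sint_diff[OF simplexM[OF S]]) (intro continuous_intros cq[OF S] cd[OF S])+
      then show "sint S (\<lambda>x. bdiv \<sigma> S x * \<psi> S x) = sint S (\<lambda>x. bdiv \<sigma> S x * q S x) - c * sint S (divg (\<sigma> S))"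
        by (simp add: \<psi>M[OF S] bdiv_def right_diff_distrib mult.commute[of c])
    qed
    ultimately show ?thesis by (simp add: sum_subtractf sum_distrib_left[symmetric] bip_def)
  qed
  finally show ?thesis .
qed

lemma polynomial_orthogonality:
  assumes \<sigma>: "\<sigma> \<in> RT0 M (int k - 1)"
    and eq: "\<And>\<psi>. \<psi> \<in> Q0 M (int k - 1) \<Longrightarrow> bip M (bdiv \<sigma>) \<psi> = bip M f (residual M V (k - 1) \<psi>)"
    and orth: "\<And>\<eta>. \<eta> \<in> Wh k V \<Longrightarrow> bvip M \<sigma> (\<lambda>_. \<eta>) = 0"
    and \<xi>: "\<xi> \<in> vpolys (int k - 2)"
  shows "bvip M \<sigma> (\<lambda>_. \<xi>) = 0"
proof -
  have m: "1 \<le> k - 1" using k by simp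
  obtain q \<eta> where q: "q \<in> polys (int k - 1)" and \<eta>: "\<eta> \<in> Wh k V" and e: "\<And>x. \<xi> x = pgrad q x + \<eta> x"
    using koszul_decomposition[OF dim k \<xi>] by blast
  have v: "\<sigma> S \<in> vpolys (int k)" if "S \<in> M" for S using rt_local_vpolys[OF RT0D(1)[OF \<sigma> that]] by simp
  note cs = vpolys_continuous[OF v] and cd = polys_continuous[OF divg_polys[OF v]]
    and cg = vpolys_continuous[OF polys_gradient(1)[OF q]] and ce = vpolys_continuous[OF Wh_vpolys[OF \<eta>]]
  have "bip M (bdiv \<sigma>) (\<lambda>_. q) = bip M f (residual M V (k - 1) (\<lambda>_. q))"
    by (rule divergence_identity[OF \<sigma> eq]) (assumption | rule q)+
  also have "\<dots> = bip M f (\<lambda>_ _. 0)"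
    by (rule bip_cong[OF refl]) (simp only: residual_global[OF M(1) _ m])
  finally have "bip M (bdiv \<sigma>) (\<lambda>_. q) = 0" by (simp add: bip_def)
  moreover have "(\<Sum>S\<in>M. sint S (\<lambda>x. pgrad q x \<bullet> \<sigma> S x + q x * divg (\<sigma> S) x)) = bvip M \<sigma> (\<lambda>_. pgrad q) + bip M (bdiv \<sigma>) (\<lambda>_. q)"
    unfolding bvip_def bip_def sum.distrib[symmetric]
  proof (rule sum.cong[OF refl])
    fix S assume S: "S \<in> M"
    have "sint S (\<lambda>x. \<sigma> S x \<bullet> pgrad q x + divg (\<sigma> S) x * q x) = sint S (\<lambda>x. \<sigma> S x \<bullet> pgrad q x) + sint S (\<lambda>x. divg (\<sigma> S) x * q x)"
      by (rule sint_add[OF simplexM[OF S]]) (intro continuous_intros cs[OF S] cd[OF S] cg polys_continuous[OF q])+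
    then show "sint S (\<lambda>x. pgrad q x \<bullet> \<sigma> S x + q x * divg (\<sigma> S) x) = sint S (\<lambda>x. \<sigma> S x \<bullet> pgrad q x) + sint S (\<lambda>x. bdiv \<sigma> S x * q x)"
      by (simp add: bdiv_def inner_commute mult.commute)
  qed
  ultimately have "bvip M \<sigma> (\<lambda>_. pgrad q) = 0" using RT0_total_flux_zero[OF M(1) \<sigma> q] by simp
  moreover have "bvip M \<sigma> (\<lambda>_. \<xi>) = bvip M \<sigma> (\<lambda>_. pgrad q) + bvip M \<sigma> (\<lambda>_. \<eta>)"
    unfolding e[abs_def] by (rule bvip_add[where g="\<lambda>_. pgrad q" and g'="\<lambda>_. \<eta>"]) (auto intro: simplexM cs cg ce)
  ultimately show ?thesis using orth[OF \<eta>] by simp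
qed

text \<open>On each element the velocity is replaced by its polynomial piece, which makes the load
  an integral of continuous functions and visibly linear in \<psi>.\<close>

lemma rhs_eq_residual:
  assumes T: "conforming T" and MT: "M = patch T V"
    and p: "\<And>S. S \<in> M \<Longrightarrow> p S \<in> vpolys (int k)" "\<And>S x. S \<in> M \<Longrightarrow> x \<in> convex hull S \<Longrightarrow> w x = p S x"
  shows "bip M (\<lambda>_. divg w) (bubbleP T V (k - 1) (bminus \<psi> (oswald M (k - 1) \<psi>)))
    = bip M (\<lambda>S. divg (p S)) (residual M V (k - 1) \<psi>)"
  unfolding bip_def
proof (rule sum.cong[OF refl])
  fix S assume S: "S \<in> M"
  have m: "1 \<le> k - 1" using k by simp
  have "bubbleP T V (k - 1) (bminus \<psi> (oswald M (k - 1) \<psi>)) S = residual M V (k - 1) \<psi> S"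
    unfolding MT by (rule bubbleP_eq_residual[OF T _ m]) (use S MT in simp)
  moreover have "sint S (\<lambda>x. divg w x * residual M V (k - 1) \<psi> S x) = sint S (\<lambda>x. divg (p S) x * residual M V (k - 1) \<psi> S x)"
    by (rule sint_divg_piecewise(1)[OF simplexM[OF S] p(1)[OF S] p(2)[OF S]
        polys_continuous[OF residual_polys[OF simplexM[OF S] m]]])
  ultimately show "sint S (\<lambda>x. divg w x * bubbleP T V (k - 1) (bminus \<psi> (oswald M (k - 1) \<psi>)) S x)
      = sint S (\<lambda>x. divg (p S) x * residual M V (k - 1) \<psi> S x)" by simp
qed

theorem patch_problem_well_posed:
  assumes T: "conforming T" and MT: "M = patch T V"
    and p: "\<And>S. S \<in> M \<Longrightarrow> p S \<in> vpolys (int k)" "\<And>S x. S \<in> M \<Longrightarrow> x \<in> convex hull S \<Longrightarrow> w x = p S x"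
  shows "\<exists>!x. patch_problem T V k w (fst x) (fst (snd x)) (snd (snd x))"
    "patch_problem T V k w \<sigma> \<phi> lam \<Longrightarrow> sqrt (bvip M \<sigma> \<sigma>) \<le>
      2 * real N * (real k ^ (CARD('n) + 1) * real (k - 1) ^ (k - 1)) *
      (C1 + 2 * real (N\<^sup>2) * (1 + real CARD('n) * C1 + C3 * C1 + C2)) * sqrt (\<rho> ^ (N\<^sup>2)) *
      h * sqrt (bip M (\<lambda>_. divg w) (\<lambda>_. divg w))"
    "patch_problem T V k w \<sigma> \<phi> lam \<Longrightarrow> q \<in> broken_polys T (int k - 1) \<Longrightarrow>
      bip T (bdiv \<sigma>) q = bip M (\<lambda>_. divg w) (bubbleP T V (k - 1) (bminus q (oswald M (k - 1) q)))"
    "patch_problem T V k w \<sigma> \<phi> lam \<Longrightarrow> \<xi> \<in> vpolys (int k - 2) \<Longrightarrow> bvip M \<sigma> (\<lambda>_. \<xi>) = 0"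
proof -
  define \<Lambda> where "\<Lambda> \<psi> = bip M (\<lambda>S. divg (p S)) (residual M V (k - 1) \<psi>)" for \<psi>
  have rhs: "bip M (\<lambda>_. divg w) (bubbleP T V (k - 1) (bminus \<psi> (oswald M (k - 1) \<psi>))) = \<Lambda> \<psi>" for \<psi>
    unfolding \<Lambda>_def by (rule rhs_eq_residual[OF T MT p])
  \<comment> \<open>The local problem is the symmetric form on triples with a load that sees only
    the second component of the test triple.\<close>
  have iff: "patch_problem T V k w (fst x) (fst (snd x)) (snd (snd x)) \<longleftrightarrow>
      x \<in> trial \<and> (\<forall>y\<in>trial. form x y = \<Lambda> (fst (snd y)))" for x
    unfolding patch_problem_def Let_def MT[symmetric] rhs trial_def form_def
    by (cases x) auto
  have lin: "linear_functional_on X \<Lambda>" for X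
    unfolding \<Lambda>_def[abs_def] by (rule residual_functional_linear[OF p(1)])
  show "\<exists>!x. patch_problem T V k w (fst x) (fst (snd x)) (snd (snd x))"
    unfolding iff by (rule form_unique_solution[OF lin])
  have \<Lambda>0: "\<Lambda> (\<lambda>_ _. 0) = 0"
  proof -
    have "\<Lambda> (0 *\<^sub>R (\<lambda>_ _. 0)) = 0 * \<Lambda> (\<lambda>_ _. 0)"
      using lin[of UNIV] unfolding linear_functional_on_def by blast
    then show ?thesis by (simp add: zero_fun_def)
  qed
  assume sol: "patch_problem T V k w \<sigma> \<phi> lam"
  have x: "(\<sigma>, \<phi>, lam) \<in> trial" "\<And>y. y \<in> trial \<Longrightarrow> form (\<sigma>, \<phi>, lam) y = \<Lambda> (fst (snd y))"
    using sol iff[of "(\<sigma>, \<phi>, lam)"] by auto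
  have x': "\<sigma> \<in> RT0 M (int k - 1)" "\<phi> \<in> Q0 M (int k - 1)" "lam \<in> Wh k V" using x(1) by (auto simp: trial_def)
  note sol = form_solution[where f=\<Lambda>, OF x \<Lambda>0]
  interpret patch_equation M V k N C1 C2 C3 h \<rho> \<sigma> \<phi> lam
    by unfold_locales (use x' Q0_broken sol(1) in auto)
  have "bip M (\<lambda>_. divg w) (\<lambda>_. divg w) = bip M (\<lambda>S. divg (p S)) (\<lambda>S. divg (p S))"
    unfolding bip_def
    by (rule sum.cong[OF refl], rule sint_divg_piecewise(2)[OF simplexM p(1) p(2) continuous_on_const]) assumption+
  then show "sqrt (bvip M \<sigma> \<sigma>) \<le>
      2 * real N * (real k ^ (CARD('n) + 1) * real (k - 1) ^ (k - 1)) *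
      (C1 + 2 * real (N\<^sup>2) * (1 + real CARD('n) * C1 + C3 * C1 + C2)) * sqrt (\<rho> ^ (N\<^sup>2)) *
      h * sqrt (bip M (\<lambda>_. divg w) (\<lambda>_. divg w))"
    using stability[OF p(1) sol(4)[unfolded \<Lambda>_def]] by simp
  show "bvip M \<sigma> (\<lambda>_. \<xi>) = 0" if "\<xi> \<in> vpolys (int k - 2)"
    by (rule polynomial_orthogonality[OF x'(1) sol(2)[unfolded \<Lambda>_def] sol(3) that])
  assume q: "q \<in> broken_polys T (int k - 1)"
  have MsubT: "M \<subseteq> T" unfolding MT patch_def by auto
  have "bip T (bdiv \<sigma>) q = bip M (bdiv \<sigma>) q"
    unfolding bip_def
  proof (rule sum.mono_neutral_right[OF conformingD(1)[OF T] MsubT], rule ballI)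
    fix S assume "S \<in> T - M"
    then have "\<sigma> S = (\<lambda>_. 0)" using RT0D(2)[OF x'(1)] by blast
    then have "bdiv \<sigma> S x = 0" for x by (simp add: bdiv_def divg_def frechet_derivative_const)
    then show "sint S (\<lambda>x. bdiv \<sigma> S x * q S x) = 0" by simp
  qed
  also have "\<dots> = bip M (\<lambda>S. divg (p S)) (residual M V (k - 1) q)"
    by (rule divergence_identity[OF x'(1) sol(2)[unfolded \<Lambda>_def]]) (use broken_polysD(1)[OF q] MsubT in blast)+
  finally show "bip T (bdiv \<sigma>) q = bip M (\<lambda>_. divg w) (bubbleP T V (k - 1) (bminus q (oswald M (k - 1) q)))"
    unfolding rhs \<Lambda>_def .
qed

end

theorem theorem4p2:
  fixes \<Omega> :: "((real,'n::{finite,linorder}) vec) set" and k :: nat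
  assumes dim: "CARD('n) = 2 \<or> CARD('n) = 3"
    and dom: "polyhedral_domain \<Omega>" and lip: "lipschitz_boundary \<Omega>"
    and k: "k \<ge> 2"
  shows "\<forall>\<gamma>::real. \<exists>C::real. \<forall>T V w.
     conforming_triangulation T \<Omega> \<and> (\<forall>S\<in>T. shape_param S \<le> \<gamma>) \<and>
     V \<in> mesh_vertices T \<and> w \<in> Vh T \<Omega> k \<longrightarrow>
       (\<exists>!s. patch_problem T V k w (fst s) (fst (snd s)) (snd (snd s))) \<and>
       (\<forall>\<sigma> \<phi> lam. patch_problem T V k w \<sigma> \<phi> lam \<longrightarrow>
          sqrt (bvip (patch T V) \<sigma> \<sigma>)
            \<le> C * hV T V * sqrt (bip (patch T V) (\<lambda>_. divg w) (\<lambda>_. divg w)) \<and>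
          (\<forall>q\<in>broken_polys T (int k - 1).
             bip T (bdiv \<sigma>) q =
             bip (patch T V) (\<lambda>_. divg w)
               (bubbleP T V (k - 1) (bminus q (oswald (patch T V) (k - 1) q)))) \<and>
          (\<forall>\<xi>\<in>vpolys (int k - 2). bvip (patch T V) \<sigma> (\<lambda>_. \<xi>) = 0))"
proof
  fix \<gamma> :: real
  obtain C1 where C1: "0 \<le> C1" "\<forall>(S :: (real,'n) vec set) v p x. is_simplex S \<and> v \<in> S \<and> p \<in> polys (int k - 1) \<and>
      x \<in> convex hull S \<longrightarrow> \<bar>p x - p v\<bar> \<le> C1 * sqrt (savg S (\<lambda>x. bary S v x * (rad v p x * rad v p x)))"
    using oscillation_bound[of "int k - 1"] by blast
  obtain C2 where C2: "0 \<le> C2" "\<forall>(S :: (real,'n) vec set) v p x. is_simplex S \<and> v \<in> S \<and> p \<in> polys (int k - 1) \<and>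
      x \<in> convex hull S \<longrightarrow> \<bar>p x\<bar> \<le> C2 * sqrt (savg S (\<lambda>x. bary S v x * (p x * p x)))"
    using weighted_sup_bound[of "int k - 1"] by blast
  obtain C3 where C3: "0 \<le> C3" "\<forall>(S :: (real,'n) vec set) v p x B. is_simplex S \<and> v \<in> S \<and> p \<in> polys (int k - 1) \<and>
      x \<in> convex hull S \<and> (\<forall>y\<in>convex hull S. \<bar>p y\<bar> \<le> B) \<longrightarrow> \<bar>rad v p x\<bar> \<le> C3 * B"
    using radial_inverse_bound[of "int k - 1"] by blast
  \<comment> \<open>All constants come from \<gamma>, k and the dimension, ahead of the mesh: N
    bounds the number of simplices at a vertex, \<rho> the ratio of volumes across a facet.\<close>
  define N where "N = nat \<lceil>(2 * \<gamma>) ^ CARD('n)\<rceil>"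
  define \<rho> where "\<rho> = (2 * \<gamma>\<^sup>2) ^ CARD('n)"
  define C where "C = 2 * real N * (real k ^ (CARD('n) + 1) * real (k - 1) ^ (k - 1)) *
      (C1 + 2 * real (N\<^sup>2) * (1 + real CARD('n) * C1 + C3 * C1 + C2)) * sqrt (\<rho> ^ (N\<^sup>2))"
  show "\<exists>C::real. \<forall>T V w.
     conforming_triangulation T \<Omega> \<and> (\<forall>S\<in>T. shape_param S \<le> \<gamma>) \<and>
     V \<in> mesh_vertices T \<and> w \<in> Vh T \<Omega> k \<longrightarrow>
       (\<exists>!s. patch_problem T V k w (fst s) (fst (snd s)) (snd (snd s))) \<and>
       (\<forall>\<sigma> \<phi> lam. patch_problem T V k w \<sigma> \<phi> lam \<longrightarrow>
          sqrt (bvip (patch T V) \<sigma> \<sigma>)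
            \<le> C * hV T V * sqrt (bip (patch T V) (\<lambda>_. divg w) (\<lambda>_. divg w)) \<and>
          (\<forall>q\<in>broken_polys T (int k - 1).
             bip T (bdiv \<sigma>) q =
             bip (patch T V) (\<lambda>_. divg w)
               (bubbleP T V (k - 1) (bminus q (oswald (patch T V) (k - 1) q)))) \<and>
          (\<forall>\<xi>\<in>vpolys (int k - 2). bvip (patch T V) \<sigma> (\<lambda>_. \<xi>) = 0))"
  proof (rule exI[of _ C], intro allI impI)
    fix T V w
    assume a: "conforming_triangulation T \<Omega> \<and> (\<forall>S\<in>T. shape_param S \<le> \<gamma>) \<and> V \<in> mesh_vertices T \<and> w \<in> Vh T \<Omega> k"
    then have T: "conforming_triangulation T \<Omega>" and shape: "\<And>S. S \<in> T \<Longrightarrow> shape_param S \<le> \<gamma>"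
      and V: "V \<in> mesh_vertices T" and w: "w \<in> Vh T \<Omega> k" by auto
    let ?M = "patch T V"
    note cT = patch_conforming(1)[OF T] and cM = patch_conforming(2)[OF T, of V]
    have VM: "V \<in> S" and MT: "S \<in> T" if "S \<in> ?M" for S using that by (auto simp: patch_def)
    have ne: "?M \<noteq> {}" using V by (auto simp: mesh_vertices_def patch_def)
    then obtain S0 where S0: "S0 \<in> ?M" by blast
    \<comment> \<open>The patch contains a simplex, whose diameter is at least its inradius, so
      smaller values of \<gamma> leave nothing to prove.\<close>
    have \<gamma>: "1 \<le> \<gamma>" by (rule shape_regular(3)[OF conformingD(2)[OF cM S0] shape[OF MT[OF S0]]])
    have "\<forall>S\<in>?M. \<exists>p\<in>vpolys (int k). \<forall>x\<in>convex hull S. w x = p x" using w MT unfolding Vh_def by blast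
    then obtain p where p: "\<forall>S\<in>?M. p S \<in> vpolys (int k) \<and> (\<forall>x\<in>convex hull S. w x = p S x)"
      unfolding Bex_def by (rule bchoice[THEN exE]) blast
    interpret vertex_patch ?M V k N C1 C2 C3 "hV T V" \<rho>
    proof
      show "CARD('n) = 2 \<or> CARD('n) = 3" "2 \<le> k" "conforming ?M" "?M \<noteq> {}" "0 \<le> C1" "0 \<le> C2" "0 \<le> C3"
        by (fact dim k cM ne C1(1) C2(1) C3(1))+
      have "real (card ?M) \<le> (2 * \<gamma>) ^ CARD('n)"
        by (rule patch_card_bound[OF cM VM shape[OF MT] ne])
      then show "card ?M \<le> N" unfolding N_def by linarith
      show "V \<in> S" if "S \<in> ?M" for S by (rule VM[OF that])
      show "A = ?M" if "A \<subseteq> ?M" "A \<noteq> {}"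
        "\<And>S S'. S \<in> A \<Longrightarrow> S' \<in> ?M \<Longrightarrow> card (S \<inter> S') = CARD('n) \<Longrightarrow> S' \<in> A" for A
        by (rule patch_facet_connected[OF _ lip T V that]) (use dom in \<open>auto simp: polyhedral_domain_def\<close>)
      show "\<bar>p x - p v\<bar> \<le> C1 * sqrt (savg S (\<lambda>x. bary S v x * (rad v p x * rad v p x)))"
        if "is_simplex S" "v \<in> S" "p \<in> polys (int k - 1)" "x \<in> convex hull S" for S :: "(real,'n) vec set" and v p x
        using C1(2) that by blast
      show "\<bar>p x\<bar> \<le> C2 * sqrt (savg S (\<lambda>x. bary S v x * (p x * p x)))"
        if "is_simplex S" "v \<in> S" "p \<in> polys (int k - 1)" "x \<in> convex hull S" for S :: "(real,'n) vec set" and v p x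
        using C2(2) that by blast
      show "\<bar>rad v p x\<bar> \<le> C3 * B"
        if "is_simplex S" "v \<in> S" "p \<in> polys (int k - 1)" "x \<in> convex hull S" "\<And>y. y \<in> convex hull S \<Longrightarrow> \<bar>p y\<bar> \<le> B"
        for S :: "(real,'n) vec set" and v p x B
        using C3(2) that by blast
      show "norm (x - y) \<le> hV T V" if S: "S \<in> ?M" "x \<in> convex hull S" "y \<in> convex hull S" for S x y
      proof -
        have "norm (x - y) \<le> diameter (convex hull S)" by (rule dist_le_diameter[OF conformingD(2)[OF cM S(1)] S(2,3)])
        also have "\<dots> \<le> hV T V" unfolding hV_def using conformingD(1)[OF cM] S(1) by (intro Max_ge) auto
        finally show ?thesis .
      qed
      have "1 \<le> \<gamma>\<^sup>2" using \<gamma> by (rule one_le_power)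
      then show "1 \<le> \<rho>" unfolding \<rho>_def by (intro one_le_power) linarith
      show "svol S' \<le> \<rho> * svol S" if S: "S \<in> ?M" "S' \<in> ?M" "card (S \<inter> S') = CARD('n)" for S S'
      proof -
        \<comment> \<open>A facet has at least two vertices in these dimensions, so the two
          simplices share an edge at V, as the comparison of volumes requires.\<close>
        have "S \<inter> S' \<noteq> {V}" using S(3) dim by auto
        then obtain u where "u \<in> S \<inter> S'" "V \<noteq> u" using VM S(1,2) by blast
        then show ?thesis unfolding \<rho>_def
          using svol_comparable[OF conformingD(2)[OF cM S(1)] shape[OF MT[OF S(1)]] conformingD(2)[OF cM S(2)] shape[OF MT[OF S(2)]]]
            VM S(1,2) by blast
      qed
    qed
    note wp = patch_problem_well_posed[OF cT refl, where p=p and w=w]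
    have p': "\<And>S. S \<in> ?M \<Longrightarrow> p S \<in> vpolys (int k)" "\<And>S x. S \<in> ?M \<Longrightarrow> x \<in> convex hull S \<Longrightarrow> w x = p S x"
      using p by auto
    show "(\<exists>!s. patch_problem T V k w (fst s) (fst (snd s)) (snd (snd s))) \<and>
       (\<forall>\<sigma> \<phi> lam. patch_problem T V k w \<sigma> \<phi> lam \<longrightarrow>
          sqrt (bvip ?M \<sigma> \<sigma>) \<le> C * hV T V * sqrt (bip ?M (\<lambda>_. divg w) (\<lambda>_. divg w)) \<and>
          (\<forall>q\<in>broken_polys T (int k - 1). bip T (bdiv \<sigma>) q =
             bip ?M (\<lambda>_. divg w) (bubbleP T V (k - 1) (bminus q (oswald ?M (k - 1) q)))) \<and>
          (\<forall>\<xi>\<in>vpolys (int k - 2). bvip ?M \<sigma> (\<lambda>_. \<xi>) = 0))"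
      using wp(1)[OF p'] wp(2)[OF p'] wp(3)[OF p'] wp(4)[OF p'] unfolding C_def by blast
  qed
qed

end
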